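(* Let $\Omega\subset\mathbb{R}^2$ be a simply connected polygonal domain, $k\ge0$ an integer, and let $\{\mathcal{T}_h\}$ be a sequence of polygonal meshes with mesh size $h$ tending to zero, with associated spaces $\mathbf{V}_h$, $Q_h$, bilinear form $b_h$ (either non-stabilized or stabilized) and discrete kernel $\mathbf{K}_h^{\mathrm{rot}}$, as described in the context. Assume: (EDK) there exists $\alpha>0$, independent of $h$, such that $(\mathrm{div}\,\mathbf{v}_h,\mathrm{div}\,\mathbf{v}_h)\ge\alpha\|\mathbf{v}_h\|_{\mathrm{div}}^2$ for all $\mathbf{v}_h\in\mathbf{K}_h^{\mathrm{rot}}$; (WA) there exists $\omega_1(h)$ going to zero as $h\to0$ such that $\sup_{\mathbf{v}_h\in\mathbf{K}_h^{\mathrm{rot}}}\frac{(\mathbf{v}_h,\mathbf{curl}\,p)}{\|\mathbf{v}_h\|_{\mathrm{div}}}\le\omega_1(h)\|p\|_{Q_0}$ for all $p\in Q_0$; (SA) there exists $\omega_2(h)$ going to zero as $h\to0$ such that for every $\mathbf{u}\in\mathbf{V}_0$ there exists $\widetilde{\mathbf{u}}_h^I\in\mathbf{K}_h^{\mathrm{rot}}$ with $\|\mathbf{u}-\widetilde{\mathbf{u}}_h^I\|_{\mathrm{div}}\le\omega_2(h)\|\mathbf{u}\|_{\mathbf{V}_0}$. Then the sequence $\{T_h\}$ converges uniformly to $T$ in $\mathbf{V}$: there exists $\omega_3(h)$ tending to zero as $h\to0$ such that $$\|T\mathbf{f}-T_h\mathbf{f}\|_{\mathrm{div}}\le\omega_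3(h)\|\mathbf{f}\|_0\qquad\forall\,\mathbf{f}\in\mathbf{L}^2(\Omega).$$
   Context: Notation. $(\cdot,\cdot)$ and $\|\cdot\|_0$ are the $L^2(\Omega)$ inner product and norm (scalar or vector valued), $\mathbf{L}^2(\Omega)=[L^2(\Omega)]^2$; a subscript $E$ means the element $E$ instead of $\Omega$. $\mathrm{div}\,\mathbf{v}=\partial_1v_1+\partial_2v_2$, $\mathrm{rot}\,\mathbf{v}=\partial_1v_2-\partial_2v_1$, $\mathbf{curl}\,q=(\partial_2q,-\partial_1q)^\top$, $\mathbf{grad}\,q=(\partial_1q,\partial_2q)^\top$. $\mathbf{V}=\{\mathbf{v}\in\mathbf{L}^2(\Omega):\mathrm{div}\,\mathbf{v}\in L^2(\Omega),\ \mathbf{v}\cdot\mathbf{n}=0\text{ on }\partial\Omega\}$ with $\|\mathbf{v}\|_{\mathrm{div}}^2=\|\mathbf{v}\|_0^2+\|\mathrm{div}\,\mathbf{v}\|_0^2$; $Q=H^1_0(\Omega)$. Suprema of quotients are over nonzero elements. Continuous source problem and operator. For $\mathbf{f}\in\mathbf{L}^2(\Omega)$ let $(\mathbf{u},p)\in\mathbf{V}\times Q$ be the solution of (P): $(\mathrm{div}\,\mathbf{u},\mathrm{div}\,\mathbf{v})+(\mathbf{v},\mathbf{curl}\,p)=(\mathbf{f},\mathbf{v})$ for all $\mathbf{v}\in\mathbf{V}$ and $(\mathbf{u},\mathbf{curl}\,q)=0$ for all $q\in Q$. Set $T\mathbf{f}=\mathbf{u}$. $\mathbf{V}_0\subset\mathbf{V}$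 and $Q_0\subset Q$ are the spaces of all first, respectively second, components of solutions of (P) as $\mathbf{f}$ ranges over $\mathbf{L}^2(\Omega)$, with norms $\|\mathbf{u}\|_{\mathbf{V}_0}=\inf\{\|\mathbf{f}\|_0:T\mathbf{f}=\mathbf{u}\}$ and $\|p\|_{Q_0}=\inf\{\|\mathbf{f}\|_0: p\text{ is the second component of the solution of (P) with datum }\mathbf{f}\}$. Meshes. Each $\mathcal{T}_h$ is a decomposition of $\Omega$ into finitely many non-overlapping polygons; $h_E$ is the diameter of $E$, $h_e$ the length of an edge $e$, $h=\max_E h_E$. There is a constant $C_\tau>0$, independent of the mesh, such that each element $E$ is star-shaped with respect to a disk of radius greater than $C_\tau h_E$ and $h_e\ge C_\tau h_E$ for every edge $e$ of $E$. Discrete spaces. $\mathcal{P}_j$ denotes polynomials of degree at most $j$. $\mathbf{V}_h^E=\{\mathbf{v}\in \mathbf{H}(\mathrm{div};E)\cap\mathbf{H}(\mathrm{rot};E):\ \mathbf{v}\cdot\mathbf{n}\in\mathcal{P}_k(e)\ \forall e\subset\partial E,\ \mathrm{div}\,\mathbf{v}\in\mathcal{P}_k(E),\ \mathrm{rot}\,\mathbf{v}=0\text{ in }E\}$ and $\mathbf{V}_h=\{\mathbf{v}\in\mathbf{V}:\mathbf{v}|_E\in\mathbf{V}_h^E\ \forall E\in\mathcal{T}_h\}$. $Q_h\subset Q$ is the subspace with $\mathbf{curl}\,Q_h=\{\mathbf{v}_h\in\mathbf{V}_h:\mathrm{div}\,\mathbf{v}_h=0\}$. Discrete form. $\Pi_h^E:\mathbf{L}^2(E)\to\mathbf{grad}(\mathcal{P}_{k+1}(E))\subset\mathbf{V}_h^E$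 is the $\mathbf{L}^2(E)$-orthogonal projection; $b_{h,0}(\mathbf{u},\mathbf{v})=\sum_{E}(\Pi_h^E\mathbf{u},\Pi_h^E\mathbf{v})_E$ and $b_{h,s}(\mathbf{u},\mathbf{v})=b_{h,0}(\mathbf{u},\mathbf{v})+\sum_E S^E(\mathbf{u}-\Pi_h^E\mathbf{u},\mathbf{v}-\Pi_h^E\mathbf{v})$, where $S^E$ is any symmetric positive definite bilinear form such that $\underline{c}\|\mathbf{v}_h\|_{0,E}^2\le S^E(\mathbf{v}_h,\mathbf{v}_h)\le\overline{c}\|\mathbf{v}_h\|_{0,E}^2$ for all $\mathbf{v}_h\in\mathbf{V}_h^E$, with positive constants $\underline{c},\overline{c}$ independent of $E$ and $h$; the same formulas are used when the datum $\mathbf{f}$ is inserted as an argument. $b_h$ denotes either $b_{h,0}$ (for all meshes) or $b_{h,s}$ (for all meshes). $\mathbf{K}_h^{\mathrm{rot}}=\{\mathbf{v}_h\in\mathbf{V}_h:b_h(\mathbf{v}_h,\mathbf{curl}\,q_h)=0\ \forall q_h\in Q_h\}$. Discrete operator. For $\mathbf{f}\in\mathbf{L}^2(\Omega)$, $T_h\mathbf{f}=\mathbf{u}_h$, the first component of the solution $(\mathbf{u}_h,p_h)\in\mathbf{V}_h\times Q_h$ of $(\mathrm{div}\,\mathbf{u}_h,\mathrm{div}\,\mathbf{v}_h)+b_h(\mathbf{v}_h,\mathbf{curl}\,p_h)=b_h(\mathbf{f},\mathbf{v}_h)$ for all $\mathbf{v}_h\in\mathbf{V}_h$ and $b_h(\mathbf{u}_h,\mathbf{curl}\,q_h)=0$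 for all $q_h\in Q_h$.
   Formalization: Since the datum f is inserted in S^E, S^E is taken as a nonnegative symmetric bilinear form on L^2(E) whose upper bound by \overline{c} holds on all of L^2(E), not only on V_h^E; definiteness and the lower bound are required on V_h^E only. *)

theory Defs
  imports "HOL-Analysis.Analysis"
begin

type_synonym point = "real^2"
type_synonym scalar_field = "point \<Rightarrow> real"
type_synonym vector_field = "point \<Rightarrow> point"

text \<open>Elements of $L^2(E)$ are represented by functions on the whole plane. Only their values on
  \<open>E\<close> matter, and all notions below are invariant under changes on null sets. The definitions cover
  scalar and vector valued functions.\<close>

definition L2_space :: "point set \<Rightarrow> (point \<Rightarrow> 'b::euclidean_space) set" where
  "L2_space E = {u. u \<in> borel_measurable (lebesgue_on E) \<and>
                    integrable (lebesgue_on E) (\<lambda>x. (norm (u x))\<^sup>2)}"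

definition l2_inner :: "point set \<Rightarrow> (point \<Rightarrow> 'b::euclidean_space) \<Rightarrow> (point \<Rightarrow> 'b) \<Rightarrow> real" where
  "l2_inner E u v = (LINT x|lebesgue_on E. u x \<bullet> v x)"

definition l2_norm :: "point set \<Rightarrow> (point \<Rightarrow> 'b::euclidean_space) \<Rightarrow> real" where
  "l2_norm E u = sqrt (l2_inner E u u)"

definition partial_derivative :: "2 \<Rightarrow> scalar_field \<Rightarrow> scalar_field" where
  "partial_derivative i q x = frechet_derivative q (at x) (axis i 1)"

definition grad :: "scalar_field \<Rightarrow> vector_field" where
  "grad q x = vector [partial_derivative 1 q x, partial_derivative 2 q x]"

definition curl :: "scalar_field \<Rightarrow> vector_field" where
  "curl q x = vector [partial_derivative 2 q x, - partial_derivative 1 q x]"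

primrec times_cont_diff :: "nat \<Rightarrow> scalar_field \<Rightarrow> bool" where
  "times_cont_diff 0 q \<longleftrightarrow> continuous_on UNIV q"
| "times_cont_diff (Suc m) q \<longleftrightarrow>
     (\<forall>x. q differentiable (at x)) \<and> (\<forall>i. times_cont_diff m (partial_derivative i q))"

definition smooth :: "scalar_field \<Rightarrow> bool" where
  "smooth q \<longleftrightarrow> (\<forall>m. times_cont_diff m q)"

definition test_function :: "point set \<Rightarrow> scalar_field \<Rightarrow> bool" where
  "test_function E \<phi> \<longleftrightarrow>
     smooth \<phi> \<and> compact (closure {x. \<phi> x \<noteq> 0}) \<and> closure {x. \<phi> x \<noteq> 0} \<subseteq> E"

definition has_weak_grad :: "point set \<Rightarrow> scalar_field \<Rightarrow> vector_field \<Rightarrow> bool" where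
  "has_weak_grad E q g \<longleftrightarrow>
     (\<forall>\<phi>. test_function E \<phi> \<longrightarrow>
        (\<forall>i. l2_inner E q (partial_derivative i \<phi>) = - l2_inner E (\<lambda>x. g x $ i) \<phi>))"

definition has_weak_div :: "point set \<Rightarrow> vector_field \<Rightarrow> scalar_field \<Rightarrow> bool" where
  "has_weak_div E v g \<longleftrightarrow>
     (\<forall>\<phi>. test_function E \<phi> \<longrightarrow> l2_inner E v (grad \<phi>) = - l2_inner E g \<phi>)"

text \<open>No minus sign: integrating $(\partial_1 v_2 - \partial_2 v_1)\phi$ by parts gives the integral
  of $v_1 \partial_2\phi - v_2 \partial_1\phi$, that is $(v, \mathbf{curl}\,\phi)$.\<close>

definition has_weak_rot :: "point set \<Rightarrow> vector_field \<Rightarrow> scalar_field \<Rightarrow> bool" where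
  "has_weak_rot E v g \<longleftrightarrow>
     (\<forall>\<phi>. test_function E \<phi> \<longrightarrow> l2_inner E v (curl \<phi>) = l2_inner E g \<phi>)"

definition H1 :: "point set \<Rightarrow> scalar_field set" where
  "H1 E = {q \<in> L2_space E. \<exists>g \<in> L2_space E. has_weak_grad E q g}"

definition Hdiv :: "point set \<Rightarrow> vector_field set" where
  "Hdiv E = {v \<in> L2_space E. \<exists>g \<in> L2_space E. has_weak_div E v g}"

definition Hrot :: "point set \<Rightarrow> vector_field set" where
  "Hrot E = {v \<in> L2_space E. \<exists>g \<in> L2_space E. has_weak_rot E v g}"

text \<open>Weak derivatives are unique up to null sets, so that \<open>SOME\<close> selects a representative.\<close>

definition weak_grad :: "point set \<Rightarrow> scalar_field \<Rightarrow> vector_field" where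
  "weak_grad E q = (SOME g. g \<in> L2_space E \<and> has_weak_grad E q g)"

definition weak_curl :: "point set \<Rightarrow> scalar_field \<Rightarrow> vector_field" where
  "weak_curl E q x = vector [weak_grad E q x $ 2, - (weak_grad E q x $ 1)]"

definition weak_div :: "point set \<Rightarrow> vector_field \<Rightarrow> scalar_field" where
  "weak_div E v = (SOME g. g \<in> L2_space E \<and> has_weak_div E v g)"

definition div_norm :: "point set \<Rightarrow> vector_field \<Rightarrow> real" where
  "div_norm E v = sqrt ((l2_norm E v)\<^sup>2 + (l2_norm E (weak_div E v))\<^sup>2)"

definition H10 :: "point set \<Rightarrow> scalar_field set" where
  "H10 E = {q \<in> H1 E. \<exists>\<phi>. (\<forall>m. test_function E (\<phi> m)) \<and>
      (\<lambda>m. l2_norm E (\<lambda>x. q x - \<phi> m x)) \<longlonglongrightarrow> 0 \<and>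
      (\<lambda>m. l2_norm E (\<lambda>x. weak_grad E q x - grad (\<phi> m) x)) \<longlonglongrightarrow> 0}"

text \<open>For $v \in H(\mathrm{div};E)$ the normal trace $v\cdot n$ is the functional given by Green's
  formula, $\langle v\cdot n, q\rangle = (v, \mathbf{grad}\,q)_E + (\mathrm{div}\,v, q)_E$. On the
  Lipschitz domains considered here it is determined by its values at functions \<open>q\<close> that are smooth
  up to the boundary, these being dense in $H^1(E)$.\<close>

definition normal_trace :: "point set \<Rightarrow> vector_field \<Rightarrow> scalar_field \<Rightarrow> real" where
  "normal_trace E v q = l2_inner E v (grad q) + l2_inner E (weak_div E v) q"

definition V_space :: "point set \<Rightarrow> vector_field set" where
  "V_space \<Omega> = {v \<in> Hdiv \<Omega>. \<forall>q. smooth q \<longrightarrow> normal_trace \<Omega> v q = 0}"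

text \<open>A polygon is given by the cyclic list of its vertices. Consecutive edges may be collinear, so
  the edges are not determined by the underlying point set.\<close>

type_synonym polygon = "point list"

fun polygonal_path :: "point list \<Rightarrow> real \<Rightarrow> point" where
  "polygonal_path (a # b # c # vs) = linepath a b +++ polygonal_path (b # c # vs)"
| "polygonal_path [a, b] = linepath a b"
| "polygonal_path [a] = linepath a a"
| "polygonal_path [] = linepath 0 0"

definition polygon_boundary :: "polygon \<Rightarrow> point set" where
  "polygon_boundary P = path_image (polygonal_path (P @ [hd P]))"

definition simple_polygon :: "polygon \<Rightarrow> bool" where
  "simple_polygon P \<longleftrightarrow> 3 \<le> length P \<and> simple_path (polygonal_path (P @ [hd P]))"

definition polygon_edges :: "polygon \<Rightarrow> (point \<times> point) list" where
  "polygon_edges P = zip P (rotate1 P)"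

definition polygon_interior :: "polygon \<Rightarrow> point set" where
  "polygon_interior P = inside (polygon_boundary P)"

definition polygonal_domain :: "point set \<Rightarrow> bool" where
  "polygonal_domain \<Omega> \<longleftrightarrow> open \<Omega> \<and> connected \<Omega> \<and> bounded \<Omega> \<and> \<Omega> \<noteq> {} \<and>
     (\<exists>\<P>. finite \<P> \<and> (\<forall>P\<in>\<P>. simple_polygon P) \<and>
          (\<forall>P\<in>\<P>. \<forall>P'\<in>\<P>. P \<noteq> P' \<longrightarrow> polygon_boundary P \<inter> polygon_boundary P' = {}) \<and>
          frontier \<Omega> = (\<Union>P\<in>\<P>. polygon_boundary P))"

definition polygonal_mesh :: "point set \<Rightarrow> polygon set \<Rightarrow> bool" where
  "polygonal_mesh \<Omega> \<T> \<longleftrightarrow> finite \<T> \<and>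
     (\<forall>P\<in>\<T>. simple_polygon P \<and> polygon_interior P \<subseteq> \<Omega>) \<and>
     (\<forall>P\<in>\<T>. \<forall>P'\<in>\<T>. P \<noteq> P' \<longrightarrow> polygon_interior P \<inter> polygon_interior P' = {}) \<and>
     closure \<Omega> = (\<Union>P\<in>\<T>. closure (polygon_interior P))"

definition mesh_size :: "polygon set \<Rightarrow> real" where
  "mesh_size \<T> = Max ((\<lambda>P. diameter (polygon_interior P)) ` \<T>)"

definition star_shaped_wrt :: "point set \<Rightarrow> point set \<Rightarrow> bool" where
  "star_shaped_wrt E B \<longleftrightarrow> B \<subseteq> E \<and> (\<forall>x\<in>B. \<forall>y\<in>E. closed_segment x y \<subseteq> E)"

definition shape_regular :: "real \<Rightarrow> polygon \<Rightarrow> bool" where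
  "shape_regular C P \<longleftrightarrow>
     (\<exists>c r. r > C * diameter (polygon_interior P) \<and> star_shaped_wrt (polygon_interior P) (ball c r)) \<and>
     (\<forall>(a, b) \<in> set (polygon_edges P). dist a b \<ge> C * diameter (polygon_interior P))"

definition solves_source ::
    "point set \<Rightarrow> vector_field \<Rightarrow> vector_field \<Rightarrow> scalar_field \<Rightarrow> bool" where
  "solves_source \<Omega> f u p \<longleftrightarrow> u \<in> V_space \<Omega> \<and> p \<in> H10 \<Omega> \<and>
     (\<forall>v \<in> V_space \<Omega>. l2_inner \<Omega> (weak_div \<Omega> u) (weak_div \<Omega> v) + l2_inner \<Omega> v (weak_curl \<Omega> p)
                    = l2_inner \<Omega> f v) \<and>
     (\<forall>q \<in> H10 \<Omega>. l2_inner \<Omega> u (weak_curl \<Omega> q) = 0)"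

text \<open>The solution is unique up to null sets; \<open>SOME\<close> picks a representative.\<close>

definition T_op :: "point set \<Rightarrow> vector_field \<Rightarrow> vector_field" where
  "T_op \<Omega> f = (SOME u. \<exists>p. solves_source \<Omega> f u p)"

definition V0_space :: "point set \<Rightarrow> vector_field set" where
  "V0_space \<Omega> = {u. \<exists>f \<in> L2_space \<Omega>. \<exists>p. solves_source \<Omega> f u p}"

definition V0_norm :: "point set \<Rightarrow> vector_field \<Rightarrow> real" where
  "V0_norm \<Omega> u = Inf {l2_norm \<Omega> f | f. f \<in> L2_space \<Omega> \<and> (\<exists>p. solves_source \<Omega> f u p)}"

definition Q0_space :: "point set \<Rightarrow> scalar_field set" where
  "Q0_space \<Omega> = {p. \<exists>f \<in> L2_space \<Omega>. \<exists>u. solves_source \<Omega> f u p}"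

definition Q0_norm :: "point set \<Rightarrow> scalar_field \<Rightarrow> real" where
  "Q0_norm \<Omega> p = Inf {l2_norm \<Omega> f | f. f \<in> L2_space \<Omega> \<and> (\<exists>u. solves_source \<Omega> f u p)}"

definition polys :: "nat \<Rightarrow> scalar_field set" where
  "polys j = {p. \<exists>c. \<forall>x. p x = (\<Sum>(a, b) \<in> {(a, b). a + b \<le> j}. c a b * (x $ 1) ^ a * (x $ 2) ^ b)}"

text \<open>On the edge from \<open>a\<close> to \<open>b\<close>, a polynomial of degree at most \<open>k\<close> is written as a polynomial in
  the parameter \<open>t\<close> of \<open>linepath a b\<close>; the factor \<open>dist a b\<close> turns \<open>dt\<close> into arc length.\<close>

definition edgewise_polynomial_normal_trace :: "nat \<Rightarrow> polygon \<Rightarrow> vector_field \<Rightarrow> bool" where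
  "edgewise_polynomial_normal_trace k P v \<longleftrightarrow>
     (\<exists>g :: point \<times> point \<Rightarrow> real poly. (\<forall>e. degree (g e) \<le> k) \<and>
        (\<forall>q. smooth q \<longrightarrow> normal_trace (polygon_interior P) v q =
           (\<Sum>(a, b) \<in> set (polygon_edges P).
              dist a b * integral {0..1} (\<lambda>t. poly (g (a, b)) t * q (linepath a b t)))))"

definition VhE_space :: "nat \<Rightarrow> polygon \<Rightarrow> vector_field set" where
  "VhE_space k P = {v \<in> Hdiv (polygon_interior P) \<inter> Hrot (polygon_interior P).
      edgewise_polynomial_normal_trace k P v \<and>
      (\<exists>g \<in> polys k. has_weak_div (polygon_interior P) v g) \<and>
      has_weak_rot (polygon_interior P) v (\<lambda>_. 0)}"

definition Vh_space :: "point set \<Rightarrow> polygon set \<Rightarrow> nat \<Rightarrow> vector_field set" where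
  "Vh_space \<Omega> \<T> k = {v \<in> V_space \<Omega>. \<forall>P\<in>\<T>. v \<in> VhE_space k P}"

text \<open>On a simply connected domain $\mathbf{curl}$ maps $H^1_0$ bijectively onto the divergence free
  elements of \<open>V_space\<close> (modulo null sets); hence $Q_h$, the subspace whose image is the set of
  divergence free elements of $V_h$, is the preimage of that set.\<close>

definition Qh_space :: "point set \<Rightarrow> polygon set \<Rightarrow> nat \<Rightarrow> scalar_field set" where
  "Qh_space \<Omega> \<T> k =
     {q \<in> H10 \<Omega>. weak_curl \<Omega> q \<in> {v \<in> Vh_space \<Omega> \<T> k. has_weak_div \<Omega> v (\<lambda>_. 0)}}"

definition grad_polys :: "nat \<Rightarrow> vector_field set" where
  "grad_polys j = grad ` polys j"

definition proj_grad :: "nat \<Rightarrow> polygon \<Rightarrow> vector_field \<Rightarrow> vector_field" where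
  "proj_grad k P u = (SOME w. w \<in> grad_polys (k + 1) \<and>
     (\<forall>z \<in> grad_polys (k + 1). l2_inner (polygon_interior P) (\<lambda>x. u x - w x) z = 0))"

definition bh0 :: "polygon set \<Rightarrow> nat \<Rightarrow> vector_field \<Rightarrow> vector_field \<Rightarrow> real" where
  "bh0 \<T> k u v = (\<Sum>P\<in>\<T>. l2_inner (polygon_interior P) (proj_grad k P u) (proj_grad k P v))"

definition bhs :: "polygon set \<Rightarrow> nat \<Rightarrow> (polygon \<Rightarrow> vector_field \<Rightarrow> vector_field \<Rightarrow> real) \<Rightarrow>
    vector_field \<Rightarrow> vector_field \<Rightarrow> real" where
  "bhs \<T> k S u v = bh0 \<T> k u v +
     (\<Sum>P\<in>\<T>. S P (\<lambda>x. u x - proj_grad k P u x) (\<lambda>x. v x - proj_grad k P v x))"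

text \<open>The datum of the discrete problem is an arbitrary $L^2$ field and is inserted into the form
  \<open>S\<close>, so \<open>S\<close> is a form on $L^2(E)$ and the upper bound has to hold there; on the local space alone
  it would leave the discrete right-hand side unbounded in the datum. Definiteness and the lower
  bound are needed on the local space only.\<close>

definition stabilization ::
    "nat \<Rightarrow> polygon \<Rightarrow> real \<Rightarrow> real \<Rightarrow> (vector_field \<Rightarrow> vector_field \<Rightarrow> real) \<Rightarrow> bool" where
  "stabilization k P clow cup S \<longleftrightarrow>
     (let E = polygon_interior P in
      (\<forall>u \<in> L2_space E. \<forall>v \<in> L2_space E. S u v = S v u) \<and>
      (\<forall>u \<in> L2_space E. \<forall>v \<in> L2_space E. \<forall>w \<in> L2_space E.
          S (\<lambda>x. u x + v x) w = S u w + S v w) \<and>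
      (\<forall>c. \<forall>u \<in> L2_space E. \<forall>w \<in> L2_space E. S (\<lambda>x. c *\<^sub>R u x) w = c * S u w) \<and>
      (\<forall>v \<in> L2_space E. 0 \<le> S v v \<and> S v v \<le> cup * (l2_norm E v)\<^sup>2) \<and>
      (\<forall>v \<in> VhE_space k P. l2_norm E v \<noteq> 0 \<longrightarrow> 0 < S v v) \<and>
      (\<forall>v \<in> VhE_space k P. clow * (l2_norm E v)\<^sup>2 \<le> S v v))"

definition admissible_forms ::
    "(nat \<Rightarrow> polygon set) \<Rightarrow> nat \<Rightarrow> (nat \<Rightarrow> vector_field \<Rightarrow> vector_field \<Rightarrow> real) \<Rightarrow> bool" where
  "admissible_forms \<T> k b \<longleftrightarrow>
     (\<forall>n. b n = bh0 (\<T> n) k) \<or>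
     (\<exists>S clow cup. 0 < clow \<and> 0 < cup \<and>
        (\<forall>n. \<forall>P \<in> \<T> n. stabilization k P clow cup (S n P)) \<and>
        (\<forall>n. b n = bhs (\<T> n) k (S n)))"

definition Kh_rot :: "point set \<Rightarrow> polygon set \<Rightarrow> nat \<Rightarrow> (vector_field \<Rightarrow> vector_field \<Rightarrow> real) \<Rightarrow>
    vector_field set" where
  "Kh_rot \<Omega> \<T> k b =
     {v \<in> Vh_space \<Omega> \<T> k. \<forall>q \<in> Qh_space \<Omega> \<T> k. b v (weak_curl \<Omega> q) = 0}"

definition solves_discrete :: "point set \<Rightarrow> polygon set \<Rightarrow> nat \<Rightarrow>
    (vector_field \<Rightarrow> vector_field \<Rightarrow> real) \<Rightarrow> vector_field \<Rightarrow> vector_field \<Rightarrow> scalar_field \<Rightarrow> bool" where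
  "solves_discrete \<Omega> \<T> k b f u p \<longleftrightarrow> u \<in> Vh_space \<Omega> \<T> k \<and> p \<in> Qh_space \<Omega> \<T> k \<and>
     (\<forall>v \<in> Vh_space \<Omega> \<T> k.
        l2_inner \<Omega> (weak_div \<Omega> u) (weak_div \<Omega> v) + b v (weak_curl \<Omega> p) = b f v) \<and>
     (\<forall>q \<in> Qh_space \<Omega> \<T> k. b u (weak_curl \<Omega> q) = 0)"

definition Th_op :: "point set \<Rightarrow> polygon set \<Rightarrow> nat \<Rightarrow> (vector_field \<Rightarrow> vector_field \<Rightarrow> real) \<Rightarrow>
    vector_field \<Rightarrow> vector_field" where
  "Th_op \<Omega> \<T> k b f = (SOME u. \<exists>p. solves_discrete \<Omega> \<T> k b f u p)"

definition ellipticity_discrete_kernel :: "point set \<Rightarrow> (nat \<Rightarrow> polygon set) \<Rightarrow> nat \<Rightarrow>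
    (nat \<Rightarrow> vector_field \<Rightarrow> vector_field \<Rightarrow> real) \<Rightarrow> bool" where
  "ellipticity_discrete_kernel \<Omega> \<T> k b \<longleftrightarrow>
     (\<exists>\<alpha>>0. \<forall>n. \<forall>v \<in> Kh_rot \<Omega> (\<T> n) k (b n).
        l2_inner \<Omega> (weak_div \<Omega> v) (weak_div \<Omega> v) \<ge> \<alpha> * (div_norm \<Omega> v)\<^sup>2)"

text \<open>The supremum is taken in the extended reals, so that it is also meaningful when the kernel is
  trivial.\<close>

definition weak_approximability :: "point set \<Rightarrow> (nat \<Rightarrow> polygon set) \<Rightarrow> nat \<Rightarrow>
    (nat \<Rightarrow> vector_field \<Rightarrow> vector_field \<Rightarrow> real) \<Rightarrow> bool" where
  "weak_approximability \<Omega> \<T> k b \<longleftrightarrow>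
     (\<exists>\<omega> :: real \<Rightarrow> real. (\<omega> \<longlongrightarrow> 0) (at_right 0) \<and>
        (\<forall>n. \<forall>p \<in> Q0_space \<Omega>.
           (SUP v \<in> {v \<in> Kh_rot \<Omega> (\<T> n) k (b n). div_norm \<Omega> v \<noteq> 0}.
              ereal (l2_inner \<Omega> v (weak_curl \<Omega> p) / div_norm \<Omega> v))
           \<le> ereal (\<omega> (mesh_size (\<T> n)) * Q0_norm \<Omega> p)))"

definition strong_approximability :: "point set \<Rightarrow> (nat \<Rightarrow> polygon set) \<Rightarrow> nat \<Rightarrow>
    (nat \<Rightarrow> vector_field \<Rightarrow> vector_field \<Rightarrow> real) \<Rightarrow> bool" where
  "strong_approximability \<Omega> \<T> k b \<longleftrightarrow>
     (\<exists>\<omega> :: real \<Rightarrow> real. (\<omega> \<longlongrightarrow> 0) (at_right 0) \<and>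
        (\<forall>n. \<forall>u \<in> V0_space \<Omega>. \<exists>uI \<in> Kh_rot \<Omega> (\<T> n) k (b n).
           div_norm \<Omega> (\<lambda>x. u x - uI x) \<le> \<omega> (mesh_size (\<T> n)) * V0_norm \<Omega> u))"

end

theory Submission
  imports Defs "HOL-Complex_Analysis.Riemann_Mapping" "HOL-Library.Function_Algebras"
begin

text \<open>The difference \<open>w\<close> between \<open>T\<^sub>h f\<close> and the interpolant of \<open>T f\<close> lies in the discrete kernel, where
  the divergence is coercive, so one has to bound the consistency error \<open>b f w - (f, w)\<close> and
  \<open>(w, curl p)\<close>. Write \<open>w = v + curl q\<close> with \<open>v\<close> orthogonal to all \<open>curl q'\<close>. As \<open>q\<close> is the second component of the
  solution with datum \<open>curl q\<close>, weak approximability makes \<open>curl q\<close> small. For \<open>v\<close> the projection error is at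
  most \<open>\<theta>\<close> times the norm of the divergence, where \<open>\<theta>\<close> tends to zero with the mesh size: such \<open>v\<close>
  is a limit of gradients of smooth functions, and the Poincare inequality on star-shaped elements shows
  that \<open>v\<close> is of the order of the mesh size if its divergence has vanishing cell means; the cell means are finitely
  many functionals, which leaves a finite-dimensional set.

  That \<open>v\<close> is a limit of gradients, and that discrete fields are determined by finitely many moments,
  rests on the following: a square integrable field that is orthogonal to the gradients of smooth functions
  and to the curls of test functions vanishes. Its mollification is the curl of an explicit potential that vanishes
  near the exterior; by a Poincare inequality along paths in the exterior, cutting the potential off
  at distance \<open>d\<close> from the boundary costs a factor independent of \<open>d\<close>. No traces or extension theorems are
  needed for this.\<close>

text \<open>The datum is merely square integrable and is nevertheless inserted into
  \<open>b\<close>, so the consistency error can be small only through its other argument: it is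
  bounded by the norm of \<open>f\<close> times the residual of \<open>w\<close> under the
  elementwise projection. The rate \<open>\<theta>\<close> for these residuals is not explicit. It
  arises from two meshes: a coarse one is fixed and supplies finitely many fields, and fine meshes
  then resolve those fields. Functions are never identified up to null sets. All forms are therefore
  semidefinite, a space counts as finite dimensional if finitely many functionals have a null common
  kernel, and weak derivatives and projections are linear only almost everywhere. Both solution
  operators are defined by choice, so existence for the continuous and for the discrete problem is
  part of the proof. One geometric property, a connected exterior that touches the whole frontier,
  serves the domain and each element alike: on the domain it yields the gradient approximation, on
  elements the finite dimensionality of the discrete fields.\<close>

abbreviation "intr \<equiv> polygon_interior"

abbreviation "pd \<equiv> partial_derivative"

abbreviation nn :: "('a::euclidean_space \<Rightarrow> ennreal) \<Rightarrow> ennreal" where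
  "nn f \<equiv> nn_integral lborel f"

subsection \<open>Semi-inner product spaces\<close>

text \<open>Pointwise operations turn fields into vectors, so that \<open>subspace\<close>, finite
  sums and linear functionals are available for sets of functions. Equality of vectors is literal
  equality of functions; null sets are left to the semidefinite forms below.\<close>

instantiation "fun" :: (type, real_vector) real_vector
begin

definition scaleR_fun :: "real => ('a => 'b) => 'a => 'b" where
 "scaleR_fun c f = (%x. c*\<^sub>R f x)"

instance
 by standard (auto simp: scaleR_fun_def fun_eq_iff algebra_simps)

end

lemma scaleR_fun_apply [simp]: "(c*\<^sub>R f) x = c*\<^sub>R f x"
 by (simp add: scaleR_fun_def)

lemma sum_fun_apply: "sum f A x = (\<Sum>i\<in>A. f i x)"
 by (induction A rule: infinite_finite_induct) auto

text \<open>Semidefinite, because functions that differ on a null set are distinct vectors and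
  because the divergence form used later vanishes on all curls. The carrier is a set since square
  integrability is a property of total functions.\<close>

locale semi_inner_space =
 fixes H :: "'v::real_vector set" and B :: "'v => 'v => real"
 assumes subspace_H: "subspace H"
  and sym: "!!u v. u\<in>H ==> v\<in>H ==> B u v = B v u"
  and add_left: "!!u v w. u\<in>H ==> v\<in>H ==> w\<in>H ==> B (u + v) w = B u w + B v w"
  and scale_left: "!!c u w. u\<in>H ==> w\<in>H ==> B (c*\<^sub>R u) w = c*B u w"
  and nonneg: "!!u. u\<in>H ==> 0 <= B u u"
begin

definition nrm :: "'v => real" where "nrm u = sqrt (B u u)"

lemma zero_in [simp]: "0\<in>H"
 using subspace_H by (rule subspace_0)

lemma closed [simp]:
 "u\<in>H ==> v\<in>H ==> u + v\<in>H" "u\<in>H ==> c*\<^sub>R u\<in>H" "u\<in>H ==> v\<in>H ==> u - v\<in>H"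
 "u\<in>H ==> - u\<in>H"
 using subspace_H by (auto intro: subspace_add subspace_scale subspace_diff subspace_neg)

lemma add_right: "u\<in>H ==> v\<in>H ==> w\<in>H ==> B w (u + v) = B w u + B w v"
 using add_left sym closed by metis

lemma scale_right: "u\<in>H ==> w\<in>H ==> B w (c*\<^sub>R u) = c*B w u"
 using scale_left sym closed by metis

lemma diff_left: "u\<in>H ==> v\<in>H ==> w\<in>H ==> B (u - v) w = B u w - B v w"
 using add_left[of u "(-1)*\<^sub>R v" w] scale_left[of v w "-1"] by simp

lemma diff_right: "u\<in>H ==> v\<in>H ==> w\<in>H ==> B w (u - v) = B w u - B w v"
 using diff_left sym closed by metis

lemma zero_left [simp]: "w\<in>H ==> B 0 w = 0"
 using scale_left[of 0 w 0] by simp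

lemma zero_right [simp]: "w\<in>H ==> B w 0 = 0"
 using scale_right[of 0 w 0] by simp

lemma nrm_nonneg [simp]: "u\<in>H ==> 0 <= nrm u"
 by (simp add: nrm_def nonneg)

lemma nrm_sq: "u\<in>H ==> (nrm u)^2 = B u u"
 by (simp add: nrm_def nonneg)

lemma B_self_scale: "u\<in>H ==> B (c*\<^sub>R u) (c*\<^sub>R u) = c^2*B u u"
 by (simp add: scale_left scale_right power2_eq_square)

lemma nrm_scale: "u\<in>H ==> nrm (c*\<^sub>R u) = \<bar>c\<bar>*nrm u"
 by (simp add: nrm_def B_self_scale real_sqrt_mult)

lemma expand_sq:
 assumes "u\<in>H" "v\<in>H"
 shows "B (u + t*\<^sub>R v) (u + t*\<^sub>R v) = B u u + 2*t*B u v + t^2*B v v"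
 using assms sym[of u v]
 by (simp add: add_left add_right scale_left scale_right power2_eq_square algebra_simps)

lemma Cauchy_Schwarz_sq:
 assumes "u\<in>H" "v\<in>H"
 shows "(B u v)^2 <= B u u*B v v"
proof (cases "B v v = 0")
 case True
 have "B u v = 0"
 proof (rule ccontr)
  assume nz: "B u v ~= 0"
  \<comment> \<open>With \<open>B v v = 0\<close> the polynomial in \<open>t\<close> is affine with
    nonzero slope; this \<open>t\<close> gives it the value -1.\<close>
  define t where "t = - (B u u + 1)/(2*B u v)"
  have "0 <= B (u + t*\<^sub>R v) (u + t*\<^sub>R v)"
   using assms by (intro nonneg) simp
  also have "... = B u u - (B u u + 1)"
   using nz True by (simp add: expand_sq assms t_def field_simps)
  finally show False by simp
 qed
 thus ?thesis
  using True by simp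
next
 case False
 hence pos: "B v v > 0"
  using nonneg[OF assms(2)] by simp
 \<comment> \<open>The minimizer of the quadratic polynomial in \<open>t\<close>; its minimum is the
   Gram determinant divided by \<open>B v v\<close>.\<close>
 define t where "t = - B u v/B v v"
 have "0 <= B (u + t*\<^sub>R v) (u + t*\<^sub>R v)"
  using assms by (intro nonneg) simp
 also have "... = B u u - (B u v)^2/B v v"
  unfolding expand_sq[OF assms] using pos by (simp add: t_def power2_eq_square field_simps)
 finally show ?thesis
  using pos by (simp add: field_simps)
qed

lemma Cauchy_Schwarz:
 assumes "u\<in>H" "v\<in>H"
 shows "\<bar>B u v\<bar> <= nrm u*nrm v"
 using real_sqrt_le_mono[OF Cauchy_Schwarz_sq[OF assms]]
 by (simp add: nrm_def real_sqrt_mult)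

lemma null_orth:
 assumes "u\<in>H" "v\<in>H" "B v v = 0"
 shows "B u v = 0" "B v u = 0"
 using Cauchy_Schwarz_sq[OF assms(1,2)] assms sym by auto

lemma nrm_triangle:
 assumes "u\<in>H" "v\<in>H"
 shows "nrm (u + v) <= nrm u + nrm v"
proof (rule power2_le_imp_le)
 have "(nrm (u + v))^2 = B u u + 2*B u v + B v v"
  using expand_sq[OF assms, of 1] assms by (simp add: nrm_sq)
 also have "... <= (nrm u + nrm v)^2"
  using Cauchy_Schwarz[OF assms] nrm_sq[OF assms(1)] nrm_sq[OF assms(2)]
  by (simp add: power2_sum)
 finally show "(nrm (u + v))^2 <= (nrm u + nrm v)^2" .
 show "0 <= nrm u + nrm v" using assms by simp
qed

lemma nrm_uminus: "u\<in>H ==> nrm (- u) = nrm u"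
 using nrm_scale[of u "-1"] by simp

lemma nrm_triangle_diff:
 assumes "u\<in>H" "v\<in>H"
 shows "nrm (u - v) <= nrm u + nrm v"
 using nrm_triangle[of u "-v"] assms by (simp add: nrm_uminus)

lemma nrm_minus_commute: "u\<in>H ==> v\<in>H ==> nrm (u - v) = nrm (v - u)"
 using nrm_uminus[of "u - v"] by simp

lemma nrm_triangle3:
 assumes "u\<in>H" "v\<in>H" "w\<in>H"
 shows "nrm (u - w) <= nrm (u - v) + nrm (v - w)"
 using nrm_triangle[of "u - v" "v - w"] assms by simp

lemma nrm_abs_diff:
 assumes "u\<in>H" "v\<in>H"
 shows "\<bar>nrm u - nrm v\<bar> <= nrm (u - v)"
 using nrm_triangle[of "u - v" v] nrm_triangle[of "v - u" u] assms nrm_minus_commute[of u v]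
 by auto

lemma nrm_sum:
 assumes "finite A" "!!i. i\<in>A ==> f i\<in>H"
 shows "sum f A\<in>H" "nrm (sum f A) <= (\<Sum>i\<in>A. nrm (f i))"
proof -
 have "sum f A\<in>H & nrm (sum f A) <= (\<Sum>i\<in>A. nrm (f i))"
  using assms
 proof (induction A rule: finite_induct)
  case empty
  thus ?case by (simp add: nrm_def)
 next
  case (insert x F)
  hence "sum f F\<in>H" "f x\<in>H" "nrm (sum f F) <= (\<Sum>i\<in>F. nrm (f i))" by auto
  thus ?case
   using insert(1,2) nrm_triangle[of "f x" "sum f F"] by simp
 qed
 thus "sum f A\<in>H" "nrm (sum f A) <= (\<Sum>i\<in>A. nrm (f i))" by auto
qed

lemma sum_right:
 assumes "finite A" "!!i. i\<in>A ==> f i\<in>H" "u\<in>H"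
 shows "B u (sum f A) = (\<Sum>i\<in>A. B u (f i))"
 using assms
proof (induction A rule: finite_induct)
 case (insert x F)
 thus ?case by (simp add: add_right nrm_sum)
qed simp

lemma B_tendsto:
 assumes "!!n. x n\<in>H" "a\<in>H" "v\<in>H" "(%n. nrm (x n - a)) \<longlonglongrightarrow> 0"
 shows "(%n. B (x n) v) \<longlonglongrightarrow> B a v"
proof (rule LIM_zero_cancel, rule Lim_null_comparison)
 show "\<forall>\<^sub>F n in sequentially. norm (B (x n) v - B a v) <= nrm (x n - a)*nrm v"
  using assms Cauchy_Schwarz[of "x _ - a" v] by (simp add: diff_left)
 show "(%n. nrm (x n - a)*nrm v) \<longlonglongrightarrow> 0"
  using assms(4) by (rule tendsto_mult_left_zero)
qed

lemma nrm_tendsto: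
 assumes "!!n. x n\<in>H" "a\<in>H" "(%n. nrm (x n - a)) \<longlonglongrightarrow> 0"
 shows "(%n. nrm (x n)) \<longlonglongrightarrow> nrm a"
proof (rule LIM_zero_cancel, rule Lim_null_comparison)
 show "\<forall>\<^sub>F n in sequentially. norm (nrm (x n) - nrm a) <= nrm (x n - a)"
  using assms nrm_abs_diff by simp
qed fact

definition complete_seq :: bool where
 "complete_seq \<longleftrightarrow> (ALL x. (ALL n. x n\<in>H) --> (ALL e>0. EX N. ALL m>=N. ALL n>=N. nrm (x m - x n) < e) -->
  (\<exists>a\<in>H. (%n. nrm (x n - a)) \<longlonglongrightarrow> 0))"

lemma parallelogram:
 assumes "u\<in>H" "v\<in>H"
 shows "B (u - v) (u - v) = 2*B u u + 2*B v v - 4*B ((1/2)*\<^sub>R (u + v)) ((1/2)*\<^sub>R (u + v))"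
 using assms sym[of u v]
 by (simp add: add_left add_right scale_left scale_right diff_left diff_right field_simps)

text \<open>The subspaces of interest, such as gradients or curls of test functions, are not closed,
  so a nearest point need not exist in \<open>W\<close>. A minimizing sequence is Cauchy, and it is
  the residual \<open>u - w n\<close> that converges in the complete carrier.\<close>

lemma orthogonal_residual:
 assumes W: "subspace W" "W \<subseteq> H" and u: "u\<in>H" and complete: "complete_seq"
 obtains r w where "r\<in>H" "!!n::nat. w n\<in>W" "(%n. nrm (u - w n - r)) \<longlonglongrightarrow> 0"
  "!!v. v\<in>W ==> B r v = 0"
proof -
 define S where "S = (%w. B (u - w) (u - w)) ` W"
 define d where "d = Inf S"
 have W0: "0\<in>W" using W(1) by (rule subspace_0)
 have S_ne: "S ~= {}" using W0 by (auto simp: S_def)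
 have S_bdd: "bdd_below S"
  unfolding S_def by (rule bdd_belowI[of _ 0]) (use W u nonneg in auto)
 have d_le: "d <= B (u - w) (u - w)" if "w\<in>W" for w
  unfolding d_def using S_bdd that by (intro cInf_lower) (auto simp: S_def)
 have "\<exists>w\<in>W. B (u - w) (u - w) < d + 1/Suc n" for n
 proof -
  have "\<exists>s\<in>S. s < d + 1/Suc n"
   using cInf_lessD[OF S_ne, of "d + 1/Suc n"] by (auto simp: d_def)
  thus ?thesis by (auto simp: S_def)
 qed
 then obtain w where w: "!!n. w n\<in>W" and w_lt: "!!n. B (u - w n) (u - w n) < d + 1/Suc n"
  by metis
 have wH: "w n\<in>H" for n using w W by auto
 \<comment> \<open>The midpoint of two elements of \<open>W\<close> lies in \<open>W\<close>, so its
   squared distance from \<open>u\<close> is at least \<open>d\<close>; the parallelogram law turns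
   near-minimality into closeness.\<close>
 have close: "B (w m - w n) (w m - w n) <= 2/Suc m + 2/Suc n" for m n
 proof -
  have mid: "(1/2)*\<^sub>R ((u - w m) + (u - w n)) = u - (1/2)*\<^sub>R (w m + w n)"
   by (simp add: algebra_simps flip: scaleR_add_left)
  have "B ((u - w m) - (u - w n)) ((u - w m) - (u - w n)) =
    2*B (u - w m) (u - w m) + 2*B (u - w n) (u - w n)
    - 4*B (u - (1/2)*\<^sub>R (w m + w n)) (u - (1/2)*\<^sub>R (w m + w n))"
   using parallelogram[of "u - w m" "u - w n"] u wH by (simp only: mid closed)
  also have "... <= 2*(d + 1/Suc m) + 2*(d + 1/Suc n) - 4*d"
   using w_lt[of m] w_lt[of n] d_le[of "(1/2)*\<^sub>R (w m + w n)"] w W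
   by (auto simp: subspace_add subspace_scale)
  finally have "B (w n - w m) (w n - w m) <= 2/Suc m + 2/Suc n"
   by simp
  thus ?thesis
   using B_self_scale[of "w n - w m" "-1"] wH by simp
 qed
 have "\<exists>r\<in>H. (%n. nrm ((u - w n) - r)) \<longlonglongrightarrow> 0"
 proof (rule complete[unfolded complete_seq_def, rule_format])
  show "u - w n\<in>H" for n using u wH by simp
  fix e :: real assume e: "e > 0"
  obtain N where N: "4/e^2 < real N"
   using reals_Archimedean2 by blast
  have "nrm ((u - w m) - (u - w n)) < e" if "m >= N" "n >= N" for m n
  proof -
   have "2/Suc m + 2/Suc n <= 2/Suc N + 2/Suc N"
    using that by (intro add_mono divide_left_mono) auto
   also have "... = 4/Suc N" by simp
   also have "... < e^2"
    using N e by (simp add: field_simps) (smt (verit) zero_less_power)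
   finally have "B (w n - w m) (w n - w m) < e^2"
    using close[of n m] by simp
   hence "nrm (w n - w m) < e"
    unfolding nrm_def using e by (intro real_less_lsqrt) auto
   thus ?thesis by simp
  qed
  thus "EX N. ALL m>=N. ALL n>=N. nrm ((u - w m) - (u - w n)) < e" by blast
 qed
 then obtain r where r: "r\<in>H" and lim: "(%n. nrm ((u - w n) - r)) \<longlonglongrightarrow> 0" by blast
 have orth: "B r v = 0" if v: "v\<in>W" for v
 proof -
  have vH: "v\<in>H" using v W by auto
  have l1: "(%n. B (u - w n) v) \<longlonglongrightarrow> B r v"
   by (rule B_tendsto) (use u wH r vH lim in auto)
  have l2: "(%n. 1/real (Suc n)) \<longlonglongrightarrow> 0"
   using lim_inverse_n' LIMSEQ_Suc by blast
  \<comment> \<open>Near-minimality of \<open>w n\<close> against the competitor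
    \<open>w n - t v\<close>; the slack disappears in the limit while \<open>t\<close> stays
    free.\<close>
  have key: "- (1/Suc n) <= 2*t*B (u - w n) v + t^2*B v v" for n t
  proof -
   have "d <= B (u - (w n - t*\<^sub>R v)) (u - (w n - t*\<^sub>R v))"
    using w v W(1) by (intro d_le) (simp add: subspace_diff subspace_scale)
   also have "... = B (u - w n) (u - w n) + 2*t*B (u - w n) v + t^2*B v v"
    using expand_sq[of "u - w n" v t] u wH vH by (simp add: algebra_simps)
   finally show ?thesis using w_lt[of n] by simp
  qed
  have key2: "0 <= 2*t*B r v + t^2*B v v" for t
  proof (rule LIMSEQ_le)
   show "(%n. - (1/real (Suc n))) \<longlonglongrightarrow> 0" using tendsto_minus[OF l2] by simp
   show "(%n. 2*t*B (u - w n) v + t^2*B v v) \<longlonglongrightarrow> 2*t*B r v + t^2*B v v"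
    by (intro tendsto_intros l1)
  qed (use key in auto)
  show ?thesis
  proof (rule ccontr)
   assume nz: "B r v ~= 0"
   \<comment> \<open>The added 1 keeps the denominator positive when \<open>v\<close> is a null
     vector.\<close>
   define t where "t = - B r v/(B v v + 1)"
   have pos: "B v v + 1 > 0" using nonneg[OF vH] by simp
   have tB: "B r v = - (t*(B v v + 1))" using pos by (simp add: t_def)
   have "2*t*B r v + t^2*B v v = t^2*(B v v - 2*(B v v + 1))"
    unfolding tB by (simp add: power2_eq_square algebra_simps)
   also have "... < 0"
    using nz nonneg[OF vH] pos by (intro mult_pos_neg) (auto simp: t_def)
   finally show False using key2[of t] by simp
  qed
 qed
 show thesis
  using that[of r w] r w lim orth by simp
qed

text \<open>The residual \<open>r\<close>, with respect to the kernel of \<open>F\<close>, of some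
  \<open>u\<close> with \<open>F u\<close> nonzero is orthogonal to that kernel and satisfies
  \<open>F r = F u\<close>. Every \<open>v\<close> differs from a multiple of \<open>r\<close> by a
  kernel element, so a multiple of \<open>r\<close> represents \<open>F\<close>.\<close>

theorem Riesz_representation:
 assumes complete: "complete_seq"
  and add: "!!u v. u\<in>H ==> v\<in>H ==> F (u + v) = F u + F v"
  and scale: "!!c u. u\<in>H ==> F (c*\<^sub>R u) = c*F u"
  and bound: "!!u. u\<in>H ==> \<bar>F u\<bar> <= C*nrm u"
 obtains a where "a\<in>H" "!!v. v\<in>H ==> B a v = F v"
proof (cases "\<forall>u\<in>H. F u = 0")
 case True
 thus ?thesis using that[of 0] by simp
next
 case False
 then obtain u where u: "u\<in>H" "F u ~= 0" by blast
 define W where "W = {v\<in>H. F v = 0}"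
 have "F 0 = 0" using scale[of 0 0] by simp
 hence W: "subspace W" "W \<subseteq> H"
  by (auto simp: W_def subspace_def add scale)
 obtain r w where r: "r\<in>H" and w: "!!n::nat. w n\<in>W"
  and lim: "(%n. nrm (u - w n - r)) \<longlonglongrightarrow> 0" and orth: "!!v. v\<in>W ==> B r v = 0"
  using orthogonal_residual[OF W u(1) complete] by blast
 have Fd: "F (a - b) = F a - F b" if "a\<in>H" "b\<in>H" for a b
  using add[of a "(-1)*\<^sub>R b"] scale[of b "-1"] that by simp
 have wH: "w n\<in>H" and Fw: "F (w n) = 0" for n using w by (auto simp: W_def)
 have "(%n. F (u - w n - r)) \<longlonglongrightarrow> 0"
 proof (rule Lim_null_comparison)
  show "\<forall>\<^sub>F n in sequentially. norm (F (u - w n - r)) <= C*nrm (u - w n - r)"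
   using bound u wH r by simp
  show "(%n. C*nrm (u - w n - r)) \<longlonglongrightarrow> 0"
   using lim by (rule tendsto_mult_right_zero)
 qed
 moreover have "F (u - w n - r) = F u - F r" for n
  using u wH r Fw by (simp add: Fd)
 ultimately have Fr: "F r = F u" by (simp add: LIMSEQ_const_iff)
 have Br: "B r r ~= 0"
 proof
  assume "B r r = 0"
  hence "nrm r = 0" by (simp add: nrm_def)
  thus False using bound[OF r] Fr u by simp
 qed
 show ?thesis
 proof (rule that[of "(F r/B r r)*\<^sub>R r"])
  show "(F r/B r r)*\<^sub>R r\<in>H" using r by simp
  fix v assume v: "v\<in>H"
  have "v - (F v/F r)*\<^sub>R r\<in>W"
   using v r Fr u by (simp add: W_def Fd scale)
  hence "B r (v - (F v/F r)*\<^sub>R r) = 0" by (rule orth)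
  hence "B r v = F v/F r*B r r"
   using v r by (simp add: diff_right scale_right)
  thus "B ((F r/B r r)*\<^sub>R r) v = F v"
   using v r Br Fr u by (simp add: scale_left)
 qed
qed

end

section \<open>Finitely many linear functionals on a subspace\<close>

definition linear_on :: "'v::real_vector set => ('v => real) => bool" where
 "linear_on W F \<longleftrightarrow>
  (\<forall>u\<in>W. \<forall>v\<in>W. F (u + v) = F u + F v) & (ALL c. \<forall>u\<in>W. F (c*\<^sub>R u) = c*F u)"

lemma linear_onD:
 assumes "linear_on W F" "subspace W"
 shows "u\<in>W ==> v\<in>W ==> F (u + v) = F u + F v" "u\<in>W ==> F (c*\<^sub>R u) = c*F u"
  "u\<in>W ==> v\<in>W ==> F (u - v) = F u - F v" "F 0 = 0"
  "finite A ==> (!!i. i\<in>A ==> f i\<in>W) ==> F (sum f A) = (\<Sum>i\<in>A. F (f i))"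
proof -
 show a: "F (u + v) = F u + F v" if "u\<in>W" "v\<in>W" for u v
  using assms that by (auto simp: linear_on_def)
 show s: "F (c*\<^sub>R u) = c*F u" if "u\<in>W" for c u
  using assms that by (auto simp: linear_on_def)
 show "F (u - v) = F u - F v" if "u\<in>W" "v\<in>W"
  using a[of u "(-1)*\<^sub>R v"] s[of v "-1"] that subspace_scale[OF assms(2), of v "-1"] by simp
 show z: "F 0 = 0"
  using s[of 0 0] subspace_0[OF assms(2)] by simp
 show "F (sum f A) = (\<Sum>i\<in>A. F (f i))" if "finite A" "!!i. i\<in>A ==> f i\<in>W"
  using that
 proof (induction A rule: finite_induct)
  case (insert x F)
  thus ?case by (simp add: a subspace_sum[OF assms(2)])
 qed (simp add: z)
qed

lemma linear_on_subset:
 "linear_on W F ==> W' \<subseteq> W ==> linear_on W' F"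
 unfolding linear_on_def by (simp add: subset_iff)

text \<open>The vectors \<open>z i\<close> provide a generalized inverse of \<open>v \<mapsto> (l i v)\<^sub>i\<close>: subtracting
 \<open>\<Sum>i. l i v *\<^sub>R z i\<close> projects onto the common kernel.\<close>

lemma kernel_projection:
 assumes "finite I" "subspace W" "!!i. i\<in>I ==> linear_on W (l i)"
 obtains z where "!!i. i\<in>I ==> z i\<in>W"
  "!!v i. v\<in>W ==> i\<in>I ==> l i (v - (\<Sum>j\<in>I. l j v *\<^sub>R z j)) = 0"
proof -
 have "EX z. (\<forall>i\<in>I. z i\<in>W) & (\<forall>v\<in>W. \<forall>i\<in>I. l i (v - (\<Sum>j\<in>I. l j v *\<^sub>R z j)) = 0)"
  using assms(1,3)
 proof (induction I rule: finite_induct)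
  case empty
  thus ?case by simp
 next
  case (insert a I)
  note lin = linear_onD[OF insert.prems assms(2)]
  obtain z where z: "!!i. i\<in>I ==> z i\<in>W"
   and zl: "!!v i. v\<in>W ==> i\<in>I ==> l i (v - (\<Sum>j\<in>I. l j v *\<^sub>R z j)) = 0"
   using insert.IH insert.prems by blast
  define P where "P v = v - (\<Sum>j\<in>I. l j v *\<^sub>R z j)" for v
  have PW: "P v\<in>W" if "v\<in>W" for v
   unfolding P_def using that z assms(2) by (intro subspace_diff subspace_sum subspace_scale)
  show ?case
  proof (cases "\<forall>v\<in>W. (\<forall>i\<in>I. l i v = 0) --> l a v = 0")
   case True
   \<comment> \<open>Here \<open>l a\<close> vanishes wherever the earlier functionals do, so the
     zero vector can be assigned to it.\<close>
   define z' where "z' = z(a := 0)"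
   have eq: "(\<Sum>j\<in>insert a I. l j v *\<^sub>R z' j) = (\<Sum>j\<in>I. l j v *\<^sub>R z j)" for v
    using insert(1,2) by (auto simp: z'_def intro!: sum.cong)
   have "l i (v - (\<Sum>j\<in>insert a I. l j v *\<^sub>R z' j)) = 0" if "v\<in>W" "i\<in>insert a I" for v i
    using that zl True PW[OF that(1)] unfolding eq P_def by auto
   moreover have "\<forall>i\<in>insert a I. z' i\<in>W"
    using z subspace_0[OF assms(2)] by (auto simp: z'_def)
   ultimately show ?thesis by blast
  next
   case False
   then obtain v1 where v1: "v1\<in>W" "\<forall>i\<in>I. l i v1 = 0" "l a v1 ~= 0" by blast
   define v0 where "v0 = (1/l a v1)*\<^sub>R v1"
   have v0: "v0\<in>W" "!!i. i\<in>I ==> l i v0 = 0" "l a v0 = 1"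
    using v1 assms(2) lin(2) by (auto simp: v0_def subspace_scale)
   \<comment> \<open>\<open>v0\<close> is dual to \<open>l a\<close> and lies in the kernel of the
     other functionals; the old vectors are corrected by multiples of \<open>v0\<close> until
     \<open>l a\<close> vanishes on them.\<close>
   define z' where "z' = (%j. if j = a then v0 else z j - l a (z j)*\<^sub>R v0)"
   have z'W: "\<forall>i\<in>insert a I. z' i\<in>W"
    using z v0 assms(2) by (auto simp: z'_def subspace_diff subspace_scale)
   have laP: "l a (P v) = l a v - (\<Sum>j\<in>I. l j v * l a (z j))" if "v\<in>W" for v
    using that z assms(2) insert(1) by (simp add: P_def lin subspace_sum subspace_scale)
   have eq: "v - (\<Sum>j\<in>insert a I. l j v *\<^sub>R z' j) = P v - l a (P v)*\<^sub>R v0" if "v\<in>W" for v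
   proof -
    have "(\<Sum>j\<in>insert a I. l j v *\<^sub>R z' j) = l a v *\<^sub>R v0 + (\<Sum>j\<in>I. l j v *\<^sub>R z' j)"
     using insert(1,2) by (simp add: z'_def)
    also have "(\<Sum>j\<in>I. l j v *\<^sub>R z' j) =
      (\<Sum>j\<in>I. l j v *\<^sub>R z j - (l j v * l a (z j))*\<^sub>R v0)"
     using insert(2) by (intro sum.cong) (auto simp: z'_def scaleR_diff_right)
    also have "... = (\<Sum>j\<in>I. l j v *\<^sub>R z j) - (\<Sum>j\<in>I. l j v * l a (z j))*\<^sub>R v0"
     by (simp add: sum_subtractf scaleR_left.sum)
    finally show ?thesis
     unfolding laP[OF that] by (simp add: P_def scaleR_diff_left)
   qed
   have "l i (v - (\<Sum>j\<in>insert a I. l j v *\<^sub>R z' j)) = 0" if "v\<in>W" "i\<in>insert a I" for v i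
    unfolding eq[OF that(1)] using that zl[OF that(1)] v0 PW[OF that(1)] assms(2)
    by (auto simp: lin subspace_scale simp flip: P_def)
   thus ?thesis using z'W by blast
  qed
 qed
 thus thesis using that by blast
qed

text \<open>Representation in a space that is finite dimensional only modulo null vectors: in place
  of a basis there are functionals whose common kernel is null, and the induction adds one
  orthogonal direction per functional. It yields both the local projections and the discrete
  solution.\<close>

lemma (in semi_inner_space) finite_Riesz:
 assumes "finite I" "subspace W" "W \<subseteq> H"
  and "!!i. i\<in>I ==> linear_on W (l i)"
  and "!!v. v\<in>W ==> (!!i. i\<in>I ==> l i v = 0) ==> B v v = 0"
  and "linear_on W F" and "!!v. v\<in>W ==> B v v = 0 ==> F v = 0"
 shows "\<exists>a\<in>W. \<forall>v\<in>W. B a v = F v"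
 using assms
proof (induction I arbitrary: W F rule: finite_induct)
 case empty
 hence "B v v = 0" "F v = 0" if "v\<in>W" for v using that by auto
 thus ?case
  using subspace_0[OF empty(1)] empty(2) by (intro bexI[of _ 0]) (auto simp: subset_iff)
next
 case (insert i I)
 have WH: "v\<in>H" if "v\<in>W" for v using that insert.prems by auto
 note li = linear_onD[OF insert.prems(3)[OF insertI1] insert.prems(1)]
 note lF = linear_onD[OF insert.prems(5) insert.prems(1)]
 define W0 where "W0 = {v\<in>W. l i v = 0}"
 have W0: "subspace W0" "W0 \<subseteq> W"
  using insert.prems(1) li by (auto simp: W0_def subspace_def)
 have IH: "\<exists>a\<in>W0. \<forall>v\<in>W0. B a v = G v"
  if "linear_on W G" "!!v. v\<in>W ==> B v v = 0 ==> G v = 0" for G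
 proof (rule insert.IH)
  show "!!v. v\<in>W0 ==> (!!i. i\<in>I ==> l i v = 0) ==> B v v = 0"
   using insert.prems(4) by (auto simp: W0_def)
 qed (use W0 that insert.prems in \<open>auto intro: linear_on_subset[OF _ W0(2)]\<close>)
 obtain u0 where u0: "u0\<in>W0" "!!v. v\<in>W0 ==> B u0 v = F v"
  using IH[OF insert.prems(5,6)] by blast
 show ?case
 proof (cases "W0 = W")
  case True
  thus ?thesis using u0 by blast
 next
  case False
  then obtain v1 where v1: "v1\<in>W" "l i v1 ~= 0" by (auto simp: W0_def)
  have lin1: "linear_on W (B v1)"
   using WH v1 by (auto simp: linear_on_def add_right scale_right)
  obtain p where p: "p\<in>W0" "!!v. v\<in>W0 ==> B p v = B v1 v"
   using IH[OF lin1] null_orth WH v1 by blast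
  \<comment> \<open>The part of \<open>v1\<close> orthogonal to \<open>W0\<close>. If it is a null
    vector, \<open>F\<close> vanishes on it by assumption, which is why \<open>c = 0\<close> is then
    correct.\<close>
  define r where "r = v1 - p"
  have pW: "p\<in>W" "u0\<in>W" using p u0 W0 by auto
  have r: "r\<in>W" "l i r = l i v1"
   using pW v1 insert.prems(1) p by (auto simp: r_def W0_def li subspace_diff)
  have rorth: "B r v = 0" if "v\<in>W0" for v
   using that p v1 pW W0 WH by (simp add: r_def diff_left subset_iff)
  define c where "c = (if B r r = 0 then 0 else F r/B r r)"
  define a where "a = u0 + c*\<^sub>R r"
  have "B a v = F v" if v: "v\<in>W" for v
  proof -
   define t where "t = l i v/l i r"
   define w where "w = v - t*\<^sub>R r"
   have w: "w\<in>W0" "w\<in>W"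
    using v r v1 insert.prems(1) by (auto simp: w_def W0_def t_def li subspace_diff subspace_scale)
   have veq: "v = w + t*\<^sub>R r" by (simp add: w_def)
   have "B u0 r = 0"
    using rorth[OF u0(1)] sym WH r pW by metis
   moreover have "c*B r r = F r"
    using insert.prems(6)[OF r(1)] by (simp add: c_def)
   ultimately show ?thesis
    using w r u0(2)[OF w(1)] rorth[OF w(1)] WH pW insert.prems(1)
    by (simp add: veq a_def add_left add_right scale_left scale_right lF subspace_scale)
  qed
  moreover have "a\<in>W"
   using pW r insert.prems(1) by (simp add: a_def subspace_add subspace_scale)
  ultimately show ?thesis by blast
 qed
qed

subsection \<open>Square integrable fields\<close>

lemma norm_add_sq_le:
 fixes a b :: "'b::real_inner"
 shows "(norm (a + b))^2 <= 2*(norm a)^2 + 2*(norm b)^2"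
proof -
 have "(norm (a + b))^2 <= (norm a + norm b)^2"
  by (intro power_mono norm_triangle_ineq) auto
 also have "... <= 2*(norm a)^2 + 2*(norm b)^2"
  using sum_squares_bound[of "norm a" "norm b"] by (simp add: power2_sum)
 finally show ?thesis .
qed

lemma L2_spaceD:
 assumes "u\<in>L2_space E"
 shows "u\<in>borel_measurable (lebesgue_on E)" "integrable (lebesgue_on E) (%x. (norm (u x))^2)"
 using assms by (auto simp: L2_space_def)

lemma L2_space_dominated:
 assumes "u\<in>borel_measurable (lebesgue_on E)" "integrable (lebesgue_on E) g"
  "!!x. x\<in>E ==> (norm (u x))^2 <= g x"
 shows "u\<in>L2_space E"
 unfolding L2_space_def mem_Collect_eq
proof (intro conjI Bochner_Integration.integrable_bound[OF assms(2)] assms(1) AE_I2)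
 show "(%x. (norm (u x))^2)\<in>borel_measurable (lebesgue_on E)"
  using assms(1) by measurable
 show "norm ((norm (u x))^2) <= norm (g x)" if "x\<in>space (lebesgue_on E)" for x
  using assms(3)[of x] that by (auto simp: space_restrict_space)
qed

lemma subspace_L2_space: "subspace (L2_space E :: (point => 'b::euclidean_space) set)"
proof (rule subspaceI)
 show "0\<in>L2_space E" by (simp add: L2_space_def zero_fun_def)
next
 fix u v :: "point => 'b" assume uv: "u\<in>L2_space E" "v\<in>L2_space E"
 note [measurable] = L2_spaceD(1)[OF uv(1)] L2_spaceD(1)[OF uv(2)]
 show "u + v\<in>L2_space E"
 proof (rule L2_space_dominated)
  show "u + v\<in>borel_measurable (lebesgue_on E)" unfolding plus_fun_def by measurable
  show "integrable (lebesgue_on E) (%x. 2*(norm (u x))^2 + 2*(norm (v x))^2)"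
   using uv by (intro Bochner_Integration.integrable_add integrable_mult_right L2_spaceD)
 qed (simp add: norm_add_sq_le)
next
 fix u :: "point => 'b" and c :: real assume u: "u\<in>L2_space E"
 note [measurable] = L2_spaceD(1)[OF u]
 have "(%x. c*\<^sub>R u x)\<in>borel_measurable (lebesgue_on E)" by measurable
 thus "c*\<^sub>R u\<in>L2_space E"
  using L2_spaceD(2)[OF u] by (simp add: L2_space_def scaleR_fun_def power_mult_distrib)
qed

lemma integrable_inner_L2:
 assumes "u\<in>L2_space E" "v\<in>L2_space E"
 shows "integrable (lebesgue_on E) (%x. u x\<bullet>v x)"
proof (rule Bochner_Integration.integrable_bound)
 note [measurable] = L2_spaceD(1)[OF assms(1)] L2_spaceD(1)[OF assms(2)]
 show "integrable (lebesgue_on E) (%x. (norm (u x))^2 + (norm (v x))^2)"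
  using assms by (intro Bochner_Integration.integrable_add L2_spaceD)
 show "(%x. u x\<bullet>v x)\<in>borel_measurable (lebesgue_on E)" by measurable
 have "\<bar>u x\<bullet>v x\<bar> <= (norm (u x))^2 + (norm (v x))^2" for x
 proof -
  have "\<bar>u x\<bullet>v x\<bar> <= norm (u x)*norm (v x)" by (rule Cauchy_Schwarz_ineq2)
  also have "... <= 2*norm (u x)*norm (v x)" by simp
  also have "... <= (norm (u x))^2 + (norm (v x))^2" by (rule sum_squares_bound)
  finally show ?thesis .
 qed
 thus "AE x in lebesgue_on E. norm (u x\<bullet>v x) <= norm ((norm (u x))^2 + (norm (v x))^2)"
  by (intro AE_I2) simp
qed

global_interpretation l2: semi_inner_space "L2_space E :: (point => 'b::euclidean_space) set" "l2_inner E"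
 for E
proof
 show "subspace (L2_space E :: (point => 'b) set)" by (rule subspace_L2_space)
next
 fix u v w :: "point => 'b" and c :: real
 show "l2_inner E u v = l2_inner E v u"
  by (simp add: l2_inner_def inner_commute)
 show "0 <= l2_inner E u u"
  by (simp add: l2_inner_def)
 show "l2_inner E (c*\<^sub>R u) w = c*l2_inner E u w"
  by (simp add: l2_inner_def)
 assume "u\<in>L2_space E" "v\<in>L2_space E" "w\<in>L2_space E"
 thus "l2_inner E (u + v) w = l2_inner E u w + l2_inner E v w"
  by (simp add: l2_inner_def inner_add_left integrable_inner_L2)
qed

lemma l2_nrm [simp]: "l2.nrm E u = l2_norm E u"
 by (simp add: l2.nrm_def l2_norm_def)

lemmas l2_Cauchy_Schwarz = l2.Cauchy_Schwarz[unfolded l2_nrm]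
lemmas l2_triangle = l2.nrm_triangle[unfolded l2_nrm]
lemmas l2_triangle3 = l2.nrm_triangle3[unfolded l2_nrm]
lemmas l2_minus_commute = l2.nrm_minus_commute[unfolded l2_nrm]
lemmas l2_norm_sq = l2.nrm_sq[unfolded l2_nrm]
lemmas l2_norm_nonneg [simp] = l2.nrm_nonneg[unfolded l2_nrm]
lemmas l2_norm_scale = l2.nrm_scale[unfolded l2_nrm]
lemmas l2_norm_sum = l2.nrm_sum[unfolded l2_nrm]
lemmas l2_norm_uminus = l2.nrm_uminus[unfolded l2_nrm]

lemma l2_inner_tendsto:
 "(!!n. x n\<in>L2_space E) ==> a\<in>L2_space E ==> v\<in>L2_space E ==>
 (%n. l2_norm E (x n - a)) \<longlonglongrightarrow> 0 ==> (%n. l2_inner E (x n) v) \<longlonglongrightarrow> l2_inner E a v"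
 using l2.B_tendsto[unfolded l2_nrm] .

lemma l2_norm_tendsto:
 "(!!n. x n\<in>L2_space E) ==> a\<in>L2_space E ==>
 (%n. l2_norm E (x n - a)) \<longlonglongrightarrow> 0 ==> (%n. l2_norm E (x n)) \<longlonglongrightarrow> l2_norm E a"
 using l2.nrm_tendsto[unfolded l2_nrm] .

lemma l2_inner_fun:
 "(%x. u x + v x) = u + v" "(%x. u x - v x) = u - v" "(%x. c*\<^sub>R u x) = c*\<^sub>R u" "(%x. - u x) = - u"
 "(%x. 0) = 0"
 by (auto simp: fun_eq_iff)

lemma nn_integral_L2:
 assumes "u\<in>L2_space E"
 shows "(\<integral>\<^sup>+ x. ennreal ((norm (u x))^2) \<partial>lebesgue_on E) = ennreal ((l2_norm E u)^2)"
 using nn_integral_eq_integral[OF L2_spaceD(2)[OF assms]] l2_norm_sq[OF assms]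
 by (simp add: l2_inner_def power2_norm_eq_inner)

lemma L2_space_nn_integral:
 assumes "u\<in>borel_measurable (lebesgue_on E)"
  "(\<integral>\<^sup>+ x. ennreal ((norm (u x))^2) \<partial>lebesgue_on E) <= ennreal (e^2)" "0 <= e"
 shows "u\<in>L2_space E" "l2_norm E u <= e"
proof -
 note [measurable] = assms(1)
 have "integrable (lebesgue_on E) (%x. (norm (u x))^2)"
  by (intro integrableI_nonneg le_less_trans[OF assms(2)]) auto
 thus u: "u\<in>L2_space E" using assms(1) by (simp add: L2_space_def)
 have "(l2_norm E u)^2 <= e^2"
  using assms(2) unfolding nn_integral_L2[OF u] by (simp add: ennreal_le_iff)
 thus "l2_norm E u <= e" using assms(3) power2_le_imp_le by blast
qed

lemma l2_norm_eq_0_AE: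
 assumes "u\<in>L2_space E"
 shows "l2_norm E u = 0 \<longleftrightarrow> (AE x in lebesgue_on E. u x = 0)"
proof -
 have "l2_norm E u = 0 \<longleftrightarrow> (LINT x|lebesgue_on E. (norm (u x))^2) = 0"
  by (simp add: l2_norm_def l2_inner_def flip: power2_norm_eq_inner)
 also have "... \<longleftrightarrow> (AE x in lebesgue_on E. (norm (u x))^2 = 0)"
  by (rule integral_nonneg_eq_0_iff_AE) (auto intro: L2_spaceD assms)
 finally show ?thesis by simp
qed

lemma l2_inner_cong_AE:
 assumes "u\<in>L2_space E" "u'\<in>L2_space E" "v\<in>L2_space E" "v'\<in>L2_space E"
  "AE x in lebesgue_on E. u x = u' x" "AE x in lebesgue_on E. v x = v' x"
 shows "l2_inner E u v = l2_inner E u' v'"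
proof -
 note [measurable] = assms(1-4)[THEN L2_spaceD(1)]
 show ?thesis
  unfolding l2_inner_def using assms(5,6) by (intro integral_cong_AE) auto
qed

lemma l2_norm_cong_AE:
 assumes "u\<in>L2_space E" "u'\<in>L2_space E" "AE x in lebesgue_on E. u x = u' x"
 shows "l2_norm E u = l2_norm E u'"
 unfolding l2_norm_def using l2_inner_cong_AE[OF assms(1,2,1,2,3,3)] by simp

lemma l2_null_orth:
 assumes "u\<in>L2_space E" "v\<in>L2_space E" "l2_norm E v = 0"
 shows "l2_inner E u v = 0" "l2_inner E v u = 0"
 using l2_Cauchy_Schwarz[OF assms(1,2)] l2_Cauchy_Schwarz[OF assms(2,1)] assms(3) by auto

text \<open>Riesz-Fischer: a subsequence with geometrically decreasing steps converges almost
  everywhere, and Fatou's lemma turns the pointwise limit into a norm limit of the whole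
  sequence.\<close>

lemma L2_complete:
 fixes x :: "nat => point => 'b::euclidean_space"
 assumes x: "!!n. x n\<in>L2_space E"
  and Cauchy: "!!e. e > 0 ==> EX N. ALL m>=N. ALL n>=N. l2_norm E (x m - x n) < e"
 obtains a where "a\<in>L2_space E" "(%n. l2_norm E (x n - a)) \<longlonglongrightarrow> 0"
proof -
 let ?M = "lebesgue_on E"
 have "ALL k::nat. EX N. ALL m>=N. ALL n>=N. l2_norm E (x m - x n) < (1/2)^k"
  using Cauchy by simp
 then obtain N where N: "!!k m n. m >= N k ==> n >= N k ==> l2_norm E (x m - x n) < (1/2)^k"
  by metis
 \<comment> \<open>Cumulative sums ensure that both \<open>r k\<close> and \<open>r (Suc k)\<close>
   are beyond \<open>N k\<close>.\<close>
 define r where "r k = (\<Sum>i\<le>k. N i)" for k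
 have rN: "r k >= N k" "r (Suc k) >= N k" for k
  by (auto simp: r_def intro: member_le_sum[of k "{..k}" N, simplified] trans_le_add1)
 define d where "d k = x (r (Suc k)) - x (r k)" for k
 have dL: "d k\<in>L2_space E" for k using x by (simp add: d_def)
 have dn: "l2_norm E (d k) <= (1/2)^k" for k
  unfolding d_def using N[of k "r (Suc k)" "r k"] rN by (simp add: less_imp_le)
 note [measurable] = x[THEN L2_spaceD(1)] dL[THEN L2_spaceD(1)]
 \<comment> \<open>The weight \<open>2^k\<close> leaves the integrals summable, while finiteness of
   the weighted series at a point forces \<open>norm (d k y)\<close> to decay geometrically
   there.\<close>
 define f where "f k y = ennreal (2^k*(norm (d k y))^2)" for k y
 have [measurable]: "f k\<in>borel_measurable ?M" for k unfolding f_def by measurable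
 have fint: "(\<integral>\<^sup>+ y. f k y \<partial>?M) <= ennreal ((1/2)^k)" for k
 proof -
  have "(\<integral>\<^sup>+ y. f k y \<partial>?M) = ennreal (2^k)*(\<integral>\<^sup>+ y. ennreal ((norm (d k y))^2) \<partial>?M)"
   unfolding f_def by (subst nn_integral_cmult[symmetric]) (auto simp: ennreal_mult)
  also have "... = ennreal (2^k*(l2_norm E (d k))^2)"
   by (simp add: nn_integral_L2[OF dL] ennreal_mult)
  also have "... <= ennreal (2^k*((1/2)^k)^2)"
   using dn[of k] dL[of k] by (intro ennreal_leI mult_left_mono power_mono) auto
  also have "2^k*((1/2)^k)^2 = ((1/2)^k :: real)"
   by (simp add: power2_eq_square power_one_over)
  finally show ?thesis .
 qed
 have "(\<integral>\<^sup>+ y. (\<Sum>k. f k y) \<partial>?M) = (\<Sum>k. \<integral>\<^sup>+ y. f k y \<partial>?M)"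
  by (rule nn_integral_suminf) measurable
 also have "... <= (\<Sum>k. ennreal ((1/2)^k))"
  by (intro suminf_le fint) auto
 also have "... = ennreal (\<Sum>k. (1/2)^k)"
  by (intro suminf_ennreal2) (auto simp: summable_geometric)
 finally have "(\<integral>\<^sup>+ y. (\<Sum>k. f k y) \<partial>?M) ~= \<infinity>"
  by (auto simp: top_unique)
 hence fin: "AE y in ?M. (\<Sum>k. f k y) ~= \<infinity>"
  by (intro nn_integral_noteq_infinite) measurable
 define a where "a y = lim (%k. x (r k) y)" for y
 have [measurable]: "a\<in>borel_measurable ?M"
  unfolding a_def by measurable
 have conv: "AE y in ?M. (%k. x (r k) y) \<longlonglongrightarrow> a y"
  using fin
 proof (rule AE_mp, intro AE_I2 impI)
  fix y assume "(\<Sum>k. f k y) ~= \<infinity>"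
  then obtain C where C: "0 <= C" "(\<Sum>k. f k y) = ennreal C"
   by (cases "\<Sum>k. f k y") auto
  have "norm (d k y) <= sqrt C*(sqrt (1/2))^k" for k
  proof -
   have "f k y <= ennreal C"
    using sum_le_suminf[of "%k. f k y" "{k}"] C by simp
   hence "2^k*(norm (d k y))^2 <= C"
    using C by (simp add: f_def)
   hence "(norm (d k y))^2 <= C*(1/2)^k"
    by (simp add: power_one_over field_simps)
   hence "sqrt ((norm (d k y))^2) <= sqrt (C*(1/2)^k)"
    by (rule real_sqrt_le_mono)
   thus ?thesis by (simp add: real_sqrt_mult real_sqrt_power)
  qed
  moreover have "summable (%k. sqrt C*(sqrt (1/2))^k)"
   by (intro summable_mult summable_geometric) (simp add: real_sqrt_divide)
  ultimately have "summable (%k. d k y)"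
   by (metis summable_comparison_test')
  hence "(%n. \<Sum>k<n. d k y) \<longlonglongrightarrow> (\<Sum>k. d k y)"
   by (rule summable_LIMSEQ)
  moreover have "(\<Sum>k<n. d k y) = x (r n) y - x (r 0) y" for n
   by (simp add: d_def sum_lessThan_telescope[of "%k. x (r k) y"])
  ultimately have "(%n. (x (r n) y - x (r 0) y) + x (r 0) y) \<longlonglongrightarrow> (\<Sum>k. d k y) + x (r 0) y"
   by (intro tendsto_add) auto
  hence lim: "(%n. x (r n) y) \<longlonglongrightarrow> (\<Sum>k. d k y) + x (r 0) y" by simp
  show "(%k. x (r k) y) \<longlonglongrightarrow> a y"
   unfolding a_def limI[OF lim] by (rule lim)
 qed
 have bound: "(\<integral>\<^sup>+ y. ennreal ((norm ((x m - a) y))^2) \<partial>?M) <= ennreal (((1/2)^k)^2)"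
  if "m >= N k" for m k
 proof -
  have "(\<integral>\<^sup>+ y. ennreal ((norm ((x m - a) y))^2) \<partial>?M) =
    (\<integral>\<^sup>+ y. liminf (%n. ennreal ((norm ((x m - x (r n)) y))^2)) \<partial>?M)"
  proof (rule nn_integral_cong_AE)
   show "AE y in ?M. ennreal ((norm ((x m - a) y))^2) =
     liminf (%n. ennreal ((norm ((x m - x (r n)) y))^2))"
    using conv
   proof (rule AE_mp, intro AE_I2 impI)
    fix y assume lim: "(%k. x (r k) y) \<longlonglongrightarrow> a y"
    have "(%n. ennreal ((norm (x m y - x (r n) y))^2)) \<longlonglongrightarrow> ennreal ((norm (x m y - a y))^2)"
     by (rule tendsto_ennrealI tendsto_power tendsto_norm tendsto_diff tendsto_const lim)+
    hence "liminf (%n. ennreal ((norm (x m y - x (r n) y))^2)) = ennreal ((norm (x m y - a y))^2)"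
     by (rule lim_imp_Liminf[OF sequentially_bot])
    thus "ennreal ((norm ((x m - a) y))^2) =
      liminf (%n. ennreal ((norm ((x m - x (r n)) y))^2))"
     by simp
   qed
  qed
  also have "... <= liminf (%n. \<integral>\<^sup>+ y. ennreal ((norm ((x m - x (r n)) y))^2) \<partial>?M)"
   by (rule nn_integral_liminf) (simp add: fun_diff_def)
  also have "... <= ennreal (((1/2)^k)^2)"
  proof (rule Liminf_le)
   show "\<forall>\<^sub>F n in sequentially. (\<integral>\<^sup>+ y. ennreal ((norm ((x m - x (r n)) y))^2) \<partial>?M) <= ennreal (((1/2)^k)^2)"
   proof (rule eventually_sequentiallyI[of k])
    fix n assume "n >= k"
    hence "r n >= N k"
     by (simp add: r_def member_le_sum[of k "{..n}" N, simplified])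
    hence "l2_norm E (x m - x (r n)) <= (1/2)^k" using N that by (simp add: less_imp_le)
    thus "(\<integral>\<^sup>+ y. ennreal ((norm ((x m - x (r n)) y))^2) \<partial>?M) <= ennreal (((1/2)^k)^2)"
     using x by (subst nn_integral_L2) (auto intro!: ennreal_leI power_mono)
   qed
  qed simp
  finally show ?thesis .
 qed
 have meas: "x m - a\<in>borel_measurable ?M" for m
  unfolding fun_diff_def by measurable
 have diffL: "x m - a\<in>L2_space E" "l2_norm E (x m - a) <= (1/2)^k" if "m >= N k" for m k
  by (rule L2_space_nn_integral[OF meas bound[OF that]], simp)+
 have "a = x (N 0) - (x (N 0) - a)" by simp
 hence "a\<in>L2_space E" using diffL(1)[of 0 "N 0"] x by (metis l2.closed(3) order_refl)
 moreover have "(%n. l2_norm E (x n - a)) \<longlonglongrightarrow> 0"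
 proof (rule LIMSEQ_I)
  fix e :: real assume "e > 0"
  then obtain k where k: "(1/2)^k < e" using real_arch_pow_inv[of e "1/2"] by auto
  have "norm (l2_norm E (x n - a) - 0) < e" if "n >= N k" for n
   using diffL[OF that] k by simp
  thus "EX no. ALL n>=no. norm (l2_norm E (x n - a) - 0) < e" by blast
 qed
 ultimately show thesis using that by blast
qed

lemma l2_complete_seq:
 "semi_inner_space.complete_seq (L2_space E :: (point => 'b::euclidean_space) set) (l2_inner E)"
 unfolding l2.complete_seq_def l2_nrm
proof (intro allI impI)
 fix x :: "nat => point => 'b"
 assume "ALL n. x n\<in>L2_space E" "ALL e>0. EX N. ALL m>=N. ALL n>=N. l2_norm E (x m - x n) < e"
 thus "\<exists>a\<in>L2_space E. (%n. l2_norm E (x n - a)) \<longlonglongrightarrow> 0"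
  using L2_complete[of x E] by metis
qed

subsection \<open>Smooth functions\<close>

lemma times_cont_diff_continuous: "times_cont_diff m q ==> continuous_on UNIV q"
 by (cases m) (auto simp: continuous_on_eq_continuous_at differentiable_imp_continuous_within)

lemma times_cont_diff_Suc_imp: "times_cont_diff (Suc m) q ==> times_cont_diff m q"
proof (induction m arbitrary: q)
 case 0
 thus ?case using times_cont_diff_continuous[of "Suc 0" q] by simp
next
 case (Suc m)
 from Suc.prems have "ALL x. q differentiable (at x)" "ALL i. times_cont_diff (Suc m) (pd i q)"
  by auto
 moreover from this have "times_cont_diff m (pd i q)" for i
  using Suc.IH by blast
 ultimately show ?case by simp
qed

lemma smoothD:
 assumes "smooth q"
 shows "q differentiable (at x)" "smooth (pd i q)" "continuous_on S q"
proof -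
 have *: "times_cont_diff (Suc m) q" for m using assms by (auto simp: smooth_def simp del: times_cont_diff.simps)
 show "q differentiable (at x)" using *[of 0] by simp
 show "smooth (pd i q)" using * by (simp add: smooth_def)
 show "continuous_on S q" using times_cont_diff_continuous[OF *[of 0]] continuous_on_subset by blast
qed

text \<open>All orders of differentiability at once, from a class closed under partial derivatives.
  It is applied to tensor products and convolutions, whose derivatives keep their shape.\<close>

lemma smooth_coinduct:
 assumes "q\<in>X" "!!q x. q\<in>X ==> q differentiable (at x)"
  "!!q i. q\<in>X ==> pd i q\<in>X"
 shows "smooth q"
proof -
 have "times_cont_diff m q" if "q\<in>X" for m q
  using that
 proof (induction m arbitrary: q)
  case 0
  thus ?case
   using assms(2) by (auto simp: continuous_on_eq_continuous_at differentiable_imp_continuous_within)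
 next
  case (Suc m)
  thus ?case using assms(2,3) by auto
 qed
 thus ?thesis using assms(1) by (simp add: smooth_def)
qed

lemma pd_eq:
 "(q has_derivative D) (at x) ==> pd i q x = D (axis i 1)"
 by (simp add: partial_derivative_def flip: frechet_derivative_at)

lemma inner_point: "(a::point)\<bullet>b = a$1*b$1 + a$2*b$2"
 by (simp add: inner_vec_def sum_2)

lemma point_axis: "(h::point) = h$1*\<^sub>R axis 1 1 + h$2*\<^sub>R axis 2 1"
 by (simp add: vec_eq_iff forall_2 axis_def)

lemma grad_component [simp]: "grad q x$1 = pd 1 q x" "grad q x$2 = pd 2 q x"
 "curl q x$1 = pd 2 q x" "curl q x$2 = - pd 1 q x"
 by (simp_all add: grad_def curl_def vector_2)

lemma has_derivative_grad:
 assumes "q differentiable (at x)"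
 shows "(q has_derivative (%h. grad q x\<bullet>h)) (at x)"
proof -
 obtain D where D: "(q has_derivative D) (at x)" using assms by (auto simp: differentiable_def)
 then interpret bounded_linear D by (rule has_derivative_bounded_linear)
 have "D h = grad q x\<bullet>h" for h
 proof -
  have "D h = D (h$1*\<^sub>R axis 1 1 + h$2*\<^sub>R axis 2 1)" using point_axis[of h] by simp
  also have "... = grad q x\<bullet>h"
   by (simp add: add scaleR inner_point pd_eq[OF D])
  finally show ?thesis .
 qed
 hence "D = (%h. grad q x\<bullet>h)" by auto
 thus ?thesis using D by simp
qed

lemma pd_inner:
 "f differentiable (at x) ==> pd i f x = grad f x\<bullet>axis i 1"
 using pd_eq[OF has_derivative_grad] .

lemma pd_add:
 assumes "f differentiable (at x)" "g differentiable (at x)"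
 shows "pd i (%x. f x + g x) x = pd i f x + pd i g x"
proof -
 have "((%x. f x + g x) has_derivative (%h. grad f x\<bullet>h + grad g x\<bullet>h)) (at x)"
  using assms by (intro has_derivative_add has_derivative_grad)
 from pd_eq[OF this] show ?thesis
  using assms by (simp add: pd_inner)
qed

lemma pd_mult:
 assumes "f differentiable (at x)" "g differentiable (at x)"
 shows "pd i (%x. f x*g x) x = pd i f x*g x + f x*pd i g x"
proof -
 have "((%x. f x*g x) has_derivative (%h. f x*(grad g x\<bullet>h) + (grad f x\<bullet>h)*g x)) (at x)"
  using assms by (intro has_derivative_mult has_derivative_grad)
 from pd_eq[OF this] show ?thesis
  using assms by (simp add: pd_inner)
qed

lemma pd_const: "pd i (%x. c) = (%x. 0)"
 using pd_eq[OF has_derivative_const] by auto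

lemma times_cont_diff_add:
 "times_cont_diff m f ==> times_cont_diff m g ==> times_cont_diff m (%x. f x + g x)"
proof (induction m arbitrary: f g)
 case 0
 thus ?case by (simp add: continuous_on_add)
next
 case (Suc m)
 hence "pd i (%x. f x + g x) = (%x. pd i f x + pd i g x)" for i
  by (auto simp: pd_add)
 thus ?case using Suc by simp
qed

lemma times_cont_diff_mult:
 "times_cont_diff m f ==> times_cont_diff m g ==> times_cont_diff m (%x. f x*g x)"
proof (induction m arbitrary: f g)
 case 0
 thus ?case by (simp add: continuous_on_mult)
next
 case (Suc m)
 hence "pd i (%x. f x*g x) =
   (%x. pd i f x*g x + f x*pd i g x)" for i
  by (auto simp: pd_mult)
 moreover have "times_cont_diff m f" "times_cont_diff m g"
  using Suc.prems times_cont_diff_Suc_imp by blast+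
 ultimately show ?case using Suc by (simp add: times_cont_diff_add)
qed

lemma smooth_add: "smooth f ==> smooth g ==> smooth (%x. f x + g x)"
 by (simp add: smooth_def times_cont_diff_add)

lemma smooth_mult: "smooth f ==> smooth g ==> smooth (%x. f x*g x)"
 by (simp add: smooth_def times_cont_diff_mult)

lemma smooth_const: "smooth (%x. c)"
 by (rule smooth_coinduct[where X = "range (%c x. c)"]) (auto simp: pd_const)

lemma smooth_scale: "smooth f ==> smooth (%x. c*f x)"
 by (intro smooth_mult smooth_const)

lemma subspace_smooth: "subspace (Collect smooth)"
 by (auto simp: subspace_def plus_fun_def scaleR_fun_def zero_fun_def smooth_const smooth_add smooth_scale)

lemma pd_scale:
 assumes "f differentiable (at x)"
 shows "pd i (%x. c*f x) x = c*pd i f x"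
 using pd_mult[of "%x. c" x f i] assms by (simp add: pd_const)

subsection \<open>Bounded smooth functions of one variable\<close>

text \<open>Bounded derivatives give Taylor remainders that are uniform on the line, as required for
  differentiating a convolution with an integrable function. Compact support is not imposed since a
  step function will also serve as a kernel.\<close>

primrec bdiff :: "nat => (real => real) => bool" where
 "bdiff 0 f \<longleftrightarrow> bounded (range f)"
| "bdiff (Suc m) f \<longleftrightarrow> bounded (range f) &
  (EX f'. (ALL x. (f has_real_derivative f' x) (at x)) & bdiff m f')"

definition bsmooth :: "(real => real) => bool" where
 "bsmooth f \<longleftrightarrow> (ALL m. bdiff m f)"

lemma bdiff_bounded: "bdiff m f ==> bounded (range f)"
 by (cases m) auto

lemma bdiff_Suc_imp: "bdiff (Suc m) f ==> bdiff m f"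
proof (induction m arbitrary: f)
 case 0
 thus ?case using bdiff_bounded by auto
next
 case (Suc m)
 from Suc.prems obtain f' where "bounded (range f)" "ALL x. (f has_real_derivative f' x) (at x)" "bdiff (Suc m) f'"
  by (auto simp del: bdiff.simps simp: bdiff.simps(2)[of "Suc m"])
 with Suc.IH show ?case by auto
qed

lemma bsmoothI:
 assumes "bounded (range f)" "!!x. (f has_real_derivative f' x) (at x)" "bsmooth f'"
 shows "bsmooth f"
 unfolding bsmooth_def
proof
 fix m show "bdiff m f" using assms by (cases m) (auto simp: bsmooth_def)
qed

text \<open>Derivatives are unique, so the witnesses for the different orders agree.\<close>

lemma bsmoothE:
 assumes "bsmooth f"
 obtains f' where "!!x. (f has_real_derivative f' x) (at x)" "bsmooth f'"
proof -
 have *: "EX f'. (ALL x. (f has_real_derivative f' x) (at x)) & bdiff m f'" for m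
  using assms unfolding bsmooth_def by (metis bdiff.simps(2))
 then obtain f' where f': "!!x. (f has_real_derivative f' x) (at x)" by blast
 have "bdiff m f'" for m
 proof -
  obtain g where g: "ALL x. (f has_real_derivative g x) (at x)" "bdiff m g" using * by blast
  hence "g = f'" using f' DERIV_unique by blast
  thus ?thesis using g by simp
 qed
 thus thesis using that f' by (auto simp: bsmooth_def)
qed

lemma bsmooth_bounded: "bsmooth f ==> bounded (range f)"
 using bdiff_bounded bsmooth_def by blast

lemma bsmooth_bound:
 assumes "bsmooth f" obtains C where "C > 0" "!!x. \<bar>f x\<bar> <= C"
 using bsmooth_bounded[OF assms] by (auto simp: bounded_pos)

lemma bounded_range_add:
 fixes f g :: "real => real"
 assumes "bounded (range f)" "bounded (range g)" shows "bounded (range (%x. f x + g x))"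
 using bounded_plus_comp[of f UNIV g] assms by simp

lemma bounded_range_mult:
 fixes f g :: "real => real"
 assumes "bounded (range f)" "bounded (range g)" shows "bounded (range (%x. f x*g x))"
proof -
 obtain a b where "!!x. \<bar>f x\<bar> <= a" "!!x. \<bar>g x\<bar> <= b" using assms by (auto simp: bounded_iff)
 hence "\<bar>f x*g x\<bar> <= a*b" for x
  using mult_mono[of "\<bar>f x\<bar>" a "\<bar>g x\<bar>" b] by (auto simp: abs_mult intro: order_trans[OF abs_ge_zero])
 thus ?thesis by (auto simp: bounded_iff)
qed

lemma bdiff_add: "bdiff m f ==> bdiff m g ==> bdiff m (%x. f x + g x)"
proof (induction m arbitrary: f g)
 case 0 thus ?case by (simp add: bounded_range_add)
next
 case (Suc m)
 then obtain f' g' where d: "!!x. (f has_real_derivative f' x) (at x)" "bdiff m f'"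
  "!!x. (g has_real_derivative g' x) (at x)" "bdiff m g'" by auto
 hence "((%x. f x + g x) has_real_derivative f' x + g' x) (at x)" for x
  by (intro derivative_intros)
 moreover have "bdiff m (%x. f' x + g' x)" using Suc.IH d by blast
 ultimately show ?case using Suc.prems
  by (simp add: bounded_range_add) (rule exI[of _ "%x. f' x + g' x"], simp)
qed

lemma bdiff_mult: "bdiff m f ==> bdiff m g ==> bdiff m (%x. f x*g x)"
proof (induction m arbitrary: f g)
 case 0 thus ?case by (simp add: bounded_range_mult)
next
 case (Suc m)
 then obtain f' g' where d: "!!x. (f has_real_derivative f' x) (at x)" "bdiff m f'"
  "!!x. (g has_real_derivative g' x) (at x)" "bdiff m g'" by auto
 hence "((%x. f x*g x) has_real_derivative f' x*g x + f x*g' x) (at x)" for x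
  by (auto intro!: derivative_eq_intros)
 moreover have "bdiff m (%x. f' x*g x + f x*g' x)"
  using Suc.IH d Suc.prems by (intro bdiff_add) (blast intro: bdiff_Suc_imp)+
 ultimately show ?case using Suc.prems
  by (simp add: bounded_range_mult) (rule exI[of _ "%x. f' x*g x + f x*g' x"], simp)
qed

lemma bsmooth_mult: "bsmooth f ==> bsmooth g ==> bsmooth (%x. f x*g x)"
 by (simp add: bsmooth_def bdiff_mult)

lemma bsmooth_const: "bsmooth (%x. c)"
proof -
 have "bdiff m (%x. c)" for m and c :: real
 proof (induction m arbitrary: c)
  case (Suc m)
  have "((%x. c) has_real_derivative 0) (at x)" for x by simp
  with Suc show ?case unfolding bdiff.simps(2) by (intro conjI exI[of _ "%x. 0"]) auto
 qed simp
 thus ?thesis by (simp add: bsmooth_def)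
qed

lemma bdiff_affine: "bdiff m f ==> bdiff m (%x. f (a*x + b))"
proof (induction m arbitrary: f)
 case 0 thus ?case by (auto intro: bounded_subset)
next
 case (Suc m)
 then obtain f' where d: "!!x. (f has_real_derivative f' x) (at x)" "bdiff m f'" by auto
 have "((%x. f (a*x + b)) has_real_derivative a*f' (a*x + b)) (at x)" for x
 proof -
  have l: "((%x. a*x + b) has_real_derivative a) (at x)" by (auto intro!: derivative_eq_intros)
  show ?thesis using DERIV_chain2[OF d(1) l] by (simp add: mult.commute)
 qed
 moreover have "bdiff m (%x. a*f' (a*x + b))"
  using Suc.IH[OF d(2)] bsmooth_const[of a] by (intro bdiff_mult) (auto simp: bsmooth_def)
 moreover have "bounded (range (%x. f (a*x + b)))"
  using Suc.prems by (auto intro: bounded_subset)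
 ultimately show ?case by (simp, intro exI[of _ "%x. a*f' (a*x + b)"], simp)
qed

lemma bsmooth_affine: "bsmooth f ==> bsmooth (%x. f (a*x + b))"
 by (simp add: bsmooth_def bdiff_affine)

text \<open>A family around the classical flat function \<open>exp (-1/t)\<close> that is closed
  under differentiation.\<close>

definition flat_exp :: "real poly => real => real" where
 "flat_exp p t = (if t > 0 then poly p (1/t)*exp (- (1/t)) else 0)"

lemma poly_exp_tendsto: "((%s. poly p s*exp (- s)) \<longlongrightarrow> 0) at_top" for p :: "real poly"
proof -
 have "((%s. \<Sum>i\<le>degree p. coeff p i*(s^i/exp s)) \<longlongrightarrow> (\<Sum>i\<le>degree p. coeff p i*0)) at_top"
  by (intro tendsto_sum tendsto_mult_left tendsto_power_div_exp_0)
 moreover have "(\<Sum>i\<le>degree p. coeff p i*(s^i/exp s)) = poly p s*exp (- s)" for s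
  by (simp add: poly_altdef sum_distrib_right exp_minus field_simps sum_divide_distrib)
 ultimately show ?thesis by simp
qed

lemma flat_exp_tendsto: "(flat_exp p \<longlongrightarrow> 0) (at_right 0)"
proof -
 have "((%t. poly p (inverse t)*exp (- inverse t)) \<longlongrightarrow> 0) (at_right 0)"
  using filterlim_compose[OF poly_exp_tendsto filterlim_inverse_at_top_right] .
 thus ?thesis
  by (rule Lim_transform_eventually)
   (auto simp: flat_exp_def eventually_at_filter divide_inverse)
qed

text \<open>With \<open>s = 1/t\<close> the derivative of \<open>p(s) exp(-s)\<close> in
  \<open>t\<close> is \<open>s^2 (p(s) - p'(s)) exp(-s)\<close>, hence the polynomial. At 0 the
  difference quotient from the right is again a flat function, with \<open>p\<close> multiplied by
  the variable.\<close>

lemma has_derivative_flat_exp: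
 "(flat_exp p has_real_derivative flat_exp ([:0, 0, 1:]*(p - pderiv p)) t) (at t)"
proof -
 consider "t > 0" | "t < 0" | "t = 0" by linarith
 thus ?thesis
 proof cases
  case 1
  have "((%t. poly p (1/t)*exp (- (1/t))) has_real_derivative
   flat_exp ([:0, 0, 1:]*(p - pderiv p)) t) (at t)"
   using 1 by (auto intro!: derivative_eq_intros DERIV_chain2[OF poly_DERIV]
     simp: flat_exp_def field_simps power2_eq_square)
  thus ?thesis
   by (rule has_field_derivative_transform_within_open[where S = "{0<..}"])
    (use 1 in \<open>auto simp: flat_exp_def\<close>)
 next
  case 2
  have "((%t. 0) has_real_derivative flat_exp ([:0, 0, 1:]*(p - pderiv p)) t) (at t)"
   using 2 by (simp add: flat_exp_def)
  thus ?thesis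
   by (rule has_field_derivative_transform_within_open[where S = "{..<0}"])
    (use 2 in \<open>auto simp: flat_exp_def\<close>)
 next
  case 3
  have "((%h. (flat_exp p h - flat_exp p 0)/h) \<longlongrightarrow> 0) (at_right 0)"
   using flat_exp_tendsto[of "pCons 0 p"]
   by (rule Lim_transform_eventually) (auto simp: flat_exp_def eventually_at_filter)
  moreover have "((%h. (flat_exp p h - flat_exp p 0)/h) \<longlongrightarrow> 0) (at_left 0)"
   by (rule Lim_transform_eventually[OF tendsto_const])
    (auto simp: flat_exp_def eventually_at_filter)
  ultimately have "((%h. (flat_exp p h - flat_exp p 0)/h) \<longlongrightarrow> 0) (at 0)"
   by (simp add: filterlim_split_at)
  thus ?thesis
   using 3 by (simp add: has_field_derivative_iff flat_exp_def)
 qed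
qed

lemma bounded_flat_exp: "bounded (range (flat_exp p))"
proof -
 have "\<forall>\<^sub>F s in at_top. \<bar>poly p s*exp (- s)\<bar> < 1"
  using order_tendstoD(2)[OF tendsto_rabs_zero[OF poly_exp_tendsto[of p]], of 1] by simp
 then obtain M where M: "!!s. s >= M ==> \<bar>poly p s*exp (- s)\<bar> < 1"
  by (auto simp: eventually_at_top_linorder)
 have "compact ((%s. poly p s*exp (- s)) ` {0..max 0 M})"
  by (intro compact_continuous_image continuous_intros) auto
 then obtain C where C: "!!s. s\<in>{0..max 0 M} ==> \<bar>poly p s*exp (- s)\<bar> <= C"
  using compact_imp_bounded by (fastforce simp: bounded_iff)
 have "\<bar>flat_exp p t\<bar> <= max 1 C" for t
 proof (cases "t > 0")
  case True
  thus ?thesis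
   using M[of "1/t"] C[of "1/t"] by (cases "1/t >= M") (auto simp: flat_exp_def intro: less_imp_le max.coboundedI1 max.coboundedI2)
 qed (auto simp: flat_exp_def)
 thus ?thesis by (auto simp: bounded_iff intro!: exI[of _ "max 1 C"])
qed

lemma bsmooth_flat_exp: "bsmooth (flat_exp p)"
proof -
 have "bdiff m (flat_exp p)" for m p
  by (induction m arbitrary: p) (use has_derivative_flat_exp bounded_flat_exp in auto)
 thus ?thesis by (simp add: bsmooth_def)
qed

text \<open>The density is a flat function at 0 times a reflected one at 1, so it is supported in
  the unit interval; its normalized primitive is the step.\<close>

lemma exists_smooth_step:
 "EX R \<rho>. bsmooth R & bsmooth \<rho> & (ALL t. (R has_real_derivative \<rho> t) (at t)) & (ALL t. 0 <= \<rho> t) &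
  (\<forall>t\<le>0. R t = 0) & (ALL t>=1. R t = 1) & (ALL t. t <= 0 \<or> 1 <= t --> \<rho> t = 0)"
proof -
 define f where "f t = flat_exp 1 t*flat_exp 1 (-1*t + 1)" for t
 have f: "bsmooth f" unfolding f_def by (intro bsmooth_mult bsmooth_affine bsmooth_flat_exp)
 have f0: "f t = 0" if "t <= 0 \<or> 1 <= t" for t using that by (auto simp: f_def flat_exp_def)
 have fpos: "0 <= f t" for t by (auto simp: f_def flat_exp_def)
 have fcont: "continuous_on S f" for S
  using bsmoothE[OF f] by (meson DERIV_isCont continuous_at_imp_continuous_on)
 \<comment> \<open>Starting at -1 rather than 0 makes \<open>t = 0\<close> an interior point, so
   that the derivative there is two-sided.\<close>
 define R where "R t = integral {-1..t} f" for t
 have R0: "R t = 0" if "t <= 0" for t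
 proof -
  have "integral {-1..t} f = integral {-1..t} (%x. 0)"
   by (rule integral_cong) (use that f0 in auto)
  thus ?thesis by (simp add: R_def)
 qed
 have DR: "(R has_real_derivative f t) (at t)" for t
 proof (cases "t < 0")
  case True
  have "((%t. 0) has_real_derivative f t) (at t)" using True f0 by simp
  thus ?thesis
   by (rule has_field_derivative_transform_within_open[where S = "{..<0}"]) (use True R0 in auto)
 next
  case False
  have "(R has_real_derivative f t) (at t within {-1..t+1})"
   unfolding R_def by (rule integral_has_real_derivative[OF fcont]) (use False in auto)
  thus ?thesis using False by (simp add: at_within_Icc_at)
 qed
 have mono: "R s <= R t" if "s <= t" for s t
  by (rule DERIV_nonneg_imp_nondecreasing[OF that]) (use DR fpos in blast)
 have const: "R t = R 1" if "t >= 1" for t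
 proof (cases "t = 1")
  case False
  hence "1 < t" using that by simp
  moreover have "continuous_on {1..t} R"
   using DR by (meson DERIV_isCont continuous_at_imp_continuous_on)
  moreover have "(R has_real_derivative 0) (at x)" if "1 < x" for x
   using DR[of x] f0[of x] that by simp
  ultimately show ?thesis by (intro DERIV_isconst_end) auto
 qed simp
 define c where "c = R 1"
 have "R (1/4) < R (3/4)"
 proof (rule DERIV_pos_imp_increasing[where f = R])
  fix x :: real assume "1/4 <= x" "x <= 3/4"
  hence "f x > 0" by (auto simp: f_def flat_exp_def)
  thus "EX y. (R has_real_derivative y) (at x) & 0 < y" using DR by blast
 qed simp
 hence c: "c > 0" using mono[of 0 "1/4"] mono[of "3/4" 1] R0[of 0] by (simp add: c_def)
 have R01: "0 <= R t" "R t <= c" for t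
  using mono[of 0 t] mono[of t 1] R0[of t] R0[of 0] const[of t] c unfolding c_def
  by (cases "t <= 0"; force)+
 have bR: "bounded (range R)"
  using R01 by (auto simp: bounded_iff intro!: exI[of _ c])
 have "bsmooth R" by (rule bsmoothI[OF bR DR f])
 hence b: "bsmooth (%t. (1/c)*R t)" "bsmooth (%t. (1/c)*f t)"
  by (intro bsmooth_mult bsmooth_const f; simp)+
 have d: "ALL t. ((%t. (1/c)*R t) has_real_derivative (1/c)*f t) (at t)"
  by (intro allI DERIV_cmult[OF DR])
 have e: "(ALL t. 0 <= (1/c)*f t) & (\<forall>t\<le>0. (1/c)*R t = 0) & (ALL t>=1. (1/c)*R t = 1) &
   (ALL t. t <= 0 \<or> 1 <= t --> (1/c)*f t = 0)"
 proof -
  have "R t = c" if "t >= 1" for t using const[OF that] by (simp add: c_def)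
  thus ?thesis using c fpos R0 f0 by simp
 qed
 show ?thesis
  by (rule exI[of _ "%t. (1/c)*R t"], rule exI[of _ "%t. (1/c)*f t"])
   (intro conjI b d e[THEN conjunct1] e[THEN conjunct2, THEN conjunct1]
     e[THEN conjunct2, THEN conjunct2, THEN conjunct1] e[THEN conjunct2, THEN conjunct2, THEN conjunct2])
qed

subsection \<open>Test functions\<close>

text \<open>Fixed once by choice, so that the bounds for scaled copies involve constants that depend
  on nothing else.\<close>

definition smooth_step :: "real => real" where
 "smooth_step = (SOME R. EX \<rho>. bsmooth R & bsmooth \<rho> & (ALL t. (R has_real_derivative \<rho> t) (at t)) &
  (ALL t. 0 <= \<rho> t) & (\<forall>t\<le>0. R t = 0) & (ALL t>=1. R t = 1) & (ALL t. t <= 0 \<or> 1 <= t --> \<rho> t = 0))"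

definition smooth_bump :: "real => real" where
 "smooth_bump t = deriv smooth_step t"

lemma smooth_step:
 shows bsmooth_step: "bsmooth smooth_step" and bsmooth_bump: "bsmooth smooth_bump"
  and DERIV_smooth_step: "(smooth_step has_real_derivative smooth_bump t) (at t)"
  and smooth_bump_nonneg: "0 <= smooth_bump t"
  and smooth_step_0: "t <= 0 ==> smooth_step t = 0" and smooth_step_1: "t >= 1 ==> smooth_step t = 1"
  and smooth_bump_0: "t <= 0 \<or> 1 <= t ==> smooth_bump t = 0"
proof -
 obtain \<rho> where \<rho>: "bsmooth smooth_step" "bsmooth \<rho>" "!!t. (smooth_step has_real_derivative \<rho> t) (at t)"
  "!!t. 0 <= \<rho> t" "!!t. t\<le>0 ==> smooth_step t = 0" "!!t. t>=1 ==> smooth_step t = 1"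
  "!!t. t <= 0 \<or> 1 <= t ==> \<rho> t = 0"
  using someI_ex[OF exists_smooth_step] unfolding smooth_step_def[symmetric] by blast
 have "\<rho> = smooth_bump"
 proof
  fix t show "\<rho> t = smooth_bump t"
   unfolding smooth_bump_def using DERIV_imp_deriv[OF \<rho>(3)[of t]] by simp
 qed
 with \<rho> show "bsmooth smooth_step" "bsmooth smooth_bump" "(smooth_step has_real_derivative smooth_bump t) (at t)"
  "0 <= smooth_bump t" "t <= 0 ==> smooth_step t = 0" "t >= 1 ==> smooth_step t = 1"
  "t <= 0 \<or> 1 <= t ==> smooth_bump t = 0" by auto
qed

lemma smooth_step_mono: "s <= t ==> smooth_step s <= smooth_step t"
 by (rule DERIV_nonneg_imp_nondecreasing) (use DERIV_smooth_step smooth_bump_nonneg in blast)+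

lemma smooth_step_range: "0 <= smooth_step t" "smooth_step t <= 1"
 using smooth_step_mono[of t 1] smooth_step_mono[of 0 t] smooth_step_0[of t] smooth_step_1[of t]
  smooth_step_0[of 0] smooth_step_1[of 1] by (cases "t <= 0"; cases "t <= 1"; force)+

text \<open>Partial derivatives of products of this form are again of this form. Box cut-offs and
  the test function behind the stream potential are built this way.\<close>

definition tensor :: "(real => real) => (real => real) => scalar_field" where
 "tensor F G x = F (x$1)*G (x$2)"

lemma has_derivative_tensor:
 assumes "!!t. (F has_real_derivative F' t) (at t)" "!!t. (G has_real_derivative G' t) (at t)"
 shows "(tensor F G has_derivative (%h. F' (x$1)*G (x$2)*h$1 + F (x$1)*G' (x$2)*h$2)) (at x)"
proof -
 have 1: "((%x::point. F (x$1)) has_derivative (%h. h$1*F' (x$1))) (at x)"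
  by (rule DERIV_compose_FDERIV[OF assms(1)]) (auto intro!: derivative_intros bounded_linear_imp_has_derivative bounded_linear_vec_nth)
 have 2: "((%x::point. G (x$2)) has_derivative (%h. h$2*G' (x$2))) (at x)"
  by (rule DERIV_compose_FDERIV[OF assms(2)]) (auto intro!: derivative_intros bounded_linear_imp_has_derivative bounded_linear_vec_nth)
 show ?thesis
  unfolding tensor_def using has_derivative_mult[OF 1 2]
  by (rule has_derivative_eq_rhs) (auto simp: algebra_simps)
qed

lemma pd_tensor:
 assumes "!!t. (F has_real_derivative F' t) (at t)" "!!t. (G has_real_derivative G' t) (at t)"
 shows "pd 1 (tensor F G) = tensor F' G" "pd 2 (tensor F G) = tensor F G'"
 using pd_eq[OF has_derivative_tensor[OF assms]]
 by (auto simp: tensor_def axis_def fun_eq_iff)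

lemma smooth_tensor:
 assumes "bsmooth F" "bsmooth G"
 shows "smooth (tensor F G)"
proof (rule smooth_coinduct[where X = "{tensor F G | F G. bsmooth F & bsmooth G}"])
 show "tensor F G\<in>{tensor F G | F G. bsmooth F & bsmooth G}" using assms by auto
 fix q assume "q\<in>{tensor F G | F G. bsmooth F & bsmooth G}"
 then obtain F G where q: "q = tensor F G" "bsmooth F" "bsmooth G" by auto
 obtain F' where F': "!!t. (F has_real_derivative F' t) (at t)" "bsmooth F'" using bsmoothE[OF q(2)] by blast
 obtain G' where G': "!!t. (G has_real_derivative G' t) (at t)" "bsmooth G'" using bsmoothE[OF q(3)] by blast
 show "q differentiable (at x)" for x
  using has_derivative_tensor[OF F'(1) G'(1)] q by (auto simp: differentiable_def)
 show "pd i q\<in>{tensor F G | F G. bsmooth F & bsmooth G}" for i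
  using exhaust_2[of i] pd_tensor[OF F'(1) G'(1)] F' G' q by auto
qed

lemma test_functionI:
 assumes "smooth f" "compact K" "K \<subseteq> E" "!!x. x \<notin> K ==> f x = 0"
 shows "test_function E f"
proof -
 have "closure {x. f x ~= 0} \<subseteq> K"
  by (rule closure_minimal) (use assms compact_imp_closed in auto)
 moreover have "bounded {x. f x ~= 0}"
  by (rule bounded_subset[OF compact_imp_bounded[OF assms(2)]]) (use assms(4) in auto)
 ultimately show ?thesis
  using assms by (auto simp: test_function_def compact_closure)
qed

lemma test_functionE:
 assumes "test_function E f"
 obtains K where "compact K" "K \<subseteq> E" "!!x. x \<notin> K ==> f x = 0" "smooth f"
proof (rule that[of "closure {x. f x ~= 0}"])
 show "f x = 0" if "x \<notin> closure {x. f x ~= 0}" for x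
  using that closure_subset[of "{x. f x ~= 0}"] by auto
qed (use assms in \<open>auto simp: test_function_def\<close>)

lemma test_function_smooth: "test_function E f ==> smooth f"
 by (simp add: test_function_def)

lemma test_function_mono: "test_function E f ==> E \<subseteq> F ==> test_function F f"
 by (auto simp: test_function_def)

lemma test_function_mult: "test_function E f ==> smooth g ==> test_function E (%x. f x*g x)"
 by (erule test_functionE, rule test_functionI) (auto intro: smooth_mult)

lemma test_function_add:
 assumes "test_function E f" "test_function E g"
 shows "test_function E (%x. f x + g x)"
proof -
 obtain K where K: "compact K" "K \<subseteq> E" "!!x. x \<notin> K ==> f x = 0" "smooth f"
  using test_functionE[OF assms(1)] by blast
 obtain L where L: "compact L" "L \<subseteq> E" "!!x. x \<notin> L ==> g x = 0" "smooth g"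
  using test_functionE[OF assms(2)] by blast
 show ?thesis
  by (rule test_functionI[of _ "K \<union> L"]) (use K L in \<open>auto intro: smooth_add\<close>)
qed

lemma pd_cong_open:
 assumes "open S" "x\<in>S" "!!y. y\<in>S ==> f y = g y"
 shows "pd i f x = pd i g x"
proof -
 have "(f has_derivative D) (at x) \<longleftrightarrow> (g has_derivative D) (at x)" for D
  using has_derivative_transform_within_open[of f D x UNIV S g]
   has_derivative_transform_within_open[of g D x UNIV S f] assms by auto
 thus ?thesis by (simp add: partial_derivative_def frechet_derivative_def)
qed

lemma pd_zero_open:
 assumes "open S" "x\<in>S" "!!y. y\<in>S ==> f y = c"
 shows "pd i f x = 0"
 using pd_cong_open[OF assms(1,2), of f "%_. c"] assms(3)
 by (simp add: pd_const)

lemma test_function_partial: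
 assumes "test_function E f"
 shows "test_function E (pd i f)"
proof -
 obtain K where K: "compact K" "K \<subseteq> E" "!!x. x \<notin> K ==> f x = 0" "smooth f"
  using test_functionE[OF assms] by blast
 have "pd i f x = 0" if "x \<notin> K" for x
  by (rule pd_zero_open[of "- K"]) (use that K compact_imp_closed in auto)
 thus ?thesis by (intro test_functionI[of _ K]) (use K smoothD in auto)
qed

lemma subspace_test_function: "subspace (Collect (test_function E))"
proof (rule subspaceI)
 show "0\<in>Collect (test_function E)"
  by (auto simp: zero_fun_def intro!: test_functionI[of _ "{}"] smooth_const)
 show "c*\<^sub>R f\<in>Collect (test_function E)" if "f\<in>Collect (test_function E)" for f c
  using test_function_mult[OF _ smooth_const[of c], of E f] that
  by (simp add: scaleR_fun_def mult.commute)
qed (auto simp: plus_fun_def test_function_add)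

section \<open>Derivatives along the axes and symmetry of second derivatives\<close>

lemma DERIV_directional:
 assumes "smooth q"
 shows "((%s. q (x + s*\<^sub>R axis i 1)) has_real_derivative pd i q (x + s*\<^sub>R axis i 1)) (at s)"
proof -
 have d: "q differentiable (at y)" for y using smoothD[OF assms] by simp
 have "((%s. x + s*\<^sub>R axis i 1) has_derivative (%h. h*\<^sub>R axis i 1)) (at s)"
  by (auto intro!: derivative_eq_intros)
 from has_derivative_compose[OF this has_derivative_grad[OF d]]
 have "((%s. q (x + s*\<^sub>R axis i 1)) has_derivative (%h. grad q (x + s*\<^sub>R axis i 1)\<bullet>(h*\<^sub>R axis i 1))) (at s)" .
 thus ?thesis
  unfolding has_field_derivative_def
  by (rule has_derivative_eq_rhs) (auto simp: pd_inner[OF d] fun_eq_iff)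
qed

text \<open>The mean value theorem is applied to the second difference first in direction
  \<open>i\<close>, then in direction \<open>j\<close>. The second difference itself is symmetric in
  the two directions, so its limit gives Schwarz's theorem.\<close>

lemma mixed_partials_mean_value:
 assumes q: "smooth q" and h: "h > 0"
 shows "EX s t. 0 < s & s < h & 0 < t & t < h &
  q (x + h*\<^sub>R axis i 1 + h*\<^sub>R axis j 1) - q (x + h*\<^sub>R axis i 1) - q (x + h*\<^sub>R axis j 1) + q x =
  h*h*pd j (pd i q) (x + s*\<^sub>R axis i 1 + t*\<^sub>R axis j 1)"
proof -
 define g where "g s = q (x + h*\<^sub>R axis j 1 + s*\<^sub>R axis i 1) - q (x + s*\<^sub>R axis i 1)" for s
 have "(g has_real_derivative (pd i q (x + h*\<^sub>R axis j 1 + s*\<^sub>R axis i 1)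
   - pd i q (x + s*\<^sub>R axis i 1))) (at s)" for s
  unfolding g_def by (intro DERIV_diff DERIV_directional[OF q])
 then obtain s where s: "0 < s" "s < h" and
  gs: "g h - g 0 = (h - 0)*(pd i q (x + h*\<^sub>R axis j 1 + s*\<^sub>R axis i 1)
   - pd i q (x + s*\<^sub>R axis i 1))"
  using MVT2[OF h, of g "%s. pd i q (x + h*\<^sub>R axis j 1 + s*\<^sub>R axis i 1)
   - pd i q (x + s*\<^sub>R axis i 1)"] by blast
 obtain t where t: "0 < t" "t < h" and
  ht: "pd i q (x + s*\<^sub>R axis i 1 + h*\<^sub>R axis j 1) - pd i q (x + s*\<^sub>R axis i 1 + 0*\<^sub>R axis j 1)
   = (h - 0)*pd j (pd i q) (x + s*\<^sub>R axis i 1 + t*\<^sub>R axis j 1)"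
  using MVT2[OF h DERIV_directional[OF smoothD(2)[OF q, of i], of "x + s*\<^sub>R axis i 1" j]] by blast
 have "q (x + h*\<^sub>R axis i 1 + h*\<^sub>R axis j 1) - q (x + h*\<^sub>R axis i 1) - q (x + h*\<^sub>R axis j 1) + q x = g h - g 0"
  by (simp add: g_def add.assoc add.commute[of "h*\<^sub>R axis j 1"])
 also have "... = h*h*pd j (pd i q) (x + s*\<^sub>R axis i 1 + t*\<^sub>R axis j 1)"
  using gs ht by (simp add: add.assoc add.commute[of "h*\<^sub>R axis j 1"])
 finally show ?thesis using s t by blast
qed

lemma mixed_partials_commute:
 assumes q: "smooth q"
 shows "pd j (pd i q) x = pd i (pd j q) x"
proof -
 have lim: "EX X. (ALL n::nat. (q (x + (1/Suc n)*\<^sub>R axis i 1 + (1/Suc n)*\<^sub>R axis j 1) - q (x + (1/Suc n)*\<^sub>R axis i 1)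
   - q (x + (1/Suc n)*\<^sub>R axis j 1) + q x) = (1/Suc n)*(1/Suc n)*X n)
   & X \<longlonglongrightarrow> pd j (pd i q) x" for i j
 proof -
  have "EX s t. 0 < s & s < 1/Suc n & 0 < t & t < 1/Suc n &
   q (x + (1/Suc n)*\<^sub>R axis i 1 + (1/Suc n)*\<^sub>R axis j 1) - q (x + (1/Suc n)*\<^sub>R axis i 1) - q (x + (1/Suc n)*\<^sub>R axis j 1) + q x =
   (1/Suc n)*(1/Suc n)*pd j (pd i q) (x + s*\<^sub>R axis i 1 + t*\<^sub>R axis j 1)" for n
   by (rule mixed_partials_mean_value[OF q]) simp
  then obtain s t where st: "!!n::nat. 0 < s n & s n < 1/Suc n & 0 < t n & t n < 1/Suc n"
   and eq: "!!n::nat. q (x + (1/Suc n)*\<^sub>R axis i 1 + (1/Suc n)*\<^sub>R axis j 1) - q (x + (1/Suc n)*\<^sub>R axis i 1) - q (x + (1/Suc n)*\<^sub>R axis j 1) + q x =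
   (1/Suc n)*(1/Suc n)*pd j (pd i q) (x + s n*\<^sub>R axis i 1 + t n*\<^sub>R axis j 1)"
   by metis
  have inv0: "(%n. 1/real (Suc n)) \<longlonglongrightarrow> 0" using lim_inverse_n' LIMSEQ_Suc by blast
  have s0: "s \<longlonglongrightarrow> 0" "t \<longlonglongrightarrow> 0"
   by (rule tendsto_sandwich[OF _ _ tendsto_const inv0]; use st in \<open>force intro: always_eventually less_imp_le\<close>)+
  have "(%n. x + s n*\<^sub>R axis i 1 + t n*\<^sub>R axis j 1) \<longlonglongrightarrow> x + 0*\<^sub>R axis i 1 + 0*\<^sub>R axis j 1"
   by (intro tendsto_intros s0)
  hence "(%n. x + s n*\<^sub>R axis i 1 + t n*\<^sub>R axis j 1) \<longlonglongrightarrow> x" by simp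
  moreover have "isCont (pd j (pd i q)) x"
   using smoothD(3)[OF smoothD(2)[OF smoothD(2)[OF q]], of UNIV] by (simp add: continuous_on_eq_continuous_at)
  ultimately have "(%n. pd j (pd i q) (x + s n*\<^sub>R axis i 1 + t n*\<^sub>R axis j 1))
   \<longlonglongrightarrow> pd j (pd i q) x"
   using isCont_tendsto_compose by blast
  with eq show ?thesis
   by (intro exI[of _ "%n. pd j (pd i q)
     (x + s n*\<^sub>R axis i 1 + t n*\<^sub>R axis j 1)"]) blast
 qed
 obtain X where X: "!!n::nat. (q (x + (1/Suc n)*\<^sub>R axis i 1 + (1/Suc n)*\<^sub>R axis j 1) - q (x + (1/Suc n)*\<^sub>R axis i 1)
   - q (x + (1/Suc n)*\<^sub>R axis j 1) + q x) = (1/Suc n)*(1/Suc n)*X n"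
  "X \<longlonglongrightarrow> pd j (pd i q) x" using lim[of i j] by blast
 obtain Y where Y: "!!n::nat. (q (x + (1/Suc n)*\<^sub>R axis j 1 + (1/Suc n)*\<^sub>R axis i 1) - q (x + (1/Suc n)*\<^sub>R axis j 1)
   - q (x + (1/Suc n)*\<^sub>R axis i 1) + q x) = (1/Suc n)*(1/Suc n)*Y n"
  "Y \<longlonglongrightarrow> pd i (pd j q) x" using lim[of j i] by blast
 have "X n = Y n" for n
 proof -
  have sw: "x + (1/Suc n)*\<^sub>R axis j 1 + (1/Suc n)*\<^sub>R axis i 1 = x + (1/Suc n)*\<^sub>R axis i 1 + (1/Suc n)*\<^sub>R axis j 1"
   by (simp only: ac_simps)
  have "(1/real (Suc n))*(1/Suc n)*X n = (1/Suc n)*(1/Suc n)*Y n"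
   unfolding X(1)[symmetric] Y(1)[symmetric] sw by simp
  thus ?thesis by simp
 qed
 hence "X = Y" by auto
 thus ?thesis using X(2) Y(2) LIMSEQ_unique by blast
qed

subsection \<open>Integration by parts\<close>

lemma bounded_open_lmeasurable: "open E ==> bounded E ==> E\<in>lmeasurable"
 by (rule lmeasurable_open)

lemma sets_lebesgue_open: "open (E :: point set) ==> E\<in>sets lebesgue"
 by (metis lborelD borel_open sets_completionI_sets sets_lborel)

lemma integrable_lebesgue_on_iff:
 fixes f :: "point => 'b::{banach, second_countable_topology}"
 assumes "E\<in>sets lebesgue"
 shows "integrable (lebesgue_on E) f \<longleftrightarrow> integrable lebesgue (%x. indicator E x*\<^sub>R f x)"
 using assms by (simp add: integrable_restrict_space)

lemma integral_lebesgue_on: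
 fixes f :: "point => 'b::{banach, second_countable_topology}"
 assumes "E\<in>sets lebesgue"
 shows "(LINT x|lebesgue_on E. f x) = (LINT x|lebesgue. indicator E x*\<^sub>R f x)"
 using assms by (simp add: integral_restrict_space)

lemma integral_lebesgue_on_support:
 fixes f :: "point => real"
 assumes "E\<in>sets lebesgue" "!!x. x \<notin> E ==> f x = 0" "f\<in>borel_measurable borel"
 shows "(LINT x|lebesgue_on E. f x) = (LINT x|lborel. f x)"
proof -
 have "(LINT x|lebesgue_on E. f x) = (LINT x|lebesgue. f x)"
  unfolding integral_lebesgue_on[OF assms(1)]
  by (rule Bochner_Integration.integral_cong) (use assms(2) in \<open>auto simp: indicator_def\<close>)
 also have "... = (LINT x|lborel. f x)"
  using assms(3) by (intro integral_completion) simp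
 finally show ?thesis .
qed

lemma L2_space_subset:
 assumes "u\<in>L2_space F" "E \<subseteq> F" "E\<in>sets lebesgue" "F\<in>sets lebesgue"
 shows "u\<in>L2_space E"
proof -
 have "u\<in>borel_measurable (lebesgue_on E)"
  using measurable_restrict_mono[OF L2_spaceD(1)[OF assms(1)] assms(2)] .
 moreover have "integrable lebesgue (%x. indicator E x*\<^sub>R (indicator F x*\<^sub>R (norm (u x))^2))"
  using L2_spaceD(2)[OF assms(1), unfolded integrable_lebesgue_on_iff[OF assms(4)]] assms(3)
  by (rule integrable_mult_indicator[rotated])
 hence "integrable (lebesgue_on E) (%x. (norm (u x))^2)"
  unfolding integrable_lebesgue_on_iff[OF assms(3)]
  by (rule back_subst[of "integrable lebesgue"]) (use assms(2) in \<open>auto simp: fun_eq_iff indicator_def\<close>)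
 ultimately show ?thesis by (simp add: L2_space_def)
qed

lemma L2_space_bounded:
 fixes u :: "point => 'b::euclidean_space"
 assumes "E\<in>lmeasurable" "u\<in>borel_measurable (lebesgue_on E)" "!!x. x\<in>E ==> norm (u x) <= C"
 shows "u\<in>L2_space E" "(l2_norm E u)^2 <= C^2*measure lebesgue E"
proof -
 have fin: "emeasure (lebesgue_on E) (space (lebesgue_on E)) < \<infinity>"
  using assms(1) by (simp add: space_restrict_space emeasure_restrict_space fmeasurable_def del: emeasure_completion)
 interpret finite_measure "lebesgue_on E" using fin by (intro finite_measureI) auto
 have sq: "(norm (u x))^2 <= C^2" if "x\<in>E" for x
  using assms(3)[OF that] by (intro power_mono) auto
 show u: "u\<in>L2_space E"
  by (rule L2_space_dominated[OF assms(2), of "%_. C^2"]) (use sq in auto)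
 have "(l2_norm E u)^2 = (LINT x|lebesgue_on E. (norm (u x))^2)"
  using l2_norm_sq[OF u] by (simp add: l2_inner_def power2_norm_eq_inner)
 also have "... <= (LINT x|lebesgue_on E. C^2)"
  by (rule integral_mono) (use L2_spaceD[OF u] sq in \<open>auto simp: space_restrict_space\<close>)
 also have "... = C^2*measure lebesgue E"
  using assms(1) by (simp add: measure_restrict_space space_restrict_space fmeasurable_def)
 finally show "(l2_norm E u)^2 <= C^2*measure lebesgue E" .
qed

lemma L2_space_continuous:
 fixes u :: "point => 'b::euclidean_space"
 assumes "E\<in>lmeasurable" "bounded E" "continuous_on UNIV u"
 shows "u\<in>L2_space E"
proof -
 have "compact (u ` closure E)"
  using assms by (intro compact_continuous_image) (auto simp: compact_closure intro: continuous_on_subset)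
 from compact_imp_bounded[OF this] obtain C where C: "\<forall>y\<in>u ` closure E. norm y <= C"
  unfolding bounded_iff ..
 show ?thesis
 proof (rule L2_space_bounded(1)[OF assms(1)])
  show "u\<in>borel_measurable (lebesgue_on E)"
   using assms by (intro continuous_imp_measurable_on_sets_lebesgue) (auto intro: continuous_on_subset)
  show "norm (u x) <= C" if "x\<in>E" for x using C closure_subset[of E] that by auto
 qed
qed

lemma continuous_on_vec2:
 fixes u :: "'a::topological_space => point"
 assumes "continuous_on S (%x. u x$1)" "continuous_on S (%x. u x$2)"
 shows "continuous_on S u"
proof -
 have "continuous_on S (%x. u x$1*\<^sub>R axis 1 1 + u x$2*\<^sub>R axis 2 (1::real) :: point)"
  using assms by (intro continuous_on_add continuous_on_scaleR continuous_on_const)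
 thus ?thesis by (rule continuous_on_eq) (rule point_axis[symmetric])
qed

lemma continuous_grad: "smooth q ==> continuous_on S (grad q)" "smooth q ==> continuous_on S (curl q)"
 by (rule continuous_on_vec2; simp add: smoothD continuous_on_minus)+

lemma L2_smooth:
 assumes "open E" "bounded E" "smooth q"
 shows "q\<in>L2_space E" "grad q\<in>L2_space E" "curl q\<in>L2_space E"
 using assms by (auto intro!: L2_space_continuous bounded_open_lmeasurable continuous_grad smoothD)

lemma borel_measurable_smooth: "smooth q ==> q\<in>borel_measurable borel"
 by (intro borel_measurable_continuous_onI smoothD)

lemma test_function_bound:
 assumes "test_function E f"
 obtains C r where "C >= 0" "!!x. \<bar>f x\<bar> <= C" "r > 0" "!!x. norm x > r ==> f x = 0"
proof -
 obtain K where K: "compact K" "K \<subseteq> E" "!!x. x \<notin> K ==> f x = 0" "smooth f"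
  using test_functionE[OF assms] by blast
 have "compact (f ` K)" using K smoothD by (intro compact_continuous_image)
 from compact_imp_bounded[OF this] obtain C where C: "C > 0 & (\<forall>y\<in>f ` K. norm y <= C)"
  unfolding bounded_pos ..
 obtain r where r: "r > 0" "!!x. x\<in>K ==> norm x <= r"
  using compact_imp_bounded[OF K(1)] by (auto simp: bounded_pos)
 show thesis
 proof (rule that[of C r])
  show "\<bar>f x\<bar> <= C" for x using C K(3) by (cases "x\<in>K") auto
  show "f x = 0" if "norm x > r" for x using that r(2) K(3) by force
 qed (use C r in auto)
qed

lemma integrable_indicator_cball: "integrable lborel (%x. C*indicator (cball c r) x :: real)"
 for c :: point
 using emeasure_lborel_cball_finite[of c r]
 by (intro integrable_mult_right integrable_real_indicator) (auto simp: less_top)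

lemma integrable_bounded_support:
 fixes f :: "point => real"
 assumes "f\<in>borel_measurable borel" "!!x. \<bar>f x\<bar> <= C" "!!x. norm x > r ==> f x = 0"
 shows "integrable lborel f"
proof (rule Bochner_Integration.integrable_bound)
 show "integrable lborel (%x. C*indicator (cball (0::point) r) x :: real)"
  by (rule integrable_indicator_cball)
 show "AE x in lborel. norm (f x) <= norm (C*indicator (cball (0::point) r) x :: real)"
 proof (rule AE_I2)
  fix x show "norm (f x) <= norm (C*indicator (cball (0::point) r) x :: real)"
   using assms(2)[of x] assms(3)[of x] by (cases "norm x <= r") auto
 qed
qed (use assms in simp)

lemma integrable_test_function:
 assumes "test_function E f"
 shows "integrable lborel f"
proof -
 obtain C r where "!!x. \<bar>f x\<bar> <= C" "!!x. norm x > r ==> f x = 0" using test_function_bound[OF assms] by metis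
 thus ?thesis
  by (rule integrable_bounded_support[OF borel_measurable_smooth[OF test_function_smooth[OF assms]]])
qed

lemma integral_translate_lborel:
 fixes f :: "point => real"
 assumes "f\<in>borel_measurable borel"
 shows "(LINT x|lborel. f (c + x)) = (LINT x|lborel. f x)"
proof -
 have "(LINT x|lborel. f x) = (LINT x|distr lborel borel ((+) c). f x)"
  by (simp add: lborel_distr_plus)
 also have "... = (LINT x|lborel. f (c + x))"
  using assms by (intro integral_distr) auto
 finally show ?thesis by simp
qed

text \<open>Difference quotients of \<open>f\<close> have integral zero by translation invariance,
  and dominated convergence passes this on to the derivative.\<close>

lemma integral_partial_derivative_test:
 assumes f: "test_function E f"
 shows "(LINT x|lborel. pd i f x) = 0"
proof -
 have sm: "smooth f" using f by (rule test_function_smooth)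
 obtain r where r: "r > 0" "!!x. norm x > r ==> f x = 0" using test_function_bound[OF f] by metis
 obtain C where C: "C >= 0" "!!x. \<bar>pd i f x\<bar> <= C"
  using test_function_bound[OF test_function_partial[OF f]] by metis
 have [measurable]: "f\<in>borel_measurable borel" "pd i f\<in>borel_measurable borel"
  using sm by (auto intro: borel_measurable_smooth smoothD)
 define h where "h n = 1/real (Suc n)" for n
 have h: "0 < h n" "h n <= 1" for n by (auto simp: h_def)
 define D where "D n x = (f (h n*\<^sub>R axis i 1 + x) - f x)/h n" for n x
 have mvt: "EX s. 0 < s & s < h n & D n x = pd i f (x + s*\<^sub>R axis i 1)" for n x
 proof -
  obtain s where "0 < s" "s < h n"
   "f (x + h n*\<^sub>R axis i 1) - f (x + 0*\<^sub>R axis i 1) = (h n - 0)*pd i f (x + s*\<^sub>R axis i 1)"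
   using MVT2[OF h(1)[of n] DERIV_directional[OF sm, of x i]] by blast
  thus ?thesis
   using h(1)[of n] by (intro exI[of _ s]) (simp add: D_def add.commute[of _ x])
 qed
 have int_f: "integrable lborel f" "integrable lborel (%x. f (c + x))" for c
 proof -
  show "integrable lborel f" by (rule integrable_test_function[OF f])
  hence "integrable (distr lborel borel ((+) c)) f" by (simp add: lborel_distr_plus)
  thus "integrable lborel (%x. f (c + x))" by (rule integrable_distr[rotated]) auto
 qed
 have "(%n. LINT x|lborel. D n x) \<longlonglongrightarrow> (LINT x|lborel. pd i f x)"
 proof (rule integral_dominated_convergence)
  \<comment> \<open>The shifts are at most 1, so all difference quotients vanish outside the ball of
    radius \<open>r + 1\<close>.\<close>
  show "integrable lborel (%x. C*indicator (cball (0::point) (r + 1)) x :: real)"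
   by (rule integrable_indicator_cball)
  show "AE x in lborel. norm (D n x) <= C*indicator (cball (0::point) (r + 1)) x" for n
  proof (rule AE_I2)
   fix x
   show "norm (D n x) <= C*indicator (cball (0::point) (r + 1)) x"
   proof (cases "norm x <= r + 1")
    case True
    thus ?thesis using mvt[of n x] C(2) by auto
   next
    case False
    have "norm x <= norm (h n*\<^sub>R axis i 1 + x) + norm (h n*\<^sub>R (axis i 1 :: point))"
     using norm_triangle_ineq4[of "h n*\<^sub>R axis i 1 + x" "h n*\<^sub>R axis i 1"] by simp
    hence "norm x <= norm (h n*\<^sub>R axis i 1 + x) + 1"
     using h[of n] by (simp add: norm_axis_1)
    hence "f (h n*\<^sub>R axis i 1 + x) = 0" "f x = 0"
     using False r by auto
    thus ?thesis using False by (simp add: D_def)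
   qed
  qed
  show "AE x in lborel. (%n. D n x) \<longlonglongrightarrow> pd i f x"
  proof (rule AE_I2)
   fix x
   obtain s where s: "!!n. 0 < s n & s n < h n & D n x = pd i f (x + s n*\<^sub>R axis i 1)"
    using choice[of "%n s. 0 < s & s < h n & D n x = pd i f (x + s*\<^sub>R axis i 1)"]
     mvt[of _ x] by blast
   have h0: "h \<longlonglongrightarrow> 0" unfolding h_def using lim_inverse_n' LIMSEQ_Suc by blast
   have "s \<longlonglongrightarrow> 0"
    by (rule tendsto_sandwich[OF _ _ tendsto_const h0]; use s in \<open>force intro: always_eventually less_imp_le\<close>)
   hence "(%n. x + s n*\<^sub>R axis i 1) \<longlonglongrightarrow> x + 0*\<^sub>R axis i 1" by (intro tendsto_intros)
   moreover have "isCont (pd i f) (x + 0*\<^sub>R axis i 1)"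
    using smoothD(3)[OF smoothD(2)[OF sm], of UNIV] by (simp add: continuous_on_eq_continuous_at)
   ultimately have "(%n. pd i f (x + s n*\<^sub>R axis i 1)) \<longlonglongrightarrow> pd i f (x + 0*\<^sub>R axis i 1)"
    using isCont_tendsto_compose by blast
   thus "(%n. D n x) \<longlonglongrightarrow> pd i f x" using s by simp
  qed
  show "D n\<in>borel_measurable lborel" for n unfolding D_def by measurable
 qed measurable
 moreover have "(LINT x|lborel. D n x) = 0" for n
  using int_f integral_translate_lborel[of f] by (simp add: D_def)
 ultimately show ?thesis by (simp add: LIMSEQ_const_iff)
qed

lemma l2_inner_test:
 assumes "E\<in>sets lebesgue" "test_function E \<phi>" "smooth g"
 shows "l2_inner E g \<phi> = (LINT x|lborel. \<phi> x*g x)"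
proof -
 obtain K where K: "compact K" "K \<subseteq> E" "!!x. x \<notin> K ==> \<phi> x = 0" "smooth \<phi>"
  using test_functionE[OF assms(2)] by blast
 have "l2_inner E g \<phi> = (LINT x|lebesgue_on E. \<phi> x*g x)"
  by (simp add: l2_inner_def mult.commute)
 also have "... = (LINT x|lborel. \<phi> x*g x)"
  using K assms by (intro integral_lebesgue_on_support) (auto intro!: borel_measurable_smooth smooth_mult)
 finally show ?thesis .
qed

lemma integration_by_parts_test:
 assumes "E\<in>sets lebesgue" "test_function E \<phi>" "smooth g"
 shows "l2_inner E g (pd i \<phi>) = - l2_inner E (pd i g) \<phi>"
proof -
 have sm: "smooth \<phi>" by (rule test_function_smooth[OF assms(2)])
 have "(LINT x|lborel. pd i (%x. \<phi> x*g x) x) = 0"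
  by (rule integral_partial_derivative_test[OF test_function_mult[OF assms(2,3)]])
 moreover have "pd i (%x. \<phi> x*g x) x = pd i \<phi> x*g x + \<phi> x*pd i g x" for x
  using sm assms(3) smoothD by (intro pd_mult) auto
 moreover have "integrable lborel (%x. pd i \<phi> x*g x)" "integrable lborel (%x. \<phi> x*pd i g x)"
  using assms smoothD by (auto intro!: integrable_test_function[of E] test_function_mult test_function_partial)
 ultimately have "(LINT x|lborel. pd i \<phi> x*g x) + (LINT x|lborel. \<phi> x*pd i g x) = 0"
  by simp
 thus ?thesis
  using l2_inner_test[OF assms(1) test_function_partial[OF assms(2)] assms(3)]
   l2_inner_test[OF assms(1,2) smoothD(2)[OF assms(3)]] by simp
qed

lemma L2_component:
 assumes "(u :: vector_field)\<in>L2_space E"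
 shows "(%x. u x$i)\<in>L2_space E"
proof (rule L2_space_dominated[OF _ L2_spaceD(2)[OF assms]])
 note [measurable] = L2_spaceD(1)[OF assms]
 have "(%x. u x\<bullet>axis i 1)\<in>borel_measurable (lebesgue_on E)" by measurable
 thus "(%x. u x$i)\<in>borel_measurable (lebesgue_on E)" by (simp add: inner_axis)
 show "(norm (u x$i))^2 <= (norm (u x))^2" for x
  using component_le_norm_cart[of "u x" i] by (simp add: abs_le_square_iff[symmetric])
qed

lemma l2_inner_components:
 assumes "(u :: vector_field)\<in>L2_space E" "v\<in>L2_space E"
 shows "l2_inner E u v = l2_inner E (%x. u x$1) (%x. v x$1) + l2_inner E (%x. u x$2) (%x. v x$2)"
 using L2_component[OF assms(1)] L2_component[OF assms(2)] integrable_inner_L2[of "%x. u x$1" E "%x. v x$1"]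
  integrable_inner_L2[of "%x. u x$2" E "%x. v x$2"]
 by (simp add: l2_inner_def inner_point)

lemma L2_vector:
 assumes "u\<in>L2_space E" "v\<in>L2_space E"
 shows "(%x. vector [u x, v x] :: point)\<in>L2_space E"
proof (rule L2_space_dominated[OF _ Bochner_Integration.integrable_add[OF L2_spaceD(2)[OF assms(1)] L2_spaceD(2)[OF assms(2)]]])
 note [measurable] = L2_spaceD(1)[OF assms(1)] L2_spaceD(1)[OF assms(2)]
 have eq: "vector [a, b] = a*\<^sub>R axis 1 1 + b*\<^sub>R (axis 2 1 :: point)" for a b :: real
  by (simp add: vec_eq_iff forall_2 axis_def vector_2)
 show "(%x. vector [u x, v x] :: point)\<in>borel_measurable (lebesgue_on E)"
  unfolding eq by measurable
 show "(norm (vector [u x, v x] :: point))^2 <= (norm (u x))^2 + (norm (v x))^2" for x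
  unfolding power2_norm_eq_inner inner_point vector_2 by simp
qed

text \<open>Integration by parts moves the derivatives of \<open>\<psi>\<close> onto the gradient of
  \<open>\<phi>\<close>, where the mixed derivatives cancel. The support of \<open>\<psi>\<close>
  removes the boundary terms, so \<open>\<phi>\<close> may be arbitrary at the boundary.\<close>

lemma curl_test_orth_grad:
 assumes "open E" "bounded E" "test_function E \<psi>" "smooth \<phi>"
 shows "l2_inner E (curl \<psi>) (grad \<phi>) = 0" "l2_inner E (grad \<phi>) (curl \<psi>) = 0"
proof -
 have sm: "smooth \<psi>" by (rule test_function_smooth[OF assms(3)])
 have E: "E\<in>sets lebesgue" by (rule sets_lebesgue_open[OF assms(1)])
 note L = L2_smooth[OF assms(1,2)]
 have c2: "(%x. - pd 1 \<psi> x) = - pd 1 \<psi>" by auto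
 have "l2_inner E (grad \<phi>) (curl \<psi>) =
   l2_inner E (pd 1 \<phi>) (pd 2 \<psi>) + l2_inner E (pd 2 \<phi>) (%x. - pd 1 \<psi> x)"
  using l2_inner_components[of "grad \<phi>" E "curl \<psi>"] L sm assms(4) by simp
 also have "... = l2_inner E (pd 1 \<phi>) (pd 2 \<psi>) - l2_inner E (pd 2 \<phi>) (pd 1 \<psi>)"
  by (simp add: l2_inner_def)
 also have "... = l2_inner E (pd 1 (pd 2 \<phi>)) \<psi> - l2_inner E (pd 2 (pd 1 \<phi>)) \<psi>"
  by (simp add: integration_by_parts_test[OF E assms(3)] smoothD assms(4))
 also have "... = 0"
 proof -
  have "pd 1 (pd 2 \<phi>) = pd 2 (pd 1 \<phi>)"
   by (rule ext) (rule mixed_partials_commute[OF assms(4)])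
  thus ?thesis by simp
 qed
 finally show "l2_inner E (grad \<phi>) (curl \<psi>) = 0" .
 thus "l2_inner E (curl \<psi>) (grad \<phi>) = 0" using l2.sym L sm assms(4) by metis
qed

section \<open>The fundamental lemma of the calculus of variations\<close>

lemma box_cutoffs:
 fixes a b :: point
 obtains \<eta> where "!!n::nat. smooth (\<eta> n)" "!!n x. x \<notin> box a b ==> \<eta> n x = 0" "!!n x. \<bar>\<eta> n x\<bar> <= 1"
  "!!x. (%n. \<eta> n x) \<longlonglongrightarrow> indicator (box a b) x"
proof -
 \<comment> \<open>Two opposite steps of slope proportional to \<open>n\<close>: the product
   vanishes off the open interval for every \<open>n\<close> and equals 1 at each interior point
   from some \<open>n\<close> on.\<close>
 define F where "F n l r t = smooth_step (real n*t + (- real n*l)) * smooth_step (- real n*t + real n*r)" for n :: nat and l r t :: real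
 have Fb: "bsmooth (F n l r)" for n l r
  unfolding F_def by (intro bsmooth_mult bsmooth_affine bsmooth_step)
 have F0: "F n l r t = 0" if "\<not> (l < t & t < r)" for n l r t
 proof -
  have "real n*t + (- real n*l) <= 0 \<or> - real n*t + real n*r <= 0"
   using that by (auto simp: not_less mult_left_mono)
  thus ?thesis by (auto simp: F_def smooth_step_0)
 qed
 have F01: "0 <= F n l r t" "F n l r t <= 1" for n l r t
  unfolding F_def using smooth_step_range by (auto intro: mult_le_one)
 have F1: "\<forall>\<^sub>F n in sequentially. F n l r t = 1" if "l < t" "t < r" for l r t
 proof -
  obtain N :: nat where N: "1/(t - l) + 1/(r - t) < real N" using reals_Archimedean2 by blast
  have pos: "1/(t - l) > 0" "1/(r - t) > 0" using that by auto
  have "F n l r t = 1" if n: "n >= N" for n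
  proof -
   have nN: "real n >= real N" using n by simp
   have "1/(t - l) <= real n" "1/(r - t) <= real n" using N pos nN by linarith+
   hence "1 <= real n*(t - l)" "1 <= real n*(r - t)"
    using \<open>l < t\<close> \<open>t < r\<close> by (simp_all add: pos_divide_le_eq)
   thus ?thesis by (simp add: F_def smooth_step_1 algebra_simps)
  qed
  thus ?thesis by (auto simp: eventually_sequentially)
 qed
 define \<eta> where "\<eta> n = tensor (F n (a$1) (b$1)) (F n (a$2) (b$2))" for n
 have out: "\<eta> n x = 0" if "x \<notin> box a b" for n x
  using that F0 by (auto simp: \<eta>_def tensor_def mem_box_cart forall_2)
 show thesis
 proof (rule that[of \<eta>])
  show "smooth (\<eta> n)" for n unfolding \<eta>_def by (intro smooth_tensor Fb)
  show "\<bar>\<eta> n x\<bar> <= 1" for n x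
   unfolding \<eta>_def tensor_def using F01 by (auto simp: abs_mult intro!: mult_le_one)
  show "(%n. \<eta> n x) \<longlonglongrightarrow> indicator (box a b) x" for x
  proof (cases "x\<in>box a b")
   case True
   hence "a$1 < x$1" "x$1 < b$1" "a$2 < x$2" "x$2 < b$2"
    by (auto simp: mem_box_cart)
   hence "\<forall>\<^sub>F n in sequentially. F n (a$1) (b$1) (x$1) = 1" "\<forall>\<^sub>F n in sequentially. F n (a$2) (b$2) (x$2) = 1"
    using F1 by auto
   hence "\<forall>\<^sub>F n in sequentially. \<eta> n x = 1"
    by eventually_elim (simp add: \<eta>_def tensor_def)
   thus ?thesis using True by (simp add: tendsto_eventually)
  next
   case False
   thus ?thesis using out[OF False] by simp
  qed
 qed (rule out)
qed

text \<open>Boxes form an intersection-stable generator of the Borel sets. The plane itself is not a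
  box, so the total integral is a separate hypothesis; it handles complements.\<close>

lemma AE_zero_box_integrals:
 fixes f :: "point => real"
 assumes f: "integrable lborel f" and box: "!!a b. (LINT x|lborel. indicator (box a b) x*f x) = 0"
  and zero: "(LINT x|lborel. f x) = 0"
 shows "AE x in lborel. f x = 0"
proof (rule density_unique_real[OF f, of "%_. 0"])
 have ind: "integrable lborel (%x. indicator A x*f x)" if "A\<in>sets borel" for A
  using integrable_mult_indicator[OF _ f, of A] that by simp
 have bb: "sets (borel :: point measure) = sigma_sets UNIV (range (%(a, b). box a b))"
  by (subst borel_eq_box) simp
 have stable: "Int_stable (range (%(a, b). box a b :: point set))"
  by (auto simp: Int_stable_def box_Int_box)
 have sub: "range (%(a, b). box a b :: point set) \<subseteq> Pow UNIV" by simp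
 have "(LINT x|lborel. indicator A x*f x) = 0" if "A\<in>sigma_sets UNIV (range (%(a, b). box a b :: point set))" for A
  using stable sub that
 proof (induction rule: sigma_sets_induct_disjoint)
  case (compl A)
  hence A: "A\<in>sets borel" by (simp add: bb)
  have "(LINT x|lborel. indicator (UNIV - A) x*f x) = (LINT x|lborel. f x - indicator A x*f x)"
   by (rule Bochner_Integration.integral_cong) (auto simp: indicator_def)
  thus ?case using ind[OF A] f zero compl by simp
 next
  case (union A)
  hence A: "A i\<in>sets borel" for i by (auto simp: bb)
  have "(LINT x:(\<Union>i. A i)|lborel. f x) = (\<Sum>i. LINT x:(A i)|lborel. f x)"
  proof (rule lebesgue_integral_countable_add)
   show "set_integrable lborel (\<Union>i. A i) f"
    using ind[of "\<Union>i. A i"] A by (simp add: set_integrable_def)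
   show "A i \<inter> A j = {}" if "i ~= j" for i j
    using union that by (auto simp: disjoint_family_on_def)
  qed (use A in simp)
  thus ?case using union by (simp add: set_lebesgue_integral_def)
 qed (use box in auto)
 thus "(LINT x:A|lborel. f x) = (LINT x:A|lborel. 0)" if "A\<in>sets lborel" for A
  using that by (simp add: set_lebesgue_integral_def bb[symmetric])
qed simp

text \<open>Cut-offs converge to the indicator of a box whose closure lies in \<open>E\<close>, so
  integrals over such boxes vanish. Intersecting with further boxes gives vanishing almost
  everywhere on each of them, and countably many cover \<open>E\<close>.\<close>

theorem fundamental_lemma:
 assumes E: "open E" "bounded E" and g: "g\<in>L2_space E"
  and orth: "!!\<phi>. test_function E \<phi> ==> l2_inner E g \<phi> = 0"
 shows "AE x in lebesgue_on E. g x = 0"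
proof -
 have El: "E\<in>sets lebesgue" by (rule sets_lebesgue_open[OF E(1)])
 define h where "h x = indicator E x*g x" for x
 have "integrable (lebesgue_on E) (%x. g x\<bullet>1)"
  using g L2_smooth(1)[OF E smooth_const] by (rule integrable_inner_L2)
 hence hint: "integrable lebesgue h"
  by (simp add: integrable_lebesgue_on_iff[OF El] h_def[abs_def])
 then obtain h' where h': "h'\<in>borel_measurable lborel" "AE x in lborel. h x = h' x"
  using completion_ex_borel_measurable_real[of h lborel] borel_measurable_integrable by blast
 note [measurable] = h'(1) hint[THEN borel_measurable_integrable]
 have AEl: "AE x in lebesgue. h x = h' x" using h'(2) by (rule AE_completion)
 have [measurable]: "h'\<in>borel_measurable lebesgue" by (rule measurable_completion[OF h'(1)])
 have "integrable lebesgue h'"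
  using integrable_cong_AE[OF _ _ AEl] hint by auto
 hence h'int: "integrable lborel h'" using integrable_completion[OF h'(1)] by simp
 have test: "(LINT x|lborel. h' x*\<phi> x) = 0" if "test_function E \<phi>" for \<phi>
 proof -
  have [measurable]: "\<phi>\<in>borel_measurable borel" by (rule borel_measurable_smooth[OF test_function_smooth[OF that]])
  have "(LINT x|lborel. h' x*\<phi> x) = (LINT x|lebesgue. h' x*\<phi> x)"
   by (rule integral_completion[symmetric]) measurable
  also have "... = (LINT x|lebesgue. h x*\<phi> x)"
  proof (rule integral_cong_AE)
   have [measurable]: "\<phi>\<in>borel_measurable lebesgue" by (rule measurable_completion) simp
   show "(%x. h' x*\<phi> x)\<in>borel_measurable lebesgue" "(%x. h x*\<phi> x)\<in>borel_measurable lebesgue"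
    by measurable
   show "AE x in lebesgue. h' x*\<phi> x = h x*\<phi> x" using AEl by eventually_elim simp
  qed
  also have "... = l2_inner E g \<phi>"
   unfolding l2_inner_def integral_lebesgue_on[OF El] h_def by (simp add: mult.assoc)
  finally show ?thesis using orth[OF that] by simp
 qed
 have box0: "(LINT x|lborel. indicator (box a b) x*h' x) = 0" if "cbox a b \<subseteq> E" for a b
 proof -
  obtain \<eta> where \<eta>: "!!n::nat. smooth (\<eta> n)" "!!n x. x \<notin> box a b ==> \<eta> n x = 0" "!!n x. \<bar>\<eta> n x\<bar> <= 1"
   "!!x. (%n. \<eta> n x) \<longlonglongrightarrow> indicator (box a b) x" using box_cutoffs[of a b] by blast
  have "\<eta> n x = 0" if "x \<notin> cbox a b" for n x
   by (rule \<eta>(2)) (use that box_subset_cbox[of a b] in blast)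
  hence "test_function E (\<eta> n)" for n
   using \<eta>(1) that by (intro test_functionI[of _ "cbox a b"]) auto
  hence 0: "(LINT x|lborel. h' x*\<eta> n x) = 0" for n using test by blast
  have [measurable]: "\<eta> n\<in>borel_measurable borel" for n by (rule borel_measurable_smooth[OF \<eta>(1)])
  have "(%n. LINT x|lborel. h' x*\<eta> n x) \<longlonglongrightarrow> (LINT x|lborel. h' x*indicator (box a b) x)"
  proof (rule integral_dominated_convergence)
   show "integrable lborel (%x. norm (h' x))" using h'int by simp
   show "AE x in lborel. (%n. h' x*\<eta> n x) \<longlonglongrightarrow> h' x*indicator (box a b) x"
    by (intro AE_I2 tendsto_mult tendsto_const \<eta>(4))
   show "AE x in lborel. norm (h' x*\<eta> n x) <= norm (h' x)" for n
    by (intro AE_I2) (simp add: abs_mult mult_left_le \<eta>(3))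
  qed (use h'(1) in measurable)
  thus ?thesis by (simp add: 0 LIMSEQ_const_iff mult.commute)
 qed
 have AEbox: "AE x in lborel. indicator (box p q) x*h' x = 0" if pq: "cbox p q \<subseteq> E" for p q
 proof (rule AE_zero_box_integrals)
  show "integrable lborel (%x. indicator (box p q) x*h' x)"
   using integrable_mult_indicator[OF _ h'int, of "box p q"] by simp
  show "(LINT x|lborel. indicator (box p q) x*h' x) = 0" by (rule box0[OF pq])
  fix a b
  obtain c d where cd: "box a b \<inter> box p q = box c d" by (auto simp: box_Int_box)
  have "(LINT x|lborel. indicator (box a b) x*(indicator (box p q) x*h' x)) =
    (LINT x|lborel. indicator (box c d) x*h' x)"
   by (simp add: cd[symmetric] indicator_inter_arith mult.assoc)
  also have "... = 0"
  \<comment> \<open>An empty intersection may come with arbitrary corners; only a nonempty one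
    yields a closed box inside \<open>E\<close>.\<close>
  proof (cases "box c d = {}")
   case False
   hence "cbox c d = closure (box c d)" by simp
   also have "... \<subseteq> cbox p q"
    using cd box_subset_cbox[of p q] by (intro closure_minimal) auto
   finally have "cbox c d \<subseteq> E" using pq by blast
   thus ?thesis by (rule box0)
  qed simp
  finally show "(LINT x|lborel. indicator (box a b) x*(indicator (box p q) x*h' x)) = 0" .
 qed
 define \<F> where "\<F> = {box a b | a b. cbox a b \<subseteq> E}"
 have "\<Union>\<F> = E"
 proof
  show "\<Union>\<F> \<subseteq> E" using box_subset_cbox by (force simp: \<F>_def)
  show "E \<subseteq> \<Union>\<F>"
  proof
   fix x assume "x\<in>E"
   then obtain a b where "cbox a b \<subseteq> E" "x\<in>box a b" using open_contains_cbox[OF E(1)] by metis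
   thus "x\<in>\<Union>\<F>" by (auto simp: \<F>_def)
  qed
 qed
 moreover obtain \<D> where \<D>: "\<D> \<subseteq> \<F>" "countable \<D>" "\<Union>\<D> = \<Union>\<F>"
  using Lindelof[of \<F>] by (auto simp: \<F>_def)
 ultimately have \<D>E: "\<Union>\<D> = E" by simp
 have "AE x in lborel. \<forall>X\<in>\<D>. indicator X x*h' x = 0"
  using \<D>(1) AEbox by (intro AE_ball_countable'[OF _ \<D>(2)]) (auto simp: \<F>_def)
 hence "AE x in lborel. x\<in>E --> h' x = 0"
 proof (rule AE_mp, intro AE_I2 impI)
  fix x assume "\<forall>X\<in>\<D>. indicator X x*h' x = 0" "x\<in>E"
  thus "h' x = 0" using \<D>E by (auto simp: indicator_def)
 qed
 hence "AE x in lebesgue. x\<in>E --> h' x = 0" by (rule AE_completion)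
 with AEl have "AE x in lebesgue. x\<in>E --> g x = 0"
  by eventually_elim (auto simp: h_def)
 thus ?thesis using El by (simp add: AE_restrict_space_iff)
qed

subsection \<open>Weak derivatives\<close>

text \<open>The residual of the projection onto test functions is orthogonal to all of them, hence
  null by the fundamental lemma.\<close>

lemma test_functions_dense:
 assumes E: "open E" "bounded E" and u: "(u :: scalar_field)\<in>L2_space E"
 obtains \<phi> where "!!n::nat. test_function E (\<phi> n)" "(%n. l2_norm E (u - \<phi> n)) \<longlonglongrightarrow> 0"
proof -
 have sub: "Collect (test_function E) \<subseteq> L2_space E"
  using L2_smooth[OF E] test_function_smooth by auto
 obtain r w where r: "r\<in>L2_space E" and w: "!!n::nat. w n\<in>Collect (test_function E)"
  and lim: "(%n. l2_norm E (u - w n - r)) \<longlonglongrightarrow> 0"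
  and orth: "!!v. v\<in>Collect (test_function E) ==> l2_inner E r v = 0"
  using l2.orthogonal_residual[OF subspace_test_function sub u l2_complete_seq] unfolding l2_nrm by blast
 have "AE x in lebesgue_on E. r x = 0"
  using fundamental_lemma[OF E r] orth by auto
 hence r0: "l2_norm E r = 0" using l2_norm_eq_0_AE[OF r] by simp
 have wL: "w n\<in>L2_space E" for n using w sub by auto
 have "(%n. l2_norm E (u - w n)) \<longlonglongrightarrow> 0"
 proof (rule Lim_null_comparison[OF _ lim])
  have "l2_norm E (u - w n) <= l2_norm E (u - w n - r)" for n
   using l2_triangle[of "u - w n - r" E r] u wL[of n] r r0 by simp
  thus "\<forall>\<^sub>F n in sequentially. norm (l2_norm E (u - w n)) <= l2_norm E (u - w n - r)"
   using u wL by simp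
 qed
 thus thesis using that[of w] w by auto
qed

lemma AE_lebesgue_on_subset:
 assumes "AE x in lebesgue_on F. P x" "E \<subseteq> F" "E\<in>sets lebesgue" "F\<in>sets lebesgue"
 shows "AE x in lebesgue_on E. P x"
 using assms by (auto simp: AE_restrict_space_iff subset_iff elim!: eventually_mono)

lemma L2_const: "open E ==> bounded E ==> (%x. c :: real)\<in>L2_space E"
 by (rule L2_smooth(1)[OF _ _ smooth_const])

lemma AE_eq_if_tests:
 assumes E: "open E" "bounded E" and "g\<in>L2_space E" "g'\<in>L2_space E"
  and "!!\<phi>. test_function E \<phi> ==> l2_inner E g \<phi> = l2_inner E g' \<phi>"
 shows "AE x in lebesgue_on E. g x = g' x"
proof -
 have "l2_inner E (g - g') \<phi> = 0" if "test_function E \<phi>" for \<phi>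
  using that assms L2_smooth(1)[OF E test_function_smooth[OF that]] by (simp add: l2.diff_left)
 hence "AE x in lebesgue_on E. (g - g') x = 0"
  using fundamental_lemma[OF E, of "g - g'"] assms by auto
 thus ?thesis by simp
qed

context
 fixes E :: "point set"
 assumes E: "open E" "bounded E"
begin

lemma L2_test: "test_function E \<phi> ==> \<phi>\<in>L2_space E" "test_function E \<phi> ==> grad \<phi>\<in>L2_space E"
 "test_function E \<phi> ==> curl \<phi>\<in>L2_space E" "test_function E \<phi> ==> pd i \<phi>\<in>L2_space E"
 using L2_smooth[OF E] test_function_smooth smoothD(2) by blast+

lemma weak_div_unique:
 assumes "has_weak_div E v g" "has_weak_div E v g'" "g\<in>L2_space E" "g'\<in>L2_space E"
 shows "AE x in lebesgue_on E. g x = g' x"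
 using assms by (intro AE_eq_if_tests[OF E]) (auto simp: has_weak_div_def)

lemma weak_div_spec:
 assumes "v\<in>Hdiv E"
 shows "weak_div E v\<in>L2_space E" "has_weak_div E v (weak_div E v)"
 using assms someI_ex[of "%g. g\<in>L2_space E & has_weak_div E v g"]
 by (auto simp: Hdiv_def weak_div_def)

lemma weak_divI:
 assumes "v\<in>L2_space E" "g\<in>L2_space E" "has_weak_div E v g"
 shows "v\<in>Hdiv E" "AE x in lebesgue_on E. weak_div E v x = g x"
proof -
 show v: "v\<in>Hdiv E" using assms by (auto simp: Hdiv_def)
 show "AE x in lebesgue_on E. weak_div E v x = g x"
  using weak_div_spec[OF v] assms weak_div_unique by blast
qed

text \<open>\<open>weak_div\<close> is a chosen representative and equals \<open>g\<close> only
  almost everywhere; identities are therefore transferred through inner products.\<close>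

lemma weak_div_inner:
 assumes "v\<in>L2_space E" "g\<in>L2_space E" "has_weak_div E v g" "w\<in>L2_space E"
 shows "l2_inner E (weak_div E v) w = l2_inner E g w"
 using weak_divI[OF assms(1-3)] weak_div_spec assms
 by (intro l2_inner_cong_AE) auto

lemma has_weak_div_add:
 assumes "u\<in>L2_space E" "v\<in>L2_space E" "g\<in>L2_space E" "h\<in>L2_space E"
  "has_weak_div E u g" "has_weak_div E v h"
 shows "has_weak_div E (u + v) (g + h)"
 using assms L2_test by (simp add: has_weak_div_def l2.add_left)

lemma has_weak_div_scale:
 assumes "u\<in>L2_space E" "g\<in>L2_space E" "has_weak_div E u g"
 shows "has_weak_div E (c*\<^sub>R u) (c*\<^sub>R g)"
 using assms L2_test by (simp add: has_weak_div_def l2.scale_left)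

lemma HdivD: "v\<in>Hdiv E ==> v\<in>L2_space E"
 by (simp add: Hdiv_def)

lemma weak_div_add:
 assumes "u\<in>Hdiv E" "v\<in>Hdiv E"
 shows "u + v\<in>Hdiv E" "AE x in lebesgue_on E. weak_div E (u + v) x = weak_div E u x + weak_div E v x"
 using weak_divI[OF _ _ has_weak_div_add[OF _ _ _ _ weak_div_spec(2)[OF assms(1)] weak_div_spec(2)[OF assms(2)]]]
  assms HdivD weak_div_spec(1) by auto

lemma weak_div_scale:
 assumes "u\<in>Hdiv E"
 shows "c*\<^sub>R u\<in>Hdiv E" "AE x in lebesgue_on E. weak_div E (c*\<^sub>R u) x = c*weak_div E u x"
 using weak_divI[OF _ _ has_weak_div_scale[OF _ _ weak_div_spec(2)[OF assms]]]
  assms HdivD weak_div_spec(1) by auto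

lemma weak_div_inner_add:
 assumes "u\<in>Hdiv E" "v\<in>Hdiv E" "w\<in>L2_space E"
 shows "l2_inner E (weak_div E (u + v)) w = l2_inner E (weak_div E u) w + l2_inner E (weak_div E v) w"
 using weak_div_inner[OF _ _ has_weak_div_add[OF _ _ _ _ weak_div_spec(2)[OF assms(1)] weak_div_spec(2)[OF assms(2)]] assms(3)]
  assms HdivD weak_div_spec(1) by (simp add: l2.add_left)

lemma weak_div_inner_scale:
 assumes "u\<in>Hdiv E" "w\<in>L2_space E"
 shows "l2_inner E (weak_div E (c*\<^sub>R u)) w = c*l2_inner E (weak_div E u) w"
 using weak_div_inner[OF _ _ has_weak_div_scale[OF _ _ weak_div_spec(2)[OF assms(1)]] assms(2)]
  assms HdivD weak_div_spec(1) by (simp add: l2.scale_left)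

lemma weak_div_zero:
 assumes "v\<in>L2_space E" "has_weak_div E v (%_. 0)"
 shows "v\<in>Hdiv E" "l2_norm E (weak_div E v) = 0"
proof -
 have 0: "(%_. 0)\<in>L2_space E" using l2.zero_in unfolding zero_fun_def .
 show v: "v\<in>Hdiv E" by (rule weak_divI(1)[OF assms(1) 0 assms(2)])
 have "AE x in lebesgue_on E. weak_div E v x = 0" by (rule weak_divI(2)[OF assms(1) 0 assms(2)])
 thus "l2_norm E (weak_div E v) = 0" using l2_norm_eq_0_AE weak_div_spec[OF v] by blast
qed

lemma has_weak_div_tendsto:
 assumes "!!n. v n\<in>L2_space E" "!!n. g n\<in>L2_space E" "!!n::nat. has_weak_div E (v n) (g n)"
  "u\<in>L2_space E" "h\<in>L2_space E" "(%n. l2_norm E (v n - u)) \<longlonglongrightarrow> 0" "(%n. l2_norm E (g n - h)) \<longlonglongrightarrow> 0"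
 shows "has_weak_div E u h"
 unfolding has_weak_div_def
proof (intro allI impI)
 fix \<phi> assume \<phi>: "test_function E \<phi>"
 have "(%n. l2_inner E (v n) (grad \<phi>)) \<longlonglongrightarrow> l2_inner E u (grad \<phi>)"
  using assms L2_test[OF \<phi>] by (intro l2_inner_tendsto)
 moreover have "(%n. - l2_inner E (g n) \<phi>) \<longlonglongrightarrow> - l2_inner E h \<phi>"
  using assms L2_test[OF \<phi>] by (intro tendsto_minus l2_inner_tendsto)
 moreover have "l2_inner E (v n) (grad \<phi>) = - l2_inner E (g n) \<phi>" for n
  using assms(3) \<phi> by (simp add: has_weak_div_def)
 ultimately show "l2_inner E u (grad \<phi>) = - l2_inner E h \<phi>"
  using LIMSEQ_unique by simp
qed

lemma normal_trace_add:
 assumes "u\<in>Hdiv E" "v\<in>Hdiv E" "smooth q"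
 shows "normal_trace E (u + v) q = normal_trace E u q + normal_trace E v q"
 using assms HdivD L2_smooth[OF E assms(3)] by (simp add: normal_trace_def l2.add_left weak_div_inner_add)

lemma normal_trace_scale:
 assumes "u\<in>Hdiv E" "smooth q"
 shows "normal_trace E (c*\<^sub>R u) q = c*normal_trace E u q"
 using assms HdivD L2_smooth[OF E assms(2)]
 by (simp add: normal_trace_def l2.scale_left weak_div_inner_scale algebra_simps)

text \<open>Both fields admit the same weak divergences, so the choice in \<open>weak_div\<close>
  picks literally the same function for them.\<close>

lemma Hdiv_cong_AE:
 assumes "u\<in>L2_space E" "v\<in>L2_space E" "AE x in lebesgue_on E. u x = v x"
 shows "has_weak_div E u g \<longleftrightarrow> has_weak_div E v g" "has_weak_rot E u g \<longleftrightarrow> has_weak_rot E v g"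
  "u\<in>Hdiv E \<longleftrightarrow> v\<in>Hdiv E" "weak_div E u = weak_div E v" "smooth q ==> normal_trace E u q = normal_trace E v q"
proof -
 have *: "l2_inner E u w = l2_inner E v w" if "w\<in>L2_space E" for w
  using assms that by (intro l2_inner_cong_AE) auto
 show d: "has_weak_div E u g \<longleftrightarrow> has_weak_div E v g" for g
  using * L2_test by (auto simp: has_weak_div_def)
 show "has_weak_rot E u g \<longleftrightarrow> has_weak_rot E v g"
  using * L2_test by (auto simp: has_weak_rot_def)
 show "u\<in>Hdiv E \<longleftrightarrow> v\<in>Hdiv E" using d assms by (auto simp: Hdiv_def)
 show w: "weak_div E u = weak_div E v" by (simp add: weak_div_def d)
 show "smooth q ==> normal_trace E u q = normal_trace E v q"
  using * L2_smooth[OF E] by (simp add: normal_trace_def w)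
qed

lemma weak_grad_spec:
 assumes "q\<in>H1 E"
 shows "weak_grad E q\<in>L2_space E" "has_weak_grad E q (weak_grad E q)"
 using assms someI_ex[of "%g. g\<in>L2_space E & has_weak_grad E q g"]
 by (auto simp: H1_def weak_grad_def)

lemma weak_gradI:
 assumes "q\<in>L2_space E" "g\<in>L2_space E" "has_weak_grad E q g"
 shows "q\<in>H1 E" "AE x in lebesgue_on E. weak_grad E q x = g x"
proof -
 show q: "q\<in>H1 E" using assms by (auto simp: H1_def)
 note s = weak_grad_spec[OF q]
 have "AE x in lebesgue_on E. weak_grad E q x$i = g x$i" for i
  by (rule AE_eq_if_tests[OF E]) (use s assms L2_component in \<open>auto simp: has_weak_grad_def\<close>)
 from this[of 1] this[of 2] show "AE x in lebesgue_on E. weak_grad E q x = g x"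
  by eventually_elim (simp add: vec_eq_iff forall_2)
qed

lemma has_weak_grad_smooth:
 assumes "smooth q"
 shows "has_weak_grad E q (grad q)"
 unfolding has_weak_grad_def
proof (intro allI impI)
 fix \<phi> i assume "test_function E \<phi>"
 moreover have "(%x. grad q x$i) = pd i q" using exhaust_2[of i] by auto
 ultimately show "l2_inner E q (pd i \<phi>) = - l2_inner E (%x. grad q x$i) \<phi>"
  using integration_by_parts_test[OF sets_lebesgue_open[OF E(1)] _ assms] by simp
qed

lemma l2_norm_component_le:
 assumes "(u :: vector_field)\<in>L2_space E"
 shows "l2_norm E (%x. u x$i) <= l2_norm E u"
proof (rule power2_le_imp_le)
 have c: "(%x. u x$j)\<in>L2_space E" for j by (rule L2_component[OF assms])
 have "(l2_norm E u)^2 = (l2_norm E (%x. u x$1))^2 + (l2_norm E (%x. u x$2))^2"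
  using l2_inner_components[OF assms assms] assms c by (simp add: l2_norm_sq)
 thus "(l2_norm E (%x. u x$i))^2 <= (l2_norm E u)^2"
  using exhaust_2[of i] by auto
qed (use assms in simp)

lemma has_weak_grad_tendsto:
 assumes "!!n. q n\<in>L2_space E" "!!n. g n\<in>L2_space E" "!!n::nat. has_weak_grad E (q n) (g n)"
  "p\<in>L2_space E" "h\<in>L2_space E" "(%n. l2_norm E (q n - p)) \<longlonglongrightarrow> 0" "(%n. l2_norm E (g n - h)) \<longlonglongrightarrow> 0"
 shows "has_weak_grad E p h"
 unfolding has_weak_grad_def
proof (intro allI impI)
 fix \<phi> i assume \<phi>: "test_function E \<phi>"
 have c: "(%n. l2_norm E ((%x. g n x$i) - (%x. h x$i))) \<longlonglongrightarrow> 0"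
 proof (rule Lim_null_comparison[OF _ assms(7)])
  have "l2_norm E ((%x. g n x$i) - (%x. h x$i)) <= l2_norm E (g n - h)" for n
  proof -
   have eq: "(%x. (g n - h) x$i) = (%x. g n x$i) - (%x. h x$i)" by auto
   have "g n - h\<in>L2_space E" using assms by simp
   from l2_norm_component_le[OF this, of i] show ?thesis unfolding eq .
  qed
  thus "\<forall>\<^sub>F n in sequentially. norm (l2_norm E ((%x. g n x$i) - (%x. h x$i))) <= l2_norm E (g n - h)"
   using assms(2,5) L2_component by (intro always_eventually allI) (simp del: minus_apply)
 qed
 have "(%n. l2_inner E (q n) (pd i \<phi>)) \<longlonglongrightarrow> l2_inner E p (pd i \<phi>)"
  using assms L2_test[OF \<phi>] by (intro l2_inner_tendsto)
 moreover have "(%n. - l2_inner E (%x. g n x$i) \<phi>) \<longlonglongrightarrow> - l2_inner E (%x. h x$i) \<phi>"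
  by (intro tendsto_minus l2_inner_tendsto L2_component assms L2_test \<phi> c)
 moreover have "l2_inner E (q n) (pd i \<phi>) = - l2_inner E (%x. g n x$i) \<phi>" for n
  using assms(3) \<phi> by (simp add: has_weak_grad_def)
 ultimately show "l2_inner E p (pd i \<phi>) = - l2_inner E (%x. h x$i) \<phi>"
  using LIMSEQ_unique by simp
qed

end

text \<open>Rotation by a right angle: an isometry that exchanges gradients and curls up to sign, so
  that norm statements carry over from one to the other.\<close>

definition rotate_field :: "vector_field => vector_field" where
 "rotate_field w x = vector [- (w x$2), w x$1]"

lemma rotate_field_component [simp]: "rotate_field w x$1 = - (w x$2)" "rotate_field w x$2 = w x$1"
 by (simp_all add: rotate_field_def vector_2)

lemma point_eqI: "(a::point)$1 = b$1 ==> a$2 = b$2 ==> a = b"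
 by (simp add: vec_eq_iff forall_2)

lemma rotate_field_linear:
 "rotate_field (u + v) = rotate_field u + rotate_field v" "rotate_field (c*\<^sub>R u) = c*\<^sub>R rotate_field u"
 "rotate_field (u - v) = rotate_field u - rotate_field v" "rotate_field (- u) = - rotate_field u"
 by (auto intro!: ext point_eqI)

lemma curl_rotate: "curl q = - rotate_field (grad q)" "weak_curl E q = - rotate_field (weak_grad E q)"
 by (auto intro!: ext point_eqI simp: weak_curl_def vector_2)

lemma L2_rotate: "w\<in>L2_space E ==> rotate_field w\<in>L2_space E"
proof -
 assume w: "w\<in>L2_space E"
 have "- (%x. w x$2)\<in>L2_space E" using L2_component[OF w] by (rule l2.closed)
 hence "(%x. - (w x$2))\<in>L2_space E" by (simp add: fun_Compl_def)
 thus ?thesis using L2_vector[OF _ L2_component[OF w]] by (simp add: rotate_field_def[abs_def])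
qed

lemma l2_inner_rotate: "l2_inner E (rotate_field u) (rotate_field v) = l2_inner E u v"
 by (simp add: l2_inner_def inner_point add.commute)

lemma l2_norm_rotate: "l2_norm E (rotate_field u) = l2_norm E u"
 by (simp add: l2_norm_def l2_inner_rotate)

lemma l2_inner_partition:
 assumes fin: "finite A" and meas: "!!P. P\<in>A ==> S P\<in>sets lebesgue" "Z\<in>sets lebesgue"
  and sub: "!!P. P\<in>A ==> S P \<subseteq> Z" and disj: "disjoint_family_on S A"
  and null: "negligible (Z - (\<Union>P\<in>A. S P))"
  and u: "u\<in>L2_space Z" and v: "v\<in>L2_space Z"
 shows "l2_inner Z u v = (\<Sum>P\<in>A. l2_inner (S P) u v)"
proof -
 have int: "integrable lebesgue (%x. indicator (S P) x*\<^sub>R (u x\<bullet>v x))" if "P\<in>A" for P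
  using integrable_inner_L2[of u "S P" v] L2_space_subset[OF u sub meas(1) meas(2)]
   L2_space_subset[OF v sub meas(1) meas(2)] that
  by (simp add: integrable_lebesgue_on_iff[OF meas(1)])
 have "l2_inner Z u v = (LINT x|lebesgue. indicator Z x*\<^sub>R (u x\<bullet>v x))"
  unfolding l2_inner_def by (rule integral_lebesgue_on[OF meas(2)])
 also have "... = (LINT x|lebesgue. (\<Sum>P\<in>A. indicator (S P) x*\<^sub>R (u x\<bullet>v x)))"
 proof (rule integral_cong_AE)
  show "(%x. indicator Z x*\<^sub>R (u x\<bullet>v x))\<in>borel_measurable lebesgue"
   using integrable_inner_L2[OF u v] unfolding integrable_lebesgue_on_iff[OF meas(2)]
   by (rule borel_measurable_integrable)
  show "(%x. \<Sum>P\<in>A. indicator (S P) x*\<^sub>R (u x\<bullet>v x))\<in>borel_measurable lebesgue"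
   using int by (intro borel_measurable_sum borel_measurable_integrable)
  have "AE x in lebesgue. x \<notin> Z - (\<Union>P\<in>A. S P)"
   using null[unfolded negligible_iff_null_sets] by (rule AE_not_in)
  thus "AE x in lebesgue. indicator Z x*\<^sub>R (u x\<bullet>v x) = (\<Sum>P\<in>A. indicator (S P) x*\<^sub>R (u x\<bullet>v x))"
  proof eventually_elim
   case (elim x)
   have "(\<Sum>P\<in>A. indicator (S P) x) = (indicator (\<Union>P\<in>A. S P) x :: real)"
    by (rule indicator_UN_disjoint[OF fin disj, symmetric])
   moreover have "indicator (\<Union>P\<in>A. S P) x = (indicator Z x :: real)"
    using elim sub by (auto simp: indicator_def)
   ultimately show ?case by (simp only: real_scaleR_def sum_distrib_right[symmetric])
  qed
 qed
 also have "... = (\<Sum>P\<in>A. LINT x|lebesgue. indicator (S P) x*\<^sub>R (u x\<bullet>v x))"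
  by (rule Bochner_Integration.integral_sum) (rule int)
 also have "... = (\<Sum>P\<in>A. l2_inner (S P) u v)"
  unfolding l2_inner_def by (intro sum.cong refl integral_lebesgue_on[symmetric] meas)
 finally show ?thesis .
qed

subsection \<open>A Poincare inequality on squares\<close>

definition pt :: "real => real => point" where
 "pt s t = vector [s, t]"

lemma pt_component [simp]: "pt s t$1 = s" "pt s t$2 = t"
 by (simp_all add: pt_def vector_2)

lemma pt_eq: "pt s t = s*\<^sub>R axis 1 1 + t*\<^sub>R axis 2 1"
 by (rule point_eqI) (simp_all add: axis_def)

lemma pt_components: "pt (x$1) (x$2) = x"
 by (rule point_eqI) simp_all

lemma continuous_on_pt:
 "continuous_on S f ==> continuous_on S g ==> continuous_on S (%x. pt (f x) (g x))"
 unfolding pt_eq by (intro continuous_on_add continuous_on_scaleR continuous_on_const)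

lemma borel_measurable_pt [measurable (raw)]:
 assumes [measurable]: "f\<in>borel_measurable M" "g\<in>borel_measurable M"
 shows "(%x. pt (f x) (g x))\<in>borel_measurable M"
 unfolding pt_eq by measurable

lemma prod_Basis_point: "(\<Prod>b\<in>Basis. f (b :: point)) = f (axis 1 1)*f (axis 2 1)"
proof -
 have B: "(Basis :: point set) = {axis 1 1, axis 2 1}"
  by (auto simp: Basis_vec_def) (metis exhaust_2)
 have "axis 1 1 ~= (axis 2 1 :: point)" by (simp add: axis_eq_axis)
 thus ?thesis by (simp add: B)
qed

text \<open>Identifies Lebesgue measure on vectors indexed by the type \<open>2\<close> with the
  image of a product measure, which gives access to iterated integrals in either order.\<close>

lemma lborel_point: "lborel = distr (lborel \<Otimes>\<^sub>M lborel) borel (%(s, t). pt s t)"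
proof (rule lborel_eqI)
 fix l u :: point assume le: "!!b. b\<in>Basis ==> l\<bullet>b <= u\<bullet>b"
 have "axis i 1\<in>(Basis :: point set)" for i by (simp add: axis_in_Basis_iff)
 hence lu: "l$i <= u$i" for i using le[of "axis i 1"] by (simp add: inner_axis)
 have pre: "(%(s, t). pt s t) -` box l u \<inter> space (lborel \<Otimes>\<^sub>M lborel) = {l$1<..<u$1} \<times> {l$2<..<u$2}"
  by (auto simp: mem_box_cart forall_2 space_pair_measure)
 have [measurable]: "(%(s, t). pt s t)\<in>(lborel \<Otimes>\<^sub>M lborel) \<rightarrow>\<^sub>M borel" by measurable
 have "emeasure (distr (lborel \<Otimes>\<^sub>M lborel) borel (%(s, t). pt s t)) (box l u) =
   emeasure (lborel \<Otimes>\<^sub>M lborel) ({l$1<..<u$1} \<times> {l$2<..<u$2})"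
  by (simp add: emeasure_distr pre)
 also have "... = ennreal (u$1 - l$1)*ennreal (u$2 - l$2)"
  using lu[of 1] lu[of 2] by (simp add: lborel.emeasure_pair_measure_Times)
 also have "... = ennreal (\<Prod>b\<in>Basis. (u - l)\<bullet>b)"
  using lu[of 1] lu[of 2] by (simp add: prod_Basis_point inner_axis ennreal_mult)
 finally show "emeasure (distr (lborel \<Otimes>\<^sub>M lborel) borel (%(s, t). pt s t)) (box l u) = ennreal (\<Prod>b\<in>Basis. (u - l)\<bullet>b)" .
qed simp

lemma nn_integral_point:
 assumes [measurable]: "f\<in>borel_measurable borel"
 shows "(nn (%x. f x)) = (nn (%s. nn (%t. f (pt s t))))"
  "(nn (%x. f x)) = (nn (%t. nn (%s. f (pt s t))))"
proof -
 have [measurable]: "(%(s, t). pt s t)\<in>(lborel \<Otimes>\<^sub>M lborel) \<rightarrow>\<^sub>M borel" by measurable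
 have "(nn (%x. f x)) = (\<integral>\<^sup>+ z. f (case z of (s, t) => pt s t) \<partial>(lborel \<Otimes>\<^sub>M lborel))"
  by (subst lborel_point) (rule nn_integral_distr; measurable)
 also have "... = (\<integral>\<^sup>+ z. (case z of (s, t) => f (pt s t)) \<partial>(lborel \<Otimes>\<^sub>M lborel))"
  by (simp add: case_prod_beta')
 finally have *: "(nn (%x. f x)) = (\<integral>\<^sup>+ z. (case z of (s, t) => f (pt s t)) \<partial>(lborel \<Otimes>\<^sub>M lborel))" .
 show "(nn (%x. f x)) = (nn (%s. nn (%t. f (pt s t))))"
  unfolding * by (subst lborel.nn_integral_fst[symmetric]) auto
 show "(nn (%x. f x)) = (nn (%t. nn (%s. f (pt s t))))"
  unfolding * by (subst lborel_pair.nn_integral_snd[symmetric]) auto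
qed

text \<open>Nonnegativity of the variance; \<open>m\<close> is the mean of \<open>g\<close>.\<close>

lemma integral_square_le:
 fixes g :: "real => real"
 assumes "c <= d" "continuous_on {c..d} g"
 shows "(integral {c..d} g)^2 <= (d - c)*integral {c..d} (%x. (g x)^2)"
proof (cases "c = d")
 case False
 hence cd: "c < d" using assms by simp
 define m where "m = integral {c..d} g/(d - c)"
 have i: "g integrable_on {c..d}" "(%x. (g x)^2) integrable_on {c..d}"
  using assms by (auto intro!: integrable_continuous_real continuous_intros)
 have "0 <= integral {c..d} (%x. (g x - m)^2)"
  using assms by (intro integral_nonneg integrable_continuous_real continuous_intros) auto
 also have "(%x. (g x - m)^2) = (%x. (g x)^2 - 2*m*g x + m^2)"
  by (auto simp: power2_eq_square algebra_simps)
 also have "integral {c..d} ... = integral {c..d} (%x. (g x)^2) - 2*m*integral {c..d} g + (d - c)*m^2"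
 proof (rule integral_unique)
  have "((%x. (g x)^2 - 2*m*g x + m^2) has_integral
    (integral {c..d} (%x. (g x)^2) - 2*m*integral {c..d} g + measure lborel {c..d}*\<^sub>R m^2)) {c..d}"
   using i by (intro has_integral_add has_integral_diff has_integral_mult_right integrable_integral has_integral_const_real)
  thus "((%x. (g x)^2 - 2*m*g x + m^2) has_integral
    (integral {c..d} (%x. (g x)^2) - 2*m*integral {c..d} g + (d - c)*m^2)) {c..d}"
   using cd by simp
 qed
 finally have nn: "0 <= integral {c..d} (%x. (g x)^2) - 2*m*integral {c..d} g + (d - c)*m^2" .
 have I: "integral {c..d} g = m*(d - c)" using cd by (simp add: m_def)
 have "m^2*(d - c) <= integral {c..d} (%x. (g x)^2)"
  using nn unfolding I by (simp add: power2_eq_square algebra_simps)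
 hence "(d - c)*(m^2*(d - c)) <= (d - c)*integral {c..d} (%x. (g x)^2)"
  using cd by (intro mult_left_mono) auto
 thus ?thesis unfolding I by (simp add: power2_eq_square algebra_simps)
qed simp

lemma nn_integral_Icc:
 fixes h :: "real => real"
 assumes "continuous_on {c..d} h" "!!x. 0 <= h x"
 shows "(nn (%r. ennreal (h r)*indicator {c..d} r)) = ennreal (integral {c..d} h)"
 by (rule nn_integral_has_integral_lebesgue')
  (use assms in \<open>auto intro!: integrable_integral integrable_continuous_real\<close>)

text \<open>The increment is bounded by the integral of the absolute derivative over the whole
  interval, which no longer depends on the two points. The extended nonnegative reals allow the
  bound to be integrated directly.\<close>

lemma two_point_bound:
 fixes f f' :: "real => real"
 assumes f: "!!x. (f has_real_derivative f' x) (at x)" and cont: "continuous_on UNIV f'"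
  and st: "s\<in>{c..d}" "t\<in>{c..d}"
 shows "ennreal ((f t)^2) <= 2*ennreal ((f s)^2) +
  ennreal (2*(d - c))*(nn (%r. ennreal ((f' r)^2)*indicator {c..d} r))"
proof -
 have cS: "continuous_on S f'" for S using cont continuous_on_subset by blast
 have le: "\<bar>f b - f a\<bar> <= integral {c..d} (%x. \<bar>f' x\<bar>)" if "a <= b" "a\<in>{c..d}" "b\<in>{c..d}" for a b
 proof -
  have "(f' has_integral (f b - f a)) {a..b}"
   using that f by (intro fundamental_theorem_of_calculus)
    (auto simp: has_real_derivative_iff_has_vector_derivative[symmetric] intro: DERIV_subset)
  hence "f b - f a = integral {a..b} f'" by (rule integral_unique[symmetric])
  also have "\<bar>...\<bar> <= integral {a..b} (%x. \<bar>f' x\<bar>)"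
   using integral_norm_bound_integral[of f' "{a..b}" "%x. \<bar>f' x\<bar>"] cS
   by (auto intro!: integrable_continuous_real continuous_intros)
  also have "... <= integral {c..d} (%x. \<bar>f' x\<bar>)"
   using that cS by (intro integral_subset_le integrable_continuous_real continuous_intros) auto
  finally show ?thesis .
 qed
 have diff: "\<bar>f t - f s\<bar> <= integral {c..d} (%x. \<bar>f' x\<bar>)"
  using le[of s t] le[of t s] st by (cases "s <= t") (auto simp: abs_minus_commute)
 have "(f t)^2 <= 2*(f s)^2 + 2*(f t - f s)^2"
  using norm_add_sq_le[of "f s" "f t - f s"] by simp
 also have "(f t - f s)^2 <= (integral {c..d} (%x. \<bar>f' x\<bar>))^2"
  using diff by (simp add: abs_le_square_iff[symmetric])
 also have "... <= (d - c)*integral {c..d} (%x. (f' x)^2)"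
  using integral_square_le[of c d "%x. \<bar>f' x\<bar>"] st cS by (auto intro!: continuous_intros)
 finally have "(f t)^2 <= 2*(f s)^2 + 2*((d - c)*integral {c..d} (%x. (f' x)^2))" by simp
 hence "(f t)^2 <= 2*(f s)^2 + 2*(d - c)*integral {c..d} (%x. (f' x)^2)"
  by (simp only: mult.assoc)
 hence "ennreal ((f t)^2) <= ennreal (2*(f s)^2 + 2*(d - c)*integral {c..d} (%x. (f' x)^2))"
  by (rule ennreal_leI)
 also have "... = 2*ennreal ((f s)^2) + ennreal (2*(d - c))*ennreal (integral {c..d} (%x. (f' x)^2))"
 proof -
  have gen: "ennreal (2*a + D*I) = 2*ennreal a + ennreal D*ennreal I" if "0 <= a" "0 <= D" "0 <= I" for a D I
   using that by (simp add: ennreal_plus ennreal_mult)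
  show ?thesis
   by (rule gen) (use st cS in \<open>auto intro!: integral_nonneg integrable_continuous_real continuous_intros\<close>)
 qed
 also have "ennreal (integral {c..d} (%x. (f' x)^2)) = (nn (%r. ennreal ((f' r)^2)*indicator {c..d} r))"
  by (rule nn_integral_Icc[symmetric]) (auto intro!: continuous_intros cS)
 finally show ?thesis .
qed

lemma continuous_real2_measurable:
 fixes u :: "real => real => real"
 assumes "continuous_on UNIV (%(s, t). u s t)" "f\<in>borel_measurable M" "g\<in>borel_measurable M"
 shows "(%x. u (f x) (g x))\<in>borel_measurable M"
 using borel_measurable_continuous_on[OF assms(1), of "%x. (f x, g x)"] assms(2,3) by simp

text \<open>The zero set of \<open>u\<close> meets every vertical line over an interval of length comparable to the side
 of the square. This gives a Poincare inequality on the square without any further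
 information on the zero set.\<close>

lemma square_Poincare:
 fixes u us ut :: "real => real => real"
 assumes ds: "!!s t. ((%s. u s t) has_real_derivative us s t) (at s)"
  and dt: "!!s t. ((%t. u s t) has_real_derivative ut s t) (at t)"
  and cu: "continuous_on UNIV (%(s, t). u s t)" and cs: "continuous_on UNIV (%(s, t). us s t)"
  and ct: "continuous_on UNIV (%(s, t). ut s t)"
  and L: "L > 0" and J: "J = {p - L..p + L}" and J': "J' = {p' - L..p' + L}"
  and ab: "{a..b} \<subseteq> J" "b - a >= L/2"
  and zero: "!!s. s\<in>{a..b} ==> \<exists>t\<in>J'. u s t = 0"
 shows "(nn (%s. nn (%t. ennreal ((u s t)^2)*indicator J s*indicator J' t))) <=
  ennreal (64*L^2)*(nn (%s. nn (%t. ennreal ((us s t)^2 + (ut s t)^2)*indicator J s*indicator J' t)))"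
proof -
 note [measurable (raw)] = continuous_real2_measurable[OF cu] continuous_real2_measurable[OF cs] continuous_real2_measurable[OF ct]
 have [measurable]: "J\<in>sets borel" "J'\<in>sets borel" by (auto simp: J J')
 have cs1: "continuous_on UNIV (%s. us s t)" for t
  using continuous_on_compose2[OF cs, of UNIV "%s. (s, t)"]
  by (simp add: continuous_on_Pair continuous_on_id continuous_on_const)
 have ct1: "continuous_on UNIV (%t. ut s t)" for s
  using continuous_on_compose2[OF ct, of UNIV "%t. (s, t)"]
  by (simp add: continuous_on_Pair continuous_on_id continuous_on_const)
 define N where "N s = (nn (%t. ennreal ((ut s t)^2)*indicator J' t))" for s
 define M where "M t = (nn (%s. ennreal ((us s t)^2)*indicator J s))" for t
 define U where "U t = (nn (%s. ennreal ((u s t)^2)*indicator J s))" for t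
 have [measurable]: "N\<in>borel_measurable borel" "M\<in>borel_measurable borel" "U\<in>borel_measurable borel"
  unfolding N_def M_def U_def by measurable
 define W where "W = (nn (%t. U t*indicator J' t))"
 define NN where "NN = (nn (%s. N s*indicator J s))"
 define MM where "MM = (nn (%t. M t*indicator J' t))"
 have lenJ: "(nn (%s. indicator J s)) = ennreal (2*L)" "(nn (%s. indicator J' s)) = ennreal (2*L)"
  using L by (auto simp: J J')
 \<comment> \<open>On a line that meets the zero set, the derivative along that line alone controls
   the value.\<close>
 have A: "ennreal ((u s t)^2) <= ennreal (4*L)*N s" if s: "s\<in>{a..b}" and t: "t\<in>J'" for s t
 proof -
  obtain t0 where t0: "t0\<in>J'" "u s t0 = 0" using zero[OF s] by blast
  have "ennreal ((u s t)^2) <= 2*ennreal ((u s t0)^2) + ennreal (2*((p' + L) - (p' - L)))*N s"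
   unfolding N_def J' using t0(1) t unfolding J' by (intro two_point_bound[OF dt ct1])
  thus ?thesis using t0(2) by simp
 qed
 have A': "(nn (%t. ennreal ((u s t)^2)*indicator J' t)) <= ennreal (8*L^2)*N s" if s: "s\<in>{a..b}" for s
 proof -
  have "(nn (%t. ennreal ((u s t)^2)*indicator J' t)) <= (nn (%t. ennreal (4*L)*N s*indicator J' t))"
   using A[OF s] by (intro nn_integral_mono) (auto simp: indicator_def)
  also have "... = ennreal (4*L)*N s*ennreal (2*L)"
   by (subst nn_integral_cmult) (auto simp: lenJ)
  also have "... = ennreal (4*L)*ennreal (2*L)*N s" by (simp add: mult.commute mult.left_commute)
  also have "ennreal (4*L)*ennreal (2*L) = ennreal (8*L^2)"
   using L by (simp add: ennreal_mult[symmetric] power2_eq_square)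
  finally show ?thesis .
 qed
 \<comment> \<open>From the one line at \<open>s'\<close> to all others, moving in the other
   direction.\<close>
 have Bd: "U t <= ennreal (4*L)*ennreal ((u s' t)^2) + ennreal (8*L^2)*M t" if s': "s'\<in>J" for s' t
 proof -
  have "U t <= (nn (%s. (2*ennreal ((u s' t)^2) + ennreal (4*L)*M t)*indicator J s))"
   unfolding U_def
  proof (rule nn_integral_mono)
   fix s
   have "ennreal ((u s t)^2) <= 2*ennreal ((u s' t)^2) + ennreal (2*((p + L) - (p - L)))*M t" if "s\<in>J"
    unfolding M_def J using s' that unfolding J by (intro two_point_bound[OF ds cs1])
   thus "ennreal ((u s t)^2)*indicator J s <= (2*ennreal ((u s' t)^2) + ennreal (4*L)*M t)*indicator J s"
    by (auto simp: indicator_def)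
  qed
  also have "... = (2*ennreal ((u s' t)^2) + ennreal (4*L)*M t)*ennreal (2*L)"
   by (subst nn_integral_cmult) (auto simp: lenJ)
  also have "... = (2*ennreal (2*L))*ennreal ((u s' t)^2) + (ennreal (4*L)*ennreal (2*L))*M t"
   by (simp add: distrib_right distrib_left mult_ac)
  also have "2*ennreal (2*L) = ennreal (4*L)"
   using L by (simp add: ennreal_mult[symmetric] flip: ennreal_numeral)
  also have "ennreal (4*L)*ennreal (2*L) = ennreal (8*L^2)"
   using L by (simp add: ennreal_mult[symmetric] power2_eq_square)
  finally show ?thesis .
 qed
 have Cd: "W <= ennreal (32*L^3)*N s' + ennreal (8*L^2)*MM" if s': "s'\<in>{a..b}" for s'
 proof -
  have s'J: "s'\<in>J" using s' ab by auto
  have "W <= (nn (%t. ennreal (4*L)*(ennreal ((u s' t)^2)*indicator J' t) + ennreal (8*L^2)*(M t*indicator J' t)))"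
   unfolding W_def using Bd[OF s'J] by (intro nn_integral_mono) (auto simp: indicator_def)
  also have "... = ennreal (4*L)*(nn (%t. ennreal ((u s' t)^2)*indicator J' t)) + ennreal (8*L^2)*MM"
   unfolding MM_def by (subst nn_integral_add) (auto simp: nn_integral_cmult)
  also have "... <= ennreal (4*L)*(ennreal (8*L^2)*N s') + ennreal (8*L^2)*MM"
   by (intro add_right_mono mult_left_mono A'[OF s']) simp
  also have "ennreal (4*L)*(ennreal (8*L^2)*N s') = ennreal (32*L^3)*N s'"
   using L by (simp add: mult.assoc[symmetric] ennreal_mult[symmetric] power2_eq_square power3_eq_cube)
  finally show ?thesis .
 qed
 \<comment> \<open>The bound is averaged over all \<open>s'\<close> in \<open>{a..b}\<close>. The
   left side gains the length \<open>b - a >= L/2\<close>, and dividing by \<open>L/2\<close> turns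
   32 into 64.\<close>
 have "ennreal (L/2)*W <= ennreal (b - a)*W"
  using ab by (intro mult_right_mono ennreal_leI) auto
 also have "... = (nn (%s. W*indicator {a..b} s))"
  using ab L by (subst nn_integral_cmult) (auto simp: mult.commute)
 also have "... <= (nn (%s. ennreal (32*L^3)*(N s*indicator J s) + ennreal (8*L^2)*MM*indicator J s))"
 proof (rule nn_integral_mono)
  fix s show "W*indicator {a..b} s <= ennreal (32*L^3)*(N s*indicator J s) + ennreal (8*L^2)*MM*indicator J s"
   using Cd[of s] ab(1) by (auto simp: indicator_def)
 qed
 also have "... = ennreal (32*L^3)*NN + ennreal (8*L^2)*MM*ennreal (2*L)"
  unfolding NN_def by (subst nn_integral_add) (auto simp: nn_integral_cmult lenJ)
 also have "ennreal (8*L^2)*MM*ennreal (2*L) = ennreal (16*L^3)*MM"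
 proof -
  have "ennreal (8*L^2)*MM*ennreal (2*L) = ennreal (8*L^2)*ennreal (2*L)*MM"
   by (simp add: mult.commute mult.left_commute)
  also have "ennreal (8*L^2)*ennreal (2*L) = ennreal (16*L^3)"
   using L by (simp add: ennreal_mult[symmetric] power2_eq_square power3_eq_cube)
  finally show ?thesis .
 qed
 also have "ennreal (32*L^3)*NN + ennreal (16*L^3)*MM <= ennreal (32*L^3)*(MM + NN)"
  using L by (simp add: distrib_left add.commute add_mono mult_right_mono ennreal_leI)
 finally have main: "ennreal (L/2)*W <= ennreal (32*L^3)*(MM + NN)" .
 have "W = ennreal (2/L)*(ennreal (L/2)*W)"
  using L by (simp add: mult.assoc[symmetric] ennreal_mult[symmetric])
 also have "... <= ennreal (2/L)*(ennreal (32*L^3)*(MM + NN))"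
  by (intro mult_left_mono main) simp
 also have "... = ennreal (64*L^2)*(MM + NN)"
  using L by (simp add: mult.assoc[symmetric] ennreal_mult[symmetric] power2_eq_square power3_eq_cube)
 finally have fin: "W <= ennreal (64*L^2)*(MM + NN)" .
 have Weq: "(nn (%s. nn (%t. ennreal ((u s t)^2)*indicator J s*indicator J' t))) = W"
 proof -
  have "(nn (%s. nn (%t. ennreal ((u s t)^2)*indicator J s*indicator J' t))) =
   (nn (%t. nn (%s. ennreal ((u s t)^2)*indicator J s*indicator J' t)))"
   by (rule lborel_pair.Fubini') measurable
  also have "... = W" unfolding W_def U_def by (simp add: nn_integral_multc)
  finally show ?thesis .
 qed
 have "(nn (%s. nn (%t. ennreal ((us s t)^2 + (ut s t)^2)*indicator J s*indicator J' t))) =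
  (nn (%s. (nn (%t. ennreal ((us s t)^2)*indicator J s*indicator J' t)) + N s*indicator J s))"
  unfolding N_def
  by (intro nn_integral_cong, subst nn_integral_multc[symmetric], measurable, subst nn_integral_add[symmetric])
   (auto simp: distrib_right distrib_left mult_ac intro!: nn_integral_cong)
 also have "... = (nn (%s. nn (%t. ennreal ((us s t)^2)*indicator J s*indicator J' t))) + NN"
  unfolding NN_def by (rule nn_integral_add) measurable
 also have "(nn (%s. nn (%t. ennreal ((us s t)^2)*indicator J s*indicator J' t))) = 
  (nn (%t. nn (%s. ennreal ((us s t)^2)*indicator J s*indicator J' t)))"
  by (rule lborel_pair.Fubini') measurable
 also have "... = MM" unfolding MM_def M_def by (simp add: nn_integral_multc)
 finally show ?thesis using fin Weq by simp
qed

subsection \<open>Mollification\<close>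

lemma bsmooth_continuous: "bsmooth F ==> continuous_on S F"
 by (meson DERIV_isCont bsmoothE continuous_at_imp_continuous_on)

lemma bsmooth_measurable: "bsmooth F ==> F\<in>borel_measurable borel"
 by (intro borel_measurable_continuous_onI bsmooth_continuous)

lemma bsmooth_Lipschitz:
 assumes "bsmooth F"
 obtains C where "C > 0" "!!s h. \<bar>F (s + h) - F s\<bar> <= C*\<bar>h\<bar>"
proof -
 obtain F' where F': "!!x. (F has_real_derivative F' x) (at x)" "bsmooth F'" using bsmoothE[OF assms] by blast
 obtain C where C: "C > 0" "!!x. \<bar>F' x\<bar> <= C" using bsmooth_bound[OF F'(2)] by blast
 have "norm (F (s + h) - F s) <= C*norm (s + h - s)" for s h
  by (rule field_differentiable_bound[of UNIV F F']) (use F' C in auto)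
 thus thesis using that[of C] C by simp
qed

lemma bsmooth_Taylor:
 assumes "bsmooth F" "!!x. (F has_real_derivative F' x) (at x)" "bsmooth F'"
 obtains C where "C > 0" "!!s h. \<bar>F (s + h) - F s - h*F' s\<bar> <= C*h^2"
proof -
 obtain C where C: "C > 0" "!!s h. \<bar>F' (s + h) - F' s\<bar> <= C*\<bar>h\<bar>" using bsmooth_Lipschitz[OF assms(3)] by blast
 have "\<bar>F (s + h) - F s - h*F' s\<bar> <= C*h^2" for s h
 proof -
  define g where "g r = F (s + r) - r*F' s" for r
  have "(g has_real_derivative (F' (s + r) - F' s)) (at r within closed_segment 0 h)" for r
   unfolding g_def
   by (rule DERIV_subset[OF _ subset_UNIV])
    (auto intro!: derivative_eq_intros DERIV_chain2[OF assms(2), of "%r. s + r" 1, simplified])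
  moreover have "norm (F' (s + r) - F' s) <= C*\<bar>h\<bar>" if "r\<in>closed_segment 0 h" for r
  proof -
   have "\<bar>r\<bar> <= \<bar>h\<bar>" using that by (auto simp: closed_segment_eq_real_ivl split: if_splits)
   hence "C*\<bar>r\<bar> <= C*\<bar>h\<bar>" using C(1) by simp
   thus ?thesis using C(2)[of s r] by simp
  qed
  ultimately have "norm (g h - g 0) <= C*\<bar>h\<bar>*norm (h - 0)"
   by (intro field_differentiable_bound[of "closed_segment 0 h" g "%r. F' (s + r) - F' s"]) auto
  thus ?thesis by (simp add: g_def power2_eq_square algebra_simps)
 qed
 thus thesis using that C(1) by blast
qed

lemma has_derivative_quadratic_remainder:
 fixes f :: "'a::real_normed_vector => real"
 assumes D: "bounded_linear D" and R: "!!h. \<bar>f (x + h) - f x - D h\<bar> <= C*(norm h)^2"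
 shows "(f has_derivative D) (at x)"
 unfolding has_derivative_at
proof (rule conjI[OF D], rule Lim_null_comparison)
 have "norm (norm (f (x + h) - f x - D h)/norm h) <= C*norm h" if "h ~= 0" for h
  using R[of h] that by (simp add: divide_le_eq power2_eq_square mult.assoc)
 thus "\<forall>\<^sub>F h in at 0. norm (norm (f (x + h) - f x - D h)/norm h) <= C*norm h"
  unfolding eventually_at_filter by (intro always_eventually allI impI)
 show "((%h. C*norm h) \<longlongrightarrow> 0) (at 0)"
  by (rule tendsto_mult_right_zero[OF tendsto_norm_zero[OF tendsto_ident_at]])
qed

lemma LINT_abs_bound:
 fixes f g :: "'a => real"
 assumes "integrable M f" "integrable M g" "!!x. \<bar>f x\<bar> <= g x"
 shows "\<bar>LINT x|M. f x\<bar> <= (LINT x|M. g x)"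
proof -
 have "\<bar>LINT x|M. f x\<bar> <= (LINT x|M. \<bar>f x\<bar>)" by (rule integral_abs_bound)
 also have "... <= (LINT x|M. g x)" using assms by (intro integral_mono) auto
 finally show ?thesis .
qed

lemma test_function_zero: "test_function E f ==> x \<notin> E ==> f x = 0"
 by (erule test_functionE) blast

text \<open>The two kernel factors are independent parameters: differentiation replaces one factor
  by its derivative and stays in the family, and a step as first factor gives a primitive of the
  mollification.\<close>

definition conv :: "(real => real) => (real => real) => scalar_field => scalar_field" where
 "conv F G u x = (LINT y|lborel. F (x$1 - y$1)*G (x$2 - y$2)*u y)"

lemma borel_measurable_component [measurable]: "(%x::point. x$i)\<in>borel_measurable borel"
 by (intro borel_measurable_continuous_onI continuous_intros)

lemma conv_integrable:
 fixes x :: point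
 assumes F: "bsmooth F" and G: "bsmooth G" and u: "integrable lborel u"
 shows "integrable lborel (%y. F (x$1 - y$1)*G (x$2 - y$2)*u y)"
proof -
 obtain A where A: "A > 0" "!!s. \<bar>F s\<bar> <= A" using bsmooth_bound[OF F] by blast
 obtain B where B: "B > 0" "!!s. \<bar>G s\<bar> <= B" using bsmooth_bound[OF G] by blast
 note [measurable] = bsmooth_measurable[OF F] bsmooth_measurable[OF G] borel_measurable_integrable[OF u]
 show ?thesis
 proof (rule Bochner_Integration.integrable_bound)
  show "integrable lborel (%y. A*B*u y)" using u by simp
  show "AE y in lborel. norm (F (x$1 - y$1)*G (x$2 - y$2)*u y) <= norm (A*B*u y)"
   using A B by (intro AE_I2) (simp add: abs_mult mult_mono mult_right_mono)
 qed measurable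
qed

lemma has_derivative_conv:
 assumes F: "bsmooth F" "!!x. (F has_real_derivative F' x) (at x)" "bsmooth F'"
  and G: "bsmooth G" "!!x. (G has_real_derivative G' x) (at x)" "bsmooth G'"
  and u: "integrable lborel u"
 shows "(conv F G u has_derivative (%h. conv F' G u x*h$1 + conv F G' u x*h$2)) (at x)"
proof -
 obtain C1 where C1: "C1 > 0" "!!s h. \<bar>F (s + h) - F s - h*F' s\<bar> <= C1*h^2" using bsmooth_Taylor[OF F] by blast
 obtain C2 where C2: "C2 > 0" "!!s h. \<bar>G (s + h) - G s - h*G' s\<bar> <= C2*h^2" using bsmooth_Taylor[OF G] by blast
 obtain C3 where C3: "C3 > 0" "!!s h. \<bar>G (s + h) - G s\<bar> <= C3*\<bar>h\<bar>" using bsmooth_Lipschitz[OF G(1)] by blast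
 obtain A where A: "A > 0" "!!s. \<bar>F s\<bar> <= A" using bsmooth_bound[OF F(1)] by blast
 obtain A' where A': "A' > 0" "!!s. \<bar>F' s\<bar> <= A'" using bsmooth_bound[OF F(3)] by blast
 obtain B where B: "B > 0" "!!s. \<bar>G s\<bar> <= B" using bsmooth_bound[OF G(1)] by blast
 define C where "C = C1*B + A*C2 + A'*C3"
 have rem: "\<bar>F (a + h$1)*G (b + h$2) - F a*G b - (F' a*G b*h$1 + F a*G' b*h$2)\<bar> <= C*(norm h)^2"
  for a b and h :: point
 proof -
  have h12: "\<bar>h$1\<bar> <= norm h" "\<bar>h$2\<bar> <= norm h" using component_le_norm_cart by auto
  have sq: "(h$1)^2 <= (norm h)^2" "(h$2)^2 <= (norm h)^2" "\<bar>h$1\<bar>*\<bar>h$2\<bar> <= (norm h)^2"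
   using power_mono[OF h12(1), of 2] power_mono[OF h12(2), of 2] mult_mono[OF h12]
   by (simp_all add: power2_eq_square)
  \<comment> \<open>The product rule with remainders: two Taylor remainders and a product of two
    first-order increments, each quadratic in \<open>h\<close>.\<close>
  have e: "F (a + h$1)*G (b + h$2) - F a*G b - (F' a*G b*h$1 + F a*G' b*h$2) =
   (F (a + h$1) - F a - h$1*F' a)*G (b + h$2) + F a*(G (b + h$2) - G b - h$2*G' b)
   + h$1*F' a*(G (b + h$2) - G b)" by (simp add: algebra_simps)
  have "\<bar>(F (a + h$1) - F a - h$1*F' a)*G (b + h$2)\<bar> <= (C1*(norm h)^2)*B"
   unfolding abs_mult using C1(1) B by (intro mult_mono order_trans[OF C1(2)] mult_left_mono sq) auto
  moreover have "\<bar>F a*(G (b + h$2) - G b - h$2*G' b)\<bar> <= A*(C2*(norm h)^2)"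
   unfolding abs_mult using C2(1) A by (intro mult_mono order_trans[OF C2(2)] mult_left_mono sq) auto
  moreover have "\<bar>h$1*F' a*(G (b + h$2) - G b)\<bar> <= A'*C3*(norm h)^2"
  proof -
   have "\<bar>h$1*F' a*(G (b + h$2) - G b)\<bar> <= (\<bar>h$1\<bar>*A')*(C3*\<bar>h$2\<bar>)"
    unfolding abs_mult using A' C3 by (intro mult_mono) auto
   also have "... = A'*C3*(\<bar>h$1\<bar>*\<bar>h$2\<bar>)" by simp
   also have "... <= A'*C3*(norm h)^2" using A' C3 by (intro mult_left_mono sq) auto
   finally show ?thesis .
  qed
  ultimately have "\<bar>F (a + h$1)*G (b + h$2) - F a*G b - (F' a*G b*h$1 + F a*G' b*h$2)\<bar> <=
   (C1*(norm h)^2)*B + A*(C2*(norm h)^2) + A'*C3*(norm h)^2"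
   unfolding e by (intro order_trans[OF abs_triangle_ineq] add_mono)
  also have "... = C*(norm h)^2" by (simp add: C_def algebra_simps)
  finally show ?thesis .
 qed
 show ?thesis
 proof (rule has_derivative_quadratic_remainder)
  show "bounded_linear (%h. conv F' G u x*h$1 + conv F G' u x*h$2)"
   by (intro bounded_linear_add bounded_linear_const_mult bounded_linear_vec_nth)
  fix h :: point
  note i = conv_integrable[OF F(1) G(1) u] conv_integrable[OF F(3) G(1) u] conv_integrable[OF F(1) G(3) u]
  define r where "r y = F ((x$1 - y$1) + h$1)*G ((x$2 - y$2) + h$2) - F (x$1 - y$1)*G (x$2 - y$2) -
     (F' (x$1 - y$1)*G (x$2 - y$2)*h$1 + F (x$1 - y$1)*G' (x$2 - y$2)*h$2)" for y :: point
  have ru: "r y*u y = F ((x + h)$1 - y$1)*G ((x + h)$2 - y$2)*u y - F (x$1 - y$1)*G (x$2 - y$2)*u y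
    - (F' (x$1 - y$1)*G (x$2 - y$2)*u y*h$1 + F (x$1 - y$1)*G' (x$2 - y$2)*u y*h$2)" for y
   by (simp add: r_def algebra_simps)
  have int: "integrable lborel (%y. r y*u y)"
   unfolding ru using i by (intro Bochner_Integration.integrable_diff Bochner_Integration.integrable_add integrable_mult_left)
  have eq: "conv F G u (x + h) - conv F G u x - (conv F' G u x*h$1 + conv F G' u x*h$2) = (LINT y|lborel. r y*u y)"
   unfolding ru conv_def using i[of "x + h"] i[of x] by simp
  have "\<bar>LINT y|lborel. r y*u y\<bar> <= (LINT y|lborel. C*(norm h)^2*\<bar>u y\<bar>)"
  proof (rule LINT_abs_bound[OF int])
   show "integrable lborel (%y. C*(norm h)^2*\<bar>u y\<bar>)" using u by simp
   show "\<bar>r y*u y\<bar> <= C*(norm h)^2*\<bar>u y\<bar>" for y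
    unfolding abs_mult r_def by (intro mult_right_mono rem) simp
  qed
  also have "... = C*(norm h)^2*(LINT y|lborel. \<bar>u y\<bar>)" by (rule integral_mult_right_zero)
  also have "... = (C*(LINT y|lborel. \<bar>u y\<bar>))*(norm h)^2" by (simp only: mult_ac)
  finally show "\<bar>conv F G u (x + h) - conv F G u x - (conv F' G u x*h$1 + conv F G' u x*h$2)\<bar>
   <= (C*(LINT y|lborel. \<bar>u y\<bar>))*(norm h)^2" unfolding eq .
 qed
qed

lemma pd_conv:
 assumes "bsmooth F" "!!x. (F has_real_derivative F' x) (at x)" "bsmooth F'"
  "bsmooth G" "!!x. (G has_real_derivative G' x) (at x)" "bsmooth G'" "integrable lborel u"
 shows "pd 1 (conv F G u) = conv F' G u" "pd 2 (conv F G u) = conv F G' u"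
 using pd_eq[OF has_derivative_conv[OF assms]] by (auto simp: axis_def fun_eq_iff)

lemma smooth_conv:
 assumes u: "integrable lborel u" and "bsmooth F" "bsmooth G"
 shows "smooth (conv F G u)"
proof (rule smooth_coinduct[where X = "{conv F G u | F G. bsmooth F & bsmooth G}"])
 show "conv F G u\<in>{conv F G u | F G. bsmooth F & bsmooth G}" using assms by auto
 fix q assume "q\<in>{conv F G u | F G. bsmooth F & bsmooth G}"
 then obtain F G where q: "q = conv F G u" "bsmooth F" "bsmooth G" by auto
 obtain F' where F': "!!t. (F has_real_derivative F' t) (at t)" "bsmooth F'" using bsmoothE[OF q(2)] by blast
 obtain G' where G': "!!t. (G has_real_derivative G' t) (at t)" "bsmooth G'" using bsmoothE[OF q(3)] by blast
 note a = q(2) F' q(3) G' u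
 show "q differentiable (at x)" for x
  using has_derivative_conv[OF a] q by (auto simp: differentiable_def)
 show "pd i q\<in>{conv F G u | F G. bsmooth F & bsmooth G}" for i
  using exhaust_2[of i] pd_conv[OF a] F' G' q by auto
qed

lemma conv_diff:
 assumes "bsmooth F" "bsmooth G" "integrable lborel u" "integrable lborel v"
 shows "conv F G (u - v) = conv F G u - conv F G v"
 using conv_integrable[OF assms(1,2,3)] conv_integrable[OF assms(1,2,4)]
 by (auto simp: conv_def right_diff_distrib)

text \<open>A one-sided kernel supported in \<open>[0, e]\<close>, so that its primitive
  \<open>stp\<close> vanishes on the negative half-line; this later makes the potential vanish to
  the left of the domain. The summand 0 matches the pattern \<open>a*x + b\<close> of the affine
  rules.\<close>

definition mol :: "real => real => real" where "mol e t = (1/e) * smooth_bump ((1/e)*t + 0)"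
definition stp :: "real => real => real" where "stp e t = smooth_step ((1/e)*t + 0)"

lemma bsmooth_mol: "bsmooth (mol e)" "bsmooth (stp e)"
 unfolding mol_def stp_def by (intro bsmooth_mult bsmooth_const bsmooth_affine bsmooth_step bsmooth_bump)+

lemma DERIV_stp: "(stp e has_real_derivative mol e t) (at t)"
proof -
 have "((%t. (1/e)*t + 0) has_real_derivative (1/e)*1 + 0) (at t)"
  by (intro DERIV_add DERIV_cmult DERIV_ident DERIV_const)
 from DERIV_chain2[OF DERIV_smooth_step this] show ?thesis
  by (simp add: mol_def stp_def[abs_def] mult.commute)
qed

lemma mol_nonneg: "e > 0 ==> 0 <= mol e t"
 by (simp add: mol_def smooth_bump_nonneg)

lemma mol_0: "e > 0 ==> t <= 0 \<or> e <= t ==> mol e t = 0"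
 by (auto simp: mol_def smooth_bump_0 divide_nonpos_pos)

lemma stp_0: "e > 0 ==> t <= 0 ==> stp e t = 0"
 by (simp add: stp_def smooth_step_0 divide_nonpos_pos)

lemma stp_1: "e > 0 ==> t >= e ==> stp e t = 1"
 by (simp add: stp_def smooth_step_1)

lemma nn_integral_mol:
 assumes e: "e > 0"
 shows "(nn (%s. ennreal (mol e (a - s)))) = 1" "(nn (%s. ennreal (mol e (s - a)))) = 1"
proof -
 have gen: "(nn (%s. ennreal (f s))) = 1"
  if D: "!!s. (F has_real_derivative f s) (at s)" and c: "continuous_on UNIV f" and nn: "!!s. 0 <= f s"
   and z: "!!s. s \<notin> {c..d} ==> f s = 0" and F: "F d - F c = 1" "c <= d" for F f :: "real => real" and c d
 proof -
  have "(f has_integral (F d - F c)) {c..d}"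
   using D F by (intro fundamental_theorem_of_calculus)
    (auto simp: has_real_derivative_iff_has_vector_derivative[symmetric] intro: DERIV_subset)
  hence "(nn (%s. ennreal (f s)*indicator {c..d} s)) = ennreal 1"
   unfolding F(1) by (intro nn_integral_has_integral_lebesgue') (auto simp: nn)
  moreover have "ennreal (f s)*indicator {c..d} s = ennreal (f s)" for s
   using z[of s] by (auto simp: indicator_def)
  ultimately show ?thesis by simp
 qed
 have cm: "continuous_on UNIV (%s. mol e (f s))" if "continuous_on UNIV f" for f :: "real => real"
  using continuous_on_compose2[OF bsmooth_continuous[OF bsmooth_mol(1)] that, of UNIV] by simp
 show "(nn (%s. ennreal (mol e (a - s)))) = 1"
 proof (rule gen[of "%s. - stp e (a - s)" _ "a - e" a])
  show "((%s. - stp e (a - s)) has_real_derivative mol e (a - s)) (at s)" for s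
  proof -
   have "((%s. a - s) has_real_derivative - 1) (at s)" by (auto intro!: derivative_eq_intros)
   from DERIV_minus[OF DERIV_chain2[OF DERIV_stp this]] show ?thesis by simp
  qed
 qed (use e in \<open>auto simp: mol_nonneg mol_0 stp_0 stp_1 intro!: cm continuous_intros\<close>)
 show "(nn (%s. ennreal (mol e (s - a)))) = 1"
 proof (rule gen[of "%s. stp e (s - a)" _ a "a + e"])
  show "((%s. stp e (s - a)) has_real_derivative mol e (s - a)) (at s)" for s
  proof -
   have "((%s. s - a) has_real_derivative 1) (at s)" by (auto intro!: derivative_eq_intros)
   from DERIV_chain2[OF DERIV_stp this] show ?thesis by simp
  qed
 qed (use e in \<open>auto simp: mol_nonneg mol_0 stp_0 stp_1 intro!: cm continuous_intros\<close>)
qed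

definition kern :: "real => point => point => real" where
 "kern e x y = mol e (x$1 - y$1)*mol e (x$2 - y$2)"

abbreviation mollify :: "real => scalar_field => scalar_field" where
 "mollify e u \<equiv> conv (mol e) (mol e) u"

lemma mollify_eq: "mollify e u x = (LINT y|lborel. kern e x y*u y)"
 by (simp add: conv_def kern_def)

lemma mol_measurable [measurable]: "mol e\<in>borel_measurable borel" "stp e\<in>borel_measurable borel"
 by (intro bsmooth_measurable bsmooth_mol)+

lemma kern_measurable [measurable (raw)]:
 assumes [measurable]: "f\<in>borel_measurable M" "g\<in>borel_measurable M"
 shows "(%x. kern e (f x) (g x))\<in>borel_measurable M"
 unfolding kern_def by measurable

lemma kern_nonneg: "e > 0 ==> 0 <= kern e x y"
 by (simp add: kern_def mol_nonneg)

lemma kern_0: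
 assumes e: "e > 0" and "kern e x y ~= 0"
 shows "dist x y <= 2*e"
proof -
 have "mol e (x$i - y$i) ~= 0" for i
  using assms(2) exhaust_2[of i] by (auto simp: kern_def)
 hence *: "0 < x$i - y$i & x$i - y$i < e" for i using mol_0[OF e] not_le by blast
 have "\<bar>x$i - y$i\<bar> <= e" for i using *[of i] by linarith
 hence "\<bar>(x - y)$i\<bar> <= e" for i by simp
 hence "norm (x - y) <= (\<Sum>i\<in>(UNIV::2 set). e)"
  by (intro order_trans[OF norm_le_l1_cart] sum_mono)
 thus ?thesis by (simp add: dist_norm)
qed

lemma nn_integral_kern:
 assumes "e > 0"
 shows "(nn (%y. ennreal (kern e x y))) = 1" "(nn (%x. ennreal (kern e x y))) = 1"
proof -
 have *: "ennreal (kern e (pt a b) (pt s t)) = ennreal (mol e (a - s))*ennreal (mol e (b - t))" for a b s t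
  by (simp add: kern_def ennreal_mult mol_nonneg assms)
 have "(nn (%y. ennreal (kern e (pt a b) y))) = 1" for a b
  by (subst nn_integral_point(1)) (simp_all add: * nn_integral_cmult nn_integral_mol assms)
 thus "(nn (%y. ennreal (kern e x y))) = 1" using pt_components by metis
 have "(nn (%x. ennreal (kern e x (pt a b)))) = 1" for a b
  by (subst nn_integral_point(1)) (simp_all add: * nn_integral_cmult nn_integral_mol assms)
 thus "(nn (%x. ennreal (kern e x y))) = 1" using pt_components by metis
qed

lemma integral_kern:
 assumes "e > 0"
 shows "integrable lborel (%y. kern e x y)" "(LINT y|lborel. kern e x y) = 1"
proof -
 show i: "integrable lborel (%y. kern e x y)"
  by (rule integrableI_nonneg) (auto simp: kern_nonneg assms nn_integral_kern)
 thus "(LINT y|lborel. kern e x y) = 1"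
  using nn_integral_eq_integral[OF i] nn_integral_kern[OF assms] kern_nonneg[OF assms]
  by (simp flip: ennreal_1 add: ennreal_inj Bochner_Integration.integral_nonneg del: ennreal_1)
qed

lemma mollify_integrable:
 "integrable lborel u ==> integrable lborel (%y. kern e x y*u y)"
 using conv_integrable[OF bsmooth_mol(1) bsmooth_mol(1), of u e x e] by (simp add: kern_def)

text \<open>For fixed \<open>x\<close> the kernel is a probability density, so the square of the
  average is at most the average of the square. Integrating in \<open>x\<close>, in which the kernel
  also has mass 1, removes it.\<close>

lemma mollify_L2:
 assumes e: "e > 0" and u: "integrable lborel u" and u2: "integrable lborel (%x. (u x)^2)"
 shows "(nn (%x. ennreal ((mollify e u x)^2))) <= (nn (%y. ennreal ((u y)^2)))"
proof -
 note [measurable] = borel_measurable_integrable[OF u]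
 have ptw: "ennreal ((mollify e u x)^2) <= (nn (%y. ennreal (kern e x y*(u y)^2)))" for x
 proof -
  define m where "m = mollify e u x"
  have i: "integrable lborel (%y. kern e x y*(u y)^2)" "integrable lborel (%y. kern e x y*u y)" "integrable lborel (%y. kern e x y)"
   using mollify_integrable[OF u2] mollify_integrable[OF u] integral_kern[OF e] by auto
  have "0 <= (LINT y|lborel. kern e x y*(u y - m)^2)"
   by (intro Bochner_Integration.integral_nonneg) (simp add: kern_nonneg e)
  also have "... = (LINT y|lborel. kern e x y*(u y)^2 - 2*m*(kern e x y*u y) + m^2*kern e x y)"
   by (rule Bochner_Integration.integral_cong) (auto simp: power2_eq_square algebra_simps)
  also have "... = (LINT y|lborel. kern e x y*(u y)^2) - 2*m*m + m^2*1"
   using i integral_kern[OF e] by (simp add: m_def mollify_eq)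
  finally have "m^2 <= (LINT y|lborel. kern e x y*(u y)^2)"
   by (simp add: power2_eq_square)
  hence "ennreal (m^2) <= ennreal (LINT y|lborel. kern e x y*(u y)^2)" by (rule ennreal_leI)
  also have "... = (nn (%y. ennreal (kern e x y*(u y)^2)))"
   using i(1) by (intro nn_integral_eq_integral[symmetric]) (auto simp: kern_nonneg e)
  finally show ?thesis by (simp add: m_def)
 qed
 have "(nn (%x. ennreal ((mollify e u x)^2))) <= (nn (%x. nn (%y. ennreal (kern e x y*(u y)^2))))"
  by (intro nn_integral_mono ptw)
 also have "... = (nn (%y. nn (%x. ennreal (kern e x y*(u y)^2))))"
  by (rule lborel_pair.Fubini') measurable
 also have "... = (nn (%y. ennreal ((u y)^2)))"
  by (intro nn_integral_cong) (simp add: ennreal_mult kern_nonneg e nn_integral_multc nn_integral_kern)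
 finally show ?thesis .
qed

lemma nn_integral_lebesgue_on_lborel:
 fixes v :: scalar_field
 assumes "Z\<in>sets lebesgue" "v\<in>borel_measurable borel"
 shows "(\<integral>\<^sup>+ x. ennreal ((norm (v x))^2) \<partial>lebesgue_on Z) <= (nn (%x. ennreal ((v x)^2)))"
  "(!!x. x \<notin> Z ==> v x = 0) ==> (\<integral>\<^sup>+ x. ennreal ((norm (v x))^2) \<partial>lebesgue_on Z) = (nn (%x. ennreal ((v x)^2)))"
proof -
 have *: "(\<integral>\<^sup>+ x. ennreal ((norm (v x))^2) \<partial>lebesgue_on Z) = (\<integral>\<^sup>+ x. ennreal ((v x)^2)*indicator Z x \<partial>lebesgue)"
  using assms(1) by (subst nn_integral_restrict_space) auto
 have **: "(\<integral>\<^sup>+ x. ennreal ((v x)^2) \<partial>lebesgue) = (nn (%x. ennreal ((v x)^2)))"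
  by (rule nn_integral_completion)
 show "(\<integral>\<^sup>+ x. ennreal ((norm (v x))^2) \<partial>lebesgue_on Z) <= (nn (%x. ennreal ((v x)^2)))"
  unfolding * **[symmetric] by (intro nn_integral_mono) (auto simp: indicator_def)
 show "(\<integral>\<^sup>+ x. ennreal ((norm (v x))^2) \<partial>lebesgue_on Z) = (nn (%x. ennreal ((v x)^2)))" if "!!x. x \<notin> Z ==> v x = 0"
  unfolding * **[symmetric] using that by (intro nn_integral_cong) (auto simp: indicator_def)
qed

context
 fixes Z :: "point set"
 assumes Z: "open Z" "bounded Z"
begin

lemma L2_integrable_lborel:
 fixes u :: scalar_field
 assumes u: "u\<in>L2_space Z" "u\<in>borel_measurable borel" "!!x. x \<notin> Z ==> u x = 0"
 shows "integrable lborel u" "integrable lborel (%x. (u x)^2)"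
  "(nn (%x. ennreal ((u x)^2))) = ennreal ((l2_norm Z u)^2)"
proof -
 note [measurable] = u(2)
 have Zl: "Z\<in>sets lebesgue" by (rule sets_lebesgue_open[OF Z(1)])
 show nn: "(nn (%x. ennreal ((u x)^2))) = ennreal ((l2_norm Z u)^2)"
  using nn_integral_lebesgue_on_lborel(2)[OF Zl u(2,3)] nn_integral_L2[OF u(1)] by simp
 show "integrable lborel (%x. (u x)^2)"
  by (rule integrableI_nonneg) (auto simp: nn)
 have "integrable (lebesgue_on Z) u"
  using integrable_inner_L2[OF u(1) L2_const[OF Z, of 1]] by simp
 hence "integrable lebesgue (%x. indicator Z x*\<^sub>R u x)" by (simp add: integrable_lebesgue_on_iff[OF Zl])
 moreover have "(%x. indicator Z x*\<^sub>R u x) = u" using u(3) by (force simp: indicator_def)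
 ultimately have "integrable lebesgue u" by simp
 thus "integrable lborel u" using integrable_completion[of u lborel] u(2) by simp
qed

lemma mollify_in_L2: "integrable lborel u ==> mollify e u\<in>L2_space Z"
 by (intro L2_smooth(1)[OF Z] smooth_conv bsmooth_mol)

lemma mollify_norm_le:
 assumes e: "e > 0" and u: "u\<in>L2_space Z" "u\<in>borel_measurable borel" "!!x. x \<notin> Z ==> u x = 0"
 shows "l2_norm Z (mollify e u) <= l2_norm Z u"
proof (rule L2_space_nn_integral(2))
 note i = L2_integrable_lborel[OF u]
 have Zl: "Z\<in>sets lebesgue" by (rule sets_lebesgue_open[OF Z(1)])
 show "mollify e u\<in>borel_measurable (lebesgue_on Z)"
  using mollify_in_L2[OF i(1)] by (rule L2_spaceD)
 have "(\<integral>\<^sup>+ x. ennreal ((norm (mollify e u x))^2) \<partial>lebesgue_on Z) <= (nn (%x. ennreal ((mollify e u x)^2)))"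
  by (intro nn_integral_lebesgue_on_lborel(1) Zl borel_measurable_smooth smooth_conv bsmooth_mol i(1))
 also have "... <= (nn (%y. ennreal ((u y)^2)))"
  by (rule mollify_L2[OF e i(1,2)])
 finally show "(\<integral>\<^sup>+ x. ennreal ((norm (mollify e u x))^2) \<partial>lebesgue_on Z) <= ennreal ((l2_norm Z u)^2)"
  by (simp add: i(3))
qed (use u in simp)

lemma test_function_Lipschitz:
 assumes "test_function E \<phi>"
 obtains C where "C >= 0" "!!x y. \<bar>\<phi> x - \<phi> y\<bar> <= C*dist x y"
proof -
 obtain A where A: "A >= 0" "!!x. \<bar>pd 1 \<phi> x\<bar> <= A"
  using test_function_bound[OF test_function_partial[OF assms]] by metis
 obtain B where B: "B >= 0" "!!x. \<bar>pd 2 \<phi> x\<bar> <= B"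
  using test_function_bound[OF test_function_partial[OF assms]] by metis
 have "norm (\<phi> x - \<phi> y) <= (A + B)*norm (x - y)" for x y
 proof (rule differentiable_bound[of UNIV \<phi> "%x h. grad \<phi> x\<bullet>h"])
  fix x :: point
  show "(\<phi> has_derivative (%h. grad \<phi> x\<bullet>h)) (at x within UNIV)"
   using has_derivative_grad[OF smoothD(1)[OF test_function_smooth[OF assms]]] by simp
  show "onorm (%h. grad \<phi> x\<bullet>h) <= A + B"
  proof (rule onorm_le)
   fix h :: point
   have "\<bar>grad \<phi> x\<bullet>h\<bar> <= \<bar>pd 1 \<phi> x\<bar>*\<bar>h$1\<bar> + \<bar>pd 2 \<phi> x\<bar>*\<bar>h$2\<bar>"
    by (simp add: inner_point abs_mult[symmetric] abs_triangle_ineq)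
   also have "... <= A*norm h + B*norm h"
    using A B component_le_norm_cart[of h] by (intro add_mono mult_mono) auto
   finally show "norm (grad \<phi> x\<bullet>h) <= (A + B)*norm h" by (simp add: distrib_right)
  qed
 qed auto
 thus thesis using that[of "A + B"] A(1) B(1) by (auto simp: dist_norm)
qed

text \<open>Uniform convergence for a Lipschitz test function close to \<open>u\<close>, and the
  contraction property for the difference.\<close>

lemma mollify_tendsto:
 assumes u: "u\<in>L2_space Z" "u\<in>borel_measurable borel" "!!x. x \<notin> Z ==> u x = 0" and d: "d > 0"
 obtains e0 where "e0 > 0" "!!e. 0 < e ==> e < e0 ==> l2_norm Z (mollify e u - u) < d"
proof -
 obtain \<phi> where \<phi>: "!!n::nat. test_function Z (\<phi> n)" "(%n. l2_norm Z (u - \<phi> n)) \<longlonglongrightarrow> 0"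
  using test_functions_dense[OF Z u(1)] by blast
 obtain n where n: "l2_norm Z (u - \<phi> n) < d/3"
  using order_tendstoD(2)[OF \<phi>(2), of "d/3"] d by (auto dest: eventually_happens)
 define \<psi> where "\<psi> = \<phi> n"
 have \<psi>: "test_function Z \<psi>" "l2_norm Z (u - \<psi>) < d/3" using \<phi>(1) n by (auto simp: \<psi>_def)
 have \<psi>L: "\<psi>\<in>L2_space Z" by (rule L2_test[OF Z \<psi>(1)])
 have \<psi>b: "\<psi>\<in>borel_measurable borel" by (rule borel_measurable_smooth[OF test_function_smooth[OF \<psi>(1)]])
 have \<psi>0: "\<psi> x = 0" if "x \<notin> Z" for x using test_function_zero[OF \<psi>(1)] that by simp
 have iu: "integrable lborel u" by (rule L2_integrable_lborel[OF u])
 have i\<psi>: "integrable lborel \<psi>" by (rule integrable_test_function[OF \<psi>(1)])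
 obtain C where C: "C >= 0" "!!x y. \<bar>\<psi> x - \<psi> y\<bar> <= C*dist x y" using test_function_Lipschitz[OF \<psi>(1)] by blast
 have iud: "integrable lborel (u - \<psi>)"
  unfolding fun_diff_def by (rule Bochner_Integration.integrable_diff[OF iu i\<psi>])
 define m where "m = measure lebesgue Z"
 have m: "m >= 0" by (simp add: m_def)
 \<comment> \<open>Keeps the error \<open>2*C*e*(m + 1)\<close> of the test function below
   \<open>d/3\<close>. Here \<open>m + 1\<close> dominates the square root of the measure, and the
   last 1 keeps the denominator positive for \<open>C = 0\<close>.\<close>
 define e0 where "e0 = (d/3)/(2*C*(m + 1) + 1)"
 have pos: "2*C*(m + 1) + 1 > 0" using C(1) m by (intro add_nonneg_pos mult_nonneg_nonneg) auto
 hence e0: "e0 > 0" using d by (simp add: e0_def)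
 show thesis
 proof (rule that[OF e0])
  fix e :: real assume e: "0 < e" "e < e0"
  have ptw: "\<bar>mollify e \<psi> x - \<psi> x\<bar> <= 2*C*e" for x
  proof -
   have "mollify e \<psi> x - \<psi> x = (LINT y|lborel. kern e x y*\<psi> y) - (LINT y|lborel. kern e x y*\<psi> x)"
    using integral_kern[OF e(1)] by (simp add: mollify_eq)
   also have "... = (LINT y|lborel. kern e x y*\<psi> y - kern e x y*\<psi> x)"
    using mollify_integrable[OF i\<psi>] integral_kern[OF e(1)] by simp
   also have "\<bar>...\<bar> <= (LINT y|lborel. kern e x y*(2*C*e))"
   proof (rule LINT_abs_bound)
    show "integrable lborel (%y. kern e x y*\<psi> y - kern e x y*\<psi> x)" "integrable lborel (%y. kern e x y*(2*C*e))"
     using mollify_integrable[OF i\<psi>] integral_kern[OF e(1)] by simp_all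
    fix y
    show "\<bar>kern e x y*\<psi> y - kern e x y*\<psi> x\<bar> <= kern e x y*(2*C*e)"
    proof (cases "kern e x y = 0")
     case False
     have "\<bar>\<psi> y - \<psi> x\<bar> <= C*(2*e)"
      using C(2)[of y x] kern_0[OF e(1) False] C(1) by (auto simp: dist_commute intro: order_trans mult_left_mono)
     hence "kern e x y*\<bar>\<psi> y - \<psi> x\<bar> <= kern e x y*(C*(2*e))"
      using kern_nonneg[OF e(1)] by (intro mult_left_mono)
     moreover have "\<bar>kern e x y*\<psi> y - kern e x y*\<psi> x\<bar> = kern e x y*\<bar>\<psi> y - \<psi> x\<bar>"
      using kern_nonneg[OF e(1), of x y] unfolding right_diff_distrib[symmetric] abs_mult by simp
     ultimately show ?thesis by simp
    qed simp
   qed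
   also have "... = 2*C*e" using integral_kern[OF e(1)] by simp
   finally show ?thesis .
  qed
  have mo: "mollify e \<psi>\<in>L2_space Z" "mollify e u\<in>L2_space Z" "mollify e (u - \<psi>)\<in>L2_space Z"
   by (intro mollify_in_L2 iu i\<psi> iud)+
  have "(l2_norm Z (mollify e \<psi> - \<psi>))^2 <= (2*C*e)^2*measure lebesgue Z"
  proof (rule L2_space_bounded(2)[OF bounded_open_lmeasurable[OF Z]])
   show "mollify e \<psi> - \<psi>\<in>borel_measurable (lebesgue_on Z)"
    using mo(1) \<psi>L by (intro L2_spaceD(1) l2.closed)
  qed (use ptw in simp)
  also have "... <= (2*C*e)^2*(m + 1)^2"
  proof (rule mult_left_mono)
   show "measure lebesgue Z <= (m + 1)^2"
    unfolding m_def[symmetric] using m by (simp add: power2_eq_square algebra_simps)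
  qed simp
  finally have "(l2_norm Z (mollify e \<psi> - \<psi>))^2 <= (2*C*e*(m + 1))^2"
   by (simp add: power_mult_distrib)
  hence "l2_norm Z (mollify e \<psi> - \<psi>) <= 2*C*e*(m + 1)"
   by (rule power2_le_imp_le) (use C(1) e m in auto)
  also have "... = (2*C*(m + 1))*e" by simp
  also have "... <= (2*C*(m + 1) + 1)*e" using e by (intro mult_right_mono) auto
  also have "... < (2*C*(m + 1) + 1)*e0" using e pos by (intro mult_strict_left_mono)
  also have "... = d/3" unfolding e0_def using pos by (metis less_irrefl nonzero_mult_div_cancel_left times_divide_eq_right)
  finally have 1: "l2_norm Z (mollify e \<psi> - \<psi>) < d/3" .
  have "l2_norm Z (mollify e (u - \<psi>)) <= l2_norm Z (u - \<psi>)"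
  proof (rule mollify_norm_le[OF e(1)])
   show "u - \<psi>\<in>L2_space Z" using u(1) \<psi>L by (rule l2.closed)
   show "u - \<psi>\<in>borel_measurable borel" using u(2) \<psi>b unfolding fun_diff_def by measurable
  qed (simp add: u(3) \<psi>0)
  hence 2: "l2_norm Z (mollify e u - mollify e \<psi>) < d/3"
   using conv_diff[OF bsmooth_mol(1) bsmooth_mol(1) iu i\<psi>] \<psi>(2) by simp
  have 3: "l2_norm Z (\<psi> - u) < d/3" using \<psi>(2) l2_minus_commute[OF \<psi>L u(1)] by simp
  have "l2_norm Z (mollify e u - u) <= l2_norm Z (mollify e u - mollify e \<psi>) + l2_norm Z (mollify e \<psi> - u)"
   by (rule l2_triangle3[OF mo(2,1) u(1)])
  also have "l2_norm Z (mollify e \<psi> - u) <= l2_norm Z (mollify e \<psi> - \<psi>) + l2_norm Z (\<psi> - u)"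
   by (rule l2_triangle3[OF mo(1) \<psi>L u(1)])
  finally show "l2_norm Z (mollify e u - u) < d" using 1 2 3 by linarith
 qed
qed

end

subsection \<open>Cut-off functions\<close>

text \<open>Convolutions integrate a Borel function over the whole plane, whereas an element of
  \<open>L2_space Z\<close> is only Lebesgue measurable on \<open>Z\<close> and arbitrary
  outside.\<close>

lemma borel_representative:
 assumes Z: "open Z" "bounded Z" and u: "(u :: scalar_field)\<in>L2_space Z"
 obtains u' where "u'\<in>borel_measurable borel" "!!x. x \<notin> Z ==> u' x = 0" "u'\<in>L2_space Z"
  "AE x in lebesgue_on Z. u x = u' x"
proof -
 have Zl: "Z\<in>sets lebesgue" by (rule sets_lebesgue_open[OF Z(1)])
 have "integrable (lebesgue_on Z) u"
  using integrable_inner_L2[OF u L2_const[OF Z, of 1]] by simp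
 hence "integrable lebesgue (%x. indicator Z x*\<^sub>R u x)" by (simp add: integrable_lebesgue_on_iff[OF Zl])
 then obtain f where f: "f\<in>borel_measurable lborel" "AE x in lborel. indicator Z x*\<^sub>R u x = f x"
  using completion_ex_borel_measurable_real[of _ lborel] borel_measurable_integrable by blast
 define u' where "u' x = indicator Z x*f x" for x
 have b: "u'\<in>borel_measurable borel"   proof -
  have [measurable]: "Z\<in>sets borel" "f\<in>borel_measurable borel" using Z(1) f(1) by auto
  show ?thesis unfolding u'_def by measurable
 qed
 have "AE x in lebesgue. indicator Z x*\<^sub>R u x = f x" using f(2) by (rule AE_completion)
 hence ae: "AE x in lebesgue_on Z. u x = u' x"
  using Zl by (auto simp: AE_restrict_space_iff u'_def elim!: eventually_mono)
 have m: "u'\<in>borel_measurable (lebesgue_on Z)"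
  by (rule measurable_restrict_space1[OF measurable_completion]) (use b in simp)
 have "integrable (lebesgue_on Z) (%x. (norm (u' x))^2) \<longleftrightarrow> integrable (lebesgue_on Z) (%x. (norm (u x))^2)"
  using m L2_spaceD(1)[OF u] ae by (intro integrable_cong_AE) (auto elim!: eventually_mono)
 hence "u'\<in>L2_space Z" using m L2_spaceD(2)[OF u] by (simp add: L2_space_def)
 thus thesis using that[OF b] ae by (simp add: u'_def)
qed

text \<open>The path starts within \<open>L/2\<close> of the centre in each coordinate and leaves
  the square, so one coordinate changes by at least \<open>L/2\<close> before it leaves. Every value
  in between is taken at a zero of \<open>q\<close> inside the square, as the inequality on squares
  requires in that coordinate.\<close>

lemma square_Poincare_path:
 assumes q: "smooth q" and L: "L > 0" and B: "B = {x. \<bar>x$1 - p$1\<bar> <= L & \<bar>x$2 - p$2\<bar> <= L}"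
  and g: "path g" "!!i. \<bar>pathstart g$i - p$i\<bar> <= L/2" "pathfinish g \<notin> B"
  and zero: "!!x. x\<in>path_image g ==> q x = 0"
 shows "(nn (%x. ennreal ((q x)^2)*indicator B x)) <=
  ennreal (64*L^2)*(nn (%x. ennreal ((pd 1 q x)^2 + (pd 2 q x)^2)*indicator B x))"
proof -
 define J where "J i = {p$i - L..p$i + L}" for i
 have BJ: "x\<in>B \<longleftrightarrow> x$1\<in>J 1 & x$2\<in>J 2" for x by (auto simp: B J_def abs_le_iff)
 have Bbox: "B = cbox (\<chi> i. p$i - L) (\<chi> i. p$i + L)"
  by (auto simp: BJ J_def mem_box_cart forall_2)
 have Bm [measurable]: "B\<in>sets borel" unfolding Bbox by simp
 have [measurable]: "q\<in>borel_measurable borel" "pd i q\<in>borel_measurable borel" for i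
  using q by (auto intro: borel_measurable_smooth smoothD)
 have "pathstart g\<in>B" using g(2)[of 1] g(2)[of 2] L by (auto simp: B)
 then obtain h where h: "path h" "pathstart h = pathstart g" "path_image h \<subseteq> path_image g \<inter> B" "pathfinish h\<in>frontier B"
  using exists_path_subpath_to_frontier_closed[of B g] g Bbox by auto
 have fB: "pathfinish h\<in>B" "pathfinish h \<notin> box (\<chi> i. p$i - L) (\<chi> i. p$i + L)"
  using h(4) unfolding Bbox by (auto simp: frontier_def)
 \<comment> \<open>The exit point lies on a side of the square; \<open>i\<close> is the coordinate
   constant on that side.\<close>
 then obtain i where i: "\<bar>pathfinish h$i - p$i\<bar> = L"
  by (fastforce simp: BJ J_def mem_box_cart forall_2)
 define a where "a = min (pathstart h$i) (pathfinish h$i)"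
 define b where "b = max (pathstart h$i) (pathfinish h$i)"
 have ab: "b - a >= L/2" using i g(2)[of i] unfolding a_def b_def h(2) by linarith
 have inJ: "pathstart h$i\<in>J i" "pathfinish h$i\<in>J i"
  using i g(2)[of i] L unfolding J_def h(2) atLeastAtMost_iff by linarith+
 have abJ: "{a..b} \<subseteq> J i" using inJ by (auto simp: a_def b_def J_def)
 have "connected ((%x. x$i) ` path_image h)"
  using connected_path_image[OF h(1)] by (intro connected_continuous_image continuous_intros)
 moreover have "a\<in>(%x. x$i) ` path_image h" "b\<in>(%x. x$i) ` path_image h"
  using pathstart_in_path_image[of h] pathfinish_in_path_image[of h] by (auto simp: a_def b_def min_def max_def)
 ultimately have sub: "{a..b} \<subseteq> (%x. x$i) ` path_image h" by (rule connected_contains_Icc)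
 have hit: "\<exists>x\<in>B. x$i = s & q x = 0" if s: "s\<in>{a..b}" for s
 proof -
  obtain x where x: "s = x$i" "x\<in>path_image h" using subsetD[OF sub s] by (rule imageE)
  hence "x\<in>path_image g" "x\<in>B" using subsetD[OF h(3) x(2)] by simp_all
  thus ?thesis using zero x by (intro bexI[of _ x]) simp_all
 qed
 have cont: "continuous_on UNIV (%(s, t). f (pt s t))" "continuous_on UNIV (%(s, t). f (pt t s))" if "smooth f" for f
  using continuous_on_compose2[OF smoothD(3)[OF that, of UNIV] continuous_on_pt[of UNIV fst snd]]
   continuous_on_compose2[OF smoothD(3)[OF that, of UNIV] continuous_on_pt[of UNIV snd fst]]
  by (simp_all add: case_prod_beta' continuous_on_fst continuous_on_snd continuous_on_id)
 have D1: "((%s. q (pt s t)) has_real_derivative pd 1 q (pt s t)) (at s)" for s t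
  using DERIV_directional[OF q, of "t*\<^sub>R axis 2 1" 1 s] by (simp add: pt_eq add.commute)
 have D2: "((%t. q (pt s t)) has_real_derivative pd 2 q (pt s t)) (at t)" for s t
  using DERIV_directional[OF q, of "s*\<^sub>R axis 1 1" 2 t] by (simp add: pt_eq)
 have ind: "indicator B (pt s t) = (indicator (J 1) s*indicator (J 2) t :: ennreal)" for s t
  by (auto simp: indicator_def BJ)
 consider "i = 1" | "i = 2" using exhaust_2 by blast
 thus ?thesis
 proof cases
  case 1
  have "\<exists>t\<in>J 2. q (pt s t) = 0" if s: "s\<in>{a..b}" for s
  proof -
   obtain x where "x\<in>B" "x$1 = s" "q x = 0" using hit[OF s] 1 by blast
   thus ?thesis using pt_components[of x] by (intro bexI[of _ "x$2"]) (auto simp: BJ)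
  qed
  from square_Poincare[OF D1 D2 cont(1)[OF q] cont(1)[OF smoothD(2)[OF q]] cont(1)[OF smoothD(2)[OF q]] L
    J_def J_def abJ[unfolded 1] ab this]
  show ?thesis
   by (subst (1 2) nn_integral_point(1)) (simp_all add: ind mult.assoc)
 next
  case 2
  have "\<exists>t\<in>J 1. q (pt t s) = 0" if s: "s\<in>{a..b}" for s
  proof -
   obtain x where "x\<in>B" "x$2 = s" "q x = 0" using hit[OF s] 2 by blast
   thus ?thesis using pt_components[of x] by (intro bexI[of _ "x$1"]) (auto simp: BJ)
  qed
  from square_Poincare[OF D2 D1 cont(2)[OF q] cont(2)[OF smoothD(2)[OF q]] cont(2)[OF smoothD(2)[OF q]] L
    J_def J_def abJ[unfolded 2] ab this]
  show ?thesis
   by (subst (1 2) nn_integral_point(2)) (simp_all add: ind mult_ac add.commute)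
 qed
qed

text \<open>Young's inequality for product kernels: each factor contributes the integral of a
  majorant.\<close>

lemma conv_bound:
 fixes x :: point
 assumes F: "bsmooth F" and G: "bsmooth G" and u: "integrable lborel u" "!!y. \<bar>u y\<bar> <= 1"
  and f: "f\<in>borel_measurable borel" "!!s. \<bar>F s\<bar> <= f s" "!!a. (nn (%s. ennreal (f (a - s)))) <= ennreal \<alpha>"
  and g: "g\<in>borel_measurable borel" "!!s. \<bar>G s\<bar> <= g s" "!!a. (nn (%s. ennreal (g (a - s)))) <= ennreal \<beta>"
  and ab: "0 <= \<alpha>" "0 <= \<beta>"
 shows "\<bar>conv F G u x\<bar> <= \<alpha>*\<beta>"
proof -
 note [measurable] = bsmooth_measurable[OF F] bsmooth_measurable[OF G] borel_measurable_integrable[OF u(1)] f(1) g(1)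
 have fg: "0 <= f s" "0 <= g s" for s using f(2)[of s] g(2)[of s] by linarith+
 have "ennreal \<bar>conv F G u x\<bar> <= (nn (%y. ennreal (norm (F (x$1 - y$1)*G (x$2 - y$2)*u y))))"
  using integral_norm_bound_ennreal[OF conv_integrable[OF F G u(1), of x]] by (simp add: conv_def)
 also have "... <= (nn (%y. ennreal (f (x$1 - (y :: point)$1))*ennreal (g (x$2 - y$2))))"
 proof (rule nn_integral_mono)
  fix y :: point
  have "\<bar>F (x$1 - y$1)\<bar>*\<bar>G (x$2 - y$2)\<bar>*\<bar>u y\<bar> <= f (x$1 - y$1)*g (x$2 - y$2)*1"
   using f(2) g(2) u(2) fg by (intro mult_mono) auto
  thus "ennreal (norm (F (x$1 - y$1)*G (x$2 - y$2)*u y)) <= ennreal (f (x$1 - y$1))*ennreal (g (x$2 - y$2))"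
   using fg by (simp add: abs_mult flip: ennreal_mult)
 qed
 also have "... = (nn (%s. ennreal (f (x$1 - s))))*(nn (%s. ennreal (g (x$2 - s))))"
  by (subst nn_integral_point(1)) (simp_all add: nn_integral_cmult nn_integral_multc)
 also have "... <= ennreal \<alpha>*ennreal \<beta>" by (intro mult_mono f(3) g(3)) auto
 finally have "ennreal \<bar>conv F G u x\<bar> <= ennreal (\<alpha>*\<beta>)" using ab by (simp add: ennreal_mult)
 thus ?thesis using ab by (subst (asm) ennreal_le_iff) auto
qed

lemma DERIV_mol:
 obtains b' C where "C > 0" "bsmooth b'" "!!t. \<bar>b' t\<bar> <= C*indicator {0..1} t"
  "!!e t. (mol e has_real_derivative (1/e)*((1/e)*b' ((1/e)*t + 0))) (at t)"
proof -
 obtain b' where b': "!!x. (smooth_bump has_real_derivative b' x) (at x)" "bsmooth b'" using bsmoothE[OF bsmooth_bump] by blast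
 obtain C where C: "C > 0" "!!x. \<bar>b' x\<bar> <= C" using bsmooth_bound[OF b'(2)] by blast
 have b0: "b' x = 0" if "x < 0 \<or> 1 < x" for x
 proof -
  have "((%_. 0) has_real_derivative b' x) (at x)"
  proof (rule has_field_derivative_transform_within_open[OF b'(1)])
   show "open ({..<0} \<union> {1<..} :: real set)" by auto
   show "x\<in>{..<0} \<union> {1<..}" using that by auto
   show "!!y. y\<in>{..<0} \<union> {1<..} ==> smooth_bump y = 0" by (auto intro: smooth_bump_0)
  qed
  thus ?thesis using DERIV_unique DERIV_const by blast
 qed
 show thesis
 proof (rule that[OF C(1) b'(2)])
  show "\<bar>b' t\<bar> <= C*indicator {0..1} t" for t
   using C(2)[of t] b0[of t] by (auto simp: indicator_def)
  fix e t :: real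
  have "((%t. (1/e)*t + 0) has_real_derivative (1/e)*1 + 0) (at t)"
   by (intro DERIV_add DERIV_cmult DERIV_ident DERIV_const)
  from DERIV_cmult[OF DERIV_chain2[OF b'(1) this], of "1/e"]
  show "(mol e has_real_derivative (1/e)*((1/e)*b' ((1/e)*t + 0))) (at t)"
   by (simp add: mol_def[abs_def] mult.commute)
 qed
qed

text \<open>The constant comes from the derivative of the fixed bump and is chosen before
  \<open>Z\<close> and \<open>d\<close>. The growth \<open>C/d\<close> of the gradient will be
  compensated by a potential of order \<open>d\<close> on the strip.\<close>

lemma exists_cutoff:
 obtains C where "C > 0"
  "!!Z d. open Z ==> bounded Z ==> d > 0 ==> EX \<eta>. test_function Z \<eta> & (ALL x. 0 <= \<eta> x & \<eta> x <= 1) &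
   (ALL x. infdist x (- Z) > 6*d --> \<eta> x = 1) &
   (ALL x i. \<bar>pd i \<eta> x\<bar> <= C/d*indicator {x\<in>Z. infdist x (- Z) <= 6*d} x)"
proof -
 obtain b' C where C: "C > 0" and b': "bsmooth b'" "!!t. \<bar>b' t\<bar> <= C*indicator {0..1} t"
  and D: "!!e t. (mol e has_real_derivative (1/e)*((1/e)*b' ((1/e)*t + 0))) (at t)"
  by (rule DERIV_mol, rule that)
 show thesis
 proof (rule that[OF C])
  fix Z :: "point set" and d :: real assume Z: "open Z" "bounded Z" and d: "d > 0"
  have ne: "- Z ~= {}"
  proof
   assume "- Z = {}"
   hence "Z = UNIV" by auto
   thus False using Z(2) not_bounded_UNIV[where 'a = point] by simp
  qed
  have cl: "closed (- Z)" using Z(1) by auto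
  \<comment> \<open>The kernel of scale \<open>d\<close> reaches at most \<open>2*d\<close>, so
    mollifying the indicator of \<open>K\<close> leaves the transition between distances
    \<open>2*d\<close> and \<open>6*d\<close>.\<close>
  define K where "K = {x. infdist x (- Z) >= 4*d}"
  have contid: "continuous_on UNIV (%x. infdist x (- Z))" by (intro continuous_intros)
  have Kc: "closed K" unfolding K_def using contid by (intro closed_Collect_le continuous_intros)
  have inZ: "x\<in>Z" if "infdist x (- Z) > 0" for x
  proof (rule ccontr)
   assume "x \<notin> Z"
   hence "infdist x (- Z) = 0" by (intro infdist_zero) simp
   thus False using that by simp
  qed
  have KZ: "K \<subseteq> Z" using d inZ by (force simp: K_def)
  define u :: scalar_field where "u = indicator K"
  obtain r where r: "!!x. x\<in>Z ==> norm x <= r" using Z(2) by (auto simp: bounded_iff)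
  have u: "integrable lborel u" "\<bar>u y\<bar> <= 1" "0 <= u y" for y
  proof -
   show "integrable lborel u"
    by (rule integrable_bounded_support[of _ 1 r]) (use Kc KZ r in \<open>force simp: u_def indicator_def borel_closed\<close>)+
  qed (auto simp: u_def)
  define \<eta> where "\<eta> = mollify d u"
  have sm: "smooth \<eta>" unfolding \<eta>_def by (intro smooth_conv u bsmooth_mol)
  have lip: "infdist x (- Z) <= infdist y (- Z) + dist x y" for x y by (rule infdist_triangle)
  have \<eta>0: "\<eta> x = 0" if "infdist x (- Z) < 2*d" for x
  proof -
   have z: "kern d x y*u y = 0" for y
   proof (cases "kern d x y = 0")
    case False
    hence "infdist y (- Z) < 4*d"
     using kern_0[OF d, of x y] lip[of y x] that by (simp add: dist_commute)
    thus ?thesis by (simp add: u_def K_def)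
   qed simp
   show ?thesis unfolding \<eta>_def mollify_eq z by simp
  qed
  have \<eta>1: "\<eta> x = 1" if "infdist x (- Z) > 6*d" for x
  proof -
   have z: "kern d x y*u y = kern d x y" for y
   proof (cases "kern d x y = 0")
    case False
    hence "infdist y (- Z) >= 4*d" using kern_0[OF d, of x y] lip[of x y] that by simp
    thus ?thesis by (simp add: u_def K_def)
   qed simp
   show ?thesis unfolding \<eta>_def mollify_eq z by (rule integral_kern[OF d])
  qed
  have \<eta>01: "0 <= \<eta> x & \<eta> x <= 1" for x
  proof -
   have "0 <= \<eta> x" unfolding \<eta>_def mollify_eq using u(3) kern_nonneg[OF d] by (intro Bochner_Integration.integral_nonneg) simp
   moreover have "\<eta> x <= (LINT y|lborel. kern d x y)"
    unfolding \<eta>_def mollify_eq using u(2) kern_nonneg[OF d] integral_kern[OF d] mollify_integrable[OF u(1)]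
    by (intro integral_mono) (auto simp: u_def indicator_def)
   ultimately show ?thesis using integral_kern[OF d] by simp
  qed
  have grad0: "pd i \<eta> x = 0" if "infdist x (- Z) < 2*d \<or> infdist x (- Z) > 6*d" for i x
   using that
  proof
   assume "infdist x (- Z) < 2*d"
   thus ?thesis
    by (intro pd_zero_open[of "{x. infdist x (- Z) < 2*d}" x \<eta> 0])
     (auto intro!: open_Collect_less continuous_intros \<eta>0)
  next
   assume "infdist x (- Z) > 6*d"
   thus ?thesis
    by (intro pd_zero_open[of "{x. 6*d < infdist x (- Z)}" x \<eta> 1])
     (auto intro!: open_Collect_less continuous_intros \<eta>1)
  qed
  define m' where "m' t = (1/d)*((1/d)*b' ((1/d)*t + 0))" for t
  have m': "bsmooth m'" "!!t. (mol d has_real_derivative m' t) (at t)"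
   unfolding m'_def by (intro bsmooth_mult bsmooth_const bsmooth_affine b' D)+
  \<comment> \<open>Size \<open>C/d^2\<close> on an interval of length \<open>d\<close> gives the
    integral \<open>C/d\<close>.\<close>
  have fm: "\<bar>m' s\<bar> <= C/d^2*indicator {0..d} s" for s
  proof -
   have "\<bar>m' s\<bar> = 1/d^2*\<bar>b' ((1/d) * s + 0)\<bar>"
    using d by (simp add: m'_def abs_mult power2_eq_square)
   also have "... <= 1/d^2*(C*indicator {0..1} ((1/d) * s + 0))"
    by (intro mult_left_mono b') simp
   also have "indicator {0..1} ((1/d) * s + 0) = (indicator {0..d} s :: real)"
    using d by (auto simp: indicator_def field_simps)
   finally show ?thesis by simp
  qed
  have fint: "(nn (%s. ennreal (C/d^2*indicator {0..d} (a - s)))) <= ennreal (C/d)" for a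
  proof -
   have "(nn (%s. ennreal (C/d^2*indicator {0..d} (a - s)))) = (nn (%s. ennreal (C/d^2)*indicator {a - d..a} s))"
    by (intro nn_integral_cong) (auto simp: indicator_def)
   also have "... = ennreal (C/d^2)*ennreal d" using d by (simp add: nn_integral_cmult)
   also have "... = ennreal (C/d)" using d C by (simp add: ennreal_mult[symmetric] power2_eq_square)
   finally show ?thesis by simp
  qed
  have molab: "\<bar>mol d s\<bar> <= mol d s" "(nn (%s. ennreal (mol d (a - s)))) <= ennreal 1" for s a
   using mol_nonneg[OF d, of s] nn_integral_mol[OF d] by auto
  have gb: "\<bar>pd i \<eta> x\<bar> <= C/d" for i x
  proof -
   note p = pd_conv[OF bsmooth_mol(1) m'(2,1) bsmooth_mol(1) m'(2,1) u(1)]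
   have "\<bar>conv m' (mol d) u x\<bar> <= C/d*1"
    using C d by (intro conv_bound[OF m'(1) bsmooth_mol(1) u(1,2) _ fm fint _ molab]) auto
   moreover have "\<bar>conv (mol d) m' u x\<bar> <= 1*(C/d)"
    using C d by (intro conv_bound[OF bsmooth_mol(1) m'(1) u(1,2) _ molab _ fm fint]) auto
   ultimately show ?thesis using exhaust_2[of i] p by (auto simp: \<eta>_def)
  qed
  have test: "test_function Z \<eta>"
  proof (rule test_functionI[OF sm])
   show "{x. infdist x (- Z) >= 2*d} \<subseteq> Z" using d inZ by force
   hence "bounded {x. infdist x (- Z) >= 2*d}" using Z(2) bounded_subset by blast
   thus "compact {x. infdist x (- Z) >= 2*d}"
    unfolding compact_eq_bounded_closed by (auto intro!: closed_Collect_le continuous_intros)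
  qed (use \<eta>0 in auto)
  have "\<bar>pd i \<eta> x\<bar> <= C/d*indicator {x\<in>Z. infdist x (- Z) <= 6*d} x" for i x
   using gb[of i x] grad0[of x i] inZ[of x] d
   by (cases "infdist x (- Z) < 2*d \<or> infdist x (- Z) > 6*d") (auto simp: indicator_def)
  thus "EX \<eta>. test_function Z \<eta> & (ALL x. 0 <= \<eta> x & \<eta> x <= 1) &
   (ALL x. infdist x (- Z) > 6*d --> \<eta> x = 1) &
   (ALL x i. \<bar>pd i \<eta> x\<bar> <= C/d*indicator {x\<in>Z. infdist x (- Z) <= 6*d} x)"
   using test \<eta>01 \<eta>1 by blast
 qed
qed

subsection \<open>Fields orthogonal to gradients and curls\<close>

lemma L2_dominated:
 fixes f :: scalar_field and g :: scalar_field
 assumes g: "g\<in>L2_space E" and f: "f\<in>borel_measurable (lebesgue_on E)" and c: "0 <= c"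
  and le: "!!x. x\<in>E ==> \<bar>f x\<bar> <= c*\<bar>g x\<bar>"
 shows "f\<in>L2_space E" "l2_norm E f <= c*l2_norm E g"
proof -
 have sq: "(norm (f x))^2 <= c^2*(norm (g x))^2" if "x\<in>E" for x
  using power_mono[OF le[OF that], of 2] by (simp add: power_mult_distrib)
 show fL: "f\<in>L2_space E"
  by (rule L2_space_dominated[OF f, of "%x. c^2*(norm (g x))^2"]) (use sq L2_spaceD(2)[OF g] in auto)
 have "(l2_norm E f)^2 = (LINT x|lebesgue_on E. (norm (f x))^2)"
  using l2_norm_sq[OF fL] by (simp add: l2_inner_def power2_eq_square)
 also have "... <= (LINT x|lebesgue_on E. c^2*(norm (g x))^2)"
  by (rule integral_mono) (use L2_spaceD(2)[OF fL] L2_spaceD(2)[OF g] sq in \<open>auto simp: space_restrict_space\<close>)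
 also have "... = c^2*(l2_norm E g)^2"
  using l2_norm_sq[OF g] by (simp add: l2_inner_def power2_eq_square)
 finally have "(l2_norm E f)^2 <= (c*l2_norm E g)^2" by (simp add: power_mult_distrib)
 thus "l2_norm E f <= c*l2_norm E g"
  by (rule power2_le_imp_le) (use c g in simp)
qed

lemma borel_lebesgue_on: "f\<in>borel_measurable borel ==> f\<in>borel_measurable (lebesgue_on E)"
 by (rule measurable_restrict_space1[OF measurable_completion]) simp

lemma l2_inner_lborel:
 fixes w f :: scalar_field
 assumes "open Z" "w\<in>borel_measurable borel" "!!x. x \<notin> Z ==> w x = 0" "f\<in>borel_measurable borel"
 shows "l2_inner Z w f = (LINT x|lborel. w x*f x)"
 unfolding l2_inner_def inner_real_def
 by (rule integral_lebesgue_on_support) (use assms sets_lebesgue_open in auto)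

text \<open>The stream function of the mollified field: minus the primitive of its second component
  in the first coordinate, taken from the left, where the field vanishes.\<close>

definition pot :: "real => scalar_field => scalar_field" where
 "pot e w x = - conv (stp e) (mol e) w x"

text \<open>The components are extended by zero. Orthogonality to the gradients of all smooth
  functions, rather than of test functions only, says that the extension is divergence free in the
  whole plane.\<close>

locale div_free_extension =
 fixes Z :: "point set" and w1 w2 :: scalar_field
 assumes Z: "open Z" "bounded Z"
  and w1: "w1\<in>L2_space Z" "w1\<in>borel_measurable borel" "!!x. x \<notin> Z ==> w1 x = 0"
  and w2: "w2\<in>L2_space Z" "w2\<in>borel_measurable borel" "!!x. x \<notin> Z ==> w2 x = 0"
  and divfree: "!!\<phi>. smooth \<phi> ==> l2_inner Z w1 (pd 1 \<phi>) + l2_inner Z w2 (pd 2 \<phi>) = 0"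
begin

lemma w_integrable: "integrable lborel w1" "integrable lborel w2"
 using L2_integrable_lborel[OF Z] w1 w2 by blast+

text \<open>The first derivative can be read off the kernel. The second uses divergence freeness,
  tested with the kernel of the potential at \<open>x\<close>, regarded as a function of the
  integration variable.\<close>

lemma pot_facts:
 shows smooth_pot: "smooth (pot e w2)" and pot_1: "pd 1 (pot e w2) x = - mollify e w2 x"
  and pot_2: "pd 2 (pot e w2) x = mollify e w1 x"
proof -
 have eq: "pot e w2 = (%x. (-1)*conv (stp e) (mol e) w2 x)" by (auto simp: pot_def)
 have sc: "smooth (conv (stp e) (mol e) w2)" by (intro smooth_conv w_integrable bsmooth_mol)
 show "smooth (pot e w2)" unfolding eq by (intro smooth_scale sc)
 obtain m' where m': "!!t. (mol e has_real_derivative m' t) (at t)" "bsmooth m'" using bsmoothE[OF bsmooth_mol(1)] by blast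
 note pc = pd_conv[OF bsmooth_mol(2) DERIV_stp bsmooth_mol(1) bsmooth_mol(1) m' w_integrable(2)]
 have p: "pd i (pot e w2) x = - pd i (conv (stp e) (mol e) w2) x" for i
  unfolding eq using pd_scale[OF smoothD(1)[OF sc], of i "-1" x] by simp
 show "pd 1 (pot e w2) x = - mollify e w2 x" unfolding p pc by simp
 define F where "F t = stp e (-1*t + x$1)" for t
 define G where "G t = mol e (-1*t + x$2)" for t
 have lin: "((%t. -1*t + c) has_real_derivative -1) (at t)" for c t :: real
  by (auto intro!: derivative_eq_intros)
 have F: "bsmooth F" "!!t. (F has_real_derivative - mol e (x$1 - t)) (at t)"
  and G: "bsmooth G" "!!t. (G has_real_derivative - m' (x$2 - t)) (at t)"
 proof -
  show "bsmooth F" "bsmooth G" unfolding F_def G_def by (rule bsmooth_affine bsmooth_mol)+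
  show "(F has_real_derivative - mol e (x$1 - t)) (at t)" for t
   using DERIV_chain2[OF DERIV_stp lin, of e "x$1" t] by (simp add: F_def[abs_def])
  show "(G has_real_derivative - m' (x$2 - t)) (at t)" for t
   using DERIV_chain2[OF m'(1) lin, of "x$2" t] by (simp add: G_def[abs_def])
 qed
 have t1: "pd 1 (tensor F G) = (%y. - kern e x y)"
  and t2: "pd 2 (tensor F G) = (%y. - (stp e (x$1 - y$1)*m' (x$2 - y$2)))"
  using pd_tensor[OF F(2) G(2)] by (auto simp: tensor_def F_def G_def kern_def fun_eq_iff)
 have sm: "smooth (tensor F G)" by (rule smooth_tensor[OF F(1) G(1)])
 have m: "pd i (tensor F G)\<in>borel_measurable borel" for i
  by (rule borel_measurable_smooth[OF smoothD(2)[OF sm]])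
 have "l2_inner Z w1 (pd 1 (tensor F G)) = - mollify e w1 x"
 proof -
  have "l2_inner Z w1 (pd 1 (tensor F G)) = (LINT y|lborel. w1 y*pd 1 (tensor F G) y)"
   by (rule l2_inner_lborel[OF Z(1) w1(2) w1(3) m])
  thus ?thesis unfolding t1 mollify_eq by (simp add: mult.commute)
 qed
 moreover have "l2_inner Z w2 (pd 2 (tensor F G)) = - conv (stp e) m' w2 x"
 proof -
  have "l2_inner Z w2 (pd 2 (tensor F G)) = (LINT y|lborel. w2 y*pd 2 (tensor F G) y)"
   by (rule l2_inner_lborel[OF Z(1) w2(2) w2(3) m])
  thus ?thesis unfolding t2 conv_def by (simp add: mult.commute)
 qed
 ultimately have "- conv (stp e) m' w2 x = mollify e w1 x" using divfree[OF sm] by simp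
 thus "pd 2 (pot e w2) x = mollify e w1 x" unfolding p pc by simp
qed

lemma mollify_zero_far:
 assumes u: "!!x. x \<notin> Z ==> u x = 0" and e: "e > 0" and far: "ball x d \<inter> Z = {}" "2*e < d"
 shows "mollify e u x = 0"
proof -
 have z: "kern e x y*u y = 0" for y
 proof (cases "kern e x y = 0")
  case False
  hence "y\<in>ball x d" using kern_0[OF e False] far(2) by (simp add: dist_commute)
  hence "y \<notin> Z" using far(1) by blast
  thus ?thesis using u by simp
 qed simp
 show ?thesis unfolding mollify_eq z by simp
qed

text \<open>Away from \<open>Z\<close> the mollified field vanishes, so the potential is locally
  constant along \<open>\<Gamma>\<close>. Its value is zero because \<open>z\<close> lies to the
  left of \<open>Z\<close>, where the step kernel sees nothing of the field.\<close>

lemma pot_zero_on_connected: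
 assumes U: "open U" "U \<inter> Z = {}" and \<Gamma>: "compact \<Gamma>" "connected \<Gamma>" "\<Gamma> \<subseteq> U"
  and z: "z\<in>\<Gamma>" "z$1 <= - M" and M: "!!y. y\<in>Z ==> norm y <= M"
 shows "EX e0>0. ALL e. 0 < e & e < e0 --> (\<forall>x\<in>\<Gamma>. pot e w2 x = 0)"
proof -
 obtain d where d: "d > 0" "(\<Union>x\<in>\<Gamma>. ball x d) \<subseteq> U"
  using compact_subset_open_imp_ball_epsilon_subset[OF \<Gamma>(1) U(1) \<Gamma>(3)] by blast
 have "pot e w2 x = 0" if e: "0 < e" "e < d/4" and x: "x\<in>\<Gamma>" for e x
 proof -
  have near: "ball y (d/2) \<inter> Z = {}" if x': "x'\<in>\<Gamma>" and y: "y\<in>ball x' (d/2)" for x' y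
  proof -
   have "ball y (d/2) \<subseteq> ball x' d"
   proof
    fix v assume "v\<in>ball y (d/2)"
    thus "v\<in>ball x' d" using y dist_triangle[of x' v y] by simp
   qed
   thus ?thesis using d(2) x' U(2) by blast
  qed
  have const: "pot e w2 y = pot e w2 x'" if x': "x'\<in>\<Gamma>" and y: "y\<in>ball x' (d/2)" for x' y
  proof (rule has_derivative_zero_unique[of "ball x' (d/2)"])
   show "(pot e w2 has_derivative (%h. 0)) (at v within ball x' (d/2))" if v: "v\<in>ball x' (d/2)" for v
   proof -
    have "grad (pot e w2) v\<bullet>h = 0" for h
     using mollify_zero_far[OF w1(3) e(1) near[OF x' v]] mollify_zero_far[OF w2(3) e(1) near[OF x' v]] e(2)
     by (simp add: inner_point pot_1 pot_2)
    thus ?thesis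
     using has_derivative_grad[OF smoothD(1)[OF smooth_pot[of e], of v]] has_derivative_at_withinI by simp
   qed
  qed (use d y in auto)
  have "pot e w2 x = pot e w2 z"
  proof (rule connected_local_const[OF \<Gamma>(2) x z(1)])
   show "\<forall>a\<in>\<Gamma>. \<forall>\<^sub>F b in at a within \<Gamma>. pot e w2 a = pot e w2 b"
   proof
    fix a assume a: "a\<in>\<Gamma>"
    show "\<forall>\<^sub>F b in at a within \<Gamma>. pot e w2 a = pot e w2 b"
     unfolding eventually_at
    proof (intro exI[of _ "d/2"] conjI ballI impI)
     fix y assume "y\<in>\<Gamma>" "y ~= a & dist y a < d/2"
     thus "pot e w2 a = pot e w2 y" using const[OF a, of y] by (simp add: dist_commute)
    qed (use d(1) in simp)
   qed
  qed
  also have "pot e w2 z = 0"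
  proof -
   have zz: "stp e (z$1 - y$1)*mol e (z$2 - y$2)*w2 y = 0" for y
   proof (cases "y\<in>Z")
    case True
    hence "- M <= y$1" using M[OF True] component_le_norm_cart[of y 1] by linarith
    thus ?thesis using stp_0[OF e(1), of "z$1 - y$1"] z(2) by simp
   qed (simp add: w2(3))
   show ?thesis unfolding pot_def conv_def zz by simp
  qed
  finally show ?thesis .
 qed
 thus ?thesis using d(1) by (intro exI[of _ "d/4"]) auto
qed

text \<open>Indicator of a square of half side \<open>r\<close>, symmetric in point and centre.
  Integrating over all centres takes the place of a covering with bounded overlap.\<close>

definition nbx :: "real => point => point => ennreal" where
 "nbx r x p = indicator {-r..r} (x$1 - p$1)*indicator {-r..r} (x$2 - p$2)"

lemma nbx_measurable [measurable (raw)]: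
 assumes [measurable]: "f\<in>borel_measurable M" "g\<in>borel_measurable M"
 shows "(%x. nbx r (f x) (g x))\<in>borel_measurable M"
 unfolding nbx_def by measurable

lemma nbx_eq: "nbx r x p = indicator {x. \<bar>x$1 - p$1\<bar> <= r & \<bar>x$2 - p$2\<bar> <= r} x"
 by (auto simp: nbx_def indicator_def abs_le_iff)

lemma nn_integral_nbx:
 assumes r: "r > 0" shows "(nn (%p. nbx r x p)) = ennreal (4*r^2)"
proof -
 have 1: "(nn (%s. indicator {-r..r} (a - s))) = ennreal (2*r)" for a
 proof -
  have "(nn (%s. indicator {-r..r} (a - s))) = (nn (%s. indicator {a-r..a+r} s))"
   by (intro nn_integral_cong) (auto simp: indicator_def)
  thus ?thesis using r by simp
 qed
 have "(nn (%p. nbx r x p)) = ennreal (2*r)*ennreal (2*r)"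
  by (subst nn_integral_point(1)) (simp_all add: nbx_def nn_integral_cmult nn_integral_multc 1)
 thus ?thesis using r by (simp add: ennreal_mult[symmetric] power2_eq_square)
qed

text \<open>A small square that meets the strip lies near the frontier, hence near the start of a
  path in \<open>U\<close> that leaves the larger square and on which the potential vanishes. The
  inequality on squares is then integrated over the centres. Since \<open>L\<close> is proportional
  to \<open>d\<close>, the potential is of order \<open>d\<close> on the strip.\<close>

lemma strip_bound:
 assumes U: "open U" "connected U" "U \<inter> Z = {}" "frontier Z \<subseteq> closure U" "!!x. norm x > M ==> x\<in>U"
  and M: "!!y. y\<in>Z ==> norm y <= M" "M > 0"
  and d: "d > 0" and L: "L = 48*d"
 shows "EX e0>0. ALL e. 0 < e & e < e0 -->
  (nn (%x. indicator {x\<in>Z. infdist x (- Z) <= 6*d} x*ennreal ((pot e w2 x)^2))) <=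
  ennreal (1024*L^2)*(nn (%x. ennreal ((mollify e w1 x)^2 + (mollify e w2 x)^2)))"
proof -
 define S where "S = {x\<in>Z. infdist x (- Z) <= 6*d}"
 have Lp: "L > 0" using d L by simp
 have ne: "- Z ~= {}"
 proof
  assume "- Z = {}"
  hence "Z = UNIV" by auto
  thus False using Z(2) not_bounded_UNIV[where 'a = point] by simp
 qed
 have "closed {x. infdist x (- Z) <= 6*d}" by (intro closed_Collect_le continuous_intros)
 hence "Z \<inter> {x. infdist x (- Z) <= 6*d}\<in>sets borel" using Z(1) by auto
 hence [measurable]: "S\<in>sets borel" by (simp add: S_def Int_def)
 have "compact (frontier Z)" using Z(2) by (rule compact_frontier_bounded)
 \<comment> \<open>Finitely many starting points mean finitely many paths, so one positive threshold
   for \<open>e\<close> serves them all.\<close>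
 then obtain T where T: "T \<subseteq> frontier Z" "finite T" "frontier Z \<subseteq> (\<Union>b\<in>T. ball b (L/16))"
  using Lp by (elim compactE_image[of _ "frontier Z" "%b. ball b (L/16)"]) auto
 \<comment> \<open>Far enough to the left to lie outside every large square whose small square meets
   \<open>Z\<close>.\<close>
 define z where "z = pt (- (M + 2*L)) 0"
 have z1: "z$1 = - (M + 2*L)" by (simp add: z_def)
 have "\<bar>z$1\<bar> <= norm z" by (rule component_le_norm_cart)
 hence zU: "z\<in>U" using M(2) Lp by (intro U(5)) (simp add: z_def)
 have "EX g. path g & path_image g \<subseteq> U & pathfinish g = z & dist (pathstart g) b < L/16" if b: "b\<in>T" for b
 proof -
  have "b\<in>closure U" using T(1) U(4) b by auto
  then obtain y where y: "y\<in>U" "dist y b < L/16" using Lp by (meson closure_approachable divide_pos_pos zero_less_numeral)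
  have "path_connected U" using U(1,2) connected_open_path_connected by blast
  then obtain g where "path g" "path_image g \<subseteq> U" "pathstart g = y" "pathfinish g = z"
   using y(1) zU unfolding path_connected_def by blast
  thus ?thesis using y(2) by blast
 qed
 then obtain g where g: "!!b. b\<in>T ==> path (g b)" "!!b. b\<in>T ==> path_image (g b) \<subseteq> U"
  "!!b. b\<in>T ==> pathfinish (g b) = z" "!!b. b\<in>T ==> dist (pathstart (g b)) b < L/16" by metis
 have "EX e0>0. ALL e. 0 < e & e < e0 --> (\<forall>x\<in>path_image (g b). pot e w2 x = 0)" if b: "b\<in>T" for b
 proof (rule pot_zero_on_connected[OF U(1,3)])
  show "z\<in>path_image (g b)" using g(3)[OF b] pathfinish_in_path_image by metis
  show "z$1 <= - M" using Lp by (simp add: z_def)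
 qed (use g b M compact_path_image connected_path_image in auto)
 then obtain E0 where E0: "!!b. b\<in>T ==> E0 b > 0"
  "!!b e x. b\<in>T ==> 0 < e ==> e < E0 b ==> x\<in>path_image (g b) ==> pot e w2 x = 0" by metis
 define e0 where "e0 = Min (insert 1 (E0 ` T))"
 have e0: "e0 > 0" "!!b. b\<in>T ==> e0 <= E0 b" using T(2) E0(1) by (auto simp: e0_def)
 have main: "(nn (%x. indicator S x*ennreal ((pot e w2 x)^2))) <=
  ennreal (1024*L^2)*(nn (%x. ennreal ((mollify e w1 x)^2 + (mollify e w2 x)^2)))" if e: "0 < e" "e < e0" for e
 proof -
  have sm: "smooth (pot e w2)" by (rule smooth_pot)
  note [measurable] = borel_measurable_smooth[OF sm]
  have [measurable]: "mollify e w1\<in>borel_measurable borel" "mollify e w2\<in>borel_measurable borel"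
   by (intro borel_measurable_smooth smooth_conv w_integrable bsmooth_mol)+
  define G where "G x = ennreal ((mollify e w1 x)^2 + (mollify e w2 x)^2)" for x
  have [measurable]: "G\<in>borel_measurable borel" unfolding G_def by measurable
  define Q where "Q x = indicator S x*ennreal ((pot e w2 x)^2)" for x
  have [measurable]: "Q\<in>borel_measurable borel" unfolding Q_def by measurable
  have G_eq: "G x = ennreal ((pd 1 (pot e w2) x)^2 + (pd 2 (pot e w2) x)^2)" for x
   by (simp add: G_def pot_1 pot_2 add.commute)
  have local: "(nn (%x. Q x*nbx (L/4) x p)) <= ennreal (64*L^2)*(nn (%x. G x*nbx L x p))" for p
  proof (cases "\<exists>x\<in>S. \<bar>x$1 - p$1\<bar> <= L/4 & \<bar>x$2 - p$2\<bar> <= L/4")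
   case False
   hence z: "Q x*nbx (L/4) x p = 0" for x by (auto simp: Q_def nbx_eq indicator_def)
   show ?thesis unfolding z by simp
  next
   case True
   then obtain x where x: "x\<in>S" "\<bar>x$1 - p$1\<bar> <= L/4" "\<bar>x$2 - p$2\<bar> <= L/4" by blast
   obtain y where y: "y\<in>- Z" "infdist x (- Z) = dist x y"
    using infdist_attains_inf[of "- Z" x] ne Z(1) by auto
   have "closed_segment x y \<inter> frontier Z ~= {}"
    using x(1) y(1) by (intro connected_Int_frontier) (auto simp: S_def)
   then obtain b0 where b0: "b0\<in>closed_segment x y" "b0\<in>frontier Z" by blast
   have db0: "dist b0 x <= L/8"
    using segment_bound(1)[OF b0(1)] x(1) y(2) L by (simp add: S_def dist_norm norm_minus_commute)
   obtain b where b: "b\<in>T" "dist b b0 < L/16" using T(3) b0(2) by auto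
   \<comment> \<open>The distances add up: \<open>6*d = L/8\<close> to the frontier,
     \<open>L/16\<close> each for the covering and for the start of the path, and \<open>L/4\<close>
     to the centre.\<close>
   have start: "\<bar>pathstart (g b)$i - p$i\<bar> <= L/2" for i
   proof -
    have "dist (pathstart (g b)) x <= dist (pathstart (g b)) b + dist b b0 + dist b0 x"
     using dist_triangle[of "pathstart (g b)" x b] dist_triangle[of b x b0] by linarith
    hence "dist (pathstart (g b)) x <= L/4" using g(4)[OF b(1)] b(2) db0 by linarith
    hence "\<bar>pathstart (g b)$i - x$i\<bar> <= L/4"
     using component_le_norm_cart[of "pathstart (g b) - x" i] by (simp add: dist_norm)
    moreover have "\<bar>x$i - p$i\<bar> <= L/4" using x exhaust_2[of i] by auto
    ultimately show ?thesis by linarith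
   qed
   have xM: "\<bar>x$1\<bar> <= M" using M(1)[of x] component_le_norm_cart[of x 1] x(1) by (simp add: S_def)
   have "(nn (%x. ennreal ((pot e w2 x)^2)*indicator {x. \<bar>x$1 - p$1\<bar> <= L & \<bar>x$2 - p$2\<bar> <= L} x)) <=
    ennreal (64*L^2)*(nn (%x. ennreal ((pd 1 (pot e w2) x)^2 + (pd 2 (pot e w2) x)^2)
    *indicator {x. \<bar>x$1 - p$1\<bar> <= L & \<bar>x$2 - p$2\<bar> <= L} x))"
   proof (rule square_Poincare_path[OF sm Lp refl g(1)[OF b(1)] start])
    have "\<bar>z$1 - p$1\<bar> > L" using xM x(2) Lp unfolding z1 by linarith
    thus "pathfinish (g b) \<notin> {x. \<bar>x$1 - p$1\<bar> <= L & \<bar>x$2 - p$2\<bar> <= L}" using g(3)[OF b(1)] by simp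
    show "pot e w2 x = 0" if "x\<in>path_image (g b)" for x
     using E0(2)[OF b(1) e(1) _ that] e(2) e0(2)[OF b(1)] by simp
   qed
   hence "(nn (%x. ennreal ((pot e w2 x)^2)*nbx L x p)) <= ennreal (64*L^2)*(nn (%x. G x*nbx L x p))"
    unfolding nbx_eq G_eq .
   moreover have "(nn (%x. Q x*nbx (L/4) x p)) <= (nn (%x. ennreal ((pot e w2 x)^2)*nbx L x p))"
    using Lp by (intro nn_integral_mono) (auto simp: Q_def nbx_eq indicator_def)
   ultimately show ?thesis by (rule order_trans[rotated])
  qed
  \<comment> \<open>A small square has area \<open>L^2/4\<close>, a large one \<open>4*L^2\<close>;
    the ratio 16 times 64 gives 1024.\<close>
  have "(nn (%x. Q x))*ennreal (L^2/4) = (nn (%x. nn (%p. Q x*nbx (L/4) x p)))"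
   using nn_integral_nbx[of "L/4"] Lp
   by (simp add: nn_integral_cmult nn_integral_multc power_divide)
  also have "... = (nn (%p. nn (%x. Q x*nbx (L/4) x p)))"
   by (rule lborel_pair.Fubini') measurable
  also have "... <= (nn (%p. ennreal (64*L^2)*(nn (%x. G x*nbx L x p))))"
   by (intro nn_integral_mono local)
  also have "... = ennreal (64*L^2)*(nn (%p. nn (%x. G x*nbx L x p)))"
   by (rule nn_integral_cmult) measurable
  also have "(nn (%p. nn (%x. G x*nbx L x p))) = (nn (%x. nn (%p. G x*nbx L x p)))"
   by (rule lborel_pair.Fubini') measurable
  also have "... = (nn (%x. G x))*ennreal (4*L^2)"
   using nn_integral_nbx[OF Lp] by (simp add: nn_integral_cmult nn_integral_multc)
  finally have fin: "(nn (%x. Q x))*ennreal (L^2/4) <= ennreal (64*L^2)*((nn (%x. G x))*ennreal (4*L^2))" .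
  have one: "ennreal (L^2/4)*ennreal (4/L^2) = 1" using Lp by (simp add: ennreal_mult[symmetric])
  have "(nn (%x. Q x)) = (nn (%x. Q x))*(ennreal (L^2/4)*ennreal (4/L^2))" unfolding one by simp
  also have "... = ((nn (%x. Q x))*ennreal (L^2/4))*ennreal (4/L^2)" by (simp only: mult.assoc)
  also have "... <= (ennreal (64*L^2)*((nn (%x. G x))*ennreal (4*L^2)))*ennreal (4/L^2)"
   by (rule mult_right_mono[OF fin]) simp
  also have "... = (ennreal (64*L^2)*ennreal (4*L^2)*ennreal (4/L^2))*(nn (%x. G x))" by (simp only: mult_ac)
  also have "ennreal (64*L^2)*ennreal (4*L^2)*ennreal (4/L^2) = ennreal (1024*L^2)"
   using Lp by (simp add: ennreal_mult[symmetric] power2_eq_square)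
  finally show ?thesis unfolding Q_def G_def .
 qed
 show ?thesis using e0(1) main unfolding S_def by blast
qed

text \<open>Testing rotation freeness with \<open>\<eta>\<close> times the potential leaves the
  energy weighted by \<open>\<eta>\<close> and terms with derivatives of \<open>\<eta>\<close>.
  These live on the strip, where the norm of the potential is at most \<open>32*L*N\<close> with
  \<open>L = 48*d\<close>; multiplied by \<open>C/d\<close> this is \<open>1536*C*N\<close>, free of
  \<open>d\<close>.\<close>

lemma energy_bound:
 assumes U: "open U" "connected U" "U \<inter> Z = {}" "frontier Z \<subseteq> closure U" "!!x. norm x > M ==> x\<in>U"
  and M: "!!y. y\<in>Z ==> norm y <= M" "M > 0"
  and rotfree: "!!\<psi>. test_function Z \<psi> ==> l2_inner Z w1 (pd 2 \<psi>) - l2_inner Z w2 (pd 1 \<psi>) = 0"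
  and N: "N = sqrt ((l2_norm Z w1)^2 + (l2_norm Z w2)^2)"
  and C: "C > 0" and d: "d > 0" and S: "S = {x\<in>Z. infdist x (- Z) <= 6*d}"
  and \<eta>: "test_function Z \<eta>" "!!x. 0 <= \<eta> x & \<eta> x <= 1" "!!x i. \<bar>pd i \<eta> x\<bar> <= C/d*indicator S x"
 shows "\<bar>l2_inner Z (%x. \<eta> x*w1 x) w1 + l2_inner Z (%x. \<eta> x*w2 x) w2\<bar> <=
  C*1536*N*(l2_norm Z (%x. indicator S x*w1 x) + l2_norm Z (%x. indicator S x*w2 x))"
proof -
 define L where "L = 48*d"
 have "closed {x. infdist x (- Z) <= 6*d}" by (intro closed_Collect_le continuous_intros)
 hence "Z \<inter> {x. infdist x (- Z) <= 6*d}\<in>sets borel" using Z(1) by auto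
 hence Sm [measurable]: "S\<in>sets borel" by (simp add: S Int_def)
 note [measurable] = w1(2) w2(2)
 have N0: "N >= 0" by (simp add: N)
 obtain e1 where e1: "e1 > 0" "!!e. 0 < e ==> e < e1 ==>
  (nn (%x. indicator S x*ennreal ((pot e w2 x)^2))) <=
  ennreal (1024*L^2)*(nn (%x. ennreal ((mollify e w1 x)^2 + (mollify e w2 x)^2)))"
  using strip_bound[OF U M d L_def] unfolding S by blast
 have SL: "(%x. indicator S x*w1 x)\<in>L2_space Z" "(%x. indicator S x*w2 x)\<in>L2_space Z"
 proof -
  have m: "(%x. indicator S x*w1 x)\<in>borel_measurable (lebesgue_on Z)" "(%x. indicator S x*w2 x)\<in>borel_measurable (lebesgue_on Z)"
   by (intro borel_lebesgue_on; measurable)+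
  show "(%x. indicator S x*w1 x)\<in>L2_space Z" by (rule L2_dominated(1)[OF w1(1) m(1), of 1]) (auto simp: indicator_def)
  show "(%x. indicator S x*w2 x)\<in>L2_space Z" by (rule L2_dominated(1)[OF w2(1) m(2), of 1]) (auto simp: indicator_def)
 qed
 have \<eta>m [measurable]: "\<eta>\<in>borel_measurable borel" by (rule borel_measurable_smooth[OF test_function_smooth[OF \<eta>(1)]])
 have dm [measurable]: "pd i \<eta>\<in>borel_measurable borel" for i
  by (rule borel_measurable_smooth[OF smoothD(2)[OF test_function_smooth[OF \<eta>(1)]]])
 have \<eta>ab: "\<bar>\<eta> x\<bar> <= 1" for x using \<eta>(2)[of x] by simp
 have \<eta>w: "(%x. \<eta> x*w1 x)\<in>L2_space Z" "l2_norm Z (%x. \<eta> x*w1 x) <= 1*l2_norm Z w1"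
  "(%x. \<eta> x*w2 x)\<in>L2_space Z" "l2_norm Z (%x. \<eta> x*w2 x) <= 1*l2_norm Z w2"
 proof -
  have m: "(%x. \<eta> x*w1 x)\<in>borel_measurable (lebesgue_on Z)" "(%x. \<eta> x*w2 x)\<in>borel_measurable (lebesgue_on Z)"
   by (intro borel_lebesgue_on; measurable)+
  have le: "\<bar>\<eta> x * v\<bar> <= 1*\<bar>v\<bar>" for x v using mult_right_mono[OF \<eta>ab[of x], of "\<bar>v\<bar>"] by (simp add: abs_mult)
  show "(%x. \<eta> x*w1 x)\<in>L2_space Z" "l2_norm Z (%x. \<eta> x*w1 x) <= 1*l2_norm Z w1"
   by (rule L2_dominated[OF w1(1) m(1) _ le]; simp)+
  show "(%x. \<eta> x*w2 x)\<in>L2_space Z" "l2_norm Z (%x. \<eta> x*w2 x) <= 1*l2_norm Z w2"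
   by (rule L2_dominated[OF w2(1) m(2) _ le]; simp)+
 qed
 define \<sigma> where "\<sigma> = l2_norm Z (%x. indicator S x*w1 x) + l2_norm Z (%x. indicator S x*w2 x)"
 define A where "A = l2_inner Z (%x. \<eta> x*w1 x) w1 + l2_inner Z (%x. \<eta> x*w2 x) w2"
 \<comment> \<open>The mollification parameter tends to zero at fixed \<open>d\<close>;
   \<open>\<kappa>\<close> absorbs the mollification error.\<close>
 have "\<bar>A\<bar> <= C*1536*N*\<sigma> + \<kappa>" if \<kappa>: "\<kappa> > 0" for \<kappa>
 proof -
  define k where "k = \<kappa>/(l2_norm Z w1 + l2_norm Z w2 + 1)"
  have den: "l2_norm Z w1 + l2_norm Z w2 + 1 > 0" using w1(1) w2(1) by (intro add_nonneg_pos add_nonneg_nonneg) auto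
  hence k: "k > 0" using \<kappa> by (simp add: k_def)
  obtain e2 where e2: "e2 > 0" "!!e. 0 < e ==> e < e2 ==> l2_norm Z (mollify e w1 - w1) < k"
   using mollify_tendsto[OF Z w1 k] by blast
  obtain e3 where e3: "e3 > 0" "!!e. 0 < e ==> e < e3 ==> l2_norm Z (mollify e w2 - w2) < k"
   using mollify_tendsto[OF Z w2 k] by blast
  define e where "e = min e1 (min e2 e3)/2"
  have e: "0 < e" "e < e1" "e < e2" "e < e3" using e1(1) e2(1) e3(1) by (auto simp: e_def)
  define q where "q = pot e w2"
  have sq: "smooth q" unfolding q_def by (rule smooth_pot)
  note qm [measurable] = borel_measurable_smooth[OF sq]
  have mL: "mollify e w1\<in>L2_space Z" "mollify e w2\<in>L2_space Z"
   by (intro mollify_in_L2[OF Z] w_integrable)+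
  have mm [measurable]: "mollify e w1\<in>borel_measurable borel" "mollify e w2\<in>borel_measurable borel"
   by (intro borel_measurable_smooth smooth_conv w_integrable bsmooth_mol)+
  have "(nn (%x. ennreal ((mollify e w1 x)^2 + (mollify e w2 x)^2))) =
   (nn (%x. ennreal ((mollify e w1 x)^2))) + (nn (%x. ennreal ((mollify e w2 x)^2)))"
   by (subst nn_integral_add[symmetric]) auto
  also have "... <= ennreal ((l2_norm Z w1)^2) + ennreal ((l2_norm Z w2)^2)"
  proof -
   have b: "(nn (%x. ennreal ((mollify e u x)^2))) <= ennreal ((l2_norm Z u)^2)"
    if u: "u\<in>L2_space Z" "u\<in>borel_measurable borel" and u0: "!!x. x \<notin> Z ==> u x = 0" for u :: scalar_field
   proof -
    have "integrable lborel u" by (rule L2_integrable_lborel(1)[OF Z u u0])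
    moreover have "integrable lborel (%x. (u x)^2)" by (rule L2_integrable_lborel(2)[OF Z u u0])
    moreover have "(nn (%x. ennreal ((u x)^2))) = ennreal ((l2_norm Z u)^2)" by (rule L2_integrable_lborel(3)[OF Z u u0])
    ultimately show ?thesis using mollify_L2[OF e(1), of u] by simp
   qed
   show ?thesis by (rule add_mono[OF b[OF w1] b[OF w2]])
  qed
  also have "... = ennreal (N^2)" by (simp add: N)
  finally have G: "(nn (%x. ennreal ((mollify e w1 x)^2 + (mollify e w2 x)^2))) <= ennreal (N^2)" .
  have qS: "(%x. indicator S x*q x)\<in>L2_space Z" "l2_norm Z (%x. indicator S x*q x) <= 32*L*N"
  proof -
   have qm: "(%x. indicator S x*q x)\<in>borel_measurable (lebesgue_on Z)" by (intro borel_lebesgue_on; measurable)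
   have "(\<integral>\<^sup>+ x. ennreal ((norm (indicator S x*q x))^2) \<partial>lebesgue_on Z) <= (nn (%x. ennreal ((indicator S x*q x)^2)))"
    by (rule nn_integral_lebesgue_on_lborel(1)[OF sets_lebesgue_open[OF Z(1)]]) measurable
   also have "... = (nn (%x. indicator S x*ennreal ((q x)^2)))"
    by (intro nn_integral_cong) (auto simp: indicator_def)
   also have "... <= ennreal (1024*L^2)*ennreal (N^2)"
    using e1(2)[OF e(1,2)] unfolding q_def by (rule order_trans) (intro mult_left_mono G, simp)
   also have "... = ennreal ((32*L*N)^2)" by (simp add: ennreal_mult[symmetric] power_mult_distrib)
   finally have le: "(\<integral>\<^sup>+ x. ennreal ((norm (indicator S x*q x))^2) \<partial>lebesgue_on Z) <= ennreal ((32*L*N)^2)" .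
   have "0 <= 32*L*N" using d N0 by (simp add: L_def)
   from L2_space_nn_integral[OF qm le this]
   show "(%x. indicator S x*q x)\<in>L2_space Z" "l2_norm Z (%x. indicator S x*q x) <= 32*L*N" .
  qed
  have test: "test_function Z (%x. \<eta> x*q x)" by (rule test_function_mult[OF \<eta>(1) sq])
  have pd: "pd i (%x. \<eta> x*q x) = (%x. pd i \<eta> x*q x) + (%x. \<eta> x*pd i q x)" for i
   using pd_mult[OF smoothD(1)[OF test_function_smooth[OF \<eta>(1)]] smoothD(1)[OF sq]] by auto
  have p2: "(%x. \<eta> x*pd 2 q x) = (%x. \<eta> x*mollify e w1 x)"
   and p1: "(%x. \<eta> x*pd 1 q x) = (-1)*\<^sub>R (%x. \<eta> x*mollify e w2 x)"
   by (auto simp: q_def pot_1 pot_2)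
  have \<eta>m1: "(%x. \<eta> x*mollify e w1 x)\<in>L2_space Z" "(%x. \<eta> x*mollify e w2 x)\<in>L2_space Z"
  proof -
   have m: "(%x. \<eta> x*mollify e w1 x)\<in>borel_measurable (lebesgue_on Z)" "(%x. \<eta> x*mollify e w2 x)\<in>borel_measurable (lebesgue_on Z)"
    by (intro borel_lebesgue_on; measurable)+
   have le: "\<bar>\<eta> x * v\<bar> <= 1*\<bar>v\<bar>" for x v using mult_right_mono[OF \<eta>ab[of x], of "\<bar>v\<bar>"] by (simp add: abs_mult)
   show "(%x. \<eta> x*mollify e w1 x)\<in>L2_space Z" by (rule L2_dominated(1)[OF mL(1) m(1) _ le]) simp
   show "(%x. \<eta> x*mollify e w2 x)\<in>L2_space Z" by (rule L2_dominated(1)[OF mL(2) m(2) _ le]) simp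
  qed
  have gq: "(%x. pd i \<eta> x*q x)\<in>L2_space Z"
   "l2_norm Z (%x. pd i \<eta> x*q x) <= C/d*l2_norm Z (%x. indicator S x*q x)" for i
  proof -
   have le: "\<bar>pd i \<eta> x*q x\<bar> <= C/d*\<bar>indicator S x*q x\<bar>" for x
    using mult_right_mono[OF \<eta>(3)[of i x], of "\<bar>q x\<bar>"] by (simp add: abs_mult mult.assoc)
   show "(%x. pd i \<eta> x*q x)\<in>L2_space Z"
    "l2_norm Z (%x. pd i \<eta> x*q x) <= C/d*l2_norm Z (%x. indicator S x*q x)"
    by (rule L2_dominated[OF qS(1) _ _ le]; use C d in \<open>auto intro!: borel_lebesgue_on\<close>)+
  qed
  have bnd: "\<bar>l2_inner Z w (%x. pd i \<eta> x*q x)\<bar> <= C*1536*N*l2_norm Z (%x. indicator S x*w x)"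
   if sL: "(%x. indicator S x*w x)\<in>L2_space Z" for w :: scalar_field and i
  proof -
   have sup: "indicator S x*pd i \<eta> x = pd i \<eta> x" for x
    using \<eta>(3)[of i x] by (auto simp: indicator_def split: if_splits)
   have "l2_inner Z w (%x. pd i \<eta> x*q x) = l2_inner Z (%x. indicator S x*w x) (%x. pd i \<eta> x*q x)"
    unfolding l2_inner_def
   proof (rule Bochner_Integration.integral_cong[OF refl])
    fix x
    have "w x*(pd i \<eta> x*q x) = w x*((indicator S x*pd i \<eta> x)*q x)" unfolding sup ..
    thus "w x\<bullet>(pd i \<eta> x*q x) = (indicator S x*w x)\<bullet>(pd i \<eta> x*q x)"
     by (simp add: mult_ac)
   qed
   also have "\<bar>...\<bar> <= l2_norm Z (%x. indicator S x*w x)*l2_norm Z (%x. pd i \<eta> x*q x)"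
    by (rule l2_Cauchy_Schwarz[OF sL gq(1)])
   also have "... <= l2_norm Z (%x. indicator S x*w x)*(C/d*(32*L*N))"
    using sL C d by (intro mult_left_mono order_trans[OF gq(2)] qS(2)) auto
   also have "C/d*(32*L*N) = C*1536*N" using d by (simp add: L_def)
   finally show ?thesis by (simp add: mult.commute)
  qed
  have "l2_inner Z w1 (pd 2 (%x. \<eta> x*q x)) = l2_inner Z w1 (%x. pd 2 \<eta> x*q x) + l2_inner Z w1 (%x. \<eta> x*mollify e w1 x)"
   unfolding pd p2 using w1(1) gq(1) \<eta>m1 by (simp only: l2.add_right)
  moreover have "l2_inner Z w2 (pd 1 (%x. \<eta> x*q x)) = l2_inner Z w2 (%x. pd 1 \<eta> x*q x) - l2_inner Z w2 (%x. \<eta> x*mollify e w2 x)"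
   unfolding pd p1 using w2(1) gq(1) \<eta>m1 by (simp only: l2.add_right l2.scale_right l2.closed)
  ultimately have ident: "l2_inner Z w1 (%x. \<eta> x*mollify e w1 x) + l2_inner Z w2 (%x. \<eta> x*mollify e w2 x) =
   l2_inner Z w2 (%x. pd 1 \<eta> x*q x) - l2_inner Z w1 (%x. pd 2 \<eta> x*q x)"
   using rotfree[OF test] by linarith
  have sw: "l2_inner Z w (%x. \<eta> x * v x) = l2_inner Z (%x. \<eta> x*w x) v" for w v :: scalar_field
   by (simp add: l2_inner_def mult_ac)
  have d1: "\<bar>l2_inner Z (%x. \<eta> x*w1 x) (mollify e w1) - l2_inner Z (%x. \<eta> x*w1 x) w1\<bar> <= l2_norm Z w1*k"
  proof -
   have "l2_inner Z (%x. \<eta> x*w1 x) (mollify e w1) - l2_inner Z (%x. \<eta> x*w1 x) w1 = l2_inner Z (%x. \<eta> x*w1 x) (mollify e w1 - w1)"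
    by (rule l2.diff_right[symmetric]) (use mL w1 \<eta>w in auto)
   also have "\<bar>...\<bar> <= l2_norm Z (%x. \<eta> x*w1 x)*l2_norm Z (mollify e w1 - w1)"
    by (rule l2_Cauchy_Schwarz[OF \<eta>w(1) l2.closed(3)[OF mL(1) w1(1)]])
   also have "... <= l2_norm Z w1*k"
    using \<eta>w(2) e2(2)[OF e(1,3)] w1(1) l2_norm_nonneg[OF l2.closed(3)[OF mL(1) w1(1)]] by (intro mult_mono) auto
   finally show ?thesis .
  qed
  have d2: "\<bar>l2_inner Z (%x. \<eta> x*w2 x) (mollify e w2) - l2_inner Z (%x. \<eta> x*w2 x) w2\<bar> <= l2_norm Z w2*k"
  proof -
   have "l2_inner Z (%x. \<eta> x*w2 x) (mollify e w2) - l2_inner Z (%x. \<eta> x*w2 x) w2 = l2_inner Z (%x. \<eta> x*w2 x) (mollify e w2 - w2)"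
    by (rule l2.diff_right[symmetric]) (use mL w2 \<eta>w in auto)
   also have "\<bar>...\<bar> <= l2_norm Z (%x. \<eta> x*w2 x)*l2_norm Z (mollify e w2 - w2)"
    by (rule l2_Cauchy_Schwarz[OF \<eta>w(3) l2.closed(3)[OF mL(2) w2(1)]])
   also have "... <= l2_norm Z w2*k"
    using \<eta>w(4) e3(2)[OF e(1,4)] w2(1) l2_norm_nonneg[OF l2.closed(3)[OF mL(2) w2(1)]] by (intro mult_mono) auto
   finally show ?thesis .
  qed
  have "l2_norm Z w1*k + l2_norm Z w2*k <= (l2_norm Z w1 + l2_norm Z w2 + 1)*k"
   using k by (simp add: algebra_simps)
  also have "... = \<kappa>" using den by (simp add: k_def)
  finally have kk: "l2_norm Z w1*k + l2_norm Z w2*k <= \<kappa>" .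
  have "C*1536*N*\<sigma> = C*1536*N*l2_norm Z (%x. indicator S x*w1 x) + C*1536*N*l2_norm Z (%x. indicator S x*w2 x)"
   by (simp add: \<sigma>_def distrib_left)
  thus ?thesis
   using d1 d2 kk ident bnd[OF SL(1), of 2] bnd[OF SL(2), of 1] unfolding A_def sw by linarith
 qed
 hence "\<bar>A\<bar> <= C*1536*N*\<sigma>" by (rule field_le_epsilon)
 thus ?thesis unfolding A_def \<sigma>_def .
qed

end

lemma l2_indicator_tendsto_zero:
 fixes u :: scalar_field
 assumes u: "u\<in>L2_space Z" "u\<in>borel_measurable borel" and S: "!!n. S n\<in>sets borel"
  and lim: "!!x. x\<in>Z ==> \<forall>\<^sub>F n in sequentially. x \<notin> S n"
 shows "(%n. l2_norm Z (%x. indicator (S n) x*u x)) \<longlonglongrightarrow> 0"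
proof -
 have "(%n. LINT x|lebesgue_on Z. (indicator (S n) x*u x)*(indicator (S n) x*u x)) \<longlonglongrightarrow> (LINT x|lebesgue_on Z. 0)"
 proof (rule integral_dominated_convergence[where w = "%x. (norm (u x))^2"])
  show "(%x. (indicator (S n) x*u x)*(indicator (S n) x*u x))\<in>borel_measurable (lebesgue_on Z)" for n
  proof -
   note [measurable] = S u(2)
   show ?thesis by (intro borel_lebesgue_on) measurable
  qed
  show "AE x in lebesgue_on Z. (%n. (indicator (S n) x*u x)*(indicator (S n) x*u x)) \<longlonglongrightarrow> 0"
  proof (rule AE_I2)
   fix x assume "x\<in>space (lebesgue_on Z)"
   hence "\<forall>\<^sub>F n in sequentially. x \<notin> S n" using lim by (simp add: space_restrict_space)
   hence "\<forall>\<^sub>F n in sequentially. (indicator (S n) x*u x)*(indicator (S n) x*u x) = 0"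
    by eventually_elim simp
   thus "(%n. (indicator (S n) x*u x)*(indicator (S n) x*u x)) \<longlonglongrightarrow> 0" by (rule tendsto_eventually)
  qed
  show "AE x in lebesgue_on Z. norm ((indicator (S n) x*u x)*(indicator (S n) x*u x)) <= (norm (u x))^2" for n
   by (rule AE_I2) (auto simp: indicator_def power2_eq_square)
 qed (use L2_spaceD(2)[OF u(1)] in auto)
 thus ?thesis unfolding l2_norm_def l2_inner_def inner_real_def by (auto intro!: tendsto_eq_intros)
qed

text \<open>As \<open>d\<close> tends to zero the strips shrink to the empty set, so both the bound
  for the weighted energy and the energy lost to the cut-off vanish. Orthogonality to all smooth
  gradients stands for zero divergence with zero normal component; the connected exterior
  \<open>U\<close> excludes the harmonic fields that holes would produce.\<close>

theorem Helmholtz_zero: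
 assumes Z: "open Z" "bounded Z"
  and U: "open U" "connected U" "U \<inter> Z = {}" "frontier Z \<subseteq> closure U" "!!x. norm x > M ==> x\<in>U"
  and w: "(w :: vector_field)\<in>L2_space Z"
  and divfree: "!!\<phi>. smooth \<phi> ==> l2_inner Z w (grad \<phi>) = 0"
  and rotfree: "!!\<psi>. test_function Z \<psi> ==> l2_inner Z w (curl \<psi>) = 0"
 shows "l2_norm Z w = 0"
proof -
 obtain w1 where w1: "w1\<in>borel_measurable borel" "!!x. x \<notin> Z ==> w1 x = 0" "w1\<in>L2_space Z"
  "AE x in lebesgue_on Z. w x$1 = w1 x" by (rule borel_representative[OF Z L2_component[OF w, of 1]]) (rule that)
 obtain w2 where w2: "w2\<in>borel_measurable borel" "!!x. x \<notin> Z ==> w2 x = 0" "w2\<in>L2_space Z"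
  "AE x in lebesgue_on Z. w x$2 = w2 x" by (rule borel_representative[OF Z L2_component[OF w, of 2]]) (rule that)
 have inner: "l2_inner Z w v = l2_inner Z w1 (%x. v x$1) + l2_inner Z w2 (%x. v x$2)" if v: "v\<in>L2_space Z" for v
  unfolding l2_inner_components[OF w v]
  by (intro arg_cong2[where f = "(+)"] l2_inner_cong_AE L2_component w v w1 w2 AE_I2[OF refl])
 define N where "N = sqrt ((l2_norm Z w1)^2 + (l2_norm Z w2)^2)"
 have c1: "l2_inner Z w1 (%x. w x$1) = l2_inner Z w1 w1" "l2_inner Z w2 (%x. w x$2) = l2_inner Z w2 w2"
  by (intro l2_inner_cong_AE L2_component w w1 w2 AE_I2[OF refl])+
 have N2: "N^2 = (l2_norm Z w1)^2 + (l2_norm Z w2)^2" by (simp add: N_def)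
 have wN: "(l2_norm Z w)^2 = N^2"
  unfolding l2_norm_sq[OF w] inner[OF w] c1 N2 l2_norm_sq[OF w1(3)] l2_norm_sq[OF w2(3)] ..
 interpret div_free_extension Z w1 w2
 proof
  show "l2_inner Z w1 (pd 1 \<phi>) + l2_inner Z w2 (pd 2 \<phi>) = 0" if "smooth \<phi>" for \<phi>
   using divfree[OF that] inner[OF L2_smooth(2)[OF Z that]] by simp
 qed (use Z w1 w2 in auto)
 have rf: "l2_inner Z w1 (pd 2 \<psi>) - l2_inner Z w2 (pd 1 \<psi>) = 0" if t: "test_function Z \<psi>" for \<psi>
 proof -
  have L: "pd 1 \<psi>\<in>L2_space Z" by (rule L2_test(4)[OF Z t])
  have "l2_inner Z w2 (%x. - pd 1 \<psi> x) = - l2_inner Z w2 (pd 1 \<psi>)" by (simp add: l2_inner_def)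
  thus ?thesis using rotfree[OF t] inner[OF L2_test(3)[OF Z t]] by (simp add: curl_def)
 qed
 obtain M1 where M1: "!!x. x\<in>Z ==> norm x <= M1" using Z(2) by (auto simp: bounded_iff)
 define M' where "M' = max 1 (max M M1)"
 have M': "!!x. norm x > M' ==> x\<in>U" "!!y. y\<in>Z ==> norm y <= M'" "M' > 0"
  using U(5) M1 by (force simp: M'_def)+
 obtain C where C: "C > 0" and cut: "!!Z d. open Z ==> bounded Z ==> d > 0 ==> EX \<eta>. test_function Z \<eta> & (ALL x. 0 <= \<eta> x & \<eta> x <= 1) &
   (ALL x. infdist x (- Z) > 6*d --> \<eta> x = 1) &
   (ALL x i. \<bar>pd i \<eta> x\<bar> <= C/d*indicator {x\<in>Z. infdist x (- Z) <= 6*d} x)"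
  by (rule exists_cutoff, rule that)
 define d where "d n = 1/real (Suc n)" for n
 have d0: "d n > 0" for n by (simp add: d_def)
 have dl: "d \<longlonglongrightarrow> 0" unfolding d_def by (rule LIMSEQ_Suc[OF lim_1_over_n])
 define S where "S n = {x\<in>Z. infdist x (- Z) <= 6*d n}" for n
 have "closed {x. infdist x (- Z) <= 6*d n}" for n by (intro closed_Collect_le continuous_intros)
 hence "Z \<inter> {x. infdist x (- Z) <= 6*d n}\<in>sets borel" for n using Z(1) by auto
 hence Sm: "S n\<in>sets borel" for n by (simp add: S_def Int_def)
 have Sl: "\<forall>\<^sub>F n in sequentially. x \<notin> S n" if x: "x\<in>Z" for x
 proof -
  have ne: "- Z ~= {}"
  proof
   assume "- Z = {}"
   hence "Z = UNIV" by auto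
   thus False using Z(2) not_bounded_UNIV[where 'a = point] by simp
  qed
  have "infdist x (- Z) > 0"
   using x Z(1) ne by (metis ComplD closed_Compl in_closed_iff_infdist_zero infdist_nonneg less_eq_real_def)
  hence "\<forall>\<^sub>F n in sequentially. d n < infdist x (- Z)/6" by (intro order_tendstoD(2)[OF dl]) simp
  thus ?thesis by eventually_elim (simp add: S_def)
 qed
 define \<sigma>1 where "\<sigma>1 n = l2_norm Z (%x. indicator (S n) x*w1 x)" for n
 define \<sigma>2 where "\<sigma>2 n = l2_norm Z (%x. indicator (S n) x*w2 x)" for n
 have s1: "\<sigma>1 \<longlonglongrightarrow> 0" unfolding \<sigma>1_def by (rule l2_indicator_tendsto_zero[OF w1(1,2) Sm Sl])
 have s2: "\<sigma>2 \<longlonglongrightarrow> 0" unfolding \<sigma>2_def by (rule l2_indicator_tendsto_zero[OF w2(1,2) Sm Sl])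
 have "N^2 <= C*1536*N*(\<sigma>1 n + \<sigma>2 n) + (\<sigma>1 n)^2 + (\<sigma>2 n)^2" for n
 proof -
  obtain \<eta> where \<eta>: "test_function Z \<eta>" "!!x. 0 <= \<eta> x & \<eta> x <= 1" "!!x. infdist x (- Z) > 6*d n ==> \<eta> x = 1"
   "!!x i. \<bar>pd i \<eta> x\<bar> <= C/d n*indicator (S n) x"
   using cut[OF Z d0[of n]] unfolding S_def by blast
  have eb: "\<bar>l2_inner Z (%x. \<eta> x*w1 x) w1 + l2_inner Z (%x. \<eta> x*w2 x) w2\<bar> <= C*1536*N*(\<sigma>1 n + \<sigma>2 n)"
   unfolding \<sigma>1_def \<sigma>2_def
   by (rule energy_bound[OF U(1-4) M'(1,2,3) rf N_def C d0 S_def \<eta>(1,2,4)])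
  note [measurable] = Sm borel_measurable_smooth[OF test_function_smooth[OF \<eta>(1)]]
  \<comment> \<open>Outside the strip \<open>\<eta>\<close> is 1, so the cut-off loses at most the
    energy on the strip.\<close>
  have part: "l2_inner Z u u - l2_inner Z (%x. \<eta> x*u x) u <= (l2_norm Z (%x. indicator (S n) x*u x))^2"
   if um [measurable]: "u\<in>borel_measurable borel" and u: "u\<in>L2_space Z" for u :: scalar_field
  proof -
   have m: "(%x. indicator (S n) x*u x)\<in>borel_measurable (lebesgue_on Z)" "(%x. \<eta> x*u x)\<in>borel_measurable (lebesgue_on Z)"
    by (intro borel_lebesgue_on; measurable)+
   have le: "\<bar>\<eta> x * v\<bar> <= 1*\<bar>v\<bar>" for x v using \<eta>(2)[of x] mult_right_mono[of "\<bar>\<eta> x\<bar>" 1 "\<bar>v\<bar>"] by (simp add: abs_mult)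
   have L: "(%x. indicator (S n) x*u x)\<in>L2_space Z" by (rule L2_dominated(1)[OF u m(1), of 1]) (auto simp: indicator_def)
   have Le: "(%x. \<eta> x*u x)\<in>L2_space Z" by (rule L2_dominated(1)[OF u m(2) _ le]) simp
   have "l2_inner Z u u - l2_inner Z (%x. \<eta> x*u x) u = (LINT x|lebesgue_on Z. u x\<bullet>u x - (\<eta> x*u x)\<bullet>u x)"
    unfolding l2_inner_def by (rule Bochner_Integration.integral_diff[symmetric]) (intro integrable_inner_L2 u Le)+
   also have "... <= (LINT x|lebesgue_on Z. (indicator (S n) x*u x)\<bullet>(indicator (S n) x*u x))"
   proof (rule integral_mono)
    fix x assume "x\<in>space (lebesgue_on Z)"
    hence x: "x\<in>Z" by (simp add: space_restrict_space)
    show "u x\<bullet>u x - (\<eta> x*u x)\<bullet>u x <= (indicator (S n) x*u x)\<bullet>(indicator (S n) x*u x)"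
    proof (cases "x\<in>S n")
     case True
     have "0 <= \<eta> x*(u x*u x)" using \<eta>(2)[of x] by simp
     thus ?thesis using True by (simp add: mult.assoc)
    next
     case False
     hence "\<eta> x = 1" using x \<eta>(3)[of x] by (simp add: S_def)
     thus ?thesis by simp
    qed
   qed (intro Bochner_Integration.integrable_diff integrable_inner_L2 u Le L)+
   also have "... = (l2_norm Z (%x. indicator (S n) x*u x))^2" unfolding l2_norm_sq[OF L] l2_inner_def ..
   finally show ?thesis .
  qed
  have p1: "(l2_norm Z w1)^2 - l2_inner Z (%x. \<eta> x*w1 x) w1 <= (\<sigma>1 n)^2"
   using part[OF w1(2,1)] unfolding l2_norm_sq[OF w1(1)] \<sigma>1_def .
  have p2: "(l2_norm Z w2)^2 - l2_inner Z (%x. \<eta> x*w2 x) w2 <= (\<sigma>2 n)^2"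
   using part[OF w2(2,1)] unfolding l2_norm_sq[OF w2(1)] \<sigma>2_def .
  show ?thesis using p1 p2 eb N2 by linarith
 qed
 moreover have "(%n. C*1536*N*(\<sigma>1 n + \<sigma>2 n) + (\<sigma>1 n)^2 + (\<sigma>2 n)^2) \<longlonglongrightarrow> 0"
  using s1 s2 by (auto intro!: tendsto_eq_intros)
 ultimately have "N^2 <= 0" by (intro LIMSEQ_le_const[of _ 0]) auto
 thus ?thesis using wN by simp
qed

subsection \<open>Star-shaped elements and polygons\<close>

lemma nn_integral_affine:
 fixes f :: "point => ennreal"
 assumes [measurable]: "f\<in>borel_measurable borel" and c: "c ~= 0"
 shows "(nn (%x. f x)) = ennreal (c^2)*(nn (%x. f (t + c*\<^sub>R x)))"
 by (subst lborel_affine[OF c, of t]) (simp add: nn_integral_density nn_integral_distr nn_integral_cmult)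

lemma segment_grad_bound:
 assumes \<phi>: "smooth \<phi>"
 shows "ennreal ((\<phi> y - \<phi> x)^2) <= ennreal ((norm (y - x))^2) *
  (nn (%t. ennreal ((norm (grad \<phi> (x + t*\<^sub>R (y - x))))^2)*indicator {0..1} t))"
proof -
 define G where "G t = grad \<phi> (x + t*\<^sub>R (y - x))" for t :: real
 have cG: "continuous_on S G" for S
  unfolding G_def by (rule continuous_on_compose2[OF continuous_grad(1)[OF \<phi>] _ subset_UNIV]) (intro continuous_intros)
 have d: "\<phi> differentiable (at z)" for z using smoothD(1)[OF \<phi>] .
 have der: "((%t. \<phi> (x + t*\<^sub>R (y - x))) has_vector_derivative G t\<bullet>(y - x)) (at t within {0..1})" for t
 proof -
  have "((%s. x + s*\<^sub>R (y - x)) has_derivative (%h. h*\<^sub>R (y - x))) (at t)"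
   by (auto intro!: derivative_eq_intros)
  from has_derivative_compose[OF this has_derivative_grad[OF d]]
  have "((%s. \<phi> (x + s*\<^sub>R (y - x))) has_derivative (%h. h*\<^sub>R (G t\<bullet>(y - x)))) (at t)"
   by (simp add: G_def)
  thus ?thesis unfolding has_vector_derivative_def by (rule has_derivative_at_withinI)
 qed
 have "((%t. G t\<bullet>(y - x)) has_integral (\<phi> (x + 1*\<^sub>R (y - x)) - \<phi> (x + 0*\<^sub>R (y - x)))) {0..1}"
  by (rule fundamental_theorem_of_calculus) (use der in auto)
 hence int: "\<phi> y - \<phi> x = integral {0..1} (%t. G t\<bullet>(y - x))" by (simp add: integral_unique)
 have "(\<phi> y - \<phi> x)^2 <= integral {0..1} (%t. (G t\<bullet>(y - x))^2)"
  unfolding int using integral_square_le[of 0 1 "%t. G t\<bullet>(y - x)"] cG by (simp add: continuous_on_inner continuous_on_const)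
 also have "... <= integral {0..1} (%t. (norm (y - x))^2*(norm (G t))^2)"
 proof (rule integral_le)
  show "(G t\<bullet>(y - x))^2 <= (norm (y - x))^2*(norm (G t))^2" for t
   using power_mono[OF Cauchy_Schwarz_ineq2[of "G t" "y - x"], of 2] by (simp add: power_mult_distrib mult.commute)
 qed (intro integrable_continuous_real continuous_intros cG)+
 also have "... = (norm (y - x))^2*integral {0..1} (%t. (norm (G t))^2)" by simp
 finally have "ennreal ((\<phi> y - \<phi> x)^2) <= ennreal ((norm (y - x))^2*integral {0..1} (%t. (norm (G t))^2))"
  by (rule ennreal_leI)
 also have "... = ennreal ((norm (y - x))^2)*ennreal (integral {0..1} (%t. (norm (G t))^2))"
  by (rule ennreal_mult') simp
 also have "ennreal (integral {0..1} (%t. (norm (G t))^2)) = (nn (%t. ennreal ((norm (G t))^2)*indicator {0..1} t))"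
  by (rule nn_integral_Icc[symmetric]) (auto intro!: continuous_intros cG)
 finally show ?thesis unfolding G_def .
qed

text \<open>The integral of \<open>\<phi> x - \<phi> y\<close> squared over \<open>E \<times> B\<close> is bounded by integrating the gradient along the segment
 from \<open>x\<close> to \<open>y\<close>; in its first half the point of the segment is substituted for \<open>x\<close>, in the second half for \<open>y\<close>.\<close>

lemma Poincare_star_shaped:
 assumes E: "open E" "bounded E" and star: "star_shaped_wrt E (ball c r)" and r: "r > 0"
  and D: "!!x y. x\<in>E ==> y\<in>E ==> dist x y <= D" and \<phi>: "smooth \<phi>" and \<epsilon>: "\<epsilon> > 0"
 shows "EX m. (l2_norm E (%x. \<phi> x - m))^2 <= 4*D^4/r^2*(l2_norm E (grad \<phi>))^2 + \<epsilon>"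
proof -
 define N where "N = l2_norm E (grad \<phi>)"
 define B where "B = ball c r"
 have BE: "B \<subseteq> E" using star by (simp add: star_shaped_wrt_def B_def)
 have cE: "c\<in>E" using BE r by (auto simp: B_def)
 have D0: "D >= 0" using D[OF cE cE] by simp
 have [measurable]: "E\<in>sets borel" "B\<in>sets borel" using E by (auto simp: B_def)
 note [measurable] = borel_measurable_smooth[OF \<phi>]
 have [measurable]: "grad \<phi>\<in>borel_measurable borel" by (intro borel_measurable_continuous_onI continuous_grad \<phi>)
 define g where "g z = indicator E z*ennreal ((norm (grad \<phi> z))^2)" for z
 have [measurable]: "g\<in>borel_measurable borel" unfolding g_def by measurable
 have on_E: "(nn (%x. indicator E x*f x)) = (\<integral>\<^sup>+ x. f x \<partial>lebesgue_on E)"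
  if [measurable]: "f\<in>borel_measurable borel" for f :: "point => ennreal"
 proof -
  have "(\<integral>\<^sup>+ x. f x \<partial>lebesgue_on E) = (\<integral>\<^sup>+ x. f x*indicator E x \<partial>lebesgue)"
   using sets_lebesgue_open[OF E(1)] by (subst nn_integral_restrict_space) auto
  also have "... = (nn (%x. f x*indicator E x))" by (rule nn_integral_completion)
  finally show ?thesis by (simp add: mult.commute)
 qed
 have G: "(nn (%z. g z)) = ennreal (N^2)"
  unfolding g_def N_def by (subst on_E) (simp_all add: nn_integral_L2[OF L2_smooth(2)[OF E \<phi>]])
 \<comment> \<open>The substitution with factor \<open>s\<close> costs \<open>1/s^2 <= 4\<close>; on
   each half of the segment one of the two end points has a weight of at least 1/2.\<close>
 have sub4: "(nn (%x. g (t + s*\<^sub>R x))) <= ennreal (4*N^2)" if s: "s >= 1/2" for s t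
 proof -
  have s2: "1/4 <= s^2" using power_mono[OF s, of 2] by (simp add: power2_eq_square)
  have one: "ennreal (s^2)*ennreal (1/s^2) = 1" using s by (simp add: ennreal_mult[symmetric])
  have "(nn (%x. g (t + s*\<^sub>R x))) = (ennreal (s^2)*ennreal (1/s^2))*(nn (%x. g (t + s*\<^sub>R x)))"
   unfolding one by simp
  also have "... = ennreal (1/s^2)*(ennreal (s^2)*(nn (%x. g (t + s*\<^sub>R x))))" by (simp only: mult_ac)
  also have "... = ennreal (1/s^2)*ennreal (N^2)"
   using nn_integral_affine[of g s t] s by (simp add: G)
  also have "... <= ennreal 4*ennreal (N^2)"
   using s2 by (intro mult_right_mono ennreal_leI) (auto simp: divide_simps)
  also have "... = ennreal (4*N^2)" by (simp add: ennreal_mult)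
  finally show ?thesis .
 qed
 define \<mu> where "\<mu> = emeasure lborel E"
 have \<mu>B: "emeasure lborel B <= \<mu>" unfolding \<mu>_def by (rule emeasure_mono[OF BE]) simp
 define H where "H t = (nn (%x. nn (%y. indicator E x*(indicator B y*g ((1 - t)*\<^sub>R x + t*\<^sub>R y)))))" for t
 have H: "H t <= ennreal (4*N^2)*\<mu>" if t: "t\<in>{0..1}" for t
 proof (cases "t <= 1/2")
  case True
  have "H t = (nn (%y. nn (%x. indicator E x*(indicator B y*g ((1 - t)*\<^sub>R x + t*\<^sub>R y)))))"
   unfolding H_def by (rule lborel_pair.Fubini') measurable
  also have "... <= (nn (%y. ennreal (4*N^2)*indicator B y))"
  proof (rule nn_integral_mono)
   fix y
   have "(nn (%x. indicator E x*(indicator B y*g ((1 - t)*\<^sub>R x + t*\<^sub>R y)))) <= (nn (%x. indicator B y*g (t*\<^sub>R y + (1 - t)*\<^sub>R x)))"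
    by (intro nn_integral_mono) (auto simp: indicator_def add.commute)
   also have "... = indicator B y*(nn (%x. g (t*\<^sub>R y + (1 - t)*\<^sub>R x)))" by (rule nn_integral_cmult) measurable
   also have "... <= indicator B y*ennreal (4*N^2)" using True by (intro mult_left_mono sub4) auto
   finally show "(nn (%x. indicator E x*(indicator B y*g ((1 - t)*\<^sub>R x + t*\<^sub>R y)))) <= ennreal (4*N^2)*indicator B y"
    by (simp add: mult.commute)
  qed
  also have "... = ennreal (4*N^2)*emeasure lborel B" by (rule nn_integral_cmult_indicator) simp
  also have "... <= ennreal (4*N^2)*\<mu>" by (intro mult_left_mono \<mu>B) simp
  finally show ?thesis .
 next
  case False
  have "H t <= (nn (%x. ennreal (4*N^2)*indicator E x))"
   unfolding H_def
  proof (rule nn_integral_mono)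
   fix x
   have "(nn (%y. indicator E x*(indicator B y*g ((1 - t)*\<^sub>R x + t*\<^sub>R y)))) <= (nn (%y. indicator E x*g ((1 - t)*\<^sub>R x + t*\<^sub>R y)))"
    by (intro nn_integral_mono) (auto simp: indicator_def)
   also have "... = indicator E x*(nn (%y. g ((1 - t)*\<^sub>R x + t*\<^sub>R y)))" by (rule nn_integral_cmult) measurable
   also have "... <= indicator E x*ennreal (4*N^2)" using False by (intro mult_left_mono sub4) auto
   finally show "(nn (%y. indicator E x*(indicator B y*g ((1 - t)*\<^sub>R x + t*\<^sub>R y)))) <= ennreal (4*N^2)*indicator E x"
    by (simp add: mult.commute)
  qed
  also have "... = ennreal (4*N^2)*\<mu>" unfolding \<mu>_def by (rule nn_integral_cmult_indicator) simp
  finally show ?thesis .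
 qed
 define f where "f y = (nn (%x. indicator E x*ennreal ((\<phi> x - \<phi> y)^2)))" for y
 have [measurable]: "f\<in>borel_measurable borel" unfolding f_def by measurable
 have "(nn (%y. indicator B y*f y)) = (nn (%y. nn (%x. indicator B y*(indicator E x*ennreal ((\<phi> x - \<phi> y)^2)))))"
  unfolding f_def by (intro nn_integral_cong nn_integral_cmult[symmetric]) measurable
 also have "... <= (nn (%y. nn (%x. ennreal (D^2)*(nn (%t. indicator {0..1} t *
   (indicator E x*(indicator B y*g ((1 - t)*\<^sub>R x + t*\<^sub>R y))))))))"
 proof (intro nn_integral_mono)
  fix x y
  show "indicator B y*(indicator E x*ennreal ((\<phi> x - \<phi> y)^2)) <= ennreal (D^2)*(nn (%t. indicator {0..1} t *
   (indicator E x*(indicator B y*g ((1 - t)*\<^sub>R x + t*\<^sub>R y)))))"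
  proof (cases "x\<in>E & y\<in>B")
   case True
   hence seg: "closed_segment y x \<subseteq> E" using star by (auto simp: star_shaped_wrt_def B_def)
   have "ennreal ((\<phi> x - \<phi> y)^2) = ennreal ((\<phi> y - \<phi> x)^2)" by (simp add: power2_commute)
   also have "... <= ennreal ((norm (y - x))^2) *
    (nn (%t. ennreal ((norm (grad \<phi> (x + t*\<^sub>R (y - x))))^2)*indicator {0..1} t))"
    by (rule segment_grad_bound[OF \<phi>])
   also have "... <= ennreal (D^2)*(nn (%t. indicator {0..1} t *
   (indicator E x*(indicator B y*g ((1 - t)*\<^sub>R x + t*\<^sub>R y)))))"
   proof (rule mult_mono)
    have "norm (y - x) <= D" using D[of y x] True BE by (auto simp: dist_norm)
    thus "ennreal ((norm (y - x))^2) <= ennreal (D^2)" by (intro ennreal_leI power_mono) auto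
    have "x + t*\<^sub>R (y - x)\<in>E" "x + t*\<^sub>R (y - x) = (1 - t)*\<^sub>R x + t*\<^sub>R y" if "t\<in>{0..1}" for t
    proof -
     show e: "x + t*\<^sub>R (y - x) = (1 - t)*\<^sub>R x + t*\<^sub>R y" by (simp add: algebra_simps)
     have "(1 - t)*\<^sub>R x + t*\<^sub>R y\<in>closed_segment x y" using that by (auto simp: closed_segment_def)
     thus "x + t*\<^sub>R (y - x)\<in>E" unfolding e using seg by (auto simp: closed_segment_commute)
    qed
    thus "(nn (%t. ennreal ((norm (grad \<phi> (x + t*\<^sub>R (y - x))))^2)*indicator {0..1} t)) <= (nn (%t. indicator {0..1} t *
   (indicator E x*(indicator B y*g ((1 - t)*\<^sub>R x + t*\<^sub>R y)))))"
     using True by (intro nn_integral_mono) (auto simp: g_def indicator_def)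
   qed auto
   finally show ?thesis using True by simp
  qed auto
 qed
 also have "... = ennreal (D^2)*(nn (%y. nn (%x. nn (%t. indicator {0..1} t *
   (indicator E x*(indicator B y*g ((1 - t)*\<^sub>R x + t*\<^sub>R y)))))))"
  by (subst nn_integral_cmult, measurable)+
 also have "(nn (%y. nn (%x. nn (%t. indicator {0..1} t*(indicator E x*(indicator B y*g ((1 - t)*\<^sub>R x + t*\<^sub>R y)))))))
  = (nn (%y. nn (%t. nn (%x. indicator {0..1} t*(indicator E x*(indicator B y*g ((1 - t)*\<^sub>R x + t*\<^sub>R y)))))))"
  by (intro nn_integral_cong lborel_pair.Fubini') measurable
 also have "... = (nn (%t. nn (%y. nn (%x. indicator {0..1} t*(indicator E x*(indicator B y*g ((1 - t)*\<^sub>R x + t*\<^sub>R y)))))))"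
  by (rule lborel_pair.Fubini') measurable
 also have "... = (nn (%t. nn (%x. nn (%y. indicator {0..1} t*(indicator E x*(indicator B y*g ((1 - t)*\<^sub>R x + t*\<^sub>R y)))))))"
  by (intro nn_integral_cong lborel_pair.Fubini') measurable
 also have "... = (nn (%t. indicator {0..1} t*H t))"
 proof (rule nn_integral_cong)
  fix t
  show "(nn (%x. nn (%y. indicator {0..1} t*(indicator E x*(indicator B y*g ((1 - t)*\<^sub>R x + t*\<^sub>R y)))))) = indicator {0..1} t*H t"
   by (cases "t\<in>{0..1}") (simp_all add: H_def)
 qed
 also have "... <= (nn (%t. (ennreal (4*N^2)*\<mu>)*indicator {0..1::real} t))"
  by (intro nn_integral_mono) (use H in \<open>auto simp: indicator_def\<close>)
 also have "... = ennreal (4*N^2)*\<mu>" by (subst nn_integral_cmult_indicator) auto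
 finally have total: "(nn (%y. indicator B y*f y)) <= ennreal (D^2)*(ennreal (4*N^2)*\<mu>)"
  by (simp add: mult_left_mono)
 \<comment> \<open>It cancels in the end: \<open>E\<close> has at most the area of a disk of radius
   \<open>D\<close>, the ball that of radius \<open>r\<close>, which leaves the ratio
   \<open>D^2/r^2\<close>.\<close>
 define v where "v = unit_ball_vol (real DIM(point))"
 have v: "v > 0" by (simp add: v_def)
 have "E \<subseteq> cball c D" using D[OF cE] by auto
 hence "\<mu> <= emeasure lborel (cball c D)" unfolding \<mu>_def by (intro emeasure_mono) auto
 also have "... = ennreal (v * D^2)" using D0 by (simp add: emeasure_cball v_def)
 finally have \<mu>le: "\<mu> <= ennreal (v * D^2)" .
 have eB: "emeasure lborel B = ennreal (v * r^2)" using r by (simp add: emeasure_ball v_def B_def)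
 define Q where "Q = 4*D^4/r^2*N^2 + \<epsilon>"
 have Q: "Q > 0" using \<epsilon> by (simp add: Q_def add_nonneg_pos)
 \<comment> \<open>Otherwise the integral over the ball would exceed the total. The value of
   \<open>\<phi>\<close> at such a \<open>y\<close> serves as the constant \<open>m\<close>; the
   term \<open>\<epsilon>\<close> makes the comparison strict.\<close>
 have "\<exists>y\<in>B. f y < ennreal Q"
 proof (rule ccontr)
  assume "\<not> ?thesis"
  hence big: "ennreal Q <= f y" if "y\<in>B" for y using that by (auto simp: not_less)
  have "ennreal (Q*(v * r^2)) = ennreal Q*emeasure lborel B" using Q v by (simp add: eB ennreal_mult)
  also have "... = (nn (%y. ennreal Q*indicator B y))" by (rule nn_integral_cmult_indicator[symmetric]) simp
  also have "... <= (nn (%y. indicator B y*f y))"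
   by (intro nn_integral_mono) (use big in \<open>auto simp: indicator_def\<close>)
  also have "... <= ennreal (D^2)*(ennreal (4*N^2)*ennreal (v * D^2))"
   using total \<mu>le by (meson mult_left_mono order_trans zero_le)
  also have "... = ennreal (D^2*(4*N^2*(v * D^2)))" using v by (simp add: ennreal_mult)
  finally have "Q*(v * r^2) <= D^2*(4*N^2*(v * D^2))"
   using v by (subst (asm) ennreal_le_iff) auto
  also have "... = (4*D^4*N^2) * v" by (simp add: power2_eq_square power4_eq_xxxx)
  finally have "(Q*r^2) * v <= (4*D^4*N^2) * v" by (simp add: mult_ac)
  hence "Q*r^2 <= 4*D^4*N^2" using v by (rule mult_right_le_imp_le)
  moreover have "Q*r^2 = 4*D^4*N^2 + \<epsilon>*r^2" using r by (simp add: Q_def field_simps)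
  moreover have "\<epsilon>*r^2 > 0" using \<epsilon> r by simp
  ultimately show False by linarith
 qed
 then obtain y where y: "f y < ennreal Q" by blast
 have sm: "smooth (%x. \<phi> x + (- \<phi> y))" by (intro smooth_add smooth_const \<phi>)
 have "f y = ennreal ((l2_norm E (%x. \<phi> x - \<phi> y))^2)"
  unfolding f_def using nn_integral_L2[OF L2_smooth(1)[OF E sm]] by (subst on_E) simp_all
 hence "(l2_norm E (%x. \<phi> x - \<phi> y))^2 <= Q" using y Q by (simp add: ennreal_less_iff)
 thus ?thesis unfolding Q_def N_def by blast
qed

text \<open>\<open>g\<close> has mean zero, so any constant may be subtracted from
  \<open>\<phi>\<close>. The constants of the previous lemma are optimal up to a slack that tends to
  zero.\<close>

lemma Poincare_functional:
 assumes E: "open E" "bounded E" and star: "star_shaped_wrt E (ball c r)" and r: "r > 0"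
  and D: "!!x y. x\<in>E ==> y\<in>E ==> dist x y <= D" and \<phi>: "smooth \<phi>"
  and g: "g\<in>L2_space E" "l2_inner E g (%_. 1) = 0"
 shows "\<bar>l2_inner E g \<phi>\<bar> <= l2_norm E g*(2*D^2/r*l2_norm E (grad \<phi>))"
proof -
 define N where "N = l2_norm E (grad \<phi>)"
 have N0: "N >= 0" using l2_norm_nonneg[OF L2_smooth(2)[OF E \<phi>]] by (simp add: N_def)
 have g0: "l2_norm E g >= 0" using l2_norm_nonneg[OF g(1)] .
 have le: "\<bar>l2_inner E g \<phi>\<bar> <= l2_norm E g*(2*D^2/r*N + e)" if e: "e > 0" for e
 proof -
  obtain m where m: "(l2_norm E (%x. \<phi> x - m))^2 <= 4*D^4/r^2*N^2 + e^2"
   using Poincare_star_shaped[OF E star r D \<phi>, of "e^2"] e unfolding N_def by auto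
  also have "4*D^4/r^2*N^2 = (2*D^2/r*N)^2" by (simp add: power_mult_distrib power_divide)
  also have "(2*D^2/r*N)^2 + e^2 <= (2*D^2/r*N + e)^2"
  proof -
   have "0 <= 2*D^2/r*N" using N0 r by simp
   hence "0 <= 2*(2*D^2/r*N)*e" using e N0 r by (intro mult_nonneg_nonneg) auto
   thus ?thesis unfolding power2_sum by linarith
  qed
  finally have m1: "l2_norm E (%x. \<phi> x - m) <= 2*D^2/r*N + e"
   by (rule power2_le_imp_le) (use N0 r e in simp)
  have m4: "(%x. \<phi> x - m) = \<phi> - (%x. m)" by (rule ext) simp
  have "l2_inner E g (%x. m) = m*l2_inner E g (%_. 1)" by (simp add: l2_inner_def)
  hence "l2_inner E g (%x. m) = 0" using g(2) by simp
  hence m2: "l2_inner E g \<phi> = l2_inner E g (\<phi> - (%x. m))"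
   using l2.diff_right[OF L2_smooth(1)[OF E \<phi>] L2_const[OF E, of m] g(1)] by linarith
  have "\<bar>l2_inner E g \<phi>\<bar> <= l2_norm E g*l2_norm E (\<phi> - (%x. m))"
   unfolding m2 by (rule l2_Cauchy_Schwarz[OF g(1) l2.closed(3)[OF L2_smooth(1)[OF E \<phi>] L2_const[OF E]]])
  moreover have "l2_norm E g*l2_norm E (\<phi> - (%x. m)) <= l2_norm E g*(2*D^2/r*N + e)"
   by (rule mult_left_mono[OF m1[unfolded m4] g0])
  ultimately show ?thesis by (rule order_trans)
 qed
 have "\<bar>l2_inner E g \<phi>\<bar> <= l2_norm E g*(2*D^2/r*N) + e" if e: "e > 0" for e
 proof -
  have p: "l2_norm E g + 1 > 0" using g0 by simp
  hence "\<bar>l2_inner E g \<phi>\<bar> <= l2_norm E g*(2*D^2/r*N + e/(l2_norm E g + 1))" using e by (intro le) simp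
  moreover have "l2_norm E g*(e/(l2_norm E g + 1)) <= e" using p e g0 by (simp add: field_simps)
  ultimately show ?thesis by (simp only: distrib_left)
 qed
 hence "\<bar>l2_inner E g \<phi>\<bar> <= l2_norm E g*(2*D^2/r*N)" by (rule field_le_epsilon)
 thus ?thesis by (simp add: N_def)
qed

section \<open>Polygons and their exteriors\<close>

lemma pathstart_polygonal_path: "pathstart (polygonal_path (a # vs)) = a"
 by (cases "a # vs" rule: polygonal_path.cases) auto

lemma pathfinish_polygonal_path: "vs ~= [] ==> pathfinish (polygonal_path vs) = last vs"
 by (induction vs rule: polygonal_path.induct) auto

lemma negligible_linepath: "negligible (path_image (linepath a (b :: point)))"
 unfolding path_image_def linepath_def
 by (rule negligible_differentiable_image_lowdim) (auto intro!: differentiable_on_subset[OF _ subset_UNIV] derivative_intros)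

lemma negligible_polygonal_path: "negligible (path_image (polygonal_path vs))"
proof (induction vs rule: polygonal_path.induct)
 case (1 a b c vs)
 show ?case
  by (rule negligible_subset[OF negligible_Un[OF negligible_linepath[of a b] 1]])
   (use path_image_join_subset[of "linepath a b" "polygonal_path (b # c # vs)"] in simp)
qed (auto simp: negligible_linepath simp del: path_image_linepath)

lemma polygon_loop:
 assumes "simple_polygon P"
 shows "simple_path (polygonal_path (P @ [hd P]))"
  "pathfinish (polygonal_path (P @ [hd P])) = pathstart (polygonal_path (P @ [hd P]))"
proof -
 obtain a vs where P: "P = a # vs" using assms by (cases P) (auto simp: simple_polygon_def)
 show "simple_path (polygonal_path (P @ [hd P]))" using assms by (simp add: simple_polygon_def)
 show "pathfinish (polygonal_path (P @ [hd P])) = pathstart (polygonal_path (P @ [hd P]))"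
  by (simp add: P pathstart_polygonal_path pathfinish_polygonal_path)
qed

text \<open>The boundary is a topological circle, so the Jordan-Brouwer theorem applies: every
  boundary point can be approached from outside.\<close>

lemma polygon_boundary_facts:
 assumes "simple_polygon P"
 shows "compact (polygon_boundary P)" "connected (polygon_boundary P)" "polygon_boundary P ~= {}"
  "negligible (polygon_boundary P)" "frontier (outside (polygon_boundary P)) = polygon_boundary P"
proof -
 note loop = polygon_loop[OF assms]
 have path: "path (polygonal_path (P @ [hd P]))" using loop(1) by (rule simple_path_imp_path)
 show c: "compact (polygon_boundary P)" "connected (polygon_boundary P)" "polygon_boundary P ~= {}" "negligible (polygon_boundary P)"
  using path by (auto simp: polygon_boundary_def negligible_polygonal_path compact_path_image connected_path_image path_image_nonempty)
 have "polygon_boundary P homeomorphic sphere (0 :: complex) 1"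
  unfolding polygon_boundary_def by (rule homeomorphic_simple_path_image_circle[OF loop]) simp
 also have "sphere (0 :: complex) 1 homeomorphic sphere (0 :: point) 1" by (rule homeomorphic_spheres_gen) auto
 finally have sph: "polygon_boundary P homeomorphic sphere (0 :: point) 1" .
 have "outside (polygon_boundary P)\<in>components (- polygon_boundary P)"
  unfolding outside_in_components
  using c(1) by (auto intro!: connected_outside outside_bounded_nonempty compact_imp_bounded)
 thus "frontier (outside (polygon_boundary P)) = polygon_boundary P"
  by (intro Jordan_Brouwer_frontier[OF sph]) auto
qed

text \<open>All the geometry that enters the vanishing theorem, isolated so that the same theorem
  applies to the domain and to every element.\<close>

definition exterior_accessible :: "point set => bool" where
 "exterior_accessible Z \<longleftrightarrow> open Z & bounded Z &
  (EX U M. open U & connected U & U \<inter> Z = {} & frontier Z \<subseteq> closure U & (ALL x. norm x > M --> x\<in>U))"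

lemma exterior_accessibleD: "exterior_accessible Z ==> open Z" "exterior_accessible Z ==> bounded Z"
 by (auto simp: exterior_accessible_def)

lemma Helmholtz_zero_exterior:
 assumes "exterior_accessible Z" "w\<in>L2_space Z" "!!\<phi>. smooth \<phi> ==> l2_inner Z w (grad \<phi>) = 0"
  "!!\<psi>. test_function Z \<psi> ==> l2_inner Z w (curl \<psi>) = 0"
 shows "l2_norm Z w = 0"
proof -
 obtain U M where U: "open U" "connected U" "U \<inter> Z = {}" "frontier Z \<subseteq> closure U" "!!x. norm x > M ==> x\<in>U"
  using assms(1) by (auto simp: exterior_accessible_def)
 show ?thesis by (rule Helmholtz_zero[OF exterior_accessibleD[OF assms(1)] U assms(2-4)])
qed

lemma exterior_accessible_polygon:
 assumes P: "simple_polygon P" and Z: "open Z" "Z \<subseteq> inside (polygon_boundary P)" "frontier Z \<subseteq> polygon_boundary P"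
 shows "exterior_accessible Z"
proof -
 note B = polygon_boundary_facts[OF P]
 have bd: "bounded (polygon_boundary P)" using B(1) compact_imp_bounded by blast
 have "bounded (- outside (polygon_boundary P))" using bd by (rule cobounded_outside)
 then obtain M where M: "!!x. x\<in>- outside (polygon_boundary P) ==> norm x <= M" by (auto simp: bounded_iff)
 have "x\<in>outside (polygon_boundary P)" if "norm x > M" for x using M[of x] that by force
 moreover have "frontier Z \<subseteq> closure (outside (polygon_boundary P))"
  using Z(3) B(5) by (auto simp: frontier_def)
 moreover have "bounded Z" using Z(2) bounded_inside[OF bd] bounded_subset by blast
 moreover have "open (outside (polygon_boundary P))" using B(1) compact_imp_closed open_outside by blast
 moreover have "connected (outside (polygon_boundary P))" using bd by (intro connected_outside) auto
 moreover have "outside (polygon_boundary P) \<inter> Z = {}" using Z(2) inside_Int_outside by blast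
 ultimately show ?thesis using Z(1) unfolding exterior_accessible_def by blast
qed

lemma polygon_interior_facts:
 assumes P: "simple_polygon P"
 shows "exterior_accessible (intr P)" "open (intr P)" "bounded (intr P)"
  "closure (intr P) \<subseteq> polygon_boundary P \<union> intr P"
proof -
 have cl: "closed (polygon_boundary P)" using polygon_boundary_facts(1)[OF P] compact_imp_closed by blast
 have op: "open (intr P)" unfolding polygon_interior_def by (rule open_inside[OF cl])
 show c: "closure (intr P) \<subseteq> polygon_boundary P \<union> intr P"
  unfolding polygon_interior_def by (rule closure_inside_subset[OF cl])
 show e: "exterior_accessible (intr P)"
 proof (rule exterior_accessible_polygon[OF P op])
  show "intr P \<subseteq> inside (polygon_boundary P)" by (simp add: polygon_interior_def)
  show "frontier (intr P) \<subseteq> polygon_boundary P"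
   using c op by (auto simp: frontier_def interior_open)
 qed
 show "open (intr P)" "bounded (intr P)" using exterior_accessibleD[OF e] by auto
qed

text \<open>The topological fact concerns subsets of the complex plane; a linear isometry transports
  it.\<close>

lemma connected_frontier_simply_connected:
 fixes S :: "point set"
 assumes S: "open S" "bounded S" "simply_connected S"
 shows "connected (frontier S)"
proof -
 obtain f :: "point => complex" and g where f: "linear f" "linear g" "!!x. norm (f x) = norm x" "!!y. norm (g y) = norm y"
  "!!x. g (f x) = x" "!!y. f (g y) = y" by (rule isomorphisms_UNIV_UNIV[where 'M = point and 'N = complex]; simp)
 have inj: "inj f" "inj g" using f(5,6) by (auto intro: inj_on_inverseI)
 have surj: "surj f" using f(6) by (metis surjI)
 have op: "open (f ` S)" using open_surjective_linear_image[OF S(1) f(1) surj] .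
 have bd: "bounded (f ` S)" using S(2) f(1) by (metis bounded_linear_image linear_conv_bounded_linear)
 have sc: "simply_connected (f ` S)"
  using homeomorphic_simply_connected[OF linear_homeomorphic_image[OF f(1) inj(1)] S(3)] .
 have "connected (frontier (f ` S))"
  using simply_connected_eq_frontier_properties[OF op] sc bd by simp
 hence "connected (g ` frontier (f ` S))"
  using f(2) by (intro connected_continuous_image linear_continuous_on) (auto simp: linear_conv_bounded_linear)
 also have "g ` frontier (f ` S) = frontier S"
 proof -
  have gf: "g ` f ` A = A" for A by (simp add: image_image f(5))
  have "g ` frontier (f ` S) = g ` (f ` closure S - f ` S)"
   using closure_injective_linear_image[OF f(1) inj(1), of S] op by (simp add: frontier_def interior_open)
  also have "... = closure S - S" unfolding image_set_diff[OF inj(1), symmetric] gf ..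
  finally show ?thesis using S(1) by (simp add: frontier_def interior_open)
 qed
 finally show ?thesis .
qed

text \<open>Simple connectedness makes the frontier connected, and a connected union of finitely
  many disjoint closed curves is a single curve. The domain lies inside it, since otherwise it would
  contain the unbounded outside.\<close>

lemma exterior_accessible_domain:
 assumes dom: "polygonal_domain Z" and sc: "simply_connected Z"
 shows "exterior_accessible Z"
proof -
 obtain \<P> where Z: "open Z" "connected Z" "bounded Z" "Z ~= {}" and fin: "finite \<P>" and simple: "!!P. P\<in>\<P> ==> simple_polygon P"
  and disj: "!!P P'. P\<in>\<P> ==> P'\<in>\<P> ==> P ~= P' ==> polygon_boundary P \<inter> polygon_boundary P' = {}"
  and fr: "frontier Z = (\<Union>P\<in>\<P>. polygon_boundary P)"
  using dom unfolding polygonal_domain_def by metis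
 have conn: "connected (frontier Z)" by (rule connected_frontier_simply_connected[OF Z(1,3) sc])
 have "frontier Z ~= {}"
  using Z by (metis frontier_eq_empty not_bounded_UNIV)
 then obtain P where P: "P\<in>\<P>" unfolding fr by auto
 note BP = polygon_boundary_facts[OF simple[OF P]]
 define R where "R = (\<Union>P'\<in>\<P> - {P}. polygon_boundary P')"
 have R: "closed R"
  unfolding R_def using fin simple polygon_boundary_facts(1) compact_imp_closed by (intro closed_UN) auto
 have eq: "frontier Z = polygon_boundary P \<union> R" unfolding fr R_def using P by auto
 have dj: "polygon_boundary P \<inter> R = {}" unfolding R_def using disj P by blast
 have "R = {}"
 proof (rule ccontr)
  assume "R ~= {}"
  moreover have "closed (polygon_boundary P)" using BP(1) by (rule compact_imp_closed)
  ultimately show False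
   using conn R BP(3) dj unfolding eq connected_closed by blast
 qed
 hence fr: "frontier Z = polygon_boundary P" using eq by simp
 have bd: "bounded (polygon_boundary P)" using BP(1) compact_imp_bounded by blast
 have "outside (polygon_boundary P) \<inter> Z = {}"
 proof (rule ccontr)
  assume ne: "outside (polygon_boundary P) \<inter> Z ~= {}"
  have "outside (polygon_boundary P) \<subseteq> Z"
  proof (rule ccontr)
   assume "\<not> ?thesis"
   hence "outside (polygon_boundary P) \<inter> frontier Z ~= {}"
    using ne bd by (intro connected_Int_frontier connected_outside) auto
   thus False unfolding fr using outside_no_overlap[of "polygon_boundary P"] by blast
  qed
  thus False using unbounded_outside[OF bd] Z(3) bounded_subset by blast
 qed
 moreover have "Z \<inter> polygon_boundary P = {}" using Z(1) fr frontier_disjoint_eq by blast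
 ultimately have "Z \<subseteq> inside (polygon_boundary P)" using inside_Un_outside[of "polygon_boundary P"] by blast
 thus ?thesis using Z(1) fr by (intro exterior_accessible_polygon[OF simple[OF P]]) auto
qed

section \<open>Domains, meshes and the local Poincare constant\<close>

locale accessible_domain =
 fixes Z :: "point set"
 assumes Z: "exterior_accessible Z" "Z ~= {}"
begin

lemmas Z_open = exterior_accessibleD(1)[OF Z(1)]
lemmas Z_bounded = exterior_accessibleD(2)[OF Z(1)]
lemmas Z_ob = Z_open Z_bounded

end

locale polygonal_mesh_of = accessible_domain Z for Z :: "point set" +
 fixes \<T> :: "polygon set" and C :: real
 assumes mesh: "polygonal_mesh Z \<T>"
  and C: "C > 0" and regular: "!!P. P\<in>\<T> ==> shape_regular C P"
begin

lemma finite_mesh: "finite \<T>" and simple: "P\<in>\<T> ==> simple_polygon P" and sub: "P\<in>\<T> ==> intr P \<subseteq> Z"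
 and closure_eq: "closure Z = (\<Union>P\<in>\<T>. closure (intr P))"
 using mesh by (auto simp: polygonal_mesh_def)

lemma E_open: "P\<in>\<T> ==> open (intr P)" and E_bounded: "P\<in>\<T> ==> bounded (intr P)"
 using polygon_interior_facts simple by blast+

lemma disjoint: "disjoint_family_on intr \<T>"
 using mesh by (auto simp: polygonal_mesh_def disjoint_family_on_def)

lemma mesh_nonempty: "\<T> ~= {}"
 using closure_eq Z(2) closure_subset[of Z] by auto

lemma null_rest: "negligible (Z - (\<Union>P\<in>\<T>. intr P))"
proof (rule negligible_subset)
 show "negligible (\<Union>P\<in>\<T>. polygon_boundary P)"
  using finite_mesh simple polygon_boundary_facts(4) by (intro negligible_Union) auto
 show "Z - (\<Union>P\<in>\<T>. intr P) \<subseteq> (\<Union>P\<in>\<T>. polygon_boundary P)"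
 proof
  fix x assume x: "x\<in>Z - (\<Union>P\<in>\<T>. intr P)"
  hence "x\<in>closure Z" using closure_subset by auto
  then obtain P where "P\<in>\<T>" "x\<in>closure (intr P)" using closure_eq by auto
  thus "x\<in>(\<Union>P\<in>\<T>. polygon_boundary P)" using polygon_interior_facts(4)[OF simple] x by blast
 qed
qed

lemma partition:
 assumes "u\<in>L2_space Z" "v\<in>L2_space Z"
 shows "l2_inner Z u v = (\<Sum>P\<in>\<T>. l2_inner (intr P) u v)"
 using finite_mesh sub disjoint null_rest E_open Z_open assms by (intro l2_inner_partition) (auto intro: sets_lebesgue_open)

lemma L2_E: "u\<in>L2_space Z ==> P\<in>\<T> ==> u\<in>L2_space (intr P)"
 by (rule L2_space_subset[OF _ sub]) (auto intro: sets_lebesgue_open E_open Z_open)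

lemma norm_partition: "u\<in>L2_space Z ==> (l2_norm Z u)^2 = (\<Sum>P\<in>\<T>. (l2_norm (intr P) u)^2)"
 by (simp add: l2_norm_sq partition L2_E)

lemma diameter_le: "P\<in>\<T> ==> diameter (intr P) <= mesh_size \<T>"
 unfolding mesh_size_def using finite_mesh by (intro Max_ge) auto

lemma diameter_pos: assumes P: "P\<in>\<T>" shows "diameter (intr P) > 0"
proof -
 obtain c r where r: "r > C*diameter (intr P)" and star: "star_shaped_wrt (intr P) (ball c r)"
  using regular[OF P] by (auto simp: shape_regular_def)
 have "0 <= C*diameter (intr P)" using C diameter_ge_0[OF E_bounded[OF P]] by simp
 hence r0: "r > 0" using r by simp
 have "diameter (ball c r) <= diameter (intr P)"
  using star by (intro diameter_subset E_bounded P) (auto simp: star_shaped_wrt_def)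
 thus ?thesis using r0 by simp
qed

lemma mesh_size_pos: "mesh_size \<T> > 0"
 using mesh_nonempty diameter_pos diameter_le by (meson all_not_in_conv less_le_trans)

text \<open>For an element of diameter \<open>d\<close> shape regularity gives
  \<open>r > C*d\<close>, so the constant \<open>2*d^2/r\<close> is at most \<open>2*d/C\<close>,
  proportional to the mesh size.\<close>

lemma Poincare_element:
 assumes P: "P\<in>\<T>" and \<phi>: "smooth \<phi>" and g: "g\<in>L2_space (intr P)" "l2_inner (intr P) g (%_. 1) = 0"
 shows "\<bar>l2_inner (intr P) g \<phi>\<bar> <=
  2/C*mesh_size \<T>*(l2_norm (intr P) g*l2_norm (intr P) (grad \<phi>))"
proof -
 define d where "d = diameter (intr P)"
 obtain c r where r: "r > C*d" and star: "star_shaped_wrt (intr P) (ball c r)"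
  using regular[OF P] by (auto simp: shape_regular_def d_def)
 have d: "0 < d" "d <= mesh_size \<T>" using diameter_pos[OF P] diameter_le[OF P] by (auto simp: d_def)
 hence Cd: "0 < C*d" using C by simp
 hence r0: "r > 0" using r by simp
 have n0: "0 <= l2_norm (intr P) g" "0 <= l2_norm (intr P) (grad \<phi>)"
  using l2_norm_nonneg[OF g(1)] l2_norm_nonneg[OF L2_smooth(2)[OF E_open[OF P] E_bounded[OF P] \<phi>]] by auto
 have "\<bar>l2_inner (intr P) g \<phi>\<bar> <= l2_norm (intr P) g*(2*d^2/r*l2_norm (intr P) (grad \<phi>))"
  by (rule Poincare_functional[OF E_open[OF P] E_bounded[OF P] star r0 _ \<phi> g])
   (auto simp: d_def intro: diameter_bounded_bound E_bounded P)
 also have "... = (2*d^2/r)*(l2_norm (intr P) g*l2_norm (intr P) (grad \<phi>))" by simp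
 also have "... <= (2/C*mesh_size \<T>)*(l2_norm (intr P) g*l2_norm (intr P) (grad \<phi>))"
 proof (rule mult_right_mono)
  have "2*d^2/r <= 2*d^2/(C*d)" using r Cd by (intro divide_left_mono) auto
  also have "... = 2/C*d" using d C by (simp add: power2_eq_square)
  also have "... <= 2/C*mesh_size \<T>" using d C by (intro mult_left_mono) auto
  finally show "2*d^2/r <= 2/C*mesh_size \<T>" .
 qed (use n0 in simp)
 finally show ?thesis .
qed

end

subsection \<open>The Helmholtz decomposition\<close>

lemma l2_inner_null_cong:
 assumes "a\<in>L2_space E" "b\<in>L2_space E" "c\<in>L2_space E" "l2_norm E (a - b) = 0"
 shows "l2_inner E a c = l2_inner E b c" "l2_inner E c a = l2_inner E c b"
proof -
 have ab: "a - b\<in>L2_space E" by (rule l2.closed(3)[OF assms(1,2)])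
 show "l2_inner E a c = l2_inner E b c"
  using l2.diff_left[OF assms(1-3)] l2_null_orth(2)[OF assms(3) ab assms(4)] by simp
 thus "l2_inner E c a = l2_inner E c b" using l2.sym assms(1-3) by metis
qed

lemma l2_null_diff_AE:
 assumes "a\<in>L2_space E" "b\<in>L2_space E" "AE x in lebesgue_on E. a x = b x"
 shows "l2_norm E (a - b) = 0"
proof -
 have "AE x in lebesgue_on E. (a - b) x = 0" using assms(3) by eventually_elim simp
 thus ?thesis using l2_norm_eq_0_AE[OF l2.closed(3)[OF assms(1,2)]] by simp
qed

lemma pd_coordinate: "pd i (%x. x$j) = (%x. if i = j then 1 else 0)"
proof
 fix x :: point
 have "((%x::point. x$j) has_derivative (%h. h$j)) (at x)"
  by (intro bounded_linear_imp_has_derivative bounded_linear_vec_nth)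
 thus "pd i (%x. x$j) x = (if i = j then 1 else 0)"
  by (simp add: pd_eq axis_def)
qed

lemma smooth_coordinate: "smooth (%x. x$j)"
proof -
 have dd: "(%x::point. x$j) differentiable (at x)" for x
  by (intro bounded_linear_imp_differentiable bounded_linear_vec_nth)
 have "times_cont_diff m (%x. x$j)" for m
 proof (cases m)
  case 0
  thus ?thesis by (simp add: continuous_on_component)
 next
  case (Suc k)
  have "smooth (%x. if i = j then 1 else 0)" for i by (rule smooth_const)
  hence "times_cont_diff k (pd i (%x. x$j))" for i
   unfolding pd_coordinate smooth_def by blast
  thus ?thesis using Suc dd by simp
 qed
 thus ?thesis by (simp add: smooth_def)
qed

context accessible_domain
begin

lemmas L2_Z_test = L2_test[OF Z_ob]
lemmas L2_Z_smooth = L2_smooth[OF Z_ob]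

text \<open>Integrating \<open>x$1\<close> against the first derivative of the square of
  \<open>\<psi>\<close> by parts expresses the squared norm as -2 times the integral of
  \<open>x$1*\<psi>\<close> against the first derivative; \<open>x$1\<close> is bounded on
  \<open>Z\<close>.\<close>

lemma Friedrichs:
 obtains F where "F >= 0" "!!\<psi>. test_function Z \<psi> ==> l2_norm Z \<psi> <= F*l2_norm Z (grad \<psi>)"
proof -
 obtain M where M: "!!x. x\<in>Z ==> norm x <= M" using Z_bounded by (auto simp: bounded_iff)
 obtain x0 where "x0\<in>Z" using Z(2) by blast
 hence M0: "M >= 0" using M[of x0] norm_ge_zero[of x0] by linarith
 have "l2_norm Z \<psi> <= 2*M*l2_norm Z (grad \<psi>)" if t: "test_function Z \<psi>" for \<psi>
 proof -
  have s: "smooth \<psi>" using t by (rule test_function_smooth)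
  have sc: "smooth (%x. x$1)" by (rule smooth_coordinate)
  define q where "q x = x$1*\<psi> x" for x :: point
  have sq: "smooth q" unfolding q_def by (rule smooth_mult[OF sc s])
  have pq: "pd 1 q x = x$1*pd 1 \<psi> x + \<psi> x" for x
   unfolding q_def using pd_mult[OF smoothD(1)[OF sc] smoothD(1)[OF s], of 1 x] pd_coordinate[of 1 1]
   by (simp add: fun_eq_iff add.commute)
  have "l2_inner Z q (pd 1 \<psi>) = - l2_inner Z (%x. grad q x$1) \<psi>"
   using has_weak_grad_smooth[OF Z_ob sq] t by (simp add: has_weak_grad_def)
  also have "(%x. grad q x$1) = (%x. x$1*pd 1 \<psi> x) + \<psi>" by (auto simp: pq)
  finally have id: "l2_inner Z q (pd 1 \<psi>) = - l2_inner Z ((%x. x$1*pd 1 \<psi> x) + \<psi>) \<psi>" .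
  have L: "(%x. x$1*pd 1 \<psi> x)\<in>L2_space Z" "\<psi>\<in>L2_space Z" "pd 1 \<psi>\<in>L2_space Z" "q\<in>L2_space Z"
   using L2_Z_smooth(1)[OF smooth_mult[OF sc smoothD(2)[OF s]]] L2_Z_smooth(1)[OF s] L2_Z_smooth(1)[OF smoothD(2)[OF s]] L2_Z_smooth(1)[OF sq] by auto
  have sw: "l2_inner Z (%x. x$1*pd 1 \<psi> x) \<psi> = l2_inner Z q (pd 1 \<psi>)"
   by (simp add: l2_inner_def q_def mult_ac)
  have "(l2_norm Z \<psi>)^2 = - 2*l2_inner Z q (pd 1 \<psi>)"
   using id l2.add_left[OF L(1,2,2)] sw l2_norm_sq[OF L(2)] by linarith
  also have "... <= 2*(l2_norm Z q*l2_norm Z (pd 1 \<psi>))"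
   using l2_Cauchy_Schwarz[OF L(4,3)] by linarith
  also have "... <= 2*((M*l2_norm Z \<psi>)*l2_norm Z (grad \<psi>))"
  proof -
   have 1: "l2_norm Z q <= M*l2_norm Z \<psi>"
   proof (rule L2_dominated(2)[OF L(2) L2_spaceD(1)[OF L(4)] M0])
    show "\<bar>q x\<bar> <= M*\<bar>\<psi> x\<bar>" if "x\<in>Z" for x
     using order_trans[OF component_le_norm_cart M[OF that], of 1] by (simp add: q_def abs_mult mult_right_mono)
   qed
   have 2: "l2_norm Z (pd 1 \<psi>) <= l2_norm Z (grad \<psi>)"
    using l2_norm_component_le[OF Z_ob L2_Z_smooth(2)[OF s], of 1] by simp
   show ?thesis using mult_mono[OF 1 2] M0 L by simp
  qed
  finally have le: "(l2_norm Z \<psi>)^2 <= (2*M*l2_norm Z (grad \<psi>))*l2_norm Z \<psi>" by (simp add: mult_ac)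
  show ?thesis
  proof (cases "l2_norm Z \<psi> = 0")
   case True
   thus ?thesis using M0 L2_Z_smooth(2)[OF s] by simp
  next
   case False
   hence "l2_norm Z \<psi> > 0" using l2_norm_nonneg[OF L(2)] by linarith
   with le show ?thesis unfolding power2_eq_square by (rule mult_right_le_imp_le)
  qed
 qed
 thus thesis using M0 by (intro that[of "2*M"]) auto
qed

lemma weak_curl_L2: "q\<in>H1 Z ==> weak_curl Z q\<in>L2_space Z"
 unfolding curl_rotate by (intro l2.closed(4) L2_rotate weak_grad_spec(1)[OF Z_ob])

lemma H10_H1: "q\<in>H10 Z ==> q\<in>H1 Z"
 by (simp add: H10_def)

lemmas curl_H10_L2 = weak_curl_L2[OF H10_H1]

lemma l2_norm_rotate_diff:
 assumes "u\<in>L2_space Z" "v\<in>L2_space Z"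
 shows "l2_norm Z (- rotate_field u - (- rotate_field v)) = l2_norm Z (u - v)"
proof -
 have "- rotate_field u - (- rotate_field v) = - rotate_field (u - v)" by (simp only: rotate_field_linear) (simp only: minus_diff_minus)
 thus ?thesis using assms by (simp only: l2_norm_uminus[OF L2_rotate[OF l2.closed(3)]] l2_norm_rotate)
qed

lemma H10_iff: "q\<in>H10 Z \<longleftrightarrow> q\<in>H1 Z & (EX \<phi>. (ALL m. test_function Z (\<phi> m)) &
  (%m. l2_norm Z (q - \<phi> m)) \<longlonglongrightarrow> 0 & (%m. l2_norm Z (weak_grad Z q - grad (\<phi> m))) \<longlonglongrightarrow> 0)"
 by (simp only: H10_def fun_diff_def mem_Collect_eq)

lemma H10_approx:
 assumes q: "q\<in>H10 Z"
 obtains \<psi> where "!!n::nat. test_function Z (\<psi> n)" "(%n. l2_norm Z (weak_curl Z q - curl (\<psi> n))) \<longlonglongrightarrow> 0"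
proof -
 obtain \<psi> where \<psi>: "!!n::nat. test_function Z (\<psi> n)" "(%n. l2_norm Z (weak_grad Z q - grad (\<psi> n))) \<longlonglongrightarrow> 0"
  using q unfolding H10_iff by blast
 have "l2_norm Z (weak_curl Z q - curl (\<psi> n)) = l2_norm Z (weak_grad Z q - grad (\<psi> n))" for n
  unfolding curl_rotate by (rule l2_norm_rotate_diff[OF weak_grad_spec(1)[OF Z_ob H10_H1[OF q]] L2_Z_test(2)[OF \<psi>(1)]])
 with \<psi> show thesis by (intro that[of \<psi>]) auto
qed

lemma test_function_diff: "test_function Z \<phi> ==> test_function Z \<psi> ==> test_function Z (\<phi> - \<psi>)"
 using subspace_diff[OF subspace_test_function, of \<phi> Z \<psi>] by simp

end

lemma grad_diff: "smooth \<phi> ==> smooth \<psi> ==> grad (\<phi> - \<psi>) = grad \<phi> - grad \<psi>"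
 and grad_add: "smooth \<phi> ==> smooth \<psi> ==> grad (\<phi> + \<psi>) = grad \<phi> + grad \<psi>"
 and grad_scale: "smooth \<phi> ==> grad (c*\<^sub>R \<phi>) = c*\<^sub>R grad \<phi>"
proof -
 have add: "grad (\<phi> + \<psi>) = grad \<phi> + grad \<psi>" if s: "smooth \<phi>" "smooth \<psi>" for \<phi> \<psi>
 proof
  fix x
  have "pd i (%x. \<phi> x + \<psi> x) x = pd i \<phi> x + pd i \<psi> x" for i
   using pd_add[OF smoothD(1)[OF s(1)] smoothD(1)[OF s(2)], of i] by (simp add: fun_eq_iff)
  thus "grad (\<phi> + \<psi>) x = (grad \<phi> + grad \<psi>) x"
   by (intro point_eqI) (simp_all add: l2_inner_fun(1)[symmetric] del: plus_fun_apply)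
 qed
 have scale: "grad (c*\<^sub>R \<phi>) = c*\<^sub>R grad \<phi>" if s: "smooth \<phi>" for \<phi> c
 proof
  fix x
  have "pd i (%x. c*\<phi> x) x = c*pd i \<phi> x" for i
   using pd_scale[OF smoothD(1)[OF s], of i c] by (simp add: fun_eq_iff)
  moreover have "c*\<^sub>R \<phi> = (%x. c*\<phi> x)" by auto
  ultimately show "grad (c*\<^sub>R \<phi>) x = (c*\<^sub>R grad \<phi>) x" by (intro point_eqI) simp_all
 qed
 show "smooth \<phi> ==> smooth \<psi> ==> grad (\<phi> + \<psi>) = grad \<phi> + grad \<psi>" by (rule add)
 show "smooth \<phi> ==> grad (c*\<^sub>R \<phi>) = c*\<^sub>R grad \<phi>" by (rule scale)
 show "smooth \<phi> ==> smooth \<psi> ==> grad (\<phi> - \<psi>) = grad \<phi> - grad \<psi>"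
 proof -
  assume s: "smooth \<phi>" "smooth \<psi>"
  have sm: "smooth ((-1)*\<^sub>R \<psi>)" using subspace_scale[OF subspace_smooth, of \<psi> "-1"] s by simp
  have e: "a - b = a + (-1)*\<^sub>R b" for a b :: "point => 'b::real_vector" by simp
  show ?thesis unfolding e[of \<phi>] e[of "grad \<phi>"] using add[OF s(1) sm] scale[OF s(2), of "-1"] by simp
 qed
qed

lemma subspace_grad: "subspace W ==> W \<subseteq> {q. smooth q} ==> subspace (grad ` W)"
 and subspace_curl: "subspace W ==> W \<subseteq> {q. smooth q} ==> subspace (curl ` W)"
proof -
 assume W: "subspace W" "W \<subseteq> {q. smooth q}"
 have g0: "grad 0 = 0" using grad_scale[of 0 0] subspace_0[OF subspace_smooth] by simp
 show "subspace (grad ` W)"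
 proof (rule subspaceI)
  show "0\<in>grad ` W" using g0 subspace_0[OF W(1)] by force
  show "x + y\<in>grad ` W" if xy: "x\<in>grad ` W" "y\<in>grad ` W" for x y
  proof -
   obtain a b where ab: "a\<in>W" "x = grad a" "b\<in>W" "y = grad b" using xy by blast
   have "smooth a" "smooth b" using W(2) ab(1,3) by auto
   hence "x + y = grad (a + b)" unfolding ab(2,4) by (rule grad_add[symmetric])
   thus ?thesis using subspace_add[OF W(1) ab(1,3)] by blast
  qed
  show "c*\<^sub>R x\<in>grad ` W" if x: "x\<in>grad ` W" for c x
  proof -
   obtain a where a: "a\<in>W" "x = grad a" using x by blast
   have "smooth a" using W(2) a(1) by auto
   hence "c*\<^sub>R x = grad (c*\<^sub>R a)" unfolding a(2) by (rule grad_scale[symmetric])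
   thus ?thesis using subspace_scale[OF W(1) a(1)] by blast
  qed
 qed
 thus "subspace (curl ` W)"
 proof -
  assume g: "subspace (grad ` W)"
  have eq: "curl ` W = (%v. - rotate_field v) ` (grad ` W)" by (auto simp: curl_rotate image_iff)
  show ?thesis unfolding eq
  proof (rule subspaceI)
   have "- rotate_field 0 = 0" using rotate_field_linear(2)[of 0 0] by simp
   thus "0\<in>(%v. - rotate_field v) ` grad ` W" using subspace_0[OF g] by force
   show "x + y\<in>(%v. - rotate_field v) ` grad ` W" if xy: "x\<in>(%v. - rotate_field v) ` grad ` W" "y\<in>(%v. - rotate_field v) ` grad ` W" for x y
   proof -
    obtain a b where ab: "a\<in>grad ` W" "x = - rotate_field a" "b\<in>grad ` W" "y = - rotate_field b" using xy by blast
    have "x + y = - rotate_field (a + b)" unfolding ab rotate_field_linear by simp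
    thus ?thesis using subspace_add[OF g ab(1,3)] by blast
   qed
   show "c*\<^sub>R x\<in>(%v. - rotate_field v) ` grad ` W" if x: "x\<in>(%v. - rotate_field v) ` grad ` W" for c x
   proof -
    obtain a where a: "a\<in>grad ` W" "x = - rotate_field a" using x by blast
    have "c*\<^sub>R x = - rotate_field (c*\<^sub>R a)" unfolding a rotate_field_linear by simp
    thus ?thesis using subspace_scale[OF g a(1)] by blast
   qed
  qed
 qed
qed

context accessible_domain
begin

text \<open>If curls of test functions converge, so do the potentials, by the Friedrichs inequality.
  Thus the curls of \<open>H10\<close> are, up to null functions, the closure of the curls of test
  functions.\<close>

lemma H10_limit:
 assumes z: "z\<in>L2_space Z" and \<psi>: "!!n::nat. test_function Z (\<psi> n)" and lim: "(%n. l2_norm Z (z - curl (\<psi> n))) \<longlonglongrightarrow> 0"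
 shows "\<exists>q\<in>H10 Z. l2_norm Z (weak_curl Z q - z) = 0"
proof -
 obtain F where F: "F >= 0" "!!\<psi>. test_function Z \<psi> ==> l2_norm Z \<psi> <= F*l2_norm Z (grad \<psi>)" by (rule Friedrichs, rule that)
 define g where "g = rotate_field z"
 have gL: "g\<in>L2_space Z" unfolding g_def by (rule L2_rotate[OF z])
 have zg: "- rotate_field g = z" unfolding g_def by (intro ext point_eqI) simp_all
 have ng: "l2_norm Z (g - grad (\<psi> n)) = l2_norm Z (z - curl (\<psi> n))" for n
  using l2_norm_rotate_diff[OF gL L2_Z_test(2)[OF \<psi>[of n]]] unfolding zg curl_rotate by simp
 have glim: "(%n. l2_norm Z (g - grad (\<psi> n))) \<longlonglongrightarrow> 0" using lim unfolding ng .
 have L: "\<psi> n\<in>L2_space Z" "grad (\<psi> n)\<in>L2_space Z" for n using L2_Z_test \<psi> by auto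
 have dist: "l2_norm Z (\<psi> m - \<psi> n) <= F*(l2_norm Z (g - grad (\<psi> m)) + l2_norm Z (g - grad (\<psi> n)))" for m n
 proof -
  have "l2_norm Z (\<psi> m - \<psi> n) <= F*l2_norm Z (grad (\<psi> m - \<psi> n))" by (rule F(2)[OF test_function_diff[OF \<psi> \<psi>]])
  also have "grad (\<psi> m - \<psi> n) = grad (\<psi> m) - grad (\<psi> n)" by (rule grad_diff[OF test_function_smooth[OF \<psi>] test_function_smooth[OF \<psi>]])
  finally have 1: "l2_norm Z (\<psi> m - \<psi> n) <= F*l2_norm Z (grad (\<psi> m) - grad (\<psi> n))" .
  have 2: "l2_norm Z (grad (\<psi> m) - grad (\<psi> n)) <= l2_norm Z (g - grad (\<psi> m)) + l2_norm Z (g - grad (\<psi> n))"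
   using l2_triangle3[OF L(2) gL L(2), of m n] l2_minus_commute[OF L(2) gL, of m] by simp
  show ?thesis by (rule order_trans[OF 1 mult_left_mono[OF 2 F(1)]])
 qed
 obtain q where q: "q\<in>L2_space Z" "(%n. l2_norm Z (\<psi> n - q)) \<longlonglongrightarrow> 0"
 proof (rule L2_complete[of \<psi>, OF L(1)])
  fix e :: real assume e: "e > 0"
  have "\<forall>\<^sub>F n in sequentially. l2_norm Z (g - grad (\<psi> n)) < e/(2*(F + 1))"
   using e F(1) by (intro order_tendstoD(2)[OF glim]) simp
  then obtain N where N: "!!n. n >= N ==> l2_norm Z (g - grad (\<psi> n)) < e/(2*(F + 1))" by (auto simp: eventually_sequentially)
  have "l2_norm Z (\<psi> m - \<psi> n) < e" if mn: "m >= N" "n >= N" for m n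
  proof -
   have "l2_norm Z (\<psi> m - \<psi> n) <= F*(l2_norm Z (g - grad (\<psi> m)) + l2_norm Z (g - grad (\<psi> n)))" by (rule dist)
   also have "... <= F*(e/(F + 1))"
    using N[OF mn(1)] N[OF mn(2)] F(1) by (intro mult_left_mono) (auto simp: field_simps)
   also have "... < e" using F(1) e by (simp add: field_simps)
   finally show ?thesis .
  qed
  thus "EX N. ALL m>=N. ALL n>=N. l2_norm Z (\<psi> m - \<psi> n) < e" by blast
 qed
 have glim': "(%n. l2_norm Z (grad (\<psi> n) - g)) \<longlonglongrightarrow> 0" using glim l2_minus_commute[OF gL L(2)] by simp
 have "has_weak_grad Z q g"
  by (rule has_weak_grad_tendsto[OF Z_ob L _ q(1) gL q(2) glim']) (rule has_weak_grad_smooth[OF Z_ob test_function_smooth[OF \<psi>]])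
 note w = weak_gradI[OF Z_ob q(1) gL this]
 have wL: "weak_grad Z q\<in>L2_space Z" by (rule weak_grad_spec(1)[OF Z_ob w(1)])
 have z0: "l2_norm Z (weak_grad Z q - g) = 0" by (rule l2_null_diff_AE[OF wL gL w(2)])
 have "l2_norm Z (weak_grad Z q - grad (\<psi> n)) = l2_norm Z (g - grad (\<psi> n))" for n
 proof (rule l2_norm_cong_AE[OF l2.closed(3)[OF wL L(2)] l2.closed(3)[OF gL L(2)]])
  show "AE x in lebesgue_on Z. (weak_grad Z q - grad (\<psi> n)) x = (g - grad (\<psi> n)) x" using w(2) by eventually_elim simp
 qed
 hence "q\<in>H10 Z"
  unfolding H10_iff using w(1) \<psi> glim q(2) by (intro conjI exI[of _ \<psi>] allI) (simp_all only: l2_minus_commute[OF q(1) L(1)])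
 moreover have "l2_norm Z (weak_curl Z q - z) = 0"
  using l2_norm_rotate_diff[OF wL gL] z0 unfolding zg curl_rotate by simp
 ultimately show ?thesis by blast
qed

lemma curl_H10_limit_zero:
 assumes q: "q\<in>H10 Z" and v: "v\<in>L2_space Z" and orth: "!!\<psi>. test_function Z \<psi> ==> l2_inner Z v (curl \<psi>) = 0"
 shows "l2_inner Z v (weak_curl Z q) = 0"
proof -
 obtain \<psi> where \<psi>: "!!n::nat. test_function Z (\<psi> n)" "(%n. l2_norm Z (weak_curl Z q - curl (\<psi> n))) \<longlonglongrightarrow> 0"
  by (rule H10_approx[OF q], rule that)
 have L: "curl (\<psi> n)\<in>L2_space Z" for n by (rule L2_Z_test(3)[OF \<psi>(1)])
 have "(%n. l2_norm Z (curl (\<psi> n) - weak_curl Z q)) \<longlonglongrightarrow> 0"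
  using \<psi>(2) l2_minus_commute[OF curl_H10_L2[OF q] L] by simp
 hence "(%n. l2_inner Z (curl (\<psi> n)) v) \<longlonglongrightarrow> l2_inner Z (weak_curl Z q) v"
  by (rule l2_inner_tendsto[OF L curl_H10_L2[OF q] v])
 moreover have "l2_inner Z (curl (\<psi> n)) v = 0" for n using orth[OF \<psi>(1)] l2.sym[OF L v] by simp
 ultimately have "l2_inner Z (weak_curl Z q) v = 0" by (simp add: LIMSEQ_const_iff)
 thus ?thesis using l2.sym[OF curl_H10_L2[OF q] v] by simp
qed

lemma curl_H10_orth_grad: "q\<in>H10 Z ==> smooth \<phi> ==> l2_inner Z (weak_curl Z q) (grad \<phi>) = 0"
 using curl_H10_limit_zero[OF _ L2_Z_smooth(2)] curl_test_orth_grad[OF Z_ob] l2.sym[OF curl_H10_L2 L2_Z_smooth(2)]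
  l2.sym[OF L2_Z_test(3) L2_Z_smooth(2)] by metis

lemma V_Hdiv: "v\<in>V_space Z ==> v\<in>Hdiv Z" and V_L2: "v\<in>V_space Z ==> v\<in>L2_space Z"
 and div_L2: "v\<in>V_space Z ==> weak_div Z v\<in>L2_space Z"
 using HdivD[OF Z_ob] weak_div_spec(1)[OF Z_ob] by (auto simp: V_space_def)

text \<open>Orthogonality to all smooth gradients encodes two things: test functions give zero
  divergence, the remaining functions then give zero normal trace.\<close>

lemma V_spaceI_null:
 assumes v: "v\<in>L2_space Z" and orth: "!!\<phi>. smooth \<phi> ==> l2_inner Z v (grad \<phi>) = 0"
 shows "v\<in>V_space Z" "has_weak_div Z v (%_. 0)" "l2_norm Z (weak_div Z v) = 0"
proof -
 show h: "has_weak_div Z v (%_. 0)"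
  unfolding has_weak_div_def using orth test_function_smooth by (auto simp: l2_inner_def)
 note z = weak_div_zero[OF Z_ob v h]
 show "l2_norm Z (weak_div Z v) = 0" by (rule z)
 show "v\<in>V_space Z"
  unfolding V_space_def normal_trace_def
  using z orth l2_null_orth(2)[OF L2_Z_smooth(1) weak_div_spec(1)[OF Z_ob z(1)] z(2)] by auto
qed

lemma curl_H10_V:
 assumes q: "q\<in>H10 Z"
 shows "weak_curl Z q\<in>V_space Z" "has_weak_div Z (weak_curl Z q) (%_. 0)"
  "l2_norm Z (weak_div Z (weak_curl Z q)) = 0"
 using V_spaceI_null[OF curl_H10_L2[OF q] curl_H10_orth_grad[OF q]] by auto

lemma subspace_V: "subspace (V_space Z)"
proof (rule subspaceI)
 show "0\<in>V_space Z" by (rule V_spaceI_null(1)) (simp_all add: l2_inner_def)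
 show "x + y\<in>V_space Z" if "x\<in>V_space Z" "y\<in>V_space Z" for x y
  using that weak_div_add(1)[OF Z_ob] normal_trace_add[OF Z_ob] by (auto simp: V_space_def)
 show "c*\<^sub>R x\<in>V_space Z" if "x\<in>V_space Z" for c x
  using that weak_div_scale(1)[OF Z_ob] normal_trace_scale[OF Z_ob] by (auto simp: V_space_def)
qed

text \<open>Only semidefinite on \<open>V_space\<close>, as it vanishes on all curls. On
  \<open>K_space\<close> it will turn out to control the field itself.\<close>

definition div_form :: "vector_field => vector_field => real" where
 "div_form u v = l2_inner Z (weak_div Z u) (weak_div Z v)"

lemma div_semi_inner: "subspace W ==> W \<subseteq> V_space Z ==> semi_inner_space W div_form"
 unfolding div_form_def
 by unfold_locales
  (auto simp: subset_iff V_Hdiv div_L2 weak_div_inner_add[OF Z_ob] weak_div_inner_scale[OF Z_ob] l2.nonneg intro: l2.sym)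

sublocale div: semi_inner_space "V_space Z" div_form
 by (rule div_semi_inner[OF subspace_V order_refl])

lemma div_nrm: "div.nrm v = l2_norm Z (weak_div Z v)"
 by (simp add: div.nrm_def l2_norm_def div_form_def)

lemma V_limit:
 assumes v: "!!n::nat. v n\<in>V_space Z" and u: "u\<in>L2_space Z" "(%n. l2_norm Z (v n - u)) \<longlonglongrightarrow> 0"
  and g: "g\<in>L2_space Z" "(%n. l2_norm Z (weak_div Z (v n) - g)) \<longlonglongrightarrow> 0"
 shows "u\<in>V_space Z" "(%n. div.nrm (v n - u)) \<longlonglongrightarrow> 0"
proof -
 have h: "has_weak_div Z u g"
  by (rule has_weak_div_tendsto[OF Z_ob V_L2[OF v] div_L2[OF v] weak_div_spec(2)[OF Z_ob V_Hdiv[OF v]] u(1) g(1) u(2) g(2)])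
 note w = weak_divI[OF Z_ob u(1) g(1) h]
 have uL: "weak_div Z u\<in>L2_space Z" by (rule weak_div_spec(1)[OF Z_ob w(1)])
 have z: "l2_norm Z (weak_div Z u - g) = 0" by (rule l2_null_diff_AE[OF uL g(1) w(2)])
 show uV: "u\<in>V_space Z"
  unfolding V_space_def
 proof (intro CollectI conjI w(1) allI impI)
  fix q assume q: "smooth q"
  have "(%n. l2_inner Z (v n) (grad q) + l2_inner Z (weak_div Z (v n)) q) \<longlonglongrightarrow> l2_inner Z u (grad q) + l2_inner Z g q"
   by (intro tendsto_add l2_inner_tendsto V_L2 div_L2 v u g L2_Z_smooth q)
  moreover have "l2_inner Z (v n) (grad q) + l2_inner Z (weak_div Z (v n)) q = 0" for n
   using v[of n] q by (simp add: V_space_def normal_trace_def)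
  ultimately have "l2_inner Z u (grad q) + l2_inner Z g q = 0" by (simp add: LIMSEQ_const_iff)
  thus "normal_trace Z u q = 0"
   unfolding normal_trace_def using l2_inner_null_cong(1)[OF uL g(1) L2_Z_smooth(1)[OF q] z] by simp
 qed
 show "(%n. div.nrm (v n - u)) \<longlonglongrightarrow> 0"
 proof (rule real_tendsto_sandwich[OF _ _ tendsto_const g(2)])
  show "\<forall>\<^sub>F n in sequentially. 0 <= div.nrm (v n - u)" using v uV by simp
  show "\<forall>\<^sub>F n in sequentially. div.nrm (v n - u) <= l2_norm Z (weak_div Z (v n) - g)"
  proof (rule always_eventually, rule allI)
   fix n
   have d: "v n - u\<in>V_space Z" using v uV by simp
   have wd: "has_weak_div Z (v n - u) (weak_div Z (v n) - g)"
   proof -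
    have "has_weak_div Z (v n + (-1)*\<^sub>R u) (weak_div Z (v n) + (-1)*\<^sub>R g)"
     by (rule has_weak_div_add[OF Z_ob V_L2[OF v] l2.closed(2)[OF u(1)] div_L2[OF v] l2.closed(2)[OF g(1)]
      weak_div_spec(2)[OF Z_ob V_Hdiv[OF v]] has_weak_div_scale[OF Z_ob u(1) g(1) h]])
    thus ?thesis by (simp del: minus_apply)
   qed
   have dL: "weak_div Z (v n) - g\<in>L2_space Z" by (rule l2.closed(3)[OF div_L2[OF v] g(1)])
   have "l2_norm Z (weak_div Z (v n - u)) = l2_norm Z (weak_div Z (v n) - g)"
    by (rule l2_norm_cong_AE[OF div_L2[OF d] dL weak_divI(2)[OF Z_ob V_L2[OF d] dL wd]])
   thus "div.nrm (v n - u) <= l2_norm Z (weak_div Z (v n) - g)" by (simp add: div_nrm)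
  qed
 qed
qed

text \<open>Tested with test functions only; by density it is the orthogonal complement in
  \<open>V_space\<close> of all curls of \<open>H10\<close>, the continuous counterpart of the
  discrete kernel.\<close>

definition K_space :: "vector_field set" where
 "K_space = {v\<in>V_space Z. ALL \<psi>. test_function Z \<psi> --> l2_inner Z v (curl \<psi>) = 0}"

lemma K_V: "v\<in>K_space ==> v\<in>V_space Z"
 by (simp add: K_space_def)

lemma K_orth: "v\<in>K_space ==> q\<in>H10 Z ==> l2_inner Z v (weak_curl Z q) = 0"
 by (rule curl_H10_limit_zero) (auto simp: K_space_def V_L2)

lemma subspace_K: "subspace K_space"
 unfolding K_space_def
 by (rule subspaceI) (auto simp: subspace_0[OF subspace_V] subspace_add[OF subspace_V] subspace_scale[OF subspace_V]
  l2.add_left l2.scale_left V_L2 L2_Z_test(3))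

lemma Helmholtz_decomposition:
 assumes w: "w\<in>L2_space Z"
 obtains q where "q\<in>H10 Z" "!!\<psi>. test_function Z \<psi> ==> l2_inner Z (w - weak_curl Z q) (curl \<psi>) = 0"
proof -
 have W: "subspace (curl ` {\<psi>. test_function Z \<psi>})"
  by (rule subspace_curl[OF subspace_test_function]) (auto simp: test_function_smooth)
 have WL: "curl ` {\<psi>. test_function Z \<psi>} \<subseteq> L2_space Z" using L2_Z_test(3) by blast
 obtain r w' where r: "r\<in>L2_space Z" "!!n::nat. w' n\<in>curl ` {\<psi>. test_function Z \<psi>}"
  "(%n. l2_norm Z (w - w' n - r)) \<longlonglongrightarrow> 0" "!!v. v\<in>curl ` {\<psi>. test_function Z \<psi>} ==> l2_inner Z r v = 0"
  using l2.orthogonal_residual[OF W WL w l2_complete_seq] unfolding l2_nrm by metis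
 have "ALL n. EX \<psi>. test_function Z \<psi> & w' n = curl \<psi>" using r(2) by blast
 then obtain \<psi> where \<psi>: "!!n. test_function Z (\<psi> n)" "!!n. w' n = curl (\<psi> n)" by metis
 have wr: "w - r\<in>L2_space Z" by (rule l2.closed(3)[OF w r(1)])
 have eq: "w - w' n - r = w - r - curl (\<psi> n)" for n by (rule ext) (simp add: \<psi>(2))
 have "(%n. l2_norm Z (w - r - curl (\<psi> n))) \<longlonglongrightarrow> 0" using r(3) unfolding eq .
 from H10_limit[OF wr \<psi>(1) this] obtain q where q: "q\<in>H10 Z" "l2_norm Z (weak_curl Z q - (w - r)) = 0" by blast
 show thesis
 proof (rule that[OF q(1)])
  fix \<phi> assume t: "test_function Z \<phi>"
  note cL = L2_Z_test(3)[OF t]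
  have "l2_inner Z (w - weak_curl Z q) (curl \<phi>) = l2_inner Z w (curl \<phi>) - l2_inner Z (w - r) (curl \<phi>)"
   using l2.diff_left[OF w curl_H10_L2[OF q(1)] cL] l2_inner_null_cong(1)[OF curl_H10_L2[OF q(1)] wr cL q(2)] by simp
  also have "... = l2_inner Z r (curl \<phi>)" using l2.diff_left[OF w r(1) cL] by simp
  also have "... = 0" using r(4) t by blast
  finally show "l2_inner Z (w - weak_curl Z q) (curl \<phi>) = 0" .
 qed
qed

text \<open>A curl of \<open>H10\<close> has neither divergence nor normal trace, so subtracting it
  does not leave \<open>V_space\<close>.\<close>

lemma V_decomposition:
 assumes w: "w\<in>V_space Z"
 obtains q where "q\<in>H10 Z" "w - weak_curl Z q\<in>K_space"
proof -
 obtain q where q: "q\<in>H10 Z" "!!\<psi>. test_function Z \<psi> ==> l2_inner Z (w - weak_curl Z q) (curl \<psi>) = 0"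
  by (rule Helmholtz_decomposition[OF V_L2[OF w]], rule that)
 show thesis by (rule that[OF q(1)]) (use q w curl_H10_V(1)[OF q(1)] in \<open>auto simp: K_space_def simp del: minus_apply\<close>)
qed

text \<open>The residual of \<open>v\<close> from the smooth gradients is orthogonal to them by
  construction, and orthogonal to curls of test functions because \<open>v\<close> and all gradients
  are. The vanishing theorem makes it null.\<close>

lemma K_gradient_approx:
 assumes v: "v\<in>K_space"
 obtains \<phi> where "!!n::nat. smooth (\<phi> n)" "(%n. l2_norm Z (grad (\<phi> n) - v)) \<longlonglongrightarrow> 0"
proof -
 note vL = V_L2[OF K_V[OF v]]
 have W: "subspace (grad ` {\<phi>. smooth \<phi>})" by (rule subspace_grad[OF subspace_smooth]) simp
 have WL: "grad ` {\<phi>. smooth \<phi>} \<subseteq> L2_space Z" using L2_Z_smooth(2) by blast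
 obtain r w where r: "r\<in>L2_space Z" "!!n::nat. w n\<in>grad ` {\<phi>. smooth \<phi>}"
  "(%n. l2_norm Z (v - w n - r)) \<longlonglongrightarrow> 0" "!!u. u\<in>grad ` {\<phi>. smooth \<phi>} ==> l2_inner Z r u = 0"
  using l2.orthogonal_residual[OF W WL vL l2_complete_seq] unfolding l2_nrm by metis
 have "ALL n. EX \<phi>. smooth \<phi> & w n = grad \<phi>" using r(2) by blast
 then obtain \<phi> where \<phi>: "!!n. smooth (\<phi> n)" "!!n. w n = grad (\<phi> n)" by metis
 have gL: "grad (\<phi> n)\<in>L2_space Z" for n by (rule L2_Z_smooth(2)[OF \<phi>(1)])
 have "l2_norm Z r = 0"
 proof (rule Helmholtz_zero_exterior[OF Z(1) r(1)])
  show "l2_inner Z r (grad \<phi>) = 0" if "smooth \<phi>" for \<phi> using r(4) that by blast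
  fix \<psi> assume t: "test_function Z \<psi>"
  note cL = L2_Z_test(3)[OF t]
  have "l2_inner Z (v - grad (\<phi> n)) (curl \<psi>) = 0" for n
   using l2.diff_left[OF vL gL cL, of n] v t curl_test_orth_grad[OF Z_ob t \<phi>(1), of n] l2.sym[OF gL cL, of n] by (simp add: K_space_def)
  moreover have "(%n. l2_inner Z (v - grad (\<phi> n)) (curl \<psi>)) \<longlonglongrightarrow> l2_inner Z r (curl \<psi>)"
   by (rule l2_inner_tendsto[OF l2.closed(3)[OF vL gL] r(1) cL]) (use r(3) in \<open>simp only: \<phi>(2)\<close>)
  ultimately show "l2_inner Z r (curl \<psi>) = 0" by (simp add: LIMSEQ_const_iff)
 qed
 have "l2_norm Z (grad (\<phi> n) - v) <= l2_norm Z (v - w n - r)" for n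
 proof -
  have "grad (\<phi> n) - v = - ((v - w n - r) + r)" by (simp add: \<phi>(2) algebra_simps del: minus_apply)
  moreover have L: "v - w n - r\<in>L2_space Z" unfolding \<phi>(2) by (intro l2.closed vL gL r)
  ultimately show ?thesis
   using l2_triangle[OF L r(1)] l2_norm_uminus[OF l2.closed(1)[OF L r(1)]] \<open>l2_norm Z r = 0\<close> by simp
 qed
 hence "(%n. l2_norm Z (grad (\<phi> n) - v)) \<longlonglongrightarrow> 0"
  by (intro real_tendsto_sandwich[OF _ _ tendsto_const r(3)]) (auto intro!: always_eventually l2_norm_nonneg l2.closed(3) gL vL simp del: minus_apply)
 thus thesis by (rule that[OF \<phi>(1)])
qed

end

subsection \<open>Fields orthogonal to curls and the source problem\<close>

context accessible_domain
begin

lemma div_diff_norm: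
 assumes u: "u\<in>V_space Z" and v: "v\<in>V_space Z"
 shows "l2_norm Z (weak_div Z u - weak_div Z v) = l2_norm Z (weak_div Z (u - v))"
proof -
 have d: "u - v\<in>V_space Z" using u v by simp
 have "has_weak_div Z (u + (-1)*\<^sub>R v) (weak_div Z u + (-1)*\<^sub>R weak_div Z v)"
  by (rule has_weak_div_add[OF Z_ob V_L2[OF u] l2.closed(2)[OF V_L2[OF v]] div_L2[OF u] l2.closed(2)[OF div_L2[OF v]]
   weak_div_spec(2)[OF Z_ob V_Hdiv[OF u]] has_weak_div_scale[OF Z_ob V_L2[OF v] div_L2[OF v] weak_div_spec(2)[OF Z_ob V_Hdiv[OF v]]]])
 hence wd: "has_weak_div Z (u - v) (weak_div Z u - weak_div Z v)" by (simp del: minus_apply)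
 have dL: "weak_div Z u - weak_div Z v\<in>L2_space Z" by (rule l2.closed(3)[OF div_L2[OF u] div_L2[OF v]])
 show ?thesis
  by (rule l2_norm_cong_AE[OF div_L2[OF d] dL weak_divI(2)[OF Z_ob V_L2[OF d] dL wd], symmetric])
qed

lemma semi_inner_K: "semi_inner_space K_space div_form"
 by (rule div_semi_inner[OF subspace_K]) (auto simp: K_V)

sublocale Kd: semi_inner_space K_space div_form
 by (rule semi_inner_K)

end

section \<open>Cell means of the divergence and the continuous problem\<close>

context polygonal_mesh_of
begin

definition cell :: "polygon => vector_field => real" where
 "cell P v = l2_inner Z (weak_div Z v) (indicator (intr P))"

lemma indicator_L2:
 assumes P: "P\<in>\<T>"
 shows "(indicator (intr P) :: scalar_field)\<in>L2_space Z"
  "l2_norm Z (indicator (intr P) :: scalar_field) <= 1*l2_norm Z (%_. 1 :: real)"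
proof -
 have "(indicator (intr P) :: scalar_field)\<in>borel_measurable borel" using E_open[OF P] by simp
 hence m: "(indicator (intr P) :: scalar_field)\<in>borel_measurable (lebesgue_on Z)" by (rule borel_lebesgue_on)
 show "(indicator (intr P) :: scalar_field)\<in>L2_space Z"
  "l2_norm Z (indicator (intr P) :: scalar_field) <= 1*l2_norm Z (%_. 1 :: real)"
  by (rule L2_dominated[OF L2_const[OF Z_ob, of 1] m, where c = 1]; simp add: indicator_def)+
qed

lemma cell_eq: assumes P: "P\<in>\<T>" shows "cell P v = l2_inner (intr P) (weak_div Z v) (%_. 1)"
proof -
 have eq: "indicator Z x*\<^sub>R (weak_div Z v x\<bullet>indicator (intr P) x) = indicator (intr P) x*\<^sub>R (weak_div Z v x\<bullet>1)" for x
  using sub[OF P] by (auto simp: indicator_def)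
 show ?thesis
  unfolding cell_def l2_inner_def integral_lebesgue_on[OF sets_lebesgue_open[OF Z_open]]
   integral_lebesgue_on[OF sets_lebesgue_open[OF E_open[OF P]]]
  by (rule Bochner_Integration.integral_cong[OF refl eq])
qed

lemma cell_linear:
 assumes P: "P\<in>\<T>"
 shows "linear_on (V_space Z) (cell P)"
 unfolding linear_on_def cell_def
proof (intro conjI ballI allI)
 show "l2_inner Z (weak_div Z (u + v)) (indicator (intr P)) = l2_inner Z (weak_div Z u) (indicator (intr P)) +
  l2_inner Z (weak_div Z v) (indicator (intr P))" if "u\<in>V_space Z" "v\<in>V_space Z" for u v
  by (rule weak_div_inner_add[OF Z_ob V_Hdiv[OF that(1)] V_Hdiv[OF that(2)] indicator_L2(1)[OF P]])
 show "l2_inner Z (weak_div Z (c*\<^sub>R u)) (indicator (intr P)) = c*l2_inner Z (weak_div Z u) (indicator (intr P))"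
  if "u\<in>V_space Z" for c u
  by (rule weak_div_inner_scale[OF Z_ob V_Hdiv[OF that] indicator_L2(1)[OF P]])
qed

lemma cell_linear_K: "P\<in>\<T> ==> linear_on K_space (cell P)"
 by (rule linear_on_subset[OF cell_linear]) (auto simp: K_V)

definition m1 :: real where "m1 = l2_norm Z (%_. 1 :: real)"

lemma m1_nonneg: "m1 >= 0"
 using l2_norm_nonneg[OF L2_const[OF Z_ob, of 1]] by (simp add: m1_def)

lemma cell_bound:
 assumes P: "P\<in>\<T>" and v: "v\<in>V_space Z"
 shows "\<bar>cell P v\<bar> <= m1*div.nrm v"
proof -
 have "\<bar>cell P v\<bar> <= l2_norm Z (weak_div Z v)*l2_norm Z (indicator (intr P) :: scalar_field)"
  unfolding cell_def by (rule l2_Cauchy_Schwarz[OF div_L2[OF v] indicator_L2(1)[OF P]])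
 also have "... <= l2_norm Z (weak_div Z v)*m1"
  using indicator_L2(2)[OF P] by (intro mult_left_mono) (auto simp: m1_def div_L2 v)
 finally show ?thesis by (simp add: div_nrm mult.commute)
qed

definition \<kappa> :: real where "\<kappa> = 2/C*mesh_size \<T>"

lemma \<kappa>_pos: "\<kappa> > 0"
 using C mesh_size_pos by (simp add: \<kappa>_def)

text \<open>\<open>v\<close> is a limit of smooth gradients, and
  \<open>(v, grad \<phi>) = -(div v, \<phi>)\<close> for each of them. With vanishing cell means the
  right-hand side is estimated by the Poincare inequality on every element.\<close>

lemma K_small:
 assumes v: "v\<in>K_space" and zero: "!!P. P\<in>\<T> ==> cell P v = 0"
 shows "l2_norm Z v <= \<kappa>*div.nrm v"
proof -
 note vV = K_V[OF v]
 obtain \<phi> where \<phi>: "!!n::nat. smooth (\<phi> n)" "(%n. l2_norm Z (grad (\<phi> n) - v)) \<longlonglongrightarrow> 0"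
  by (rule K_gradient_approx[OF v], rule that)
 have gL: "grad (\<phi> n)\<in>L2_space Z" for n by (rule L2_Z_smooth(2)[OF \<phi>(1)])
 define \<delta> where "\<delta> = div.nrm v"
 have \<delta>0: "\<delta> >= 0" using vV by (simp add: \<delta>_def)
 have est: "l2_inner Z (grad (\<phi> n)) v <= \<kappa>*(\<delta>*l2_norm Z (grad (\<phi> n)))" for n
 proof -
  let ?g = "weak_div Z v"
  note gd = div_L2[OF vV]
  have "l2_inner Z v (grad (\<phi> n)) + l2_inner Z ?g (\<phi> n) = 0"
   using vV \<phi>(1) by (simp add: V_space_def normal_trace_def)
  hence "l2_inner Z (grad (\<phi> n)) v = - (\<Sum>P\<in>\<T>. l2_inner (intr P) ?g (\<phi> n))"
   using l2.sym[OF gL V_L2[OF vV], of n] partition[OF gd L2_Z_smooth(1)[OF \<phi>(1)], of n] by linarith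
  also have "... <= (\<Sum>P\<in>\<T>. \<bar>l2_inner (intr P) ?g (\<phi> n)\<bar>)"
   using sum_abs[of "%P. l2_inner (intr P) ?g (\<phi> n)" \<T>] by linarith
  also have "... <= (\<Sum>P\<in>\<T>. \<kappa>*(\<bar>l2_norm (intr P) ?g\<bar>*\<bar>l2_norm (intr P) (grad (\<phi> n))\<bar>))"
  proof (rule sum_mono)
   fix P assume P: "P\<in>\<T>"
   have "l2_inner (intr P) ?g (%_. 1) = 0" using zero[OF P] cell_eq[OF P] by simp
   from Poincare_element[OF P \<phi>(1) L2_E[OF gd P] this, of n]
   show "\<bar>l2_inner (intr P) ?g (\<phi> n)\<bar> <= \<kappa>*(\<bar>l2_norm (intr P) ?g\<bar>*\<bar>l2_norm (intr P) (grad (\<phi> n))\<bar>)"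
    using L2_E[OF gd P] L2_E[OF gL P] by (simp add: \<kappa>_def)
  qed
  also have "... = \<kappa>*(\<Sum>P\<in>\<T>. \<bar>l2_norm (intr P) ?g\<bar>*\<bar>l2_norm (intr P) (grad (\<phi> n))\<bar>)"
   by (rule sum_distrib_left[symmetric])
  also have "... <= \<kappa>*(L2_set (%P. l2_norm (intr P) ?g) \<T>*L2_set (%P. l2_norm (intr P) (grad (\<phi> n))) \<T>)"
   using \<kappa>_pos by (intro mult_left_mono L2_set_mult_ineq) auto
  also have "L2_set (%P. l2_norm (intr P) ?g) \<T> = \<delta>"
   using gd by (simp add: L2_set_def norm_partition[symmetric] \<delta>_def div_nrm)
  also have "L2_set (%P. l2_norm (intr P) (grad (\<phi> n))) \<T> = l2_norm Z (grad (\<phi> n))"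
   using gL by (simp add: L2_set_def norm_partition[symmetric])
  finally show ?thesis .
 qed
 have l1: "(%n. l2_inner Z (grad (\<phi> n)) v) \<longlonglongrightarrow> l2_inner Z v v"
  by (rule l2_inner_tendsto[OF gL V_L2[OF vV] V_L2[OF vV] \<phi>(2)])
 have l2: "(%n. \<kappa>*(\<delta>*l2_norm Z (grad (\<phi> n)))) \<longlonglongrightarrow> \<kappa>*(\<delta>*l2_norm Z v)"
  by (intro tendsto_mult tendsto_const l2_norm_tendsto gL V_L2[OF vV] \<phi>(2))
 have "l2_inner Z v v <= \<kappa>*(\<delta>*l2_norm Z v)"
  by (rule LIMSEQ_le[OF l1 l2]) (use est in blast)
 hence le: "l2_norm Z v * l2_norm Z v <= (\<kappa>*\<delta>)*l2_norm Z v"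
  using l2_norm_sq[OF V_L2[OF vV]] by (simp add: power2_eq_square mult_ac)
 show ?thesis
 proof (cases "l2_norm Z v = 0")
  case True
  thus ?thesis using \<kappa>_pos \<delta>0 by (simp add: \<delta>_def)
 next
  case False
  hence "l2_norm Z v > 0" using l2_norm_nonneg[OF V_L2[OF vV]] by linarith
  with le show ?thesis unfolding \<delta>_def by (rule mult_right_le_imp_le)
 qed
qed

lemma l2_norm_comb:
 assumes v: "v\<in>V_space Z" and z: "!!P. P\<in>\<T> ==> z P\<in>L2_space Z"
 shows "l2_norm Z (\<Sum>P\<in>\<T>. cell P v *\<^sub>R z P) <= m1*(\<Sum>P\<in>\<T>. l2_norm Z (z P))*div.nrm v"
proof -
 have "l2_norm Z (\<Sum>P\<in>\<T>. cell P v *\<^sub>R z P) <= (\<Sum>P\<in>\<T>. l2_norm Z (cell P v *\<^sub>R z P))"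
  using z by (intro l2_norm_sum(2) finite_mesh l2.closed)
 also have "... <= (\<Sum>P\<in>\<T>. (m1*div.nrm v)*l2_norm Z (z P))"
  using z cell_bound[OF _ v] by (intro sum_mono) (simp add: l2_norm_scale mult_right_mono)
 also have "... = m1*(\<Sum>P\<in>\<T>. l2_norm Z (z P))*div.nrm v" unfolding sum_distrib_left[symmetric] by (simp add: mult_ac)
 finally show ?thesis .
qed

lemma div_comb:
 assumes v: "v\<in>V_space Z" and z: "!!P. P\<in>\<T> ==> z P\<in>V_space Z"
 shows "div.nrm (\<Sum>P\<in>\<T>. cell P v *\<^sub>R z P) <= m1*(\<Sum>P\<in>\<T>. div.nrm (z P))*div.nrm v"
proof -
 have "div.nrm (\<Sum>P\<in>\<T>. cell P v *\<^sub>R z P) <= (\<Sum>P\<in>\<T>. div.nrm (cell P v *\<^sub>R z P))"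
  using z by (intro div.nrm_sum(2) finite_mesh div.closed)
 also have "... <= (\<Sum>P\<in>\<T>. (m1*div.nrm v)*div.nrm (z P))"
  using z cell_bound[OF _ v] by (intro sum_mono) (simp add: div.nrm_scale mult_right_mono)
 also have "... = m1*(\<Sum>P\<in>\<T>. div.nrm (z P))*div.nrm v" unfolding sum_distrib_left[symmetric] by (simp add: mult_ac)
 finally show ?thesis .
qed

text \<open>A correction by finitely many fields makes the cell means vanish. The constant depends
  on the mesh through these fields; only its existence matters.\<close>

lemma K_elliptic: "EX c>0. \<forall>v\<in>K_space. l2_norm Z v <= c*div.nrm v"
proof -
 obtain z where z: "!!P. P\<in>\<T> ==> z P\<in>K_space"
  "!!v P. v\<in>K_space ==> P\<in>\<T> ==> cell P (v - (\<Sum>Q\<in>\<T>. cell Q v *\<^sub>R z Q)) = 0"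
  by (rule kernel_projection[OF finite_mesh subspace_K cell_linear_K]) (assumption, rule that)
 have zV: "z P\<in>V_space Z" "z P\<in>L2_space Z" if "P\<in>\<T>" for P using z(1)[OF that] K_V V_L2 by auto
 define c where "c = \<kappa>*(1 + m1*(\<Sum>P\<in>\<T>. div.nrm (z P))) + m1*(\<Sum>P\<in>\<T>. l2_norm Z (z P))"
 have nn: "0 <= (\<Sum>P\<in>\<T>. div.nrm (z P))" "0 <= (\<Sum>P\<in>\<T>. l2_norm Z (z P))" using zV by (auto intro!: sum_nonneg)
 have "l2_norm Z v <= c*div.nrm v" if v: "v\<in>K_space" for v
 proof -
  define s where "s = (\<Sum>Q\<in>\<T>. cell Q v *\<^sub>R z Q)"
  have sK: "s\<in>K_space" unfolding s_def by (intro subspace_sum[OF subspace_K] subspace_scale[OF subspace_K] z(1))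
  have dK: "v - s\<in>K_space" by (rule subspace_diff[OF subspace_K v sK])
  have "l2_norm Z v <= l2_norm Z (v - s) + l2_norm Z s"
   using l2_triangle[OF V_L2[OF K_V[OF dK]] V_L2[OF K_V[OF sK]]] by simp
  also have "l2_norm Z (v - s) <= \<kappa>*div.nrm (v - s)"
   using z(2)[OF v] unfolding s_def[symmetric] by (rule K_small[OF dK])
  also have "div.nrm (v - s) <= div.nrm v + div.nrm s"
   by (rule div.nrm_triangle_diff[OF K_V[OF v] K_V[OF sK]])
  also have "div.nrm s <= m1*(\<Sum>P\<in>\<T>. div.nrm (z P))*div.nrm v"
   unfolding s_def by (rule div_comb[OF K_V[OF v] zV(1)])
  also have "l2_norm Z s <= m1*(\<Sum>P\<in>\<T>. l2_norm Z (z P))*div.nrm v"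
   unfolding s_def by (rule l2_norm_comb[OF K_V[OF v] zV(2)])
  finally show ?thesis using \<kappa>_pos by (simp add: c_def algebra_simps mult_left_mono)
 qed
 moreover have "c > 0" unfolding c_def using nn m1_nonneg \<kappa>_pos by (intro add_pos_nonneg mult_pos_pos) auto
 ultimately show ?thesis by blast
qed

text \<open>A Cauchy sequence in the divergence is also Cauchy in the field by the previous bound,
  so field and divergence converge together.\<close>

lemma K_complete: "Kd.complete_seq"
 unfolding Kd.complete_seq_def
proof (intro allI impI)
 fix x :: "nat => vector_field"
 assume x: "ALL n. x n\<in>K_space" and Cauchy: "ALL e>0. EX N. ALL m>=N. ALL n>=N. Kd.nrm (x m - x n) < e"
 obtain c where c: "c > 0" "!!v. v\<in>K_space ==> l2_norm Z v <= c*div.nrm v" using K_elliptic by blast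
 have xV: "x n\<in>V_space Z" "x n\<in>L2_space Z" "weak_div Z (x n)\<in>L2_space Z" for n using x K_V V_L2 div_L2 by auto
 have xd: "x m - x n\<in>K_space" for m n using x subspace_diff[OF subspace_K] by simp
 obtain u where u: "u\<in>L2_space Z" "(%n. l2_norm Z (x n - u)) \<longlonglongrightarrow> 0"
 proof (rule L2_complete[of x, OF xV(2)])
  fix e :: real assume "e > 0"
  hence "e/c > 0" using c(1) by simp
  then obtain N where N: "!!m n. m >= N ==> n >= N ==> Kd.nrm (x m - x n) < e/c" using Cauchy by metis
  have "l2_norm Z (x m - x n) < e" if mn: "m >= N" "n >= N" for m n
  proof -
   have "l2_norm Z (x m - x n) <= c*div.nrm (x m - x n)" by (rule c(2)[OF xd])
   also have "... < c*(e/c)" using N[OF mn] c(1) by (intro mult_strict_left_mono)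
   finally show ?thesis using c(1) by simp
  qed
  thus "EX N. ALL m>=N. ALL n>=N. l2_norm Z (x m - x n) < e" by blast
 qed
 obtain g where g: "g\<in>L2_space Z" "(%n. l2_norm Z (weak_div Z (x n) - g)) \<longlonglongrightarrow> 0"
 proof (rule L2_complete[of "%n. weak_div Z (x n)", OF xV(3)])
  fix e :: real assume "e > 0"
  thus "EX N. ALL m>=N. ALL n>=N. l2_norm Z (weak_div Z (x m) - weak_div Z (x n)) < e"
   unfolding div_diff_norm[OF xV(1) xV(1)] div_nrm[symmetric] using Cauchy by blast
 qed
 note lim = V_limit[OF xV(1) u g]
 have "u\<in>K_space"
  unfolding K_space_def
 proof (intro CollectI conjI allI impI lim(1))
  fix \<psi> assume t: "test_function Z \<psi>"
  have "(%n. l2_inner Z (x n) (curl \<psi>)) \<longlonglongrightarrow> l2_inner Z u (curl \<psi>)"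
   by (rule l2_inner_tendsto[OF xV(2) u(1) L2_Z_test(3)[OF t] u(2)])
  moreover have "l2_inner Z (x n) (curl \<psi>) = 0" for n using x t by (simp add: K_space_def)
  ultimately show "l2_inner Z u (curl \<psi>) = 0" by (simp add: LIMSEQ_const_iff)
 qed
 thus "\<exists>a\<in>K_space. (%n. Kd.nrm (x n - a)) \<longlonglongrightarrow> 0" using lim(2) by blast
qed

text \<open>The fields \<open>r P\<close> are taken orthogonal to the fields of vanishing cell means,
 so that subtracting them does not increase the divergence.\<close>

lemma K_split:
 obtains r where "!!P. P\<in>\<T> ==> r P\<in>K_space"
  "!!v. v\<in>K_space ==> l2_norm Z (v - (\<Sum>P\<in>\<T>. cell P v *\<^sub>R r P)) <= \<kappa>*div.nrm v"
proof -
 obtain z where z: "!!P. P\<in>\<T> ==> z P\<in>K_space"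
  "!!v P. v\<in>K_space ==> P\<in>\<T> ==> cell P (v - (\<Sum>Q\<in>\<T>. cell Q v *\<^sub>R z Q)) = 0"
  by (rule kernel_projection[OF finite_mesh subspace_K cell_linear_K]) (assumption, rule that)
 define W where "W = {v\<in>K_space. \<forall>P\<in>\<T>. cell P v = 0}"
 note lin = linear_onD[OF cell_linear_K subspace_K]
 have W: "subspace W" "W \<subseteq> K_space"
  unfolding W_def by (rule subspaceI)
   (auto simp: subspace_0[OF subspace_K] subspace_add[OF subspace_K] subspace_scale[OF subspace_K] lin(1,2,4))
 have "EX r. r\<in>K_space & (\<forall>P\<in>\<T>. cell P r = cell P (z Q)) & (\<forall>v\<in>W. div_form r v = 0)" if Q: "Q\<in>\<T>" for Q
 proof -
  \<comment> \<open>The residual of \<open>z Q\<close> from \<open>W\<close> is orthogonal to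
    \<open>W\<close> and keeps the cell values of \<open>z Q\<close>, since these vanish on
    \<open>W\<close> and are continuous in the divergence norm.\<close>
  obtain r w where r: "r\<in>K_space" "!!n::nat. w n\<in>W" "(%n. Kd.nrm (z Q - w n - r)) \<longlonglongrightarrow> 0" "!!v. v\<in>W ==> div_form r v = 0"
   by (rule Kd.orthogonal_residual[OF W z(1)[OF Q] K_complete], rule that)
  have "cell P r = cell P (z Q)" if P: "P\<in>\<T>" for P
  proof -
   have wK: "w n\<in>K_space" "cell P (w n) = 0" for n using r(2)[of n] P by (auto simp: W_def)
   have K: "z Q - w n\<in>K_space" "z Q - w n - r\<in>K_space" for n
    by (intro subspace_diff[OF subspace_K] z(1)[OF Q] wK r(1))+
   have "\<bar>cell P (z Q) - cell P r\<bar> <= m1*Kd.nrm (z Q - w n - r)" for n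
    using cell_bound[OF P K_V[OF K(2)[of n]]] lin(3)[OF P K(1) r(1), of n] lin(3)[OF P z(1)[OF Q] wK(1), of n] wK(2)[of n] by simp
   moreover have "(%n. m1*Kd.nrm (z Q - w n - r)) \<longlonglongrightarrow> 0" using tendsto_mult_left[OF r(3), of m1] by simp
   ultimately have "\<bar>cell P (z Q) - cell P r\<bar> <= 0" by (intro LIMSEQ_le_const) auto
   thus ?thesis by simp
  qed
  thus ?thesis using r by blast
 qed
 then obtain r where r: "!!Q. Q\<in>\<T> ==> r Q\<in>K_space" "!!P Q. Q\<in>\<T> ==> P\<in>\<T> ==> cell P (r Q) = cell P (z Q)"
  "!!Q v. Q\<in>\<T> ==> v\<in>W ==> div_form (r Q) v = 0" by metis
 have "l2_norm Z (v - (\<Sum>P\<in>\<T>. cell P v *\<^sub>R r P)) <= \<kappa>*div.nrm v" if v: "v\<in>K_space" for v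
 proof -
  define s where "s = (\<Sum>P\<in>\<T>. cell P v *\<^sub>R r P)"
  have tK: "cell Q v *\<^sub>R r Q\<in>K_space" "cell Q v *\<^sub>R z Q\<in>K_space" if "Q\<in>\<T>" for Q
   by (intro subspace_scale[OF subspace_K] r(1) z(1) that)+
  have sK: "s\<in>K_space" unfolding s_def by (intro subspace_sum[OF subspace_K] tK)
  have zK: "(\<Sum>Q\<in>\<T>. cell Q v *\<^sub>R z Q)\<in>K_space" by (intro subspace_sum[OF subspace_K] tK)
  have dK: "v - s\<in>K_space" by (rule subspace_diff[OF subspace_K v sK])
  have c0: "cell P (v - s) = 0" if P: "P\<in>\<T>" for P
  proof -
   have "cell P s = (\<Sum>Q\<in>\<T>. cell P (cell Q v *\<^sub>R r Q))" unfolding s_def by (rule lin(5)[OF P finite_mesh tK(1)])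
   also have "... = (\<Sum>Q\<in>\<T>. cell P (cell Q v *\<^sub>R z Q))" by (intro sum.cong refl) (simp add: lin(2)[OF P] r(1,2) z(1) P)
   also have "... = cell P (\<Sum>Q\<in>\<T>. cell Q v *\<^sub>R z Q)" by (rule lin(5)[OF P finite_mesh tK(2), symmetric])
   also have "... = cell P v" using z(2)[OF v P] lin(3)[OF P v zK] by simp
   finally show ?thesis using lin(3)[OF P v sK] by simp
  qed
  have "v - s\<in>W" unfolding W_def using dK c0 by blast
  hence "div_form (r Q) (v - s) = 0" if "Q\<in>\<T>" for Q by (rule r(3)[OF that])
  hence "div_form (v - s) (r Q) = 0" if "Q\<in>\<T>" for Q using Kd.sym[OF dK r(1)] that by metis
  hence orth: "div_form (v - s) s = 0"
   unfolding s_def using Kd.sum_right[OF finite_mesh tK(1) dK] Kd.scale_right[OF r(1) dK] by (simp add: s_def)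
  \<comment> \<open>Pythagoras: subtracting \<open>s\<close> does not increase the divergence, so
    the constant \<open>\<kappa>\<close> survives unchanged.\<close>
  have "div_form v v = div_form (v - s) (v - s) + div_form s s"
   using Kd.expand_sq[OF dK sK, of 1] orth by simp
  hence "div_form (v - s) (v - s) <= div_form v v" using Kd.nonneg[OF sK] by linarith
  hence "div.nrm (v - s) <= div.nrm v" unfolding div.nrm_def by simp
  hence "\<kappa>*div.nrm (v - s) <= \<kappa>*div.nrm v" using \<kappa>_pos by simp
  with K_small[OF dK c0] show ?thesis unfolding s_def by linarith
 qed
 with r(1) show thesis by (rule that)
qed

text \<open>\<open>u\<close> is a Riesz representative on \<open>K_space\<close>, and
  \<open>p\<close> is the potential of the curl part of \<open>f\<close>. Decomposing a general test
  field separates the two contributions.\<close>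

lemma source_solvable:
 assumes f: "f\<in>L2_space Z"
 shows "EX u p. solves_source Z f u p"
proof -
 obtain c where c: "c > 0" "!!v. v\<in>K_space ==> l2_norm Z v <= c*div.nrm v" using K_elliptic by blast
 have KL: "v\<in>L2_space Z" if "v\<in>K_space" for v using K_V[OF that] V_L2 by blast
 obtain u where u: "u\<in>K_space" "!!v. v\<in>K_space ==> div_form u v = l2_inner Z f v"
 proof (rule Kd.Riesz_representation[OF K_complete, of "l2_inner Z f" "l2_norm Z f*c"])
  show "l2_inner Z f (x + y) = l2_inner Z f x + l2_inner Z f y" if "x\<in>K_space" "y\<in>K_space" for x y
   by (rule l2.add_right[OF KL[OF that(1)] KL[OF that(2)] f])
  show "l2_inner Z f (a*\<^sub>R x) = a*l2_inner Z f x" if "x\<in>K_space" for a x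
   by (rule l2.scale_right[OF KL[OF that] f])
  show "\<bar>l2_inner Z f x\<bar> <= l2_norm Z f*c*Kd.nrm x" if x: "x\<in>K_space" for x
   using order_trans[OF l2_Cauchy_Schwarz[OF f KL[OF x]] mult_left_mono[OF c(2)[OF x] l2_norm_nonneg[OF f]]] by (simp add: mult.assoc)
 qed (rule that)
 obtain p where p: "p\<in>H10 Z" "!!\<psi>. test_function Z \<psi> ==> l2_inner Z (f - weak_curl Z p) (curl \<psi>) = 0"
  by (rule Helmholtz_decomposition[OF f], rule that)
 note pL = curl_H10_L2[OF p(1)]
 have "div_form u v + l2_inner Z v (weak_curl Z p) = l2_inner Z f v" if v: "v\<in>V_space Z" for v
 proof -
  obtain q where q: "q\<in>H10 Z" "v - weak_curl Z q\<in>K_space" by (rule V_decomposition[OF v], rule that)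
  note qL = curl_H10_L2[OF q(1)] and qV = curl_H10_V[OF q(1)]
  have "div_form u (weak_curl Z q) = 0"
   unfolding div_form_def by (rule l2_null_orth(1)[OF div_L2[OF K_V[OF u(1)]] div_L2[OF qV(1)] qV(3)])
  hence 1: "div_form u v = l2_inner Z f v - l2_inner Z f (weak_curl Z q)"
   using u(2)[OF q(2)] div.diff_right[OF v qV(1) K_V[OF u(1)]] l2.diff_right[OF V_L2[OF v] qL f] by linarith
  have 2: "l2_inner Z (f - weak_curl Z p) (weak_curl Z q) = 0"
   by (rule curl_H10_limit_zero[OF q(1) l2.closed(3)[OF f pL] p(2)])
  have 3: "l2_inner Z (v - weak_curl Z q) (weak_curl Z p) = 0" by (rule K_orth[OF q(2) p(1)])
  show ?thesis
   using 1 2 3 l2.diff_left[OF f pL qL] l2.diff_left[OF V_L2[OF v] qL pL] l2.sym[OF qL pL] by linarith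
 qed
 thus ?thesis
  unfolding solves_source_def div_form_def using K_V[OF u(1)] p(1) K_orth[OF u(1)] by blast
qed

end

subsection \<open>Projection onto gradients of polynomials\<close>

definition monomial :: "nat \<times> nat => scalar_field" where
 "monomial m x = (x$1)^fst m*(x$2)^snd m"

definition exponents :: "nat => (nat \<times> nat) set" where
 "exponents j = {(a, b). a + b <= j}"

lemma finite_exponents: "finite (exponents j)"
 by (rule finite_subset[of _ "{..j} \<times> {..j}"]) (auto simp: exponents_def)

lemma polys_iff: "p\<in>polys j \<longleftrightarrow> (EX c. p = (\<Sum>m\<in>exponents j. c m*\<^sub>R monomial m))"
proof -
 have eq: "(\<Sum>(a, b)\<in>{(a, b). a + b <= j}. c a b*(x$1)^a*(x$2)^b) =
  (\<Sum>m\<in>exponents j. (%m. c (fst m) (snd m)) m*\<^sub>R monomial m) x" for c and x :: point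
  unfolding sum_fun_apply exponents_def by (intro sum.cong) (auto simp: monomial_def)
 have eq': "(\<Sum>m\<in>exponents j. c m*\<^sub>R monomial m) x = (\<Sum>(a, b)\<in>{(a, b). a + b <= j}. c (a, b)*(x$1)^a*(x$2)^b)" for c and x :: point
  unfolding sum_fun_apply exponents_def by (intro sum.cong) (auto simp: monomial_def)
 show ?thesis
 proof
  assume "p\<in>polys j"
  then obtain c where "!!x. p x = (\<Sum>(a, b)\<in>{(a, b). a + b <= j}. c a b*(x$1)^a*(x$2)^b)"
   unfolding polys_def by blast
  hence "p = (\<Sum>m\<in>exponents j. (%m. c (fst m) (snd m)) m*\<^sub>R monomial m)" by (intro ext) (simp only: eq)
  thus "EX c. p = (\<Sum>m\<in>exponents j. c m*\<^sub>R monomial m)"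
   by (intro exI[of _ "%m. c (fst m) (snd m)"])
 next
  assume "EX c. p = (\<Sum>m\<in>exponents j. c m*\<^sub>R monomial m)"
  then obtain c where p: "p = (\<Sum>m\<in>exponents j. c m*\<^sub>R monomial m)" by blast
  show "p\<in>polys j" unfolding polys_def p using eq' by (intro CollectI exI[of _ "%a b. c (a, b)"]) blast
 qed
qed

lemma smooth_monomial: "smooth (monomial m)"
proof -
 have p: "smooth (%x. (x$i)^n)" for i n
 proof (induction n)
  case 0
  show ?case using smooth_const[of 1] by simp
 next
  case (Suc n)
  show ?case using smooth_mult[OF smooth_coordinate[of i] Suc] by simp
 qed
 have "monomial m = (%x. (x$1)^fst m*(x$2)^snd m)" by (rule ext) (simp add: monomial_def)
 thus ?thesis using smooth_mult[OF p p] by simp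
qed

lemma subspace_polys: "subspace (polys j)"
proof (rule subspaceI)
 show "0\<in>polys j" unfolding polys_iff by (rule exI[of _ "%m. 0"]) simp
 fix p q c assume "p\<in>polys j" "q\<in>polys j"
 then obtain a b where ab: "p = (\<Sum>m\<in>exponents j. a m*\<^sub>R monomial m)" "q = (\<Sum>m\<in>exponents j. b m*\<^sub>R monomial m)"
  unfolding polys_iff by blast
 show "p + q\<in>polys j"
  unfolding polys_iff ab by (rule exI[of _ "%m. a m + b m"]) (simp add: scaleR_left_distrib sum.distrib)
next
 fix p c assume "p\<in>polys j"
 then obtain a where a: "p = (\<Sum>m\<in>exponents j. a m*\<^sub>R monomial m)" unfolding polys_iff by blast
 show "c*\<^sub>R p\<in>polys j"
  unfolding polys_iff a by (rule exI[of _ "%m. c*a m"]) (simp add: scaleR_sum_right)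
qed

lemma polys_smooth: "p\<in>polys j ==> smooth p"
proof -
 assume "p\<in>polys j"
 then obtain c where "p = (\<Sum>m\<in>exponents j. c m*\<^sub>R monomial m)" unfolding polys_iff by blast
 hence "p\<in>Collect smooth"
  by (simp only:) (intro subspace_sum[OF subspace_smooth] subspace_scale[OF subspace_smooth] CollectI smooth_monomial)
 thus ?thesis by simp
qed

lemma grad_comb:
 assumes "finite A" "!!i. i\<in>A ==> smooth (f i)"
 shows "grad (\<Sum>i\<in>A. c i*\<^sub>R f i) = (\<Sum>i\<in>A. c i*\<^sub>R grad (f i))"
 using assms
proof (induction A rule: finite_induct)
 case empty
 have "grad 0 = 0" using grad_scale[of 0 0] subspace_0[OF subspace_smooth] by simp
 thus ?case by (simp only: sum.empty)
next
 case (insert i A)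
 have s: "smooth (c i*\<^sub>R f i)" using insert.prems subspace_scale[OF subspace_smooth, of "f i" "c i"] by simp
 have S: "(\<Sum>i\<in>A. c i*\<^sub>R f i)\<in>Collect smooth"
  using insert.prems by (intro subspace_sum[OF subspace_smooth] subspace_scale[OF subspace_smooth]) auto
 have IH: "grad (\<Sum>i\<in>A. c i*\<^sub>R f i) = (\<Sum>i\<in>A. c i*\<^sub>R grad (f i))"
  using insert.IH insert.prems by blast
 have sc: "grad (c i*\<^sub>R f i) = c i*\<^sub>R grad (f i)" using insert.prems by (intro grad_scale) auto
 show ?case unfolding sum.insert[OF insert.hyps] grad_add[OF s S[simplified mem_Collect_eq]] IH sc ..
qed

lemma subspace_grad_polys: "subspace (grad_polys j)"
 unfolding grad_polys_def by (rule subspace_grad[OF subspace_polys]) (auto intro: polys_smooth)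

lemma grad_polys_iff: "w\<in>grad_polys j \<longleftrightarrow> (EX c. w = (\<Sum>m\<in>exponents j. c m*\<^sub>R grad (monomial m)))"
proof
 assume "w\<in>grad_polys j"
 then obtain p where p: "p\<in>polys j" "w = grad p" unfolding grad_polys_def by blast
 then obtain c where c: "p = (\<Sum>m\<in>exponents j. c m*\<^sub>R monomial m)" unfolding polys_iff by blast
 show "EX c. w = (\<Sum>m\<in>exponents j. c m*\<^sub>R grad (monomial m))"
  unfolding p(2) c by (rule exI[of _ c]) (rule grad_comb[OF finite_exponents smooth_monomial])
next
 assume "EX c. w = (\<Sum>m\<in>exponents j. c m*\<^sub>R grad (monomial m))"
 then obtain c where c: "w = (\<Sum>m\<in>exponents j. c m*\<^sub>R grad (monomial m))" by blast
 have "w = grad (\<Sum>m\<in>exponents j. c m*\<^sub>R monomial m)"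
  unfolding c by (rule grad_comb[OF finite_exponents smooth_monomial, symmetric])
 moreover have "(\<Sum>m\<in>exponents j. c m*\<^sub>R monomial m)\<in>polys j" unfolding polys_iff by blast
 ultimately show "w\<in>grad_polys j" unfolding grad_polys_def by (rule image_eqI)
qed

text \<open>Constants are the polynomial gradients by which residuals of continuous fields are
  estimated later; the degree \<open>k + 1 >= 1\<close> of the potentials provides them.\<close>

lemma const_grad_poly: "(%x. c)\<in>grad_polys (Suc j)"
proof -
 have m: "monomial (1, 0) = (%x. x$1)" "monomial (0, 1) = (%x. x$2)" by (auto simp: monomial_def fun_eq_iff)
 have g: "grad (monomial (1, 0)) = (%x. axis 1 1)" "grad (monomial (0, 1)) = (%x. axis 2 1)"
  unfolding m by (auto intro!: ext point_eqI simp: pd_coordinate axis_def)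
 have in_p: "monomial m\<in>polys (Suc j)" if "m\<in>exponents (Suc j)" for m
  unfolding polys_iff
 proof (rule exI[of _ "%m'. if m' = m then 1 else 0"])
  have "(\<Sum>m'\<in>exponents (Suc j). (if m' = m then 1 else 0)*\<^sub>R monomial m') = (\<Sum>m'\<in>{m}. (if m' = m then 1 else 0)*\<^sub>R monomial m')"
   using that by (intro sum.mono_neutral_right finite_exponents) auto
  thus "monomial m = (\<Sum>m'\<in>exponents (Suc j). (if m' = m then 1 else 0)*\<^sub>R monomial m')" by simp
 qed
 have "(c$1)*\<^sub>R grad (monomial (1, 0)) + (c$2)*\<^sub>R grad (monomial (0, 1))\<in>grad_polys (Suc j)"
  by (intro subspace_add[OF subspace_grad_polys] subspace_scale[OF subspace_grad_polys])
   (auto simp: grad_polys_def exponents_def intro!: imageI in_p)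
 moreover have "(%x. c) = (c$1)*\<^sub>R grad (monomial (1, 0)) + (c$2)*\<^sub>R grad (monomial (0, 1))"
  unfolding g using point_axis[of c] by (auto simp: fun_eq_iff)
 ultimately show ?thesis by simp
qed

lemma l2_linear_left: "z\<in>L2_space E ==> W \<subseteq> L2_space E ==> linear_on W (%v. l2_inner E v z)"
 unfolding linear_on_def by (intro conjI ballI allI l2.add_left l2.scale_left) auto

lemma l2_linear_right: "z\<in>L2_space E ==> W \<subseteq> L2_space E ==> linear_on W (l2_inner E z)"
 unfolding linear_on_def by (intro conjI ballI allI l2.add_right l2.scale_right) auto

locale bounded_element =
 fixes P :: polygon and k :: nat
 assumes E_ob: "open (intr P)" "bounded (intr P)"
begin

abbreviation "E \<equiv> intr P"
abbreviation "proj \<equiv> proj_grad k P"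

lemma grad_polys_L2: "z\<in>grad_polys j ==> z\<in>L2_space E"
 unfolding grad_polys_def using L2_smooth(2)[OF E_ob] polys_smooth by blast

text \<open>The projection is defined by choice. A suitable gradient exists because inner products
  with the gradients of the monomials determine a polynomial gradient up to null functions.\<close>

lemma proj_grad_spec:
 assumes u: "u\<in>L2_space E"
 shows "proj u\<in>grad_polys (k + 1)" "!!z. z\<in>grad_polys (k + 1) ==> l2_inner E (u - proj u) z = 0"
proof -
 have mL: "grad (monomial m)\<in>L2_space E" for m by (rule L2_smooth(2)[OF E_ob smooth_monomial])
 have "\<exists>w\<in>grad_polys (k + 1). \<forall>v\<in>grad_polys (k + 1). l2_inner E w v = l2_inner E u v"
 proof (rule l2.finite_Riesz[OF finite_exponents subspace_grad_polys])
  show "grad_polys (k + 1) \<subseteq> L2_space E" using grad_polys_L2 by blast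
  show "linear_on (grad_polys (k + 1)) (%v. l2_inner E v (grad (monomial m)))" for m
   by (rule l2_linear_left[OF mL]) (use grad_polys_L2 in blast)
  show "linear_on (grad_polys (k + 1)) (l2_inner E u)"
   by (rule l2_linear_right[OF u]) (use grad_polys_L2 in blast)
  show "l2_inner E u v = 0" if "v\<in>grad_polys (k + 1)" "l2_inner E v v = 0" for v
   using l2_null_orth(1)[OF u grad_polys_L2[OF that(1)]] that(2) by (simp add: l2_norm_def)
  fix v assume v: "v\<in>grad_polys (k + 1)" and z: "!!m. m\<in>exponents (k + 1) ==> l2_inner E v (grad (monomial m)) = 0"
  obtain c where c: "v = (\<Sum>m\<in>exponents (k + 1). c m*\<^sub>R grad (monomial m))" using v unfolding grad_polys_iff by blast
  have "l2_inner E v (\<Sum>m\<in>exponents (k + 1). c m*\<^sub>R grad (monomial m)) = (\<Sum>m\<in>exponents (k + 1). l2_inner E v (c m*\<^sub>R grad (monomial m)))"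
   by (rule l2.sum_right[OF finite_exponents l2.closed(2)[OF mL] grad_polys_L2[OF v]])
  also have "... = 0" using z l2.scale_right[OF mL grad_polys_L2[OF v]] by (intro sum.neutral) auto
  finally show "l2_inner E v v = 0" unfolding c[symmetric] .
 qed
 then obtain w where w: "w\<in>grad_polys (k + 1)" "!!v. v\<in>grad_polys (k + 1) ==> l2_inner E w v = l2_inner E u v" by blast
 have "l2_inner E (u - w) z = 0" if "z\<in>grad_polys (k + 1)" for z
  using l2.diff_left[OF u grad_polys_L2[OF w(1)] grad_polys_L2[OF that]] w(2)[OF that] by simp
 hence "EX w. w\<in>grad_polys (k + 1) & (\<forall>z\<in>grad_polys (k + 1). l2_inner E (%x. u x - w x) z = 0)"
  using w(1) by (intro exI[of _ w] conjI ballI) (simp_all only: fun_diff_def)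
 from someI_ex[OF this]
 have "proj u\<in>grad_polys (k + 1) & (\<forall>z\<in>grad_polys (k + 1). l2_inner E (%x. u x - proj u x) z = 0)"
  unfolding proj_grad_def .
 thus "proj u\<in>grad_polys (k + 1)" "!!z. z\<in>grad_polys (k + 1) ==> l2_inner E (u - proj u) z = 0"
  by (simp_all only: fun_diff_def)
qed

lemma proj_L2: "u\<in>L2_space E ==> proj u\<in>L2_space E"
 by (rule grad_polys_L2[OF proj_grad_spec(1)])

lemma res_L2: "u\<in>L2_space E ==> u - proj u\<in>L2_space E"
 by (rule l2.closed(3)[OF _ proj_L2])

lemma Pythagoras:
 assumes u: "u\<in>L2_space E" and z: "z\<in>grad_polys (k + 1)"
 shows "(l2_norm E (u - z))^2 = (l2_norm E (u - proj u))^2 + (l2_norm E (proj u - z))^2"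
proof -
 have d: "proj u - z\<in>grad_polys (k + 1)" by (rule subspace_diff[OF subspace_grad_polys proj_grad_spec(1)[OF u] z])
 have e: "u - z = (u - proj u) + 1*\<^sub>R (proj u - z)" by (rule ext) simp
 have "l2_inner E (u - z) (u - z) = l2_inner E (u - proj u) (u - proj u) + l2_inner E (proj u - z) (proj u - z)"
  unfolding e l2.expand_sq[OF res_L2[OF u] grad_polys_L2[OF d], of 1] proj_grad_spec(2)[OF u d] by simp
 thus ?thesis
  unfolding l2_norm_sq[OF res_L2[OF u]] l2_norm_sq[OF grad_polys_L2[OF d]] l2_norm_sq[OF l2.closed(3)[OF u grad_polys_L2[OF z]]] .
qed

lemma best_approximation:
 assumes u: "u\<in>L2_space E" and z: "z\<in>grad_polys (k + 1)"
 shows "l2_norm E (u - proj u) <= l2_norm E (u - z)"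
proof (rule power2_le_imp_le)
 show "(l2_norm E (u - proj u))^2 <= (l2_norm E (u - z))^2" unfolding Pythagoras[OF u z] by simp
 show "0 <= l2_norm E (u - z)" by (rule l2_norm_nonneg[OF l2.closed(3)[OF u grad_polys_L2[OF z]]])
qed

lemma res_le: "u\<in>L2_space E ==> l2_norm E (u - proj u) <= l2_norm E u"
 using best_approximation[OF _ subspace_0[OF subspace_grad_polys], of u] unfolding diff_zero .

text \<open>The chosen projection is determined, and hence linear, only up to null functions;
  additivity and homogeneity are derived from this criterion.\<close>

lemma proj_diff_null:
 assumes u: "u\<in>L2_space E" and v: "v\<in>grad_polys (k + 1)" and orth: "!!z. z\<in>grad_polys (k + 1) ==> l2_inner E (u - v) z = 0"
 shows "l2_norm E (proj u - v) = 0"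
proof -
 have d: "proj u - v\<in>grad_polys (k + 1)" by (rule subspace_diff[OF subspace_grad_polys proj_grad_spec(1)[OF u] v])
 note L = grad_polys_L2[OF d]
 have e: "(u - v) - (u - proj u) = proj u - v" by (rule ext) simp
 have "l2_inner E (proj u - v) (proj u - v) = l2_inner E (u - v) (proj u - v) - l2_inner E (u - proj u) (proj u - v)"
  using l2.diff_left[OF l2.closed(3)[OF u grad_polys_L2[OF v]] res_L2[OF u] L] unfolding e .
 hence "l2_inner E (proj u - v) (proj u - v) = 0" using orth[OF d] proj_grad_spec(2)[OF u d] by simp
 thus ?thesis by (simp add: l2_norm_def)
qed

lemma proj_add:
 assumes u: "u\<in>L2_space E" and v: "v\<in>L2_space E"
 shows "l2_norm E (proj (u + v) - (proj u + proj v)) = 0"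
proof (rule proj_diff_null[OF l2.closed(1)[OF u v] subspace_add[OF subspace_grad_polys proj_grad_spec(1)[OF u] proj_grad_spec(1)[OF v]]])
 fix z assume z: "z\<in>grad_polys (k + 1)"
 have e: "u + v - (proj u + proj v) = (u - proj u) + (v - proj v)" by (rule ext) simp
 show "l2_inner E (u + v - (proj u + proj v)) z = 0"
  unfolding e using l2.add_left[OF res_L2[OF u] res_L2[OF v] grad_polys_L2[OF z]] proj_grad_spec(2)[OF u z] proj_grad_spec(2)[OF v z] by linarith
qed

lemma proj_scale:
 assumes u: "u\<in>L2_space E"
 shows "l2_norm E (proj (c*\<^sub>R u) - c*\<^sub>R proj u) = 0"
proof (rule proj_diff_null[OF l2.closed(2)[OF u] subspace_scale[OF subspace_grad_polys proj_grad_spec(1)[OF u]]])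
 fix z assume z: "z\<in>grad_polys (k + 1)"
 have e: "c*\<^sub>R u - c*\<^sub>R proj u = c*\<^sub>R (u - proj u)" by (rule ext) (simp add: scaleR_diff_right)
 show "l2_inner E (c*\<^sub>R u - c*\<^sub>R proj u) z = 0"
  unfolding e l2.scale_left[OF res_L2[OF u] grad_polys_L2[OF z]] proj_grad_spec(2)[OF u z] by simp
qed

lemma inner_proj:
 assumes u: "u\<in>L2_space E" and v: "v\<in>L2_space E"
 shows "l2_inner E (proj u) (proj v) = l2_inner E (proj u) v" "l2_inner E u v - l2_inner E (proj u) (proj v) = l2_inner E (u - proj u) (v - proj v)"
proof -
 note Pu = proj_L2[OF u] and Pv = proj_L2[OF v]
 have 1: "l2_inner E (proj u) v - l2_inner E (proj u) (proj v) = 0"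
  using proj_grad_spec(2)[OF v proj_grad_spec(1)[OF u]] l2.sym[OF res_L2[OF v] Pu] l2.diff_right[OF v Pv Pu] by linarith
 thus "l2_inner E (proj u) (proj v) = l2_inner E (proj u) v" by simp
 have 2: "l2_inner E (u - proj u) (proj v) = 0" by (rule proj_grad_spec(2)[OF u proj_grad_spec(1)[OF v]])
 show "l2_inner E u v - l2_inner E (proj u) (proj v) = l2_inner E (u - proj u) (v - proj v)"
  using 1 2 l2.diff_right[OF v Pv res_L2[OF u]] l2.diff_left[OF u Pu v] by linarith
qed

text \<open>The stabilization acts on residuals of the projection. Its upper bound makes it vanish
  on null functions, which compensates that the projection is not literally linear; Cauchy-Schwarz
  for the semidefinite form bounds the mixed terms.\<close>

lemma stab_form:
 assumes S: "stabilization k P clow cup S"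
 shows "u\<in>L2_space E ==> v\<in>L2_space E ==> S (u - proj u) (v - proj v) = S (v - proj v) (u - proj u)"
  "u\<in>L2_space E ==> linear_on (L2_space E) (%v :: vector_field. S (u - proj u) (v - proj v))"
  "cup >= 0 ==> u\<in>L2_space E ==> v\<in>L2_space E ==>
   \<bar>S (u - proj u) (v - proj v)\<bar> <= cup*(l2_norm E (u - proj u)*l2_norm E (v - proj v))"
proof -
 interpret S: semi_inner_space "L2_space E :: vector_field set" S
 proof
  show "subspace (L2_space E :: vector_field set)" by (rule subspace_L2_space)
  show "S u v = S v u" if "u\<in>L2_space E" "v\<in>L2_space E" for u v using S that by (simp add: stabilization_def Let_def)
  show "S (u + v) w = S u w + S v w" if "u\<in>L2_space E" "v\<in>L2_space E" "w\<in>L2_space E" for u v w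
   using S that by (simp add: stabilization_def Let_def plus_fun_def)
  show "S (c*\<^sub>R u) w = c*S u w" if "u\<in>L2_space E" "w\<in>L2_space E" for c u w
   using S that by (simp add: stabilization_def Let_def scaleR_fun_def)
  show "0 <= S u u" if "u\<in>L2_space E" for u using S that by (simp add: stabilization_def Let_def)
 qed
 have ub: "S u u <= cup*(l2_norm E u)^2" if "u\<in>L2_space E" for u using S that by (simp add: stabilization_def Let_def)
 have null: "S w (a - b) = 0" if "a\<in>L2_space E" "b\<in>L2_space E" "w\<in>L2_space E" "l2_norm E (a - b) = 0" for a b w
 proof -
  have L: "a - b\<in>L2_space E" by (rule l2.closed(3)[OF that(1,2)])
  have "S (a - b) (a - b) = 0" using ub[OF L] S.nonneg[OF L] that(4) by simp
  thus ?thesis by (rule S.null_orth(1)[OF that(3) L])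
 qed
 show sy: "S (u - proj u) (v - proj v) = S (v - proj v) (u - proj u)" if "u\<in>L2_space E" "v\<in>L2_space E" for u v :: vector_field
  by (rule S.sym[OF res_L2[OF that(1)] res_L2[OF that(2)]])
 show "linear_on (L2_space E) (%v :: vector_field. S (u - proj u) (v - proj v))" if u: "u\<in>L2_space E" for u
  unfolding linear_on_def
 proof (intro conjI ballI allI)
  fix v w :: vector_field
  assume v: "v\<in>L2_space E" and w: "w\<in>L2_space E"
  note L = res_L2[OF v] res_L2[OF w] res_L2[OF l2.closed(1)[OF v w]] l2.closed(1)[OF proj_L2[OF v] proj_L2[OF w]] proj_L2[OF l2.closed(1)[OF v w]]
  have e: "v + w - proj (v + w) = ((v - proj v) + (w - proj w)) - (proj (v + w) - (proj v + proj w))" by (rule ext) simp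
  have "S (u - proj u) (v + w - proj (v + w)) = S (u - proj u) ((v - proj v) + (w - proj w)) - S (u - proj u) (proj (v + w) - (proj v + proj w))"
   unfolding e by (rule S.diff_right[OF l2.closed(1)[OF L(1,2)] l2.closed(3)[OF L(5,4)] res_L2[OF u]])
  also have "... = S (u - proj u) (v - proj v) + S (u - proj u) (w - proj w)"
   using null[OF L(5,4) res_L2[OF u] proj_add[OF v w]] S.add_right[OF L(1,2) res_L2[OF u]] by simp
  finally show "S (u - proj u) (v + w - proj (v + w)) = S (u - proj u) (v - proj v) + S (u - proj u) (w - proj w)" .
 next
  fix v :: vector_field and c :: real
  assume v: "v\<in>L2_space E"
  note L = res_L2[OF v] proj_L2[OF l2.closed(2)[OF v]] l2.closed(2)[OF proj_L2[OF v]]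
  have e: "c*\<^sub>R v - proj (c*\<^sub>R v) = c*\<^sub>R (v - proj v) - (proj (c*\<^sub>R v) - c*\<^sub>R proj v)" by (rule ext) (simp add: scaleR_diff_right)
  have "S (u - proj u) (c*\<^sub>R v - proj (c*\<^sub>R v)) = S (u - proj u) (c*\<^sub>R (v - proj v)) - S (u - proj u) (proj (c*\<^sub>R v) - c*\<^sub>R proj v)"
   unfolding e by (rule S.diff_right[OF l2.closed(2)[OF L(1)] l2.closed(3)[OF L(2,3)] res_L2[OF u]])
  also have "... = c*S (u - proj u) (v - proj v)"
   using null[OF L(2,3) res_L2[OF u] proj_scale[OF v]] S.scale_right[OF L(1) res_L2[OF u]] by simp
  finally show "S (u - proj u) (c*\<^sub>R v - proj (c*\<^sub>R v)) = c*S (u - proj u) (v - proj v)" .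
 qed
 show "\<bar>S (u - proj u) (v - proj v)\<bar> <= cup*(l2_norm E (u - proj u)*l2_norm E (v - proj v))"
  if c: "cup >= 0" and u: "u\<in>L2_space E" and v: "v\<in>L2_space E" for u v :: vector_field
 proof -
  have sb: "S.nrm x <= sqrt cup*l2_norm E x" if x: "x\<in>L2_space E" for x
   unfolding S.nrm_def using real_sqrt_le_mono[OF ub[OF x]] l2_norm_nonneg[OF x] by (simp add: real_sqrt_mult)
  have "\<bar>S (u - proj u) (v - proj v)\<bar> <= S.nrm (u - proj u)*S.nrm (v - proj v)"
   by (rule S.Cauchy_Schwarz[OF res_L2[OF u] res_L2[OF v]])
  also have "... <= (sqrt cup*l2_norm E (u - proj u))*(sqrt cup*l2_norm E (v - proj v))"
   by (intro mult_mono sb res_L2 u v mult_nonneg_nonneg S.nrm_nonneg l2_norm_nonneg) (use c in simp_all)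
  also have "... = (sqrt cup * sqrt cup)*(l2_norm E (u - proj u)*l2_norm E (v - proj v))" by (simp only: mult_ac)
  finally show ?thesis using c by simp
 qed
qed

end

section \<open>Projection residuals and consistency of the discrete forms\<close>

definition res_norm :: "polygon set => nat => vector_field => real" where
 "res_norm \<T> k u = L2_set (%P. l2_norm (intr P) (u - proj_grad k P u)) \<T>"

context polygonal_mesh_of
begin

lemma element: "P\<in>\<T> ==> bounded_element P"
 by unfold_locales (simp_all add: E_open E_bounded)

lemma norm_L2_set: "u\<in>L2_space Z ==> l2_norm Z u = L2_set (%P. l2_norm (intr P) u) \<T>"
 by (simp add: L2_set_def norm_partition[symmetric])

lemma res_norm_nonneg: "0 <= res_norm \<T> k u"
 by (simp add: res_norm_def)

lemma res_norm_le: "u\<in>L2_space Z ==> res_norm \<T> k u <= l2_norm Z u"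
 unfolding res_norm_def norm_L2_set
 by (intro L2_set_mono bounded_element.res_le element L2_E l2_norm_nonneg bounded_element.res_L2)

text \<open>Best approximation takes the place of linearity: the sum of the two projections is an
  admissible competitor.\<close>

lemma res_norm_add:
 assumes u: "u\<in>L2_space Z" and v: "v\<in>L2_space Z"
 shows "res_norm \<T> k (u + v) <= res_norm \<T> k u + res_norm \<T> k v"
proof -
 have "res_norm \<T> k (u + v) <= L2_set (%P. l2_norm (intr P) (u - proj_grad k P u) + l2_norm (intr P) (v - proj_grad k P v)) \<T>"
  unfolding res_norm_def
 proof (rule L2_set_mono)
  fix P assume P: "P\<in>\<T>"
  interpret bounded_element P k by (rule element[OF P])
  note L = L2_E[OF u P] L2_E[OF v P]
  have "l2_norm E (u + v - proj (u + v)) <= l2_norm E (u + v - (proj u + proj v))"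
   by (rule best_approximation[OF l2.closed(1)[OF L] subspace_add[OF subspace_grad_polys proj_grad_spec(1)[OF L(1)] proj_grad_spec(1)[OF L(2)]]])
  also have "u + v - (proj u + proj v) = (u - proj u) + (v - proj v)" by (rule ext) simp
  also have "l2_norm E ((u - proj u) + (v - proj v)) <= l2_norm E (u - proj u) + l2_norm E (v - proj v)"
   by (rule l2_triangle[OF res_L2[OF L(1)] res_L2[OF L(2)]])
  finally show "l2_norm E (u + v - proj (u + v)) <= l2_norm E (u - proj u) + l2_norm E (v - proj v)" .
  show "0 <= l2_norm E (u + v - proj (u + v))" by (rule l2_norm_nonneg[OF res_L2[OF l2.closed(1)[OF L]]])
 qed
 also have "... <= res_norm \<T> k u + res_norm \<T> k v" unfolding res_norm_def by (rule L2_set_triangle_ineq)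
 finally show ?thesis .
qed

lemma res_norm_scale:
 assumes u: "u\<in>L2_space Z"
 shows "res_norm \<T> k (c*\<^sub>R u) <= \<bar>c\<bar>*res_norm \<T> k u"
proof -
 have "res_norm \<T> k (c*\<^sub>R u) <= L2_set (%P. \<bar>c\<bar>*l2_norm (intr P) (u - proj_grad k P u)) \<T>"
  unfolding res_norm_def
 proof (rule L2_set_mono)
  fix P assume P: "P\<in>\<T>"
  interpret bounded_element P k by (rule element[OF P])
  note L = L2_E[OF u P]
  have "l2_norm E (c*\<^sub>R u - proj (c*\<^sub>R u)) <= l2_norm E (c*\<^sub>R u - c*\<^sub>R proj u)"
   by (rule best_approximation[OF l2.closed(2)[OF L] subspace_scale[OF subspace_grad_polys proj_grad_spec(1)[OF L]]])
  also have "c*\<^sub>R u - c*\<^sub>R proj u = c*\<^sub>R (u - proj u)" by (rule ext) (simp add: scaleR_diff_right)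
  also have "l2_norm E (c*\<^sub>R (u - proj u)) = \<bar>c\<bar>*l2_norm E (u - proj u)" by (rule l2_norm_scale[OF res_L2[OF L]])
  finally show "l2_norm E (c*\<^sub>R u - proj (c*\<^sub>R u)) <= \<bar>c\<bar>*l2_norm E (u - proj u)" .
  show "0 <= l2_norm E (c*\<^sub>R u - proj (c*\<^sub>R u))" by (rule l2_norm_nonneg[OF res_L2[OF l2.closed(2)[OF L]]])
 qed
 also have "... = \<bar>c\<bar>*res_norm \<T> k u" unfolding res_norm_def by (rule L2_set_right_distrib[symmetric]) simp
 finally show ?thesis .
qed

lemma res_norm_sum:
 assumes "finite A" "!!i. i\<in>A ==> f i\<in>L2_space Z"
 shows "res_norm \<T> k (sum f A) <= (\<Sum>i\<in>A. res_norm \<T> k (f i))"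
 using assms
proof (induction A rule: finite_induct)
 case empty
 have "res_norm \<T> k (0*\<^sub>R 0) <= \<bar>0\<bar>*res_norm \<T> k 0" by (rule res_norm_scale[OF l2.zero_in])
 thus ?case by (simp only: sum.empty scaleR_zero_left abs_zero mult_zero_left)
next
 case (insert i A)
 hence "sum f A\<in>L2_space Z" by (intro l2_norm_sum(1)) auto
 hence "res_norm \<T> k (f i + sum f A) <= res_norm \<T> k (f i) + res_norm \<T> k (sum f A)"
  using insert.prems by (intro res_norm_add) auto
 moreover have "res_norm \<T> k (sum f A) <= (\<Sum>i\<in>A. res_norm \<T> k (f i))" using insert.IH insert.prems by blast
 ultimately show ?case unfolding sum.insert[OF insert.hyps] by linarith
qed

text \<open>What the two kinds of discrete forms have in common. The estimate is deliberately
  asymmetric: \<open>f\<close> is an arbitrary datum and enters with its full norm, while smallness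
  has to come from the residual of \<open>w\<close>.\<close>

definition form_bound :: "nat => real => (vector_field => vector_field => real) => bool" where
 "form_bound k c b \<longleftrightarrow> (\<forall>u\<in>L2_space Z. \<forall>v\<in>L2_space Z. b u v = b v u) &
  (\<forall>u\<in>L2_space Z. linear_on (L2_space Z) (b u)) &
  (\<forall>f\<in>L2_space Z. \<forall>w\<in>L2_space Z. \<bar>b f w - l2_inner Z f w\<bar> <= c*(l2_norm Z f*res_norm \<T> k w))"

lemma res_product_le:
 assumes f: "f\<in>L2_space Z"
 shows "(\<Sum>P\<in>\<T>. l2_norm (intr P) (f - proj_grad k P f)*l2_norm (intr P) (w - proj_grad k P w))
  <= l2_norm Z f*res_norm \<T> k w"
proof -
 have "(\<Sum>P\<in>\<T>. l2_norm (intr P) (f - proj_grad k P f)*l2_norm (intr P) (w - proj_grad k P w))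
  <= (\<Sum>P\<in>\<T>. \<bar>l2_norm (intr P) (f - proj_grad k P f)\<bar>*\<bar>l2_norm (intr P) (w - proj_grad k P w)\<bar>)"
  by (intro sum_mono) (simp add: abs_mult[symmetric])
 also have "... <= res_norm \<T> k f*res_norm \<T> k w" unfolding res_norm_def by (rule L2_set_mult_ineq)
 also have "... <= l2_norm Z f*res_norm \<T> k w" by (intro mult_right_mono res_norm_le f res_norm_nonneg)
 finally show ?thesis .
qed

lemma linear_functional_sum:
 assumes "!!P. P\<in>\<T> ==> linear_on W (l P)"
 shows "linear_on W (%v. \<Sum>P\<in>\<T>. l P v)"
 using assms unfolding linear_on_def by (auto simp: sum.distrib sum_distrib_left intro!: sum.cong)

text \<open>Residuals are orthogonal to projections, so the form differs from the inner product
  exactly by the products of the residuals.\<close>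

lemma form_bound_bh0: "form_bound k 1 (bh0 \<T> k)"
 unfolding form_bound_def
proof (intro conjI ballI)
 fix u v :: vector_field
 assume u: "u\<in>L2_space Z" and v: "v\<in>L2_space Z"
 show "bh0 \<T> k u v = bh0 \<T> k v u"
  unfolding bh0_def by (intro sum.cong refl l2.sym bounded_element.proj_L2 element L2_E u v)
 have "\<bar>bh0 \<T> k u v - l2_inner Z u v\<bar> = \<bar>\<Sum>P\<in>\<T>. l2_inner (intr P) (u - proj_grad k P u) (v - proj_grad k P v)\<bar>"
 proof -
  have "l2_inner Z u v - bh0 \<T> k u v = (\<Sum>P\<in>\<T>. l2_inner (intr P) (u - proj_grad k P u) (v - proj_grad k P v))"
   unfolding bh0_def partition[OF u v] sum_subtractf[symmetric]
   by (intro sum.cong refl bounded_element.inner_proj(2) element L2_E u v)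
  thus ?thesis by simp
 qed
 also have "... <= (\<Sum>P\<in>\<T>. \<bar>l2_inner (intr P) (u - proj_grad k P u) (v - proj_grad k P v)\<bar>)" by (rule sum_abs)
 also have "... <= (\<Sum>P\<in>\<T>. l2_norm (intr P) (u - proj_grad k P u)*l2_norm (intr P) (v - proj_grad k P v))"
  by (intro sum_mono l2_Cauchy_Schwarz bounded_element.res_L2 element L2_E u v)
 also have "... <= l2_norm Z u*res_norm \<T> k v" by (rule res_product_le[OF u])
 finally show "\<bar>bh0 \<T> k u v - l2_inner Z u v\<bar> <= 1*(l2_norm Z u*res_norm \<T> k v)" by simp
next
 fix u :: vector_field
 assume u: "u\<in>L2_space Z"
 show "linear_on (L2_space Z) (bh0 \<T> k u)"
  unfolding bh0_def
 proof (rule linear_functional_sum)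
  fix P assume P: "P\<in>\<T>"
  interpret bounded_element P k by (rule element[OF P])
  note uL = L2_E[OF u P]
  have eq: "l2_inner E (proj u) (proj v) = l2_inner E (proj u) v" if "v\<in>L2_space Z" for v
   by (rule inner_proj(1)[OF uL L2_E[OF that P]])
  show "linear_on (L2_space Z) (%v. l2_inner E (proj u) (proj v))"
   unfolding linear_on_def
   using eq l2.closed(1,2) l2.add_right[OF L2_E[OF _ P] L2_E[OF _ P] proj_L2[OF uL]] l2.scale_right[OF L2_E[OF _ P] proj_L2[OF uL]] by simp
 qed
qed

lemma form_bound_bhs:
 assumes S: "!!P. P\<in>\<T> ==> stabilization k P clow cup (S P)" and cup: "cup > 0"
 shows "form_bound k (1 + cup) (bhs \<T> k S)"
proof -
 have bhs: "bhs \<T> k S u v = bh0 \<T> k u v + (\<Sum>P\<in>\<T>. S P (u - proj_grad k P u) (v - proj_grad k P v))" for u v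
  by (simp only: bhs_def fun_diff_def)
 note b0 = form_bound_bh0[of k, unfolded form_bound_def]
 note sf = bounded_element.stab_form[OF element S]
 show ?thesis
  unfolding form_bound_def
 proof (intro conjI ballI)
  fix u v :: vector_field
 assume u: "u\<in>L2_space Z" and v: "v\<in>L2_space Z"
  show "bhs \<T> k S u v = bhs \<T> k S v u"
   unfolding bhs using b0 u v by (intro arg_cong2[where f = "(+)"] sum.cong refl sf(1) L2_E) auto
  have "\<bar>\<Sum>P\<in>\<T>. S P (u - proj_grad k P u) (v - proj_grad k P v)\<bar> <= (\<Sum>P\<in>\<T>. \<bar>S P (u - proj_grad k P u) (v - proj_grad k P v)\<bar>)"
   by (rule sum_abs)
  also have "... <= (\<Sum>P\<in>\<T>. cup*(l2_norm (intr P) (u - proj_grad k P u)*l2_norm (intr P) (v - proj_grad k P v)))"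
  proof (rule sum_mono)
   fix P assume P: "P\<in>\<T>"
   show "\<bar>S P (u - proj_grad k P u) (v - proj_grad k P v)\<bar> <= cup*(l2_norm (intr P) (u - proj_grad k P u)*l2_norm (intr P) (v - proj_grad k P v))"
    using cup by (intro sf(3)[OF P P] L2_E u v P) simp
  qed
  also have "... = cup*(\<Sum>P\<in>\<T>. l2_norm (intr P) (u - proj_grad k P u)*l2_norm (intr P) (v - proj_grad k P v))"
   by (rule sum_distrib_left[symmetric])
  also have "... <= cup*(l2_norm Z u*res_norm \<T> k v)" using cup by (intro mult_left_mono res_product_le u) simp
  finally have st: "\<bar>\<Sum>P\<in>\<T>. S P (u - proj_grad k P u) (v - proj_grad k P v)\<bar> <= cup*(l2_norm Z u*res_norm \<T> k v)" .
  have "\<bar>bh0 \<T> k u v - l2_inner Z u v\<bar> <= 1*(l2_norm Z u*res_norm \<T> k v)" using b0 u v by blast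
  with st show "\<bar>bhs \<T> k S u v - l2_inner Z u v\<bar> <= (1 + cup)*(l2_norm Z u*res_norm \<T> k v)"
   unfolding bhs distrib_right by linarith
 next
  fix u :: vector_field
 assume u: "u\<in>L2_space Z"
  have l0: "linear_on (L2_space Z) (bh0 \<T> k u)" using b0 u by blast
  have "linear_on (L2_space Z) (%v. \<Sum>P\<in>\<T>. S P (u - proj_grad k P u) (v - proj_grad k P v))"
  proof (rule linear_functional_sum)
   fix P assume P: "P\<in>\<T>"
   show "linear_on (L2_space Z) (%v. S P (u - proj_grad k P u) (v - proj_grad k P v))"
    by (rule linear_on_subset[OF sf(2)[OF P P L2_E[OF u P]]]) (use L2_E[OF _ P] in blast)
  qed
  with l0 show "linear_on (L2_space Z) (bhs \<T> k S u)"
   unfolding linear_on_def bhs by (simp add: distrib_left)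
 qed
qed

end

subsection \<open>Solvability of the discrete problem\<close>

lemma has_weak_rot_zero_iff: "has_weak_rot E v (%_. 0) \<longleftrightarrow> (ALL \<phi>. test_function E \<phi> --> l2_inner E v (curl \<phi>) = 0)"
 by (simp add: has_weak_rot_def l2_inner_def)

lemma integrable_poly_edge:
 assumes q: "smooth q"
 shows "(%t. poly p t*q (linepath a b t)) integrable_on {0..1}"
proof -
 have "continuous_on {0..1} (%t. q (linepath a b t))"
  by (rule continuous_on_compose2[OF smoothD(3)[OF q] continuous_on_linepath subset_UNIV])
 thus ?thesis by (intro integrable_continuous_real continuous_intros)
qed

lemma integrable_poly_edge_scale: "smooth q ==> (%t. c*(poly p t*q (linepath a b t))) integrable_on {0..1}"
 using integrable_poly_edge[of q "smult c p" a b] by (simp add: mult.assoc)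

lemma edgewise_polynomial_normal_traceE:
 assumes e: "edgewise_polynomial_normal_trace k P v"
 obtains g :: "point \<times> point => real poly" where "!!e. degree (g e) <= k" "!!q. smooth q ==> normal_trace (intr P) v q =
  (\<Sum>(a, b)\<in>set (polygon_edges P). dist a b*integral {0..1} (%t. poly (g (a, b)) t*q (linepath a b t)))"
proof -
 from e[unfolded edgewise_polynomial_normal_trace_def] obtain g :: "point \<times> point => real poly"
  where g: "(ALL e. degree (g e) <= k) & (ALL q. smooth q --> normal_trace (intr P) v q =
  (\<Sum>(a, b)\<in>set (polygon_edges P). dist a b*integral {0..1} (%t. poly (g (a, b)) t*q (linepath a b t))))" by (rule exE)
 show thesis by (rule that[OF g[THEN conjunct1, rule_format] g[THEN conjunct2, rule_format]])
qed

lemma poly_as_sum: "degree p <= k ==> poly p x = (\<Sum>i\<le>k. coeff p i*x^i)" for p :: "real poly"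
 unfolding poly_altdef by (rule sum.mono_neutral_left) (auto simp: coeff_eq_0)

context bounded_element
begin

lemma VhE_iff: "v\<in>VhE_space k P \<longleftrightarrow> v\<in>Hdiv E & edgewise_polynomial_normal_trace k P v &
  (\<exists>g\<in>polys k. has_weak_div E v g) & has_weak_rot E v (%_. 0)"
proof -
 have "(%_. 0 :: real)\<in>L2_space E" by (rule L2_const[OF E_ob])
 thus ?thesis unfolding VhE_space_def Hrot_def using HdivD[OF E_ob] by blast
qed

lemma polys_L2: "g\<in>polys j ==> g\<in>L2_space E"
 using L2_smooth(1)[OF E_ob] polys_smooth by blast

lemma VhE_comb:
 assumes u: "u\<in>VhE_space k P" and v: "v\<in>VhE_space k P"
 shows "c*\<^sub>R u + v\<in>VhE_space k P"
proof -
 note u' = u[unfolded VhE_iff] and v' = v[unfolded VhE_iff]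
 have uH: "u\<in>Hdiv E" and vH: "v\<in>Hdiv E" using u' v' by auto
 note uL = HdivD[OF E_ob uH] and vL = HdivD[OF E_ob vH]
 note cH = weak_div_scale(1)[OF E_ob uH, of c]
 have H: "c*\<^sub>R u + v\<in>Hdiv E" by (rule weak_div_add(1)[OF E_ob cH vH])
 obtain g where g: "g\<in>polys k" "has_weak_div E u g" using u' by blast
 obtain h where h: "h\<in>polys k" "has_weak_div E v h" using v' by blast
 have d: "has_weak_div E (c*\<^sub>R u + v) (c*\<^sub>R g + h)"
  by (rule has_weak_div_add[OF E_ob l2.closed(2)[OF uL] vL l2.closed(2)[OF polys_L2[OF g(1)]] polys_L2[OF h(1)]
   has_weak_div_scale[OF E_ob uL polys_L2[OF g(1)] g(2)] h(2)])
 have gp: "c*\<^sub>R g + h\<in>polys k" by (rule subspace_add[OF subspace_polys subspace_scale[OF subspace_polys g(1)] h(1)])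
 have r: "has_weak_rot E (c*\<^sub>R u + v) (%_. 0)"
  unfolding has_weak_rot_zero_iff
 proof (intro allI impI)
  fix \<phi> assume t: "test_function E \<phi>"
  have z: "l2_inner E u (curl \<phi>) = 0" "l2_inner E v (curl \<phi>) = 0" using u' v' t unfolding has_weak_rot_zero_iff by blast+
  show "l2_inner E (c*\<^sub>R u + v) (curl \<phi>) = 0"
   unfolding l2.add_left[OF l2.closed(2)[OF uL] vL L2_test(3)[OF E_ob t]] l2.scale_left[OF uL L2_test(3)[OF E_ob t]] z by simp
 qed
 obtain G where G: "!!e. degree (G e) <= k" "!!q. smooth q ==> normal_trace E u q =
  (\<Sum>(a, b)\<in>set (polygon_edges P). dist a b*integral {0..1} (%t. poly (G (a, b)) t*q (linepath a b t)))"
  by (rule edgewise_polynomial_normal_traceE[OF u'[THEN conjunct2, THEN conjunct1]], rule that)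
 obtain G' where G': "!!e. degree (G' e) <= k" "!!q. smooth q ==> normal_trace E v q =
  (\<Sum>(a, b)\<in>set (polygon_edges P). dist a b*integral {0..1} (%t. poly (G' (a, b)) t*q (linepath a b t)))"
  by (rule edgewise_polynomial_normal_traceE[OF v'[THEN conjunct2, THEN conjunct1]], rule that)
 have "edgewise_polynomial_normal_trace k P (c*\<^sub>R u + v)"
  unfolding edgewise_polynomial_normal_trace_def
 proof (intro exI[of _ "%e. smult c (G e) + G' e"] conjI allI impI)
  show "degree (smult c (G e) + G' e) <= k" for e
   by (intro degree_add_le order_trans[OF degree_smult_le] G(1) G'(1))
  fix q assume q: "smooth q"
  have i: "integral {0..1} (%t. poly (smult c (G (a, b)) + G' (a, b)) t*q (linepath a b t)) =
   c*integral {0..1} (%t. poly (G (a, b)) t*q (linepath a b t)) + integral {0..1} (%t. poly (G' (a, b)) t*q (linepath a b t))" for a b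
  proof -
   have "integral {0..1} (%t. poly (smult c (G (a, b)) + G' (a, b)) t*q (linepath a b t)) =
    integral {0..1} (%t. c*(poly (G (a, b)) t*q (linepath a b t)) + poly (G' (a, b)) t*q (linepath a b t))"
    by (rule integral_cong) (simp add: algebra_simps)
   also have "... = integral {0..1} (%t. c*(poly (G (a, b)) t*q (linepath a b t))) + integral {0..1} (%t. poly (G' (a, b)) t*q (linepath a b t))"
    by (intro Henstock_Kurzweil_Integration.integral_add integrable_poly_edge_scale integrable_poly_edge q)
   finally show ?thesis by simp
  qed
  show "normal_trace E (c*\<^sub>R u + v) q = (\<Sum>(a, b)\<in>set (polygon_edges P).
   dist a b*integral {0..1} (%t. poly (smult c (G (a, b)) + G' (a, b)) t*q (linepath a b t)))"
   unfolding normal_trace_add[OF E_ob cH vH q] normal_trace_scale[OF E_ob uH q] G(2)[OF q] G'(2)[OF q] i sum_distrib_left sum.distrib[symmetric]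
   by (intro sum.cong refl) (auto simp: algebra_simps)
 qed
 with H gp d r show ?thesis unfolding VhE_iff by blast
qed

text \<open>Used for the curl of a potential, which agrees with a discrete field only almost
  everywhere.\<close>

lemma VhE_cong:
 assumes u: "u\<in>VhE_space k P" and v: "v\<in>L2_space E" and eq: "AE x in lebesgue_on E. u x = v x"
 shows "v\<in>VhE_space k P"
proof -
 note u' = u[unfolded VhE_iff]
 have uL: "u\<in>L2_space E" using u' HdivD[OF E_ob] by blast
 note cong = Hdiv_cong_AE[OF E_ob uL v eq]
 have tr: "normal_trace E v q = normal_trace E u q" if "smooth q" for q using cong(5)[OF that] by simp
 have "edgewise_polynomial_normal_trace k P v"
 proof (rule edgewise_polynomial_normal_traceE[OF u'[THEN conjunct2, THEN conjunct1]])
  fix g :: "point \<times> point => real poly"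
  assume "!!e. degree (g e) <= k" "!!q. smooth q ==> normal_trace E u q =
   (\<Sum>(a, b)\<in>set (polygon_edges P). dist a b*integral {0..1} (%t. poly (g (a, b)) t*q (linepath a b t)))"
  thus ?thesis unfolding edgewise_polynomial_normal_trace_def by (intro exI[of _ g] conjI allI impI) (simp_all only: tr)
 qed
 with u' show ?thesis unfolding VhE_iff cong(1)[symmetric] cong(2)[symmetric] cong(3)[symmetric] by blast
qed

text \<open>Here the field is fixed and the trace is a functional of the test function.\<close>

lemma normal_trace_linear:
 assumes v: "v\<in>Hdiv E"
 shows "linear_on (Collect smooth) (normal_trace E v)"
proof -
 note L = HdivD[OF E_ob v] weak_div_spec(1)[OF E_ob v]
 show ?thesis
  unfolding linear_on_def normal_trace_def
 proof (intro conjI ballI allI)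
  fix p q assume "p\<in>Collect smooth" "q\<in>Collect smooth"
  hence s: "smooth p" "smooth q" by auto
  show "l2_inner E v (grad (p + q)) + l2_inner E (weak_div E v) (p + q) =
   l2_inner E v (grad p) + l2_inner E (weak_div E v) p + (l2_inner E v (grad q) + l2_inner E (weak_div E v) q)"
   unfolding grad_add[OF s] l2.add_right[OF L2_smooth(2)[OF E_ob s(1)] L2_smooth(2)[OF E_ob s(2)] L(1)]
    l2.add_right[OF L2_smooth(1)[OF E_ob s(1)] L2_smooth(1)[OF E_ob s(2)] L(2)] by simp
 next
  fix p and c :: real assume "p\<in>Collect smooth"
  hence s: "smooth p" by auto
  show "l2_inner E v (grad (c*\<^sub>R p)) + l2_inner E (weak_div E v) (c*\<^sub>R p) = c*(l2_inner E v (grad p) + l2_inner E (weak_div E v) p)"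
   unfolding grad_scale[OF s] l2.scale_right[OF L2_smooth(2)[OF E_ob s] L(1)] l2.scale_right[OF L2_smooth(1)[OF E_ob s] L(2)]
   by (simp add: distrib_left)
 qed
qed

text \<open>Edges times exponents: the moments that a normal trace of degree at most
  \<open>k\<close> on each edge can see.\<close>

definition dofs :: "((point \<times> point) \<times> nat) set" where
 "dofs = set (polygon_edges P) \<times> {..k}"

definition edge_moment :: "(point \<times> point) \<times> nat => scalar_field => real" where
 "edge_moment = (%((a, b), i) q. dist a b*integral {0..1} (%t. poly (monom 1 i) t*q (linepath a b t)))"

lemma edge_moment_linear: "linear_on (Collect smooth) (edge_moment j)"
proof -
 obtain a b i where j: "j = ((a, b), i)" by (metis surj_pair)
 have "integral {0..1} (%t. poly (monom 1 i) t*(p + q) (linepath a b t)) =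
  integral {0..1} (%t. poly (monom 1 i) t*p (linepath a b t)) + integral {0..1} (%t. poly (monom 1 i) t*q (linepath a b t))"
  if "smooth p" "smooth q" for p q
  using Henstock_Kurzweil_Integration.integral_add[OF integrable_poly_edge[OF that(1)] integrable_poly_edge[OF that(2)], of "monom 1 i" a b "monom 1 i" a b]
  by (simp add: distrib_left)
 moreover have "integral {0..1} (%t. poly (monom 1 i) t*(c*\<^sub>R p) (linepath a b t)) = c*integral {0..1} (%t. poly (monom 1 i) t*p (linepath a b t))" for c and p :: scalar_field
 proof -
  have "(%t. poly (monom 1 i) t*(c*\<^sub>R p) (linepath a b t)) = (%t. c*(poly (monom 1 i) t*p (linepath a b t)))"
   by (rule ext) (simp add: mult_ac)
  thus ?thesis by (simp only: integral_mult_right)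
 qed
 ultimately show ?thesis unfolding linear_on_def j edge_moment_def by (auto simp: distrib_left simp del: plus_fun_apply scaleR_fun_apply)
qed

text \<open>The trace of a discrete field is a combination of the edge moments of \<open>q\<close>,
  with coefficients from its edge polynomials. Subtracting a combination of the
  \<open>\<phi> j\<close> from \<open>q\<close> annihilates these moments, so finitely many values
  determine the trace.\<close>

lemma normal_trace_determined:
 obtains \<phi> where "!!j. j\<in>dofs ==> smooth (\<phi> j)"
  "!!v q. v\<in>VhE_space k P ==> \<forall>j\<in>dofs. normal_trace E v (\<phi> j) = 0 ==> smooth q ==> normal_trace E v q = 0"
proof -
 have fin: "finite dofs" by (simp add: dofs_def)
 obtain \<phi> where \<phi>: "!!j. j\<in>dofs ==> \<phi> j\<in>Collect smooth"
  "!!q i. q\<in>Collect smooth ==> i\<in>dofs ==> edge_moment i (q - (\<Sum>j\<in>dofs. edge_moment j q*\<^sub>R \<phi> j)) = 0"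
  by (rule kernel_projection[OF fin subspace_smooth, of edge_moment]) (rule edge_moment_linear, rule that)
 show thesis
 proof (rule that[of \<phi>])
  show "smooth (\<phi> j)" if "j\<in>dofs" for j using \<phi>(1)[OF that] by simp
  fix v q assume v: "v\<in>VhE_space k P" and z: "\<forall>j\<in>dofs. normal_trace E v (\<phi> j) = 0" and q: "smooth q"
  note v' = v[unfolded VhE_iff]
  have vH: "v\<in>Hdiv E" using v' by blast
  note lin = linear_onD[OF normal_trace_linear[OF vH] subspace_smooth]
  obtain G where G: "!!e. degree (G e) <= k" "!!q. smooth q ==> normal_trace E v q =
   (\<Sum>(a, b)\<in>set (polygon_edges P). dist a b*integral {0..1} (%t. poly (G (a, b)) t*q (linepath a b t)))"
   by (rule edgewise_polynomial_normal_traceE[OF v'[THEN conjunct2, THEN conjunct1]], rule that)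
  define s where "s = (\<Sum>j\<in>dofs. edge_moment j q*\<^sub>R \<phi> j)"
  have tS: "edge_moment j q*\<^sub>R \<phi> j\<in>Collect smooth" if "j\<in>dofs" for j
   by (rule subspace_scale[OF subspace_smooth \<phi>(1)[OF that]])
  have sS: "s\<in>Collect smooth" unfolding s_def by (intro subspace_sum[OF subspace_smooth] tS)
  have qS: "q\<in>Collect smooth" using q by simp
  have dS: "smooth (q - s)" using subspace_diff[OF subspace_smooth qS sS] by simp
  have "dist a b*integral {0..1} (%t. poly (G (a, b)) t*(q - s) (linepath a b t)) = 0" if e: "(a, b)\<in>set (polygon_edges P)" for a b
  proof -
   have "integral {0..1} (%t. poly (G (a, b)) t*(q - s) (linepath a b t)) =
    integral {0..1} (%t. \<Sum>i\<le>k. coeff (G (a, b)) i*(poly (monom 1 i) t*(q - s) (linepath a b t)))"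
    by (rule integral_cong) (simp add: poly_as_sum[OF G(1)] poly_monom sum_distrib_right mult.assoc del: minus_apply)
   also have "... = (\<Sum>i\<le>k. coeff (G (a, b)) i*integral {0..1} (%t. poly (monom 1 i) t*(q - s) (linepath a b t)))"
    by (subst integral_sum) (auto intro!: integrable_poly_edge_scale dS simp del: minus_apply poly_monom simp: integral_mult_right)
   finally have "dist a b*integral {0..1} (%t. poly (G (a, b)) t*(q - s) (linepath a b t)) =
    (\<Sum>i\<le>k. coeff (G (a, b)) i*edge_moment ((a, b), i) (q - s))"
    by (simp only: edge_moment_def prod.case sum_distrib_left mult.left_commute)
   also have "... = 0"
   proof (rule sum.neutral, rule ballI)
    fix i assume "i\<in>{..k}"
    hence "((a, b), i)\<in>dofs" using e by (simp add: dofs_def)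
    from \<phi>(2)[OF qS this] show "coeff (G (a, b)) i*edge_moment ((a, b), i) (q - s) = 0" unfolding s_def by simp
   qed
   finally show ?thesis .
  qed
  hence 1: "normal_trace E v (q - s) = 0" unfolding G(2)[OF dS] by (intro sum.neutral) auto
  have "normal_trace E v s = (\<Sum>j\<in>dofs. normal_trace E v (edge_moment j q*\<^sub>R \<phi> j))" unfolding s_def by (rule lin(5)[OF fin tS])
  also have "... = 0" using lin(2)[OF \<phi>(1)] z by (intro sum.neutral) auto
  finally show "normal_trace E v q = 0" using 1 lin(3)[OF qS sS] by simp
 qed
qed

end

context polygonal_mesh_of
begin

lemma inner_restrict:
 fixes v w :: "point => 'b::euclidean_space"
 assumes P: "P\<in>\<T>" and z: "!!x. x \<notin> intr P ==> w x = 0"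
 shows "l2_inner Z v w = l2_inner (intr P) v w"
proof -
 have eq: "indicator Z x*\<^sub>R (v x\<bullet>w x) = indicator (intr P) x*\<^sub>R (v x\<bullet>w x)" for x
  using sub[OF P] z[of x] by (auto simp: indicator_def)
 show ?thesis
  unfolding l2_inner_def integral_lebesgue_on[OF sets_lebesgue_open[OF Z_open]]
   integral_lebesgue_on[OF sets_lebesgue_open[OF E_open[OF P]]] eq ..
qed

lemma has_weak_div_restrict:
 assumes P: "P\<in>\<T>" and h: "has_weak_div Z v g"
 shows "has_weak_div (intr P) v g"
 unfolding has_weak_div_def
proof (intro allI impI)
 fix \<phi> assume t: "test_function (intr P) \<phi>"
 have z: "\<phi> x = 0" if "x \<notin> intr P" and "test_function (intr P) \<phi>" for x \<phi>
  using test_functionE[OF that(2)] that(1) by (metis subsetD)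
 have "l2_inner Z v (grad \<phi>) = - l2_inner Z g \<phi>"
  using h test_function_mono[OF t sub[OF P]] by (simp add: has_weak_div_def)
 moreover have "l2_inner Z v (grad \<phi>) = l2_inner (intr P) v (grad \<phi>)"
  by (rule inner_restrict[OF P], rule point_eqI) (simp_all add: z test_function_partial[OF t])
 moreover have "l2_inner Z g \<phi> = l2_inner (intr P) g \<phi>" by (rule inner_restrict[OF P]) (rule z[OF _ t])
 ultimately show "l2_inner (intr P) v (grad \<phi>) = - l2_inner (intr P) g \<phi>" by simp
qed

lemma subspace_Vh: "subspace (Vh_space Z \<T> k)"
proof -
 have zero: "0\<in>VhE_space k P" if P: "P\<in>\<T>" for P
 proof -
  interpret bounded_element P k by (rule element[OF P])
  have "has_weak_div E 0 (%_. 0)" by (simp add: has_weak_div_def l2_inner_def)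
  note wz = weak_div_zero[OF E_ob l2.zero_in this]
  have tr: "normal_trace E 0 q = 0" if q: "smooth q" for q
   unfolding normal_trace_def
   using l2.zero_left[OF L2_smooth(2)[OF E_ob q]] l2_null_orth(2)[OF L2_smooth(1)[OF E_ob q] weak_div_spec(1)[OF E_ob wz(1)] wz(2)] by simp
  have "edgewise_polynomial_normal_trace k P 0"
   unfolding edgewise_polynomial_normal_trace_def by (rule exI[of _ "%e. 0"]) (auto simp: tr intro!: sum.neutral[symmetric])
  moreover have "0\<in>polys k" by (rule subspace_0[OF subspace_polys])
  moreover have "has_weak_div E 0 0" by (simp add: has_weak_div_def l2_inner_def)
  moreover have "has_weak_rot E 0 (%_. 0)" by (simp add: has_weak_rot_def l2_inner_def)
  ultimately show ?thesis unfolding VhE_iff using wz(1) by blast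
 qed
 have comb: "c*\<^sub>R u + v\<in>VhE_space k P" if "P\<in>\<T>" "u\<in>VhE_space k P" "v\<in>VhE_space k P" for P c u v
  by (rule bounded_element.VhE_comb[OF element[OF that(1)] that(2,3)])
 show ?thesis
 proof (rule subspaceI)
  show "0\<in>Vh_space Z \<T> k" unfolding Vh_space_def using subspace_0[OF subspace_V] zero by blast
  fix u v assume u: "u\<in>Vh_space Z \<T> k" and v: "v\<in>Vh_space Z \<T> k"
  show "u + v\<in>Vh_space Z \<T> k"
   using u v comb[of _ u v 1] subspace_add[OF subspace_V, of u v] unfolding Vh_space_def scaleR_one by blast
 next
  fix u c assume u: "u\<in>Vh_space Z \<T> k"
  show "c*\<^sub>R u\<in>Vh_space Z \<T> k"
   using u zero comb[of _ u 0 c] subspace_scale[OF subspace_V, of u c] unfolding Vh_space_def add_0_right by blast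
 qed
qed

lemma Vh_V: "v\<in>Vh_space Z \<T> k ==> v\<in>V_space Z"
 by (simp add: Vh_space_def)

text \<open>Up to null functions, the curls of the discrete potentials. Working with fields instead
  of potentials gives a genuine subspace, although \<open>weak_curl\<close> is linear only almost
  everywhere.\<close>

definition Zh :: "nat => vector_field set" where
 "Zh k = {z\<in>Vh_space Z \<T> k. has_weak_div Z z (%_. 0)}"

lemma subspace_Zh: "subspace (Zh k)"
proof -
 have d: "has_weak_div Z (c*\<^sub>R u + v) (%_. 0)" if u: "u\<in>L2_space Z" and v: "v\<in>L2_space Z" and "has_weak_div Z u (%_. 0)" "has_weak_div Z v (%_. 0)" for u v c
  unfolding has_weak_div_def
 proof (intro allI impI)
  fix \<phi> assume t: "test_function Z \<phi>"
  have z: "l2_inner Z u (grad \<phi>) = 0" "l2_inner Z v (grad \<phi>) = 0" using that(3,4) t by (auto simp: has_weak_div_def l2_inner_def)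
  show "l2_inner Z (c*\<^sub>R u + v) (grad \<phi>) = - l2_inner Z (%_. 0) \<phi>"
   unfolding l2.add_left[OF l2.closed(2)[OF u] v L2_Z_test(2)[OF t]] l2.scale_left[OF u L2_Z_test(2)[OF t]] z by (simp add: l2_inner_def)
 qed
 have z0: "has_weak_div Z 0 (%_. 0)" by (simp add: has_weak_div_def l2_inner_def)
 have L: "v\<in>L2_space Z" if "v\<in>Vh_space Z \<T> k" for v using Vh_V[OF that] V_L2 by blast
 show ?thesis
 proof (rule subspaceI)
  show "0\<in>Zh k" unfolding Zh_def using subspace_0[OF subspace_Vh] z0 by blast
  show "u + v\<in>Zh k" if "u\<in>Zh k" "v\<in>Zh k" for u v
   using that d[of u v 1] subspace_add[OF subspace_Vh, of u k v] L unfolding Zh_def scaleR_one by blast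
  show "c*\<^sub>R u\<in>Zh k" if "u\<in>Zh k" for u c
   using that z0 d[of u 0 c] subspace_scale[OF subspace_Vh, of u k c] L l2.zero_in unfolding Zh_def add_0_right by blast
 qed
qed

text \<open>A field of \<open>Zh\<close> has neither divergence nor rotation on an element, so once
  its normal trace vanishes, the vanishing theorem on the element makes it null. The traces are
  determined by finitely many numbers.\<close>

lemma Zh_finite_functionals:
 obtains I :: "(polygon \<times> (point \<times> point) \<times> nat) set" and l where "finite I" "!!i. i\<in>I ==> linear_on (Zh k) (l i)"
  "!!z. z\<in>Zh k ==> \<forall>i\<in>I. l i z = 0 ==> l2_norm Z z = 0"
proof -
 have "EX \<phi>. (\<forall>j\<in>bounded_element.dofs P k. smooth (\<phi> j)) & (\<forall>v\<in>VhE_space k P. (\<forall>j\<in>bounded_element.dofs P k. normal_trace (intr P) v (\<phi> j) = 0) -->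
  (ALL q. smooth q --> normal_trace (intr P) v q = 0))" if P: "P\<in>\<T>" for P
 proof -
  interpret bounded_element P k by (rule element[OF P])
  obtain \<phi> where "!!j. j\<in>dofs ==> smooth (\<phi> j)"
   "!!v q. v\<in>VhE_space k P ==> \<forall>j\<in>dofs. normal_trace E v (\<phi> j) = 0 ==> smooth q ==> normal_trace E v q = 0"
   by (rule normal_trace_determined, rule that)
  thus ?thesis by (intro exI[of _ \<phi>]) blast
 qed
 then obtain \<phi> where \<phi>: "!!P j. P\<in>\<T> ==> j\<in>bounded_element.dofs P k ==> smooth (\<phi> P j)"
  "!!P v q. P\<in>\<T> ==> v\<in>VhE_space k P ==> (!!j. j\<in>bounded_element.dofs P k ==> normal_trace (intr P) v (\<phi> P j) = 0) ==>
   smooth q ==> normal_trace (intr P) v q = 0" by metis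
 define I where "I = (SIGMA P:\<T>. bounded_element.dofs P k)"
 define l where "l i v = normal_trace (intr (fst i)) v (\<phi> (fst i) (snd i))" for i v
 show thesis
 proof (rule that[of I l])
  show "finite I" unfolding I_def by (intro finite_SigmaI finite_mesh) (simp add: bounded_element.dofs_def[OF element])
  show "linear_on (Zh k) (l i)" if i: "i\<in>I" for i
  proof -
   have P: "fst i\<in>\<T>" and j: "snd i\<in>bounded_element.dofs (fst i) k" using i by (auto simp: I_def)
   note ob = E_open[OF P] E_bounded[OF P]
   have H: "v\<in>Hdiv (intr (fst i))" if "v\<in>Zh k" for v
    using that P bounded_element.VhE_iff[OF element[OF P]] by (auto simp: Zh_def Vh_space_def)
   show ?thesis unfolding linear_on_def l_def
    by (intro conjI ballI allI normal_trace_add[OF ob] normal_trace_scale[OF ob] H \<phi>(1)[OF P j])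
  qed
  fix z assume z: "z\<in>Zh k" and l0: "\<forall>i\<in>I. l i z = 0"
  have zV: "z\<in>V_space Z" and zh: "z\<in>Vh_space Z \<T> k" using z by (auto simp: Zh_def Vh_space_def)
  have "l2_norm (intr P) z = 0" if P: "P\<in>\<T>" for P
  proof -
   interpret bounded_element P k by (rule element[OF P])
   note zL = L2_E[OF V_L2[OF zV] P]
   have zE: "z\<in>VhE_space k P" using zh P by (simp add: Vh_space_def)
   have tr: "normal_trace E z q = 0" if q: "smooth q" for q
   proof (rule \<phi>(2)[OF P zE _ q])
    show "normal_trace E z (\<phi> P j) = 0" if "j\<in>dofs" for j
     using l0[rule_format, of "(P, j)"] that P by (simp add: I_def l_def)
   qed
   have "has_weak_div E z (%_. 0)" by (rule has_weak_div_restrict[OF P]) (use z in \<open>simp add: Zh_def\<close>)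
   note wz = weak_div_zero[OF E_ob zL this]
   show ?thesis
   proof (rule Helmholtz_zero_exterior[OF polygon_interior_facts(1)[OF simple[OF P]] zL])
    show "l2_inner E z (grad q) = 0" if q: "smooth q" for q
     using tr[OF q] l2_null_orth(2)[OF L2_smooth(1)[OF E_ob q] weak_div_spec(1)[OF E_ob wz(1)] wz(2)] by (simp add: normal_trace_def)
    show "l2_inner E z (curl \<psi>) = 0" if "test_function E \<psi>" for \<psi>
     using zE that unfolding VhE_iff has_weak_rot_zero_iff by blast
   qed
  qed
  thus "l2_norm Z z = 0" using norm_partition[OF V_L2[OF zV]] by simp
 qed
qed

text \<open>The part of \<open>z\<close> in \<open>K_space\<close> has null divergence and is
  therefore null, so \<open>z\<close> agrees almost everywhere with its curl part.\<close>

lemma Qh_of_Zh: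
 assumes z: "z\<in>Zh k"
 shows "\<exists>q\<in>Qh_space Z \<T> k. l2_norm Z (z - weak_curl Z q) = 0"
proof -
 have zV: "z\<in>V_space Z" and zh: "z\<in>Vh_space Z \<T> k" and zd: "has_weak_div Z z (%_. 0)"
  using z by (auto simp: Zh_def Vh_space_def)
 obtain q where q: "q\<in>H10 Z" "z - weak_curl Z q\<in>K_space" by (rule V_decomposition[OF zV], rule that)
 obtain c where c: "c > 0" "!!v. v\<in>K_space ==> l2_norm Z v <= c*div.nrm v" using K_elliptic by blast
 note qV = curl_H10_V[OF q(1)] and qL = curl_H10_L2[OF q(1)]
 have "div.nrm (z - weak_curl Z q) <= div.nrm z + div.nrm (weak_curl Z q)" by (rule div.nrm_triangle_diff[OF zV qV(1)])
 hence "div.nrm (z - weak_curl Z q) <= 0" using weak_div_zero(2)[OF Z_ob V_L2[OF zV] zd] qV(3) by (simp add: div_nrm)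
 hence "c*div.nrm (z - weak_curl Z q) <= 0" using c(1) by (simp add: mult_le_0_iff)
 hence n0: "l2_norm Z (z - weak_curl Z q) = 0"
  using c(2)[OF q(2)] l2_norm_nonneg[OF l2.closed(3)[OF V_L2[OF zV] qL]] by linarith
 hence "AE x in lebesgue_on Z. (z - weak_curl Z q) x = 0"
  using l2_norm_eq_0_AE[OF l2.closed(3)[OF V_L2[OF zV] qL]] by blast
 hence ae: "AE x in lebesgue_on Z. z x = weak_curl Z q x" by eventually_elim simp
 have "weak_curl Z q\<in>VhE_space k P" if P: "P\<in>\<T>" for P
 proof (rule bounded_element.VhE_cong[OF element[OF P]])
  show "z\<in>VhE_space k P" using zh P by (simp add: Vh_space_def)
  show "AE x in lebesgue_on (intr P). z x = weak_curl Z q x"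
   by (rule AE_lebesgue_on_subset[OF ae sub[OF P] sets_lebesgue_open[OF E_open[OF P]] sets_lebesgue_open[OF Z_open]])
 qed (rule L2_E[OF qL P])
 hence "q\<in>Qh_space Z \<T> k" using q(1) qV(1,2) by (simp add: Qh_space_def Vh_space_def)
 with n0 show ?thesis by blast
qed

lemma Qh_curl_Zh: "q\<in>Qh_space Z \<T> k ==> weak_curl Z q\<in>Zh k"
 by (simp add: Qh_space_def Zh_def)

text \<open>On each element the divergence is a polynomial, hence null once its moments against the
  monomials vanish.\<close>

lemma div_determined:
 obtains I :: "(polygon \<times> nat \<times> nat) set" and l where "finite I" "!!i. i\<in>I ==> linear_on (Vh_space Z \<T> k) (l i)"
  "!!v. v\<in>Vh_space Z \<T> k ==> \<forall>i\<in>I. l i v = 0 ==> div_form v v = 0"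
proof -
 define w where "w i x = indicator (intr (fst i)) x*monomial (snd i) x" for i :: "polygon \<times> nat \<times> nat" and x
 have wL: "w i\<in>L2_space Z" if P: "fst i\<in>\<T>" for i
 proof (rule L2_dominated(1)[OF L2_Z_smooth(1)[OF smooth_monomial[of "snd i"]], where c = 1])
  have [measurable]: "(indicator (intr (fst i)) :: scalar_field)\<in>borel_measurable borel" using E_open[OF P] by simp
  note [measurable] = borel_measurable_smooth[OF smooth_monomial[of "snd i"]]
  have "(%x. indicator (intr (fst i)) x*monomial (snd i) x)\<in>borel_measurable borel" by measurable
  thus "w i\<in>borel_measurable (lebesgue_on Z)" unfolding w_def[abs_def] by (rule borel_lebesgue_on)
 qed (auto simp: w_def indicator_def)
 define l where "l i v = l2_inner Z (weak_div Z v) (w i)" for i v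
 have l_eq: "l (P, m) v = l2_inner (intr P) (weak_div Z v) (monomial m)" if P: "P\<in>\<T>" for P m v
 proof -
  have "l (P, m) v = l2_inner (intr P) (weak_div Z v) (w (P, m))"
   unfolding l_def by (rule inner_restrict[OF P]) (simp add: w_def)
  also have "... = l2_inner (intr P) (weak_div Z v) (monomial m)"
   unfolding l2_inner_def by (rule Bochner_Integration.integral_cong[OF refl]) (simp add: w_def space_restrict_space)
  finally show ?thesis .
 qed
 show thesis
 proof (rule that[of "\<T> \<times> exponents k" l])
  show "finite (\<T> \<times> exponents k)" using finite_mesh finite_exponents by simp
  show "linear_on (Vh_space Z \<T> k) (l i)" if "i\<in>\<T> \<times> exponents k" for i
  proof -
   have P: "fst i\<in>\<T>" using that by auto
   have H: "v\<in>Hdiv Z" if "v\<in>Vh_space Z \<T> k" for v by (rule V_Hdiv[OF Vh_V[OF that]])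
   show ?thesis unfolding linear_on_def l_def
    by (intro conjI ballI allI weak_div_inner_add[OF Z_ob] weak_div_inner_scale[OF Z_ob] H wL[OF P])
  qed
  fix v assume v: "v\<in>Vh_space Z \<T> k" and l0: "\<forall>i\<in>\<T> \<times> exponents k. l i v = 0"
  note vV = Vh_V[OF v]
  have "l2_inner (intr P) (weak_div Z v) (weak_div Z v) = 0" if P: "P\<in>\<T>" for P
  proof -
   interpret bounded_element P k by (rule element[OF P])
   note dL = L2_E[OF div_L2[OF vV] P]
   have "v\<in>VhE_space k P" using v P by (simp add: Vh_space_def)
   then obtain g where g: "g\<in>polys k" "has_weak_div E v g" unfolding VhE_iff by blast
   obtain c where c: "g = (\<Sum>m\<in>exponents k. c m*\<^sub>R monomial m)" using g(1) unfolding polys_iff by blast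
   have mL: "monomial m\<in>L2_space E" for m by (rule L2_smooth(1)[OF E_ob smooth_monomial])
   have "AE x in lebesgue_on E. weak_div Z v x = g x"
    by (rule weak_div_unique[OF E_ob has_weak_div_restrict[OF P weak_div_spec(2)[OF Z_ob V_Hdiv[OF vV]]] g(2) dL polys_L2[OF g(1)]])
   hence "l2_inner E (weak_div Z v) (weak_div Z v) = l2_inner E (weak_div Z v) g"
    by (intro l2_inner_cong_AE dL polys_L2[OF g(1)] AE_I2[OF refl])
   also have "... = (\<Sum>m\<in>exponents k. l2_inner E (weak_div Z v) (c m*\<^sub>R monomial m))"
    unfolding c by (rule l2.sum_right[OF finite_exponents l2.closed(2)[OF mL] dL])
   also have "... = 0"
    using l0 P by (intro sum.neutral) (auto simp: l2.scale_right[OF mL dL] l_eq[OF P, symmetric])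
   finally show ?thesis .
  qed
  thus "div_form v v = 0" unfolding div_form_def partition[OF div_L2[OF vV] div_L2[OF vV]] by (rule sum.neutral[rule_format])
 qed
qed

lemma form_bound_norm:
 assumes b: "form_bound k c b" and c: "c >= 0" and u: "u\<in>L2_space Z" and v: "v\<in>L2_space Z"
 shows "\<bar>b u v\<bar> <= (1 + c)*(l2_norm Z u*l2_norm Z v)"
proof -
 have "\<bar>b u v - l2_inner Z u v\<bar> <= c*(l2_norm Z u*res_norm \<T> k v)" using b u v by (simp add: form_bound_def)
 also have "... <= c*(l2_norm Z u*l2_norm Z v)" by (intro mult_left_mono res_norm_le v c l2_norm_nonneg u)
 finally show ?thesis using l2_Cauchy_Schwarz[OF u v] unfolding distrib_right by linarith
qed

text \<open>\<open>u\<close> represents \<open>b f\<close> on the discrete kernel, where ellipticity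
  makes \<open>b f\<close> vanish on fields with null divergence. The remainder \<open>G\<close>
  vanishes on that kernel and has to be written as \<open>b v z\<close> with \<open>z\<close> in
  \<open>Zh k\<close>: linear algebra with finitely many functionals whose common kernel is the
  discrete kernel.\<close>

lemma discrete_solvable:
 assumes b: "form_bound k c b" and c: "c >= 0" and \<alpha>: "\<alpha> > 0"
  and elliptic: "!!v. v\<in>Kh_rot Z \<T> k b ==> l2_inner Z (weak_div Z v) (weak_div Z v) >= \<alpha>*(div_norm Z v)^2"
  and f: "f\<in>L2_space Z"
 shows "EX u p. solves_discrete Z \<T> k b f u p"
proof -
 let ?Vh = "Vh_space Z \<T> k"
 let ?Kh = "Kh_rot Z \<T> k b"
 have VhL: "v\<in>L2_space Z" if "v\<in>?Vh" for v by (rule V_L2[OF Vh_V[OF that]])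
 have ZV: "z\<in>?Vh" if "z\<in>Zh k" for z using that by (simp add: Zh_def)
 have sym: "b u v = b v u" if "u\<in>L2_space Z" "v\<in>L2_space Z" for u v using b that by (simp add: form_bound_def)
 have linr: "linear_on (L2_space Z) (b u)" if "u\<in>L2_space Z" for u using b that by (simp add: form_bound_def)
 note lr = linear_onD[OF linr subspace_L2_space]
 have linl: "linear_on ?Vh (%v. b v u)" if u: "u\<in>L2_space Z" for u
 proof -
  have "linear_on ?Vh (b u)" by (rule linear_on_subset[OF linr[OF u]]) (use VhL in blast)
  thus ?thesis
   unfolding linear_on_def
   using sym[OF VhL u] subspace_add[OF subspace_Vh] subspace_scale[OF subspace_Vh] by simp
 qed
 have null: "b u z = b u z'" if "u\<in>L2_space Z" "z\<in>L2_space Z" "z'\<in>L2_space Z" "l2_norm Z (z - z') = 0" for u z z'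
  using form_bound_norm[OF b c that(1) l2.closed(3)[OF that(2,3)]] lr(3)[OF that(1-3)] that(4) by simp
 \<comment> \<open>The curls in the definition of the kernel are replaced by \<open>Zh k\<close>, a
   subspace that \<open>b\<close> cannot distinguish from them.\<close>
 have Kh_iff: "v\<in>?Kh \<longleftrightarrow> v\<in>?Vh & (\<forall>z\<in>Zh k. b v z = 0)" for v
 proof
  assume v: "v\<in>?Kh"
  hence vV: "v\<in>?Vh" by (simp add: Kh_rot_def)
  have "b v z = 0" if z: "z\<in>Zh k" for z
  proof -
   obtain q where q: "q\<in>Qh_space Z \<T> k" "l2_norm Z (z - weak_curl Z q) = 0" using Qh_of_Zh[OF z] by blast
   have "b v z = b v (weak_curl Z q)" by (rule null[OF VhL[OF vV] VhL[OF ZV[OF z]] VhL[OF ZV[OF Qh_curl_Zh[OF q(1)]]] q(2)])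
   thus ?thesis using v q(1) by (simp add: Kh_rot_def)
  qed
  with vV show "v\<in>?Vh & (\<forall>z\<in>Zh k. b v z = 0)" by blast
 next
  assume "v\<in>?Vh & (\<forall>z\<in>Zh k. b v z = 0)"
  thus "v\<in>?Kh" using Qh_curl_Zh by (auto simp: Kh_rot_def)
 qed
 have Kh: "subspace ?Kh"
 proof (rule subspaceI)
  show "0\<in>?Kh"
   unfolding Kh_iff using subspace_0[OF subspace_Vh] linear_onD(4)[OF linl[OF VhL[OF ZV]] subspace_Vh] by blast
  show "u + v\<in>?Kh" if "u\<in>?Kh" "v\<in>?Kh" for u v
   using that subspace_add[OF subspace_Vh, of u k v] linear_onD(1)[OF linl[OF VhL[OF ZV]] subspace_Vh, of _ u v] unfolding Kh_iff by simp
  show "a*\<^sub>R u\<in>?Kh" if "u\<in>?Kh" for u a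
   using that subspace_scale[OF subspace_Vh, of u k a] linear_onD(2)[OF linl[OF VhL[OF ZV]] subspace_Vh, of _ u a] unfolding Kh_iff by simp
 qed
 obtain I :: "(polygon \<times> nat \<times> nat) set" and l where I: "finite I" "!!i. i\<in>I ==> linear_on ?Vh (l i)"
  "!!v. v\<in>?Vh ==> \<forall>i\<in>I. l i v = 0 ==> div_form v v = 0" by (rule div_determined, rule that)
 have KhVh: "?Kh \<subseteq> ?Vh" by (auto simp: Kh_rot_def)
 have bfV: "linear_on ?Vh (b f)" by (rule linear_on_subset[OF linr[OF f]]) (use VhL in blast)
 have "\<exists>u\<in>?Kh. \<forall>v\<in>?Kh. div_form u v = b f v"
 proof (rule div.finite_Riesz[OF I(1) Kh])
  show "?Kh \<subseteq> V_space Z" using KhVh Vh_V by blast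
  show "linear_on ?Kh (l i)" if "i\<in>I" for i by (rule linear_on_subset[OF I(2)[OF that] KhVh])
  show "linear_on ?Kh (b f)" by (rule linear_on_subset[OF bfV KhVh])
  show "div_form v v = 0" if "v\<in>?Kh" "!!i. i\<in>I ==> l i v = 0" for v using I(3)[of v] that KhVh by blast
  show "b f v = 0" if v: "v\<in>?Kh" "div_form v v = 0" for v
  proof -
   have vL: "v\<in>L2_space Z" using v(1) KhVh VhL by blast
   have "\<alpha>*(div_norm Z v)^2 <= 0" using elliptic[OF v(1)] v(2) by (simp add: div_form_def)
   hence "(div_norm Z v)^2 <= 0" using \<alpha> by (simp add: mult_le_0_iff)
   hence "(l2_norm Z v)^2 + (l2_norm Z (weak_div Z v))^2 <= 0" by (simp add: div_norm_def)
   hence "(l2_norm Z v)^2 <= 0" using zero_le_power2[of "l2_norm Z (weak_div Z v)"] by linarith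
   thus ?thesis using form_bound_norm[OF b c f vL] by simp
  qed
 qed
 then obtain u where u: "u\<in>?Kh" "!!v. v\<in>?Kh ==> div_form u v = b f v" by blast
 have uV: "u\<in>V_space Z" using u(1) KhVh Vh_V by blast
 define G where "G v = b f v - div_form u v" for v
 have Glin: "linear_on ?Vh G"
  using bfV div.add_right[OF Vh_V Vh_V uV] div.scale_right[OF Vh_V uV]
  unfolding linear_on_def G_def by (simp add: right_diff_distrib)
 note Gl = linear_onD[OF Glin subspace_Vh]
 obtain J :: "(polygon \<times> (point \<times> point) \<times> nat) set" and m where J: "finite J" "!!i. i\<in>J ==> linear_on (Zh k) (m i)"
  "!!z. z\<in>Zh k ==> \<forall>i\<in>J. m i z = 0 ==> l2_norm Z z = 0" by (rule Zh_finite_functionals, rule that)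
 obtain \<zeta> where \<zeta>: "!!i. i\<in>J ==> \<zeta> i\<in>Zh k" "!!z i. z\<in>Zh k ==> i\<in>J ==> m i (z - (\<Sum>j\<in>J. m j z*\<^sub>R \<zeta> j)) = 0"
  by (rule kernel_projection[OF J(1) subspace_Zh J(2)]) (assumption, rule that)
 have \<zeta>L: "\<zeta> i\<in>L2_space Z" if "i\<in>J" for i by (rule VhL[OF ZV[OF \<zeta>(1)[OF that]]])
 have span: "b v z = (\<Sum>j\<in>J. m j z*b v (\<zeta> j))" if v: "v\<in>?Vh" and z: "z\<in>Zh k" for v z
 proof -
  have tZ: "m j z*\<^sub>R \<zeta> j\<in>Zh k" if "j\<in>J" for j by (rule subspace_scale[OF subspace_Zh \<zeta>(1)[OF that]])
  have sZ: "(\<Sum>j\<in>J. m j z*\<^sub>R \<zeta> j)\<in>Zh k" by (intro subspace_sum[OF subspace_Zh] tZ)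
  have "l2_norm Z (z - (\<Sum>j\<in>J. m j z*\<^sub>R \<zeta> j)) = 0"
   by (rule J(3)[OF subspace_diff[OF subspace_Zh z sZ]]) (rule ballI, rule \<zeta>(2)[OF z])
  hence "b v z = b v (\<Sum>j\<in>J. m j z*\<^sub>R \<zeta> j)" by (rule null[OF VhL[OF v] VhL[OF ZV[OF z]] VhL[OF ZV[OF sZ]]])
  also have "... = (\<Sum>j\<in>J. b v (m j z*\<^sub>R \<zeta> j))" by (rule lr(5)[OF VhL[OF v] J(1) VhL[OF ZV[OF tZ]]])
  also have "... = (\<Sum>j\<in>J. m j z*b v (\<zeta> j))" by (intro sum.cong refl lr(2)[OF VhL[OF v] \<zeta>L])
  finally show ?thesis .
 qed
 \<comment> \<open>The \<open>y j\<close> invert the functionals \<open>b v (\<zeta> j)\<close> in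
   the generalized sense: subtracting their combination from \<open>v\<close> lands in the kernel,
   where \<open>G\<close> vanishes. This dictates the coefficients \<open>G (y j)\<close> of
   \<open>z\<close>.\<close>
 obtain y where y: "!!j. j\<in>J ==> y j\<in>?Vh" "!!v i. v\<in>?Vh ==> i\<in>J ==> b (v - (\<Sum>j\<in>J. b v (\<zeta> j)*\<^sub>R y j)) (\<zeta> i) = 0"
  by (rule kernel_projection[OF J(1) subspace_Vh, where l = "%j v. b v (\<zeta> j)"]) (rule linl[OF \<zeta>L], assumption, rule that)
 define z where "z = (\<Sum>j\<in>J. G (y j)*\<^sub>R \<zeta> j)"
 have tZ: "G (y j)*\<^sub>R \<zeta> j\<in>Zh k" if "j\<in>J" for j by (rule subspace_scale[OF subspace_Zh \<zeta>(1)[OF that]])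
 have zZ: "z\<in>Zh k" unfolding z_def by (intro subspace_sum[OF subspace_Zh] tZ)
 have bz: "b v z = G v" if v: "v\<in>?Vh" for v
 proof -
  have tV: "b v (\<zeta> j)*\<^sub>R y j\<in>?Vh" if "j\<in>J" for j by (rule subspace_scale[OF subspace_Vh y(1)[OF that]])
  have sV: "(\<Sum>j\<in>J. b v (\<zeta> j)*\<^sub>R y j)\<in>?Vh" by (intro subspace_sum[OF subspace_Vh] tV)
  note dV = subspace_diff[OF subspace_Vh v sV]
  have "v - (\<Sum>j\<in>J. b v (\<zeta> j)*\<^sub>R y j)\<in>?Kh"
   unfolding Kh_iff using dV span[OF dV] y(2)[OF v] by simp
  hence "G (v - (\<Sum>j\<in>J. b v (\<zeta> j)*\<^sub>R y j)) = 0" using u(2) by (simp add: G_def)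
  hence "G v = G (\<Sum>j\<in>J. b v (\<zeta> j)*\<^sub>R y j)" using Gl(3)[OF v sV] by simp
  also have "... = (\<Sum>j\<in>J. G (b v (\<zeta> j)*\<^sub>R y j))" by (rule Gl(5)[OF J(1) tV])
  also have "... = (\<Sum>j\<in>J. b v (G (y j)*\<^sub>R \<zeta> j))"
   by (intro sum.cong refl) (simp add: Gl(2)[OF y(1)] lr(2)[OF VhL[OF v] \<zeta>L])
  also have "... = b v z" unfolding z_def by (rule lr(5)[OF VhL[OF v] J(1) VhL[OF ZV[OF tZ]], symmetric])
  finally show ?thesis by simp
 qed
 obtain p where p: "p\<in>Qh_space Z \<T> k" "l2_norm Z (z - weak_curl Z p) = 0" using Qh_of_Zh[OF zZ] by blast
 have "b v (weak_curl Z p) = G v" if v: "v\<in>?Vh" for v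
  using null[OF VhL[OF v] VhL[OF ZV[OF zZ]] VhL[OF ZV[OF Qh_curl_Zh[OF p(1)]]] p(2)] bz[OF v] by simp
 hence "solves_discrete Z \<T> k b f u p"
  unfolding solves_discrete_def using u(1) p(1) by (simp add: Kh_rot_def G_def div_form_def)
 thus ?thesis by blast
qed

end

subsection \<open>Error estimate\<close>

lemma l2_norm_le_components:
 assumes v: "(v :: vector_field)\<in>L2_space E"
 shows "l2_norm E v <= l2_norm E (%x. v x$1) + l2_norm E (%x. v x$2)"
proof (rule power2_le_imp_le)
 note c = L2_component[OF v]
 have nn: "0 <= l2_norm E (%x. v x$1)" "0 <= l2_norm E (%x. v x$2)" by (rule l2_norm_nonneg[OF c])+
 show "0 <= l2_norm E (%x. v x$1) + l2_norm E (%x. v x$2)" using nn by simp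
 have "(l2_norm E v)^2 = (l2_norm E (%x. v x$1))^2 + (l2_norm E (%x. v x$2))^2"
  unfolding l2_norm_sq[OF v] l2_norm_sq[OF c] by (rule l2_inner_components[OF v v])
 thus "(l2_norm E v)^2 <= (l2_norm E (%x. v x$1) + l2_norm E (%x. v x$2))^2"
  using nn by (simp add: power2_sum)
qed

text \<open>The infima of the admissible constants tend to zero. Adding \<open>1/(n + 1)\<close>
  settles that an infimum need not be admissible itself.\<close>

lemma exists_rate:
 fixes P :: "nat => real => bool"
 assumes mono: "!!n s t. P n s ==> s <= t ==> P n t" and ex: "!!n. EX t. P n t"
  and small: "!!\<epsilon>. \<epsilon> > 0 ==> \<forall>\<^sub>F n in sequentially. P n \<epsilon>"
 obtains a where "a \<longlonglongrightarrow> 0" "!!n. 0 <= a n" "!!n. P n (a n)"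
proof -
 define T where "T n = {t. 0 <= t & P n t}" for n
 have T: "T n ~= {}" "bdd_below (T n)" for n
 proof -
  obtain t where "P n t" using ex by blast
  hence "max 0 t\<in>T n" using mono[of n t "max 0 t"] by (simp add: T_def)
  thus "T n ~= {}" by blast
  show "bdd_below (T n)" by (rule bdd_belowI[of _ 0]) (simp add: T_def)
 qed
 have I0: "0 <= Inf (T n)" for n by (rule cInf_greatest[OF T(1)]) (simp add: T_def)
 define a where "a n = Inf (T n) + 1/real (Suc n)" for n
 have I: "(%n. Inf (T n)) \<longlonglongrightarrow> 0"
 proof (rule order_tendstoI)
  show "\<forall>\<^sub>F n in sequentially. e < Inf (T n)" if "e < 0" for e
   using that I0 by (intro always_eventually allI) (meson less_le_trans)
  fix e :: real assume e: "0 < e"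
  hence "\<forall>\<^sub>F n in sequentially. P n (e/2)" by (intro small) simp
  thus "\<forall>\<^sub>F n in sequentially. Inf (T n) < e"
  proof eventually_elim
   case (elim n)
   hence "Inf (T n) <= e/2" using e T(2) by (intro cInf_lower) (auto simp: T_def)
   thus ?case using e by simp
  qed
 qed
 show thesis
 proof (rule that[of a])
  show "a \<longlonglongrightarrow> 0" unfolding a_def using tendsto_add[OF I LIMSEQ_Suc[OF lim_1_over_n]] by simp
  show "0 <= a n" for n using I0[of n] by (simp add: a_def)
  show "P n (a n)" for n
  proof -
   have "Inf (T n) < a n" by (simp add: a_def)
   then obtain t where "t\<in>T n" "t < a n" using T cInf_less_iff by blast
   thus ?thesis using mono[of n t "a n"] by (simp add: T_def)
  qed
 qed
qed

text \<open>Several meshes may share a mesh size, hence the supremum over all of them. As mesh sizes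
  are positive, below the least of the first \<open>N\<close> only later indices occur, so the
  supremum is small there.\<close>

lemma rate_as_function:
 fixes a m :: "nat => real"
 assumes a: "a \<longlonglongrightarrow> 0" "!!n. 0 <= a n" and m: "!!n. m n > 0"
 obtains \<omega> :: "real => real" where "(\<omega> \<longlongrightarrow> 0) (at_right 0)" "!!n. a n <= \<omega> (m n)"
proof -
 have "bounded (range a)" using a(1) convergent_imp_bounded by blast
 hence bdd: "bdd_above (a ` {n. m n = h})" for h
  by (meson bdd_above_mono bounded_imp_bdd_above image_mono subset_UNIV)
 define \<omega> where "\<omega> h = (if EX n. m n = h then Sup (a ` {n. m n = h}) else 0)" for h
 have le: "a n <= \<omega> (m n)" for n
 proof -
  have "a n <= Sup (a ` {n'. m n' = m n})" by (rule cSup_upper[OF _ bdd]) auto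
  thus ?thesis by (auto simp: \<omega>_def)
 qed
 have nn: "0 <= \<omega> h" for h
 proof (cases "EX n. m n = h")
  case True
  thus ?thesis using le a(2) order_trans by blast
 qed (simp add: \<omega>_def)
 have "(\<omega> \<longlongrightarrow> 0) (at_right 0)"
 proof (rule order_tendstoI)
  show "\<forall>\<^sub>F h in at_right 0. e < \<omega> h" if "e < 0" for e
   using that nn by (intro always_eventually allI) (meson less_le_trans)
  fix e :: real assume e: "0 < e"
  hence "\<forall>\<^sub>F n in sequentially. a n < e/2" using order_tendstoD(2)[OF a(1), of "e/2"] by simp
  then obtain N where N: "!!n. n >= N ==> a n < e/2" by (auto simp: eventually_sequentially)
  define d where "d = Min (insert 1 (m ` {..<N}))"
  have d: "d > 0" "!!n. n < N ==> d <= m n" using m by (auto simp: d_def)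
  have "\<omega> h < e" if h: "0 < h" "h < d" for h
  proof (cases "EX n. m n = h")
   case True
   have "Sup (a ` {n. m n = h}) <= e/2"
   proof (rule cSup_least)
    show "a ` {n. m n = h} ~= {}" using True by auto
    fix x assume "x\<in>a ` {n. m n = h}"
    then obtain n where n: "x = a n" "m n = h" by blast
    hence "n >= N" using d(2)[of n] h(2) by (meson not_le)
    thus "x <= e/2" using N[of n] n(1) by simp
   qed
   thus ?thesis using True e by (simp add: \<omega>_def)
  qed (use e in \<open>simp add: \<omega>_def\<close>)
  thus "\<forall>\<^sub>F h in at_right 0. \<omega> h < e"
   unfolding eventually_at_right_field using d(1) by (intro exI[of _ d]) auto
 qed
 with le show thesis by (intro that)
qed

section \<open>Uniform smallness of the residuals\<close>

context accessible_domain
begin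

text \<open>A single field is approximated by a uniformly continuous one, which is nearly constant
  on small elements, and constants are polynomial gradients. The threshold is the same for all
  meshes.\<close>

lemma res_small:
 assumes u: "u\<in>L2_space Z" and \<epsilon>: "\<epsilon> > 0"
 shows "EX \<delta>>0. ALL \<T> C. polygonal_mesh_of Z \<T> C --> mesh_size \<T> < \<delta> --> res_norm \<T> k u <= \<epsilon>"
proof -
 have approx: "EX \<phi>. test_function Z \<phi> & l2_norm Z ((%x. u x$i) - \<phi>) < \<epsilon>/4" for i
 proof -
  obtain \<phi> where \<phi>: "!!n::nat. test_function Z (\<phi> n)" "(%n. l2_norm Z ((%x. u x$i) - \<phi> n)) \<longlonglongrightarrow> 0"
   by (rule test_functions_dense[OF Z_ob L2_component[OF u]], rule that)
  have "\<forall>\<^sub>F n in sequentially. l2_norm Z ((%x. u x$i) - \<phi> n) < \<epsilon>/4" using \<epsilon> by (intro order_tendstoD(2)[OF \<phi>(2)]) simp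
  then obtain n where "l2_norm Z ((%x. u x$i) - \<phi> n) < \<epsilon>/4" by (auto simp: eventually_sequentially)
  thus ?thesis using \<phi>(1) by blast
 qed
 then obtain \<psi> where \<psi>: "!!i. test_function Z (\<psi> i)" "!!i. l2_norm Z ((%x. u x$i) - \<psi> i) < \<epsilon>/4" by metis
 define \<phi> :: vector_field where "\<phi> x = vector [\<psi> 1 x, \<psi> 2 x]" for x
 have \<phi>c: "\<phi> x$i = \<psi> i x" for x i using exhaust_2[of i] by (auto simp: \<phi>_def)
 have \<phi>L: "\<phi>\<in>L2_space Z" unfolding \<phi>_def[abs_def] by (rule L2_vector[OF L2_Z_test(1)[OF \<psi>(1)] L2_Z_test(1)[OF \<psi>(1)]])
 have dL: "u - \<phi>\<in>L2_space Z" by (rule l2.closed(3)[OF u \<phi>L])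
 have comp: "(%x. (u - \<phi>) x$i) = (%x. u x$i) - \<psi> i" for i by (rule ext) (simp add: \<phi>c)
 have d: "l2_norm Z (u - \<phi>) <= \<epsilon>/2"
  using l2_norm_le_components[OF dL] \<psi>(2)[of 1] \<psi>(2)[of 2] unfolding comp by linarith
 define m where "m = l2_norm Z (%_. 1 :: real)"
 have m0: "m >= 0" using l2_norm_nonneg[OF L2_const[OF Z_ob, of 1]] by (simp add: m_def)
 \<comment> \<open>The two components each contribute \<open>\<eta>\<close> times the norm of 1;
   summed over the mesh this is \<open>2*\<eta>*m <= \<epsilon>/2\<close>.\<close>
 define \<eta> where "\<eta> = \<epsilon>/(4*(m + 1))"
 have \<eta>: "\<eta> > 0" using \<epsilon> m0 by (simp add: \<eta>_def)
 have "EX \<delta>>0. \<forall>x\<in>closure Z. \<forall>y\<in>closure Z. dist x y < \<delta> --> \<bar>\<psi> i x - \<psi> i y\<bar> < \<eta>" for i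
 proof -
  have "uniformly_continuous_on (closure Z) (\<psi> i)"
   using Z_bounded by (intro compact_uniformly_continuous smoothD(3) test_function_smooth[OF \<psi>(1)]) (simp add: compact_closure)
  thus ?thesis using \<eta> unfolding uniformly_continuous_on_def dist_real_def by (metis dist_commute abs_minus_commute)
 qed
 then obtain \<Delta> where \<Delta>: "!!i. \<Delta> i > 0" "!!i x y. x\<in>closure Z ==> y\<in>closure Z ==> dist x y < \<Delta> i ==> \<bar>\<psi> i x - \<psi> i y\<bar> < \<eta>" by metis
 define \<delta> where "\<delta> = min (\<Delta> 1) (\<Delta> 2)"
 have \<delta>: "\<delta> > 0" "!!i. \<delta> <= \<Delta> i"
 proof -
  show "\<delta> > 0" using \<Delta>(1) by (simp add: \<delta>_def)
  show "\<delta> <= \<Delta> i" for i using exhaust_2[of i] by (auto simp: \<delta>_def)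
 qed
 have "res_norm \<T> k u <= \<epsilon>" if M: "polygonal_mesh_of Z \<T> C" and small: "mesh_size \<T> < \<delta>" for \<T> C
 proof -
  interpret M: polygonal_mesh_of Z \<T> C by (rule M)
  have "res_norm \<T> k \<phi> <= L2_set (%P. (2*\<eta>)*l2_norm (intr P) (%_. 1 :: real)) \<T>"
   unfolding res_norm_def
  proof (rule L2_set_mono)
   fix P assume P: "P\<in>\<T>"
   interpret bounded_element P k by (rule M.element[OF P])
   note L = M.L2_E[OF \<phi>L P]
   have "E ~= {}" using M.diameter_pos[OF P] by auto
   then obtain y where y: "y\<in>E" by blast
   have cG: "(%x. \<phi> y)\<in>grad_polys (k + 1)" using const_grad_poly[of "\<phi> y" k] by simp
   have vL: "\<phi> - (%x. \<phi> y)\<in>L2_space E" by (rule l2.closed(3)[OF L grad_polys_L2[OF cG]])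
   have cb: "l2_norm E (%x. (\<phi> - (%x. \<phi> y)) x$i) <= \<eta>*l2_norm E (%_. 1 :: real)" for i
   proof (rule L2_dominated(2)[OF L2_const[OF E_ob] L2_spaceD(1)[OF L2_component[OF vL]]])
    fix x assume x: "x\<in>E"
    have "dist x y <= diameter E" by (rule diameter_bounded_bound[OF E_ob(2) x y])
    hence "dist x y < \<Delta> i" using M.diameter_le[OF P] small \<delta>(2)[of i] by linarith
    moreover have "x\<in>closure Z" "y\<in>closure Z" using x y M.sub[OF P] closure_subset by blast+
    ultimately have "\<bar>\<psi> i x - \<psi> i y\<bar> < \<eta>" by (intro \<Delta>(2))
    thus "\<bar>(\<phi> - (%x. \<phi> y)) x$i\<bar> <= \<eta>*\<bar>1\<bar>" by (simp add: \<phi>c)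
   qed (use \<eta> in simp)
   have "l2_norm E (\<phi> - (%x. \<phi> y)) <= \<eta>*l2_norm E (%_. 1 :: real) + \<eta>*l2_norm E (%_. 1 :: real)"
    using l2_norm_le_components[OF vL] cb[of 1] cb[of 2] by linarith
   thus "l2_norm E (\<phi> - proj \<phi>) <= (2*\<eta>)*l2_norm E (%_. 1 :: real)"
    using best_approximation[OF L cG] by linarith
   show "0 <= l2_norm E (\<phi> - proj \<phi>)" by (rule l2_norm_nonneg[OF res_L2[OF L]])
  qed
  also have "... = (2*\<eta>)*L2_set (%P. l2_norm (intr P) (%_. 1 :: real)) \<T>"
   by (rule L2_set_right_distrib[symmetric]) (use \<eta> in simp)
  also have "... = (2*\<eta>)*m" unfolding m_def M.norm_L2_set[OF L2_const[OF Z_ob]] ..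
  also have "... <= \<epsilon>/2" using m0 \<epsilon> by (simp add: \<eta>_def field_simps)
  finally have 1: "res_norm \<T> k \<phi> <= \<epsilon>/2" .
  have 2: "res_norm \<T> k (u - \<phi>) <= \<epsilon>/2" using M.res_norm_le[OF dL] d by (rule order_trans)
  have e: "\<phi> + (u - \<phi>) = u" by (rule ext) simp
  show ?thesis using M.res_norm_add[OF \<phi>L dL, of k] 1 2 unfolding e by linarith
 qed
 thus ?thesis using \<delta>(1) by blast
qed

text \<open>A coarse mesh with \<open>\<kappa> <= \<epsilon>/2\<close> is fixed; its finitely many
  fields \<open>r P\<close> approximate all of \<open>K_space\<close> relative to the divergence
  norm, and fine meshes resolve each of them. This plays the part of a compact embedding.\<close>

lemma residual_uniform:
 assumes M: "!!n. polygonal_mesh_of Z (\<T> n) C" and lim: "(%n. mesh_size (\<T> n)) \<longlonglongrightarrow> 0" and \<epsilon>: "\<epsilon> > 0"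
 shows "\<forall>\<^sub>F n in sequentially. \<forall>v\<in>K_space. res_norm (\<T> n) k v <= \<epsilon>*div.nrm v"
proof -
 have C: "C > 0" using polygonal_mesh_of.C[OF M] .
 have "\<forall>\<^sub>F n in sequentially. mesh_size (\<T> n) < C*\<epsilon>/4" using C \<epsilon> by (intro order_tendstoD(2)[OF lim]) simp
 then obtain m where m: "mesh_size (\<T> m) < C*\<epsilon>/4" by (auto simp: eventually_sequentially)
 interpret m: polygonal_mesh_of Z "\<T> m" C by (rule M)
 have \<kappa>: "m.\<kappa> <= \<epsilon>/2" using m C by (simp add: m.\<kappa>_def field_simps)
 obtain r where r: "!!P. P\<in>\<T> m ==> r P\<in>K_space"
  "!!v. v\<in>K_space ==> l2_norm Z (v - (\<Sum>P\<in>\<T> m. m.cell P v *\<^sub>R r P)) <= m.\<kappa>*div.nrm v" by (rule m.K_split, rule that)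
 have rL: "r P\<in>L2_space Z" if "P\<in>\<T> m" for P by (rule V_L2[OF K_V[OF r(1)[OF that]]])
 \<comment> \<open>Cell values are at most \<open>m1\<close> times the divergence norm, so residuals
   of size \<open>e\<close> for all \<open>r P\<close> add up to at most
   \<open>\<epsilon>/2\<close>; the 1 keeps the denominator positive.\<close>
 define e where "e = \<epsilon>/(2*(m.m1*real (card (\<T> m)) + 1))"
 have den: "0 < m.m1*real (card (\<T> m)) + 1" using m.m1_nonneg by (intro add_nonneg_pos mult_nonneg_nonneg) auto
 have e: "e > 0" using \<epsilon> den by (simp add: e_def)
 have cancel: "X*(\<epsilon>/(2*X)) = \<epsilon>/2" if "X > 0" for X :: real using that by simp
 have "\<forall>\<^sub>F n in sequentially. res_norm (\<T> n) k (r P) <= e" if P: "P\<in>\<T> m" for P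
 proof -
  obtain \<delta> where \<delta>: "\<delta> > 0" "!!\<T> C. polygonal_mesh_of Z \<T> C ==> mesh_size \<T> < \<delta> ==> res_norm \<T> k (r P) <= e"
   using res_small[OF rL[OF P] e, of k] by blast
  have "\<forall>\<^sub>F n in sequentially. mesh_size (\<T> n) < \<delta>" by (rule order_tendstoD(2)[OF lim \<delta>(1)])
  thus ?thesis by eventually_elim (rule \<delta>(2)[OF M])
 qed
 hence "\<forall>\<^sub>F n in sequentially. \<forall>P\<in>\<T> m. res_norm (\<T> n) k (r P) <= e"
  using m.finite_mesh by (simp add: eventually_ball_finite_distrib)
 thus ?thesis
 proof eventually_elim
  case (elim n)
  interpret n: polygonal_mesh_of Z "\<T> n" C by (rule M)
  show ?case
  proof
   fix v assume v: "v\<in>K_space"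
   note vV = K_V[OF v]
   define s where "s = (\<Sum>P\<in>\<T> m. m.cell P v *\<^sub>R r P)"
   have tL: "m.cell P v *\<^sub>R r P\<in>L2_space Z" if "P\<in>\<T> m" for P by (rule l2.closed(2)[OF rL[OF that]])
   have sL: "s\<in>L2_space Z" unfolding s_def by (rule l2_norm_sum(1)[OF m.finite_mesh tL])
   note dL = l2.closed(3)[OF V_L2[OF vV] sL]
   have v0: "div.nrm v >= 0" by (rule div.nrm_nonneg[OF vV])
   have q: "v - s + s = v" by (rule ext) simp
   have "res_norm (\<T> n) k s <= (\<Sum>P\<in>\<T> m. res_norm (\<T> n) k (m.cell P v *\<^sub>R r P))"
    unfolding s_def by (rule n.res_norm_sum[OF m.finite_mesh tL])
   also have "... <= (\<Sum>P\<in>\<T> m. (m.m1*div.nrm v)*e)"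
   proof (rule sum_mono)
    fix P assume P: "P\<in>\<T> m"
    have "res_norm (\<T> n) k (m.cell P v *\<^sub>R r P) <= \<bar>m.cell P v\<bar>*res_norm (\<T> n) k (r P)" by (rule n.res_norm_scale[OF rL[OF P]])
    also have "... <= (m.m1*div.nrm v)*e"
     using m.cell_bound[OF P vV] elim P n.res_norm_nonneg e m.m1_nonneg v0 by (intro mult_mono) auto
    finally show "res_norm (\<T> n) k (m.cell P v *\<^sub>R r P) <= (m.m1*div.nrm v)*e" .
   qed
   also have "... = (m.m1*real (card (\<T> m))*e)*div.nrm v" by simp
   also have "... <= (\<epsilon>/2)*div.nrm v"
   proof (rule mult_right_mono[OF _ v0])
    have "m.m1*real (card (\<T> m))*e <= (m.m1*real (card (\<T> m)) + 1)*e" using e by (intro mult_right_mono) auto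
    also have "... = \<epsilon>/2" unfolding e_def by (rule cancel[OF den])
    finally show "m.m1*real (card (\<T> m))*e <= \<epsilon>/2" .
   qed
   finally have 1: "res_norm (\<T> n) k s <= (\<epsilon>/2)*div.nrm v" .
   have "res_norm (\<T> n) k (v - s) <= l2_norm Z (v - s)" by (rule n.res_norm_le[OF dL])
   also have "... <= m.\<kappa>*div.nrm v" unfolding s_def by (rule r(2)[OF v])
   also have "... <= (\<epsilon>/2)*div.nrm v" by (rule mult_right_mono[OF \<kappa> v0])
   finally have 2: "res_norm (\<T> n) k (v - s) <= (\<epsilon>/2)*div.nrm v" .
   have "res_norm (\<T> n) k v <= res_norm (\<T> n) k (v - s) + res_norm (\<T> n) k s"
    using n.res_norm_add[OF dL sL, of k] unfolding q .
   thus "res_norm (\<T> n) k v <= \<epsilon>*div.nrm v" using 1 2 by (simp add: field_simps)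
  qed
 qed
qed

lemma residual_rate:
 assumes M: "!!n. polygonal_mesh_of Z (\<T> n) C" and lim: "(%n. mesh_size (\<T> n)) \<longlonglongrightarrow> 0"
 obtains \<theta> where "\<theta> \<longlonglongrightarrow> 0" "!!n. 0 <= \<theta> n" "!!n. \<forall>v\<in>K_space. res_norm (\<T> n) k v <= \<theta> n*div.nrm v"
proof (rule exists_rate[of "%n t. \<forall>v\<in>K_space. res_norm (\<T> n) k v <= t*div.nrm v"])
 show "\<forall>v\<in>K_space. res_norm (\<T> n) k v <= t*div.nrm v" if "\<forall>v\<in>K_space. res_norm (\<T> n) k v <= s*div.nrm v" "s <= t" for n s t
 proof
  fix v assume v: "v\<in>K_space"
  have "s*div.nrm v <= t*div.nrm v" by (rule mult_right_mono[OF that(2) div.nrm_nonneg[OF K_V[OF v]]])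
  with that(1) v show "res_norm (\<T> n) k v <= t*div.nrm v" by (meson order_trans)
 qed
 show "EX t. \<forall>v\<in>K_space. res_norm (\<T> n) k v <= t*div.nrm v" for n
 proof -
  interpret n: polygonal_mesh_of Z "\<T> n" C by (rule M)
  obtain c where c: "!!v. v\<in>K_space ==> l2_norm Z v <= c*div.nrm v" using n.K_elliptic by blast
  have "res_norm (\<T> n) k v <= c*div.nrm v" if v: "v\<in>K_space" for v
   by (rule order_trans[OF n.res_norm_le[OF V_L2[OF K_V[OF v]]] c[OF v]])
  thus ?thesis by blast
 qed
 show "\<forall>\<^sub>F n in sequentially. \<forall>v\<in>K_space. res_norm (\<T> n) k v <= \<epsilon>*div.nrm v" if "\<epsilon> > 0" for \<epsilon>
  by (rule residual_uniform[OF M lim that])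
qed (rule that)

lemma div_norm_bounds:
 assumes v: "v\<in>V_space Z"
 shows "0 <= div_norm Z v" "l2_norm Z v <= div_norm Z v" "div.nrm v <= div_norm Z v"
 unfolding div_norm_def div_nrm by (auto intro: real_sqrt_sum_squares_ge1 real_sqrt_sum_squares_ge2)

lemma div_norm_triangle:
 assumes u: "u\<in>V_space Z" and v: "v\<in>V_space Z"
 shows "div_norm Z (u + v) <= div_norm Z u + div_norm Z v"
proof -
 have uv: "u + v\<in>V_space Z" by (rule subspace_add[OF subspace_V u v])
 have "div_norm Z (u + v) <= sqrt ((l2_norm Z u + l2_norm Z v)^2 + (div.nrm u + div.nrm v)^2)"
  unfolding div_norm_def div_nrm[symmetric]
  by (intro real_sqrt_le_mono add_mono power_mono l2_triangle V_L2 u v uv div.nrm_triangle l2_norm_nonneg div.nrm_nonneg)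
 also have "... <= div_norm Z u + div_norm Z v"
  unfolding div_norm_def div_nrm[symmetric] by (rule real_sqrt_sum_squares_triangle_ineq)
 finally show ?thesis .
qed

lemma V0_norm_le:
 assumes "f\<in>L2_space Z" "solves_source Z f u p"
 shows "0 <= V0_norm Z u" "V0_norm Z u <= l2_norm Z f"
proof -
 show "0 <= V0_norm Z u" unfolding V0_norm_def by (rule cInf_greatest) (use assms in auto)
 show "V0_norm Z u <= l2_norm Z f" unfolding V0_norm_def
  by (rule cInf_lower) (use assms in \<open>auto intro!: bdd_belowI[of _ 0]\<close>)
qed

lemma Q0_norm_le:
 assumes "f\<in>L2_space Z" "solves_source Z f u p"
 shows "0 <= Q0_norm Z p" "Q0_norm Z p <= l2_norm Z f"
proof -
 show "0 <= Q0_norm Z p" unfolding Q0_norm_def by (rule cInf_greatest) (use assms in auto)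
 show "Q0_norm Z p <= l2_norm Z f" unfolding Q0_norm_def
  by (rule cInf_lower) (use assms in \<open>auto intro!: bdd_belowI[of _ 0]\<close>)
qed

text \<open>Makes every potential in \<open>H10\<close> admissible in weak approximability, with
  \<open>Q0_norm\<close> at most the norm of its curl.\<close>

lemma solves_source_curl:
 assumes q: "q\<in>H10 Z"
 shows "solves_source Z (weak_curl Z q) 0 q"
proof -
 note qL = curl_H10_L2[OF q]
 have "l2_inner Z (weak_div Z 0) (weak_div Z v) = 0" if "v\<in>V_space Z" for v
  using div.zero_left[OF that] by (simp add: div_form_def)
 thus ?thesis
  unfolding solves_source_def using q subspace_0[OF subspace_V] l2.sym[OF qL V_L2] l2.zero_left[OF curl_H10_L2] by auto
qed

end

section \<open>The error estimate on a single mesh\<close>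

context polygonal_mesh_of
begin

lemma error_bound:
 assumes b: "form_bound k c b" and c: "c >= 0" and \<alpha>: "\<alpha> > 0"
  and elliptic: "!!v. v\<in>Kh_rot Z \<T> k b ==> l2_inner Z (weak_div Z v) (weak_div Z v) >= \<alpha>*(div_norm Z v)^2"
  and weak: "!!p. p\<in>Q0_space Z ==> (SUP v\<in>{v\<in>Kh_rot Z \<T> k b. div_norm Z v ~= 0}.
       ereal (l2_inner Z v (weak_curl Z p)/div_norm Z v)) <= ereal (\<omega>1*Q0_norm Z p)"
  and strong: "!!u. u\<in>V0_space Z ==> \<exists>uI\<in>Kh_rot Z \<T> k b. div_norm Z (%x. u x - uI x) <= \<omega>2*V0_norm Z u"
  and \<theta>: "0 <= \<theta>" "\<forall>v\<in>K_space. res_norm \<T> k v <= \<theta>*div.nrm v"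
  and f: "f\<in>L2_space Z"
 shows "div_norm Z (%x. T_op Z f x - Th_op Z \<T> k b f x) <=
  (\<bar>\<omega>2\<bar> + (c*(\<theta> + \<bar>\<omega>1\<bar>) + \<bar>\<omega>1\<bar> + \<bar>\<omega>2\<bar>)/\<alpha>)*l2_norm Z f"
proof -
 define u where "u = T_op Z f"
 define uh where "uh = Th_op Z \<T> k b f"
 define F where "F = l2_norm Z f"
 have F0: "F >= 0" using l2_norm_nonneg[OF f] by (simp add: F_def)
 have "EX p. solves_source Z f u p" unfolding u_def T_op_def using source_solvable[OF f] by (rule someI_ex)
 then obtain p where sol: "solves_source Z f u p" by blast
 have "EX p. solves_discrete Z \<T> k b f uh p"
  unfolding uh_def Th_op_def using discrete_solvable[OF b c \<alpha> elliptic f] by (rule someI_ex)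
 then obtain ph where disc: "solves_discrete Z \<T> k b f uh ph" by blast
 have uV: "u\<in>V_space Z" and pH: "p\<in>H10 Z" using sol by (auto simp: solves_source_def)
 have "u\<in>V0_space Z" using f sol by (auto simp: V0_space_def)
 then obtain uI where uI: "uI\<in>Kh_rot Z \<T> k b" "div_norm Z (u - uI) <= \<omega>2*V0_norm Z u"
  using strong unfolding fun_diff_def by blast
 have pQ: "p\<in>Q0_space Z" using f sol by (auto simp: Q0_space_def)
 have VhL: "v\<in>L2_space Z" if "v\<in>Vh_space Z \<T> k" for v by (rule V_L2[OF Vh_V[OF that]])
 have uhV: "uh\<in>Vh_space Z \<T> k" and uIV: "uI\<in>Vh_space Z \<T> k" using disc uI(1) by (auto simp: solves_discrete_def Kh_rot_def)
 define w where "w = uh - uI"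
 have wVh: "w\<in>Vh_space Z \<T> k" unfolding w_def by (rule subspace_diff[OF subspace_Vh uhV uIV])
 note wV = Vh_V[OF wVh]
 note wL = V_L2[OF wV]
 have bw: "b w (weak_curl Z q) = 0" if q: "q\<in>Qh_space Z \<T> k" for q
 proof -
  have zL: "weak_curl Z q\<in>L2_space Z" using q curl_H10_L2 by (auto simp: Qh_space_def)
  have lin: "linear_on (L2_space Z) (b (weak_curl Z q))" using b zL by (simp add: form_bound_def)
  have sym: "b v (weak_curl Z q) = b (weak_curl Z q) v" if "v\<in>L2_space Z" for v using b zL that by (simp add: form_bound_def)
  have "b uh (weak_curl Z q) = 0" "b uI (weak_curl Z q) = 0" using disc uI(1) q by (auto simp: solves_discrete_def Kh_rot_def)
  hence "b (weak_curl Z q) (uh - uI) = 0"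
   using linear_onD(3)[OF lin subspace_L2_space VhL[OF uhV] VhL[OF uIV]] sym[OF VhL[OF uhV]] sym[OF VhL[OF uIV]] by linarith
  thus ?thesis unfolding sym[OF wL] by (simp only: w_def)
 qed
 have wK: "w\<in>Kh_rot Z \<T> k b" using wVh bw by (simp add: Kh_rot_def)
 define W where "W = div_norm Z w"
 note Wb = div_norm_bounds[OF wV, folded W_def]
 \<comment> \<open>The supremum in the assumption ranges over fields of nonzero norm, so a null
   \<open>w\<close> is treated separately.\<close>
 have WA: "l2_inner Z w (weak_curl Z p') <= (\<omega>1*Q0_norm Z p')*W" if p': "p'\<in>Q0_space Z" "p'\<in>H10 Z" for p'
 proof (cases "W = 0")
  case True
  hence "l2_norm Z w = 0" using Wb(2) l2_norm_nonneg[OF wL] by linarith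
  thus ?thesis using l2_null_orth(2)[OF curl_H10_L2[OF p'(2)] wL] True by simp
 next
  case False
  hence "ereal (l2_inner Z w (weak_curl Z p')/div_norm Z w) <= (SUP v\<in>{v\<in>Kh_rot Z \<T> k b. div_norm Z v ~= 0}.
       ereal (l2_inner Z v (weak_curl Z p')/div_norm Z v))"
   using wK by (intro SUP_upper) (simp add: W_def)
  also have "... <= ereal (\<omega>1*Q0_norm Z p')" by (rule weak[OF p'(1)])
  finally have "l2_inner Z w (weak_curl Z p')/W <= \<omega>1*Q0_norm Z p'" by (simp add: W_def)
  thus ?thesis using False Wb(1) by (simp add: pos_divide_le_eq)
 qed
 \<comment> \<open>The absolute value is taken because the rate functions are not assumed to be
   nonnegative.\<close>
 have Q0le: "\<omega>1*Q0_norm Z p' <= \<bar>\<omega>1\<bar>*l2_norm Z g" if "g\<in>L2_space Z" "solves_source Z g u' p'" for g u' p'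
  using mult_mono[of \<omega>1 "\<bar>\<omega>1\<bar>" "Q0_norm Z p'" "l2_norm Z g"] Q0_norm_le[OF that] by simp
 obtain q where q: "q\<in>H10 Z" "w - weak_curl Z q\<in>K_space" by (rule V_decomposition[OF wV], rule that)
 note qL = curl_H10_L2[OF q(1)] and qV = curl_H10_V[OF q(1)] and qS = solves_source_curl[OF q(1)]
 have qQ: "q\<in>Q0_space Z" using qL qS by (auto simp: Q0_space_def)
 \<comment> \<open>Weak approximability is applied to the potential of the curl part of
   \<open>w\<close> itself: the pairing is the square of the norm to be bounded, so one factor
   cancels.\<close>
 have cq: "l2_norm Z (weak_curl Z q) <= \<bar>\<omega>1\<bar>*W"
 proof -
  let ?n = "l2_norm Z (weak_curl Z q)"
  have "l2_inner Z w (weak_curl Z q) = ?n^2"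
   using K_orth[OF q(2) q(1)] l2.diff_left[OF wL qL qL] l2_norm_sq[OF qL] by linarith
  hence "?n*?n <= (\<omega>1*Q0_norm Z q)*W" using WA[OF qQ q(1)] by (simp add: power2_eq_square)
  also have "... <= (\<bar>\<omega>1\<bar>*?n)*W" by (rule mult_right_mono[OF Q0le[OF qL qS] Wb(1)])
  finally have le: "?n*?n <= (\<bar>\<omega>1\<bar>*W)*?n" by (simp add: mult_ac)
  show ?thesis
  proof (cases "?n = 0")
   case True
   thus ?thesis using Wb(1) by simp
  next
   case False
   hence "?n > 0" using l2_norm_nonneg[OF qL] by linarith
   with le show ?thesis by (rule mult_right_le_imp_le)
  qed
 qed
 \<comment> \<open>The part in \<open>K_space\<close> has at most the divergence norm of
   \<open>w\<close>, so \<open>\<theta>\<close> applies; for the curl part the residual is at most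
   its norm.\<close>
 have res: "res_norm \<T> k w <= (\<theta> + \<bar>\<omega>1\<bar>)*W"
 proof -
  define v where "v = w - weak_curl Z q"
  have vK: "v\<in>K_space" using q(2) by (simp only: v_def)
  have e: "v + weak_curl Z q = w" unfolding v_def by (rule ext) simp
  have "div.nrm v <= div.nrm w + div.nrm (weak_curl Z q)" unfolding v_def by (rule div.nrm_triangle_diff[OF wV qV(1)])
  hence "div.nrm v <= W" using qV(3) Wb(3) by (simp add: div_nrm)
  hence 1: "res_norm \<T> k v <= \<theta>*W" using \<theta> vK by (meson mult_left_mono order_trans)
  have 2: "res_norm \<T> k (weak_curl Z q) <= \<bar>\<omega>1\<bar>*W" by (rule order_trans[OF res_norm_le[OF qL] cq])
  show ?thesis
   using res_norm_add[OF V_L2[OF K_V[OF vK]] qL, of k] 1 2 unfolding e by (simp add: distrib_right)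
 qed
 have t1: "b f w - l2_inner Z f w <= c*(\<theta> + \<bar>\<omega>1\<bar>)*F*W"
 proof -
  have "\<bar>b f w - l2_inner Z f w\<bar> <= c*(F*res_norm \<T> k w)" using b f wL unfolding form_bound_def F_def by blast
  also have "... <= c*(F*((\<theta> + \<bar>\<omega>1\<bar>)*W))" by (intro mult_left_mono res c F0)
  finally show ?thesis by (simp add: mult_ac)
 qed
 have t2: "l2_inner Z w (weak_curl Z p) <= \<bar>\<omega>1\<bar>*F*W"
  using WA[OF pQ pH] mult_right_mono[OF Q0le[OF f sol] Wb(1)] by (simp add: F_def)
 have dV: "u - uI\<in>V_space Z" by (rule subspace_diff[OF subspace_V uV Vh_V[OF uIV]])
 have sa: "div_norm Z (u - uI) <= \<bar>\<omega>2\<bar>*F"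
  unfolding F_def
  by (rule order_trans[OF uI(2) mult_mono[OF abs_ge_self V0_norm_le(2)[OF f sol] abs_ge_zero V0_norm_le(1)[OF f sol]]])
 have t3: "div_form (u - uI) w <= \<bar>\<omega>2\<bar>*F*W"
 proof -
  have "div_form (u - uI) w <= div.nrm (u - uI)*div.nrm w" using div.Cauchy_Schwarz[OF dV wV] by linarith
  also have "... <= (\<bar>\<omega>2\<bar>*F)*W"
   using div_norm_bounds[OF dV] sa Wb div.nrm_nonneg[OF wV] F0 by (intro mult_mono) auto
  finally show ?thesis .
 qed
 \<comment> \<open>Both problems are tested with the same \<open>w\<close>. In the discrete one the
   term with \<open>ph\<close> drops out because \<open>w\<close> lies in the kernel.\<close>
 have eqc: "div_form u w + l2_inner Z w (weak_curl Z p) = l2_inner Z f w"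
  using sol wV by (simp add: solves_source_def div_form_def)
 have "div_form uh w + b w (weak_curl Z ph) = b f w" "ph\<in>Qh_space Z \<T> k"
  using disc wVh by (auto simp: solves_discrete_def div_form_def)
 hence eqd: "div_form uh w = b f w" using bw by simp
 have split: "div_form w w = div_form uh w - div_form uI w" "div_form (u - uI) w = div_form u w - div_form uI w"
  unfolding w_def[symmetric] using div.diff_left[OF Vh_V[OF uhV] Vh_V[OF uIV] wV] div.diff_left[OF uV Vh_V[OF uIV] wV]
  by (simp_all only: w_def)
 \<comment> \<open>Subtracting the two equations writes \<open>div_form w w\<close> as the
   consistency error, the pairing with the curl of \<open>p\<close> and the interpolation error,
   bounded by \<open>t1\<close>, \<open>t2\<close> and \<open>t3\<close>.\<close>
 have "\<alpha>*W^2 <= div_form w w" using elliptic[OF wK] by (simp add: W_def div_form_def)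
 also have "... <= c*(\<theta> + \<bar>\<omega>1\<bar>)*F*W + \<bar>\<omega>1\<bar>*F*W + \<bar>\<omega>2\<bar>*F*W"
  using split eqc eqd t1 t2 t3 by linarith
 also have "... = ((c*(\<theta> + \<bar>\<omega>1\<bar>) + \<bar>\<omega>1\<bar> + \<bar>\<omega>2\<bar>)*F)*W" by (simp only: distrib_right)
 finally have main: "(\<alpha>*W)*W <= ((c*(\<theta> + \<bar>\<omega>1\<bar>) + \<bar>\<omega>1\<bar> + \<bar>\<omega>2\<bar>)*F)*W"
  by (simp add: power2_eq_square mult_ac)
 have Wle: "W <= (c*(\<theta> + \<bar>\<omega>1\<bar>) + \<bar>\<omega>1\<bar> + \<bar>\<omega>2\<bar>)/\<alpha>*F"
 proof (cases "W = 0")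
  case True
  have "0 <= (c*(\<theta> + \<bar>\<omega>1\<bar>) + \<bar>\<omega>1\<bar> + \<bar>\<omega>2\<bar>)/\<alpha>*F" using c \<theta>(1) \<alpha> F0 by simp
  with True show ?thesis by simp
 next
  case False
  hence "W > 0" using Wb(1) by linarith
  with main have "\<alpha>*W <= (c*(\<theta> + \<bar>\<omega>1\<bar>) + \<bar>\<omega>1\<bar> + \<bar>\<omega>2\<bar>)*F" by (rule mult_right_le_imp_le)
  thus ?thesis using \<alpha> by (simp add: field_simps)
 qed
 have neg: "(-1)*\<^sub>R w\<in>V_space Z" by (rule subspace_scale[OF subspace_V wV])
 have nw: "div_norm Z ((-1)*\<^sub>R w) = W"
  using l2_norm_scale[OF wL, of "-1"] div.nrm_scale[OF wV, of "-1"] unfolding W_def div_norm_def div_nrm by simp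
 have e: "(u - uI) + (-1)*\<^sub>R w = (%x. u x - uh x)" unfolding w_def by (rule ext) simp
 have "div_norm Z (%x. u x - uh x) <= div_norm Z (u - uI) + W"
  using div_norm_triangle[OF dV neg] unfolding e nw .
 also have "... <= \<bar>\<omega>2\<bar>*F + (c*(\<theta> + \<bar>\<omega>1\<bar>) + \<bar>\<omega>1\<bar> + \<bar>\<omega>2\<bar>)/\<alpha>*F" by (rule add_mono[OF sa Wle])
 finally show ?thesis unfolding u_def uh_def F_def by (simp only: distrib_right)
qed

end

theorem theorem1:
  fixes \<Omega> :: "(real^2) set" and k :: nat
    and \<T> :: "nat \<Rightarrow> (real^2) list set"
    and b :: "nat \<Rightarrow> (real^2 \<Rightarrow> real^2) \<Rightarrow> (real^2 \<Rightarrow> real^2) \<Rightarrow> real"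
  assumes "polygonal_domain \<Omega>" and "simply_connected \<Omega>"
    and "\<And>n. polygonal_mesh \<Omega> (\<T> n)"
    and "\<exists>C>0. \<forall>n. \<forall>P \<in> \<T> n. shape_regular C P"
    and "(\<lambda>n. mesh_size (\<T> n)) \<longlonglongrightarrow> 0"
    and "admissible_forms \<T> k b"
    and "ellipticity_discrete_kernel \<Omega> \<T> k b"
    and "weak_approximability \<Omega> \<T> k b"
    and "strong_approximability \<Omega> \<T> k b"
  shows "\<exists>\<omega> :: real \<Rightarrow> real. (\<omega> \<longlongrightarrow> 0) (at_right 0) \<and>
    (\<forall>n. \<forall>f \<in> L2_space \<Omega>.
       div_norm \<Omega> (\<lambda>x. T_op \<Omega> f x - Th_op \<Omega> (\<T> n) k (b n) f x)
         \<le> \<omega> (mesh_size (\<T> n)) * l2_norm \<Omega> f)"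
proof -
 obtain C where C: "C > 0" "!!n P. P\<in>\<T> n ==> shape_regular C P" using assms(4) by blast
 interpret accessible_domain \<Omega>
  using exterior_accessible_domain[OF assms(1,2)] assms(1) by unfold_locales (simp_all add: polygonal_domain_def)
 have M: "polygonal_mesh_of \<Omega> (\<T> n) C" for n
  using assms(3) C by unfold_locales auto
 have pos: "mesh_size (\<T> n) > 0" for n by (rule polygonal_mesh_of.mesh_size_pos[OF M])
 \<comment> \<open>The rate functions are controlled only to the right of 0, so positivity of the
   mesh sizes is essential for evaluating them along the sequence.\<close>
 have lim: "filterlim (%n. mesh_size (\<T> n)) (at_right 0) sequentially"
  by (rule tendsto_imp_filterlim_at_right[OF assms(5)]) (simp add: pos)
 \<comment> \<open>One consistency constant for all meshes: 1 without stabilization,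
   \<open>1 + cup\<close> with it.\<close>
 obtain c where c: "c >= 0" "!!n. polygonal_mesh_of.form_bound \<Omega> (\<T> n) k c (b n)"
 proof -
  from assms(6) consider (plain) "ALL n. b n = bh0 (\<T> n) k"
   | (stabilized) S clow cup where "0 < cup" "ALL n. \<forall>P\<in>\<T> n. stabilization k P clow cup (S n P)" "ALL n. b n = bhs (\<T> n) k (S n)"
   unfolding admissible_forms_def by blast
  thus thesis
  proof cases
   case plain
   thus thesis using polygonal_mesh_of.form_bound_bh0[OF M] by (intro that[of 1]) simp_all
  next
   case stabilized
   thus thesis using polygonal_mesh_of.form_bound_bhs[OF M, of _ k clow cup] by (intro that[of "1 + cup"]) simp_all
  qed
 qed
 obtain \<alpha> where \<alpha>: "\<alpha> > 0" "!!n v. v\<in>Kh_rot \<Omega> (\<T> n) k (b n) ==>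
    l2_inner \<Omega> (weak_div \<Omega> v) (weak_div \<Omega> v) >= \<alpha>*(div_norm \<Omega> v)^2"
  using assms(7) unfolding ellipticity_discrete_kernel_def by blast
 obtain \<omega>1 where \<omega>1: "(\<omega>1 \<longlongrightarrow> 0) (at_right 0)" "ALL n. \<forall>p\<in>Q0_space \<Omega>.
     (SUP v\<in>{v\<in>Kh_rot \<Omega> (\<T> n) k (b n). div_norm \<Omega> v ~= 0}.
       ereal (l2_inner \<Omega> v (weak_curl \<Omega> p)/div_norm \<Omega> v))
     <= ereal (\<omega>1 (mesh_size (\<T> n))*Q0_norm \<Omega> p)"
  using assms(8) unfolding weak_approximability_def by (elim exE conjE) (rule that)
 obtain \<omega>2 where \<omega>2: "(\<omega>2 \<longlongrightarrow> 0) (at_right 0)" "ALL n. \<forall>u\<in>V0_space \<Omega>. \<exists>uI\<in>Kh_rot \<Omega> (\<T> n) k (b n).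
     div_norm \<Omega> (%x. u x - uI x) <= \<omega>2 (mesh_size (\<T> n))*V0_norm \<Omega> u"
  using assms(9) unfolding strong_approximability_def by (elim exE conjE) (rule that)
 obtain \<theta> where \<theta>: "\<theta> \<longlonglongrightarrow> 0" "!!n. 0 <= \<theta> n" "!!n. \<forall>v\<in>K_space. res_norm (\<T> n) k v <= \<theta> n*div.nrm v"
  by (rule residual_rate[OF M assms(5)], rule that)
 define w1 where "w1 n = \<bar>\<omega>1 (mesh_size (\<T> n))\<bar>" for n
 define w2 where "w2 n = \<bar>\<omega>2 (mesh_size (\<T> n))\<bar>" for n
 have w: "w1 \<longlonglongrightarrow> 0" "w2 \<longlonglongrightarrow> 0"
  unfolding w1_def w2_def
  using tendsto_rabs_zero[OF filterlim_compose[OF \<omega>1(1) lim]] tendsto_rabs_zero[OF filterlim_compose[OF \<omega>2(1) lim]] by auto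
 define a where "a n = w2 n + (c*(\<theta> n + w1 n) + w1 n + w2 n)/\<alpha>" for n
 have err: "div_norm \<Omega> (%x. T_op \<Omega> f x - Th_op \<Omega> (\<T> n) k (b n) f x) <= a n*l2_norm \<Omega> f" if f: "f\<in>L2_space \<Omega>" for n f
  unfolding a_def w1_def w2_def
  by (rule polygonal_mesh_of.error_bound[OF M c(2,1) \<alpha> \<omega>1(2)[rule_format] \<omega>2(2)[rule_format] \<theta>(2,3) f])
 have "(%n. w2 n + (c*(\<theta> n + w1 n) + w1 n + w2 n)/\<alpha>) \<longlonglongrightarrow> 0 + (c*(0 + 0) + 0 + 0)/\<alpha>"
  using \<alpha>(1) by (intro tendsto_intros w \<theta>(1)) simp
 hence "a \<longlonglongrightarrow> 0" by (simp add: a_def[abs_def])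
 moreover have "0 <= a n" for n
  using c(1) \<theta>(2)[of n] \<alpha>(1) by (simp add: a_def w1_def w2_def)
 \<comment> \<open>The bound obtained so far is indexed by \<open>n\<close>, whereas the claim asks
   for a function of the mesh size.\<close>
 ultimately obtain \<omega> where \<omega>: "(\<omega> \<longlongrightarrow> 0) (at_right 0)" "!!n. a n <= \<omega> (mesh_size (\<T> n))"
  using rate_as_function[of a "%n. mesh_size (\<T> n)"] pos by blast
 have "div_norm \<Omega> (%x. T_op \<Omega> f x - Th_op \<Omega> (\<T> n) k (b n) f x) <= \<omega> (mesh_size (\<T> n))*l2_norm \<Omega> f"
  if f: "f\<in>L2_space \<Omega>" for n f
  by (rule order_trans[OF err[OF f] mult_right_mono[OF \<omega>(2) l2_norm_nonneg[OF f]]])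
 with \<omega>(1) show ?thesis by blast
qed

end
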